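(* There exist absolute constants $1<C_1<14$, $1<C_2<e^{10}$ such that for every fraction $p/q=[a_1,\dots,a_n]$ in lowest terms, $q\ge1$, with $a_1$ odd and $a_2,\dots,a_n$ even, one has $|\sigma'(0)|<C_2q^{C_1}$ and $w_0\ge 4/|\sigma'(0)|>4C_2^{-1}q^{-C_1}$ (where $\sigma$ is the discriminant and $w_0$ is half the width of the centermost band of $S(p/q)$), and there exist absolute constants $C_3>0$, $C_4>0$ such that, with this $C_1$, the following holds. Let $\alpha=[a_1,a_2,\dots]\in(0,1)$ be an irrational such that $a_1$ is odd, $a_k$ is even for all $k\ge2$, and $$\left|\alpha-\frac{p_n}{q_n}\right|<\frac{1}{C_3q_n^{\varkappa}},\qquad \varkappa=4C_1,\qquad (\ast)$$ for all $p_n/q_n=[a_1,a_2,\dots,a_n]$, $n=1,2,\dots$. Then: (a) For every $n=1,2,\dots$, the interior of the centermost band $B_0$ of $S(p_n/q_n)$ contains the centermost band and the closures of the gaps $G_0$, $G_{-1}$ of $S(p_{n+1}/q_{n+1})$. (b) There exist pairwise distinct gaps $G_{n,j}(\alpha)$ of $S(\alpha)$, for $j=1,2$ and $n=1,2,\dots$ with $q_n\ge3$, such that the intersections $G_{n,1}(\alpha)\cap G_{-1}(p_n/q_n)$ and $G_{n,2}(\alpha)\cap G_0(p_n/q_n)$ are non-empty and the length $\Delta_{n,j}(\alpha)$ of $G_{n,j}(\alpha)$ satisfies $$\Delta_{n,j}(\alpha)=|G_{n,j}(\alpha)|\ge|G_{n,j}(\alpha)\cap G_{j-2}(p_n/q_n)|>\frac{1}{C_4q_n^{\varkappa/2}}$$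 for all such $n$ and $j=1,2$. (c) For every $\varepsilon>0$ there exists $n_0=n_0(\varepsilon)\ge2$ such that the following holds for every irrational $\alpha=[a_1,a_2,\dots]\in(0,1)$ with $a_1$ odd, $a_k$ even for all $k\ge2$, and $|\alpha-p_n/q_n|<\frac{1}{2q_n^{4(5+\gamma_0+\varepsilon)}}$ for all $n=1,2,\dots$, where $\gamma_0$ is Euler's constant. For all $n\ge n_0$, the interior of the centermost band of $S(p_n/q_n)$ contains the centermost band and the closures of the gaps $G_0,G_{-1}$ of $S(p_{n+1}/q_{n+1})$; and there exist pairwise distinct gaps $G_{n,j}(\alpha)$, $n\ge n_0$, $j=1,2$, of $S(\alpha)$ such that $G_{n,1}(\alpha)\cap G_{-1}(p_n/q_n)$ and $G_{n,2}(\alpha)\cap G_0(p_n/q_n)$ are non-empty and $$|G_{n,j}(\alpha)|\ge|G_{n,j}(\alpha)\cap G_{j-2}(p_n/q_n)|>\frac{1}{2q_n^{2(5+\gamma_0)+\varepsilon}},\qquad n\ge n_0,\ j=1,2.$$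
   Context: Continued fractions: for positive integers $a_j$, $[a_1,a_2,\dots,a_n]=\cfrac{1}{a_1+\cfrac{1}{a_2+\cdots+\cfrac1{a_n}}}$, and $[a_1,a_2,\dots]$ is the corresponding infinite continued fraction. The convergents $p_n/q_n=[a_1,\dots,a_n]$ are written in lowest terms with $q_n>0$. The parity conditions on the $a_k$ in the claim imply that all $q_n$ are odd. For $\alpha,\theta\in(0,1]$ let $H_{\alpha,\theta}$ be the self-adjoint operator on $l^2(\mathbb{Z})$ given by $(H_{\alpha,\theta}\phi)(n)=\phi(n-1)+\phi(n+1)+2\cos(2\pi(\alpha n+\theta))\,\phi(n)$. Let $S(\alpha)$ be the union over all $\theta\in(0,1]$ of the spectra of $H_{\alpha,\theta}$ (for irrational $\alpha$ the spectrum does not depend on $\theta$). A gap of $S(\alpha)$ is a bounded connected component of $\mathbb{R}\setminus S(\alpha)$. $|A|$ denotes the Lebesgue measure of $A\subset\mathbb{R}$. For $\alpha=p/q$ with $(p,q)=1$, the discriminant is the polynomial of degree $q$ $$\sigma(E)=-\operatorname{tr}\left\{\begin{pmatrix}E-2\cos(2\pi p/q+\frac{\pi}{2q})&-1\\1&0\end{pmatrix}\begin{pmatrix}E-2\cos(2\pi\cdot 2p/q+\frac{\pi}{2q})&-1\\1&0\end{pmatrix}\cdots\begin{pmatrix}E-2\cos(2\pi qp/q+\frac{\pi}{2q})&-1\\1&0\end{pmatrix}\right\},$$ and $S(p/q)=\sigma^{-1}([-4,4])$. One has $\sigma(E)=(-1)^q\sigma(-E)$, so $S(p/q)$ is symmetric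 about $0$. For $q$ odd, $S(p/q)$ consists of $q$ disjoint closed intervals (bands) separated by $q-1$ nonempty open intervals (gaps), and each band contains exactly one zero of $\sigma$. Number the bands $B_j$ from left to right, $j=-(q-1)/2,\dots,(q-1)/2$; the centermost band $B_0$ contains $0$, is symmetric about $0$, and $B_0=[-w_0,w_0]$. The gap $G_j=G_j(p/q)$, $-(q-1)/2\le j<(q-1)/2$, is the open interval between $B_j$ and $B_{j+1}$; in particular $G_{-1}$ and $G_0$ are the gaps immediately to the left and right of $B_0$ (they exist when $q\ge3$). *)

theory Defs
  imports "HOL-Analysis.Analysis"
begin

text \<open>Continued fractions. The list \<open>[a\<^sub>1, \<dots>, a\<^sub>n]\<close> denotes
  \<open>1 / (a\<^sub>1 + 1 / (a\<^sub>2 + \<dots> + 1 / a\<^sub>n))\<close>; the value on the empty list only serves as the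
  innermost summand \<open>0\<close>.\<close>

fun cfrac :: "nat list \<Rightarrow> rat" where
  "cfrac [] = 0"
| "cfrac (a # as) = 1 / (of_nat a + cfrac as)"

text \<open>Partial quotients of an infinite continued fraction are indexed from \<open>1\<close>; the value \<open>a 0\<close>
  is never used.\<close>

definition conv :: "(nat \<Rightarrow> nat) \<Rightarrow> nat \<Rightarrow> rat" where
  "conv a n = cfrac (map a [1..<Suc n])"

text \<open>\<open>quotient_of\<close> returns the representation in lowest terms with positive denominator.\<close>

definition conv_num :: "(nat \<Rightarrow> nat) \<Rightarrow> nat \<Rightarrow> nat" where
  "conv_num a n = nat (fst (quotient_of (conv a n)))"

definition conv_den :: "(nat \<Rightarrow> nat) \<Rightarrow> nat \<Rightarrow> nat" where
  "conv_den a n = nat (snd (quotient_of (conv a n)))"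

definition has_cfrac :: "real \<Rightarrow> (nat \<Rightarrow> nat) \<Rightarrow> bool" where
  "has_cfrac \<alpha> a \<longleftrightarrow> (\<forall>k\<ge>1. a k > 0) \<and> (\<lambda>n. real_of_rat (conv a n)) \<longlonglongrightarrow> \<alpha>"


definition l2 :: "(int \<Rightarrow> complex) set" where
  "l2 = {\<phi>. (\<lambda>n. (cmod (\<phi> n))\<^sup>2) summable_on UNIV}"

definition l2_norm :: "(int \<Rightarrow> complex) \<Rightarrow> real" where
  "l2_norm \<phi> = sqrt (\<Sum>\<^sub>\<infinity>n. (cmod (\<phi> n))\<^sup>2)"

text \<open>The spectrum of an operator defined on all of \<open>l2\<close>: \<open>z\<close> is in the resolvent set iff
  \<open>T - z\<close> is a bijection of \<open>l2\<close> with bounded inverse.\<close>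

definition l2_spectrum :: "((int \<Rightarrow> complex) \<Rightarrow> (int \<Rightarrow> complex)) \<Rightarrow> complex set" where
  "l2_spectrum T = {z. \<not> (bij_betw (\<lambda>\<phi> n. T \<phi> n - z * \<phi> n) l2 l2 \<and>
     (\<exists>C. \<forall>\<phi>\<in>l2. l2_norm \<phi> \<le> C * l2_norm (\<lambda>n. T \<phi> n - z * \<phi> n)))}"

definition H_op :: "real \<Rightarrow> real \<Rightarrow> (int \<Rightarrow> complex) \<Rightarrow> (int \<Rightarrow> complex)" where
  "H_op \<alpha> \<theta> \<phi> n =
     \<phi> (n - 1) + \<phi> (n + 1) + of_real (2 * cos (2 * pi * (\<alpha> * of_int n + \<theta>))) * \<phi> n"

text \<open>The operators are self-adjoint, so their spectra are real and nothing is lost by collecting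
  real spectral values only. The same definition is used for rational and irrational \<open>\<alpha>\<close>.\<close>

definition S :: "real \<Rightarrow> real set" where
  "S \<alpha> = (\<Union>\<theta>\<in>{0<..1}. {E. complex_of_real E \<in> l2_spectrum (H_op \<alpha> \<theta>)})"

definition gaps :: "real set \<Rightarrow> real set set" where
  "gaps A = {G \<in> components (- A). bounded G}"


definition transfer :: "nat \<Rightarrow> nat \<Rightarrow> real \<Rightarrow> nat \<Rightarrow> real^2^2" where
  "transfer p q E k = vector
     [vector [E - 2 * cos (2 * pi * real (k * p) / real q + pi / (2 * real q)), -1],
      vector [1, 0]]"

definition discriminant :: "nat \<Rightarrow> nat \<Rightarrow> real \<Rightarrow> real" where
  "discriminant p q E = - trace (foldr (**) (map (transfer p q E) [1..<Suc q]) (mat 1))"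

text \<open>For odd \<open>q\<close>, \<open>S (p/q)\<close> has \<open>q\<close> components, numbered from left to right by
  \<open>-(q-1)/2, \<dots>, (q-1)/2\<close>. Thus the component with number \<open>j\<close> is the one which has exactly
  \<open>j + (q-1)/2\<close> components to its left.\<close>

definition band :: "nat \<Rightarrow> nat \<Rightarrow> int \<Rightarrow> real set" where
  "band p q j = (THE B. B \<in> components (S (real p / real q)) \<and>
     int (card {B' \<in> components (S (real p / real q)). \<forall>x\<in>B'. \<forall>y\<in>B. x < y})
       = j + (int q - 1) div 2)"

definition half_width :: "nat \<Rightarrow> nat \<Rightarrow> real" where
  "half_width p q = (Sup (band p q 0) - Inf (band p q 0)) / 2"

definition band_gap :: "nat \<Rightarrow> nat \<Rightarrow> int \<Rightarrow> real set" where
  "band_gap p q j = {x. (\<forall>y\<in>band p q j. y < x) \<and> (\<forall>y\<in>band p q (j + 1). x < y)}"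

abbreviation conv_band :: "(nat \<Rightarrow> nat) \<Rightarrow> nat \<Rightarrow> int \<Rightarrow> real set" where
  "conv_band a n j \<equiv> band (conv_num a n) (conv_den a n) j"

abbreviation conv_gap :: "(nat \<Rightarrow> nat) \<Rightarrow> nat \<Rightarrow> int \<Rightarrow> real set" where
  "conv_gap a n j \<equiv> band_gap (conv_num a n) (conv_den a n) j"

end

theory Submission
  imports Defs "HOL-Computational_Algebra.Computational_Algebra"
begin

text \<open>For odd \<open>q\<close> the spectrum at \<open>p / q\<close> is the set where the discriminant \<open>\<sigma>\<close> satisfies \<open>\<bar>\<sigma>\<bar> \<le> 4\<close>, and there
  \<open>\<bar>\<sigma>'\<bar> \<ge> q\<close>. The explicit zero energy solution expresses \<open>\<bar>\<sigma>'(0)\<bar>\<close> as \<open>q\<close> times a sum of squared products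
  of quotients of sines. Running down the continued fraction with a reciprocity formula for alternating sums of
  \<open>ln \<bar>tan\<bar>\<close> bounds each product by \<open>16 q\<^sup>4\<close>, so \<open>\<bar>\<sigma>'(0)\<bar> \<le> 16 q\<^sup>6\<close>. Since \<open>\<sigma>\<close> is odd with real simple zeros, this
  bounds from below the central band (half width \<open>w \<ge> 4 / \<bar>\<sigma>'(0)\<bar>\<close>) and its neighbouring gaps (length
  at least \<open>q w\<^sup>2 / 12\<close>). Finally the spectrum is Hoelder continuous of order \<open>1/2\<close> in the frequency, so the
  central gaps persist at a sufficiently well approximated irrational frequency.\<close>

section \<open>Sine products along continued fractions\<close>

text \<open>The lower bound for \<sigma>' and the formula for \<sigma>'(0) come from one object: the
  kernel of the monodromy matrix minus a multiplier. It has rank one, its diagonal sums to -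
  \<sigma>'(E), and for q = 2N + 1 one Fourier coefficient of its entries at distance N from the
  diagonal has modulus exactly q. Rank one turns this into \<bar>\<sigma>'\<bar> \<ge> q. At energy
  0, where the Bloch solution is explicit, the same coefficient fixes the normalisation, so
  \<bar>\<sigma>'(0)\<bar> is an exact sum of squares. The obstacle in that sum is that single sine
  quotients can be huge; only their products are controlled. The odd first partial quotient turns an
  alternating sum of ln \<bar>sin\<bar> into one of ln \<bar>tan\<bar>, and each even quotient
  reproduces the latter at a cost of at most ln (5/2). Denominators at least double with each even
  quotient, and (5/2)^2 < 2^3, so the total cost is a power of q. The exponents follow: half width
  at least q^(-6) / 4, gap length at least q^(-11) / 192. Closeness of order q^(-24) moves the
  spectrum by order q^(-12), less than the gap.\<close>

definition lgr :: "real \<Rightarrow> real" where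
  "lgr x = ln_Gamma ((x + 1) / 2) - ln_Gamma (x / 2)"

lemma ln_Gamma_add_one:
  fixes x :: real assumes "x > 0" shows "ln_Gamma (x + 1) = ln x + ln_Gamma x"
proof -
  have "Gamma (x + 1) = x * Gamma x"
    using assms by (intro Gamma_plus1) (auto elim!: nonpos_Ints_cases)
  moreover have "Gamma x > 0" using assms by simp
  ultimately show ?thesis
    using assms by (simp add: ln_Gamma_real_pos ln_mult_pos)
qed

text \<open>Formally \<open>lgr x\<close> is the divergent series of (-1)^i ln ((x + i) / 2) over i
  \<ge> 0; the functional equation of Gamma gives the quotient of Gamma values the same difference
  equation, so that it serves as the regularised value.\<close>

lemma lgr_add_one: assumes "x > 0" shows "lgr x + lgr (x + 1) = ln (x / 2)"
  using ln_Gamma_add_one[of "x/2"] assms by (simp add: lgr_def field_simps)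

lemma lgr_add_two: assumes "x > 0" shows "lgr (x + 2) - lgr x = ln ((x + 1) / x)"
  using lgr_add_one[of x] lgr_add_one[of "x + 1"] assms by (simp add: ln_div algebra_simps)

lemma has_derivative_lgr:
  assumes "x > 0"
  shows "(lgr has_real_derivative (Digamma ((x + 1) / 2) - Digamma (x / 2)) / 2) (at x)"
  unfolding lgr_def using assms
  by (auto intro!: derivative_eq_intros simp: field_simps)

lemma lgr_mono: assumes "0 < x" "x \<le> y" shows "lgr x \<le> lgr y"
proof (rule DERIV_nonneg_imp_nondecreasing[OF assms(2)])
  fix t assume t: "x \<le> t" "t \<le> y"
  have "Digamma (t / 2) \<le> Digamma ((t + 1) / 2)"
    using t assms by (intro Digamma_real_mono) auto
  then show "\<exists>d. (lgr has_real_derivative d) (at t) \<and> 0 \<le> d"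
    using has_derivative_lgr[of t] t assms by (intro exI[of _ "(Digamma ((t + 1) / 2) - Digamma (t / 2)) / 2"]) auto
qed

lemma Digamma_half_step_antimono:
  fixes x y :: real assumes "0 < x" "x \<le> y"
  shows "Digamma (y + 1/2) - Digamma y \<le> Digamma (x + 1/2) - Digamma x"
proof (rule DERIV_nonpos_imp_nonincreasing[OF assms(2), where f = "\<lambda>t. Digamma (t + 1/2) - Digamma t"])
  fix t assume t: "x \<le> t" "t \<le> y"
  have "Polygamma 1 (t + 1/2) < Polygamma 1 t"
    using t assms by (intro Polygamma_real_strict_antimono) auto
  moreover have "((\<lambda>t. Digamma (t + 1/2) - Digamma t) has_real_derivative
      (Polygamma 1 (t + 1/2) - Polygamma 1 t)) (at t)"
    using t assms by (auto intro!: derivative_eq_intros elim!: nonpos_Ints_cases)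
  ultimately show "\<exists>d. ((\<lambda>t. Digamma (t + 1/2) - Digamma t) has_real_derivative d) (at t) \<and> d \<le> 0"
    by (intro exI[of _ "Polygamma 1 (t + 1/2) - Polygamma 1 t"]) auto
qed

text \<open>Trigamma is decreasing, so half-step increments of Digamma shrink, and with them the
  increments of \<open>lgr\<close>. This is the monotonicity required by Leibniz's criterion
  below.\<close>

lemma lgr_diff_antimono:
  assumes "0 < x" "x \<le> y" "0 \<le> s"
  shows "lgr (y + s) - lgr y \<le> lgr (x + s) - lgr x"
proof (rule DERIV_nonpos_imp_nonincreasing[OF assms(2), where f = "\<lambda>t. lgr (t + s) - lgr t"])
  fix t assume t: "x \<le> t" "t \<le> y"
  let ?d = "(Digamma ((t + s + 1) / 2) - Digamma ((t + s) / 2)) / 2 - (Digamma ((t + 1) / 2) - Digamma (t / 2)) / 2"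
  have "((\<lambda>t. lgr (t + s)) has_real_derivative (Digamma ((t + s + 1) / 2) - Digamma ((t + s) / 2)) / 2) (at t)"
    using has_derivative_lgr[of "t + s"] t assms DERIV_shift[of lgr _ t s] by (simp add: add_ac)
  then have "((\<lambda>t. lgr (t + s) - lgr t) has_real_derivative ?d) (at t)"
    using has_derivative_lgr[of t] t assms by (intro DERIV_diff) auto
  moreover have "?d \<le> 0"
    using Digamma_half_step_antimono[of "t / 2" "(t + s) / 2"] t assms
    by (simp add: add_divide_distrib)
  ultimately show "\<exists>d. ((\<lambda>t. lgr (t + s) - lgr t) has_real_derivative d) (at t) \<and> d \<le> 0" by blast
qed

lemma lgr_diff_le: 
  assumes "0 < x" "0 \<le> s" "s \<le> 2"
  shows "0 \<le> lgr (x + s) - lgr x" "lgr (x + s) - lgr x \<le> 1 / x"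
proof -
  show "0 \<le> lgr (x + s) - lgr x" using lgr_mono[of x "x + s"] assms by simp
  have "lgr (x + s) \<le> lgr (x + 2)" using assms by (intro lgr_mono) auto
  moreover have "ln ((x + 1) / x) \<le> 1 / x"
    using ln_le_minus_one[of "(x + 1) / x"] assms by (simp add: field_simps)
  ultimately show "lgr (x + s) - lgr x \<le> 1 / x"
    using lgr_add_two[of x] assms by simp
qed

lemma lgr_diff_tendsto_zero:
  assumes "0 < x" "0 < a" "0 \<le> s" "s \<le> 2"
  shows "(\<lambda>j. lgr (x + real j * a + s) - lgr (x + real j * a)) \<longlonglongrightarrow> 0"
proof (rule tendsto_sandwich[OF _ _ tendsto_const])
  show "\<forall>\<^sub>F j in sequentially. 0 \<le> lgr (x + real j * a + s) - lgr (x + real j * a)"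
    using assms by (intro always_eventually allI lgr_diff_le(1)) (auto intro: add_pos_nonneg)
  show "\<forall>\<^sub>F j in sequentially. lgr (x + real j * a + s) - lgr (x + real j * a) \<le> 1 / (x + real j * a)"
    using assms by (intro always_eventually allI lgr_diff_le(2)) (auto intro: add_pos_nonneg)
  show "(\<lambda>j. 1 / (x + real j * a)) \<longlonglongrightarrow> 0"
    using assms by (intro real_tendsto_divide_at_top[OF tendsto_const]
        filterlim_tendsto_add_at_top[OF tendsto_const] filterlim_at_top_mult_tendsto_pos[OF tendsto_const _ filterlim_real_sequentially]) (use assms in auto)
qed


section \<open>An alternating double series with two difference equations\<close>

lemma alternating_differences_sums:
  fixes F :: "nat \<Rightarrow> real"
  assumes "(\<lambda>j. F (Suc j) - F j) \<longlonglongrightarrow> 0"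
  shows "(\<lambda>j. (-1) ^ j * ((F j + F (Suc j)) - (F (Suc j) + F (Suc (Suc j))))) sums (F 0 - F 1)"
proof -
  have "(\<Sum>j<n. (-1) ^ j * ((F j + F (Suc j)) - (F (Suc j) + F (Suc (Suc j)))))
      = F 0 - F 1 + (-1) ^ n * (F (Suc n) - F n)" for n
    by (induction n) (auto simp: algebra_simps)
  moreover have "(\<lambda>n. (-1) ^ n * (F (Suc n) - F n)) \<longlonglongrightarrow> 0"
    using assms by (subst tendsto_rabs_zero_iff[symmetric]) (auto simp: abs_mult power_abs tendsto_rabs_zero_iff)
  ultimately show ?thesis
    unfolding sums_def by (auto intro: tendsto_eq_intros)
qed

text \<open>Formally the double series of (-1)^(i + j) ln ((x + i + j a) / 2), hence symmetric in
  the steps 1 and a up to scaling. The terms \<open>lgr (x + j a)\<close> grow logarithmically, so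
  their alternating sum is replaced by its Euler transform: half the first term plus half the
  alternating series of differences.\<close>

definition dlgr :: "real \<Rightarrow> real \<Rightarrow> real" where
  "dlgr a x = (lgr x + (\<Sum>j. (-1) ^ j * (lgr (x + real j * a) - lgr (x + real (Suc j) * a)))) / 2"

lemma summable_dlgr:
  assumes "0 < x" "0 < a" "a \<le> 2"
  shows "summable (\<lambda>j. (-1) ^ j * (lgr (x + real j * a) - lgr (x + real (Suc j) * a)))"
proof -
  let ?d = "\<lambda>j. lgr (x + real (Suc j) * a) - lgr (x + real j * a)"
  have "?d \<longlonglongrightarrow> 0"
    using lgr_diff_tendsto_zero[of x a a] assms by (simp add: algebra_simps)
  moreover have "0 \<le> ?d n" for n using assms by (auto intro!: lgr_mono add_pos_nonneg mult_right_mono)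
  moreover have "?d (Suc n) \<le> ?d n" for n
    using lgr_diff_antimono[of "x + real n * a" "x + real (Suc n) * a" a] assms
    by (simp add: algebra_simps add_pos_nonneg)
  ultimately have "summable (\<lambda>n. (-1) ^ n * ?d n)"
    by (intro summable_Leibniz'(1))
  from summable_minus[OF this] show ?thesis by (simp add: algebra_simps)
qed

lemma dlgr_add_step:
  assumes "0 < x" "0 < a" "a \<le> 2"
  shows "dlgr a x + dlgr a (x + a) = lgr x"
proof -
  let ?f = "\<lambda>j. (-1) ^ j * (lgr (x + real j * a) - lgr (x + real (Suc j) * a))"
  have "(\<Sum>j. ?f j) = ?f 0 + (\<Sum>j. ?f (Suc j))"
    using suminf_split_head[OF summable_dlgr[OF assms]] by simp
  also have "(\<Sum>j. ?f (Suc j)) = (\<Sum>j. - ((-1) ^ j * (lgr (x + a + real j * a) - lgr (x + a + real (Suc j) * a))))"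
    by (intro suminf_cong) (simp add: algebra_simps)
  also have "\<dots> = - (\<Sum>j. (-1) ^ j * (lgr (x + a + real j * a) - lgr (x + a + real (Suc j) * a)))"
    using assms by (intro suminf_minus summable_dlgr) auto
  finally show ?thesis
    by (simp only: dlgr_def add_divide_distrib[symmetric]) simp
qed

text \<open>Summation over the step 1 first leaves the alternating sum of ln ((x + j a) / 2).
  Splitting ln a off every term gives \<open>lgr (x / a)\<close> and ln a times the regularised
  value 1/2 of 1 - 1 + 1 - ...\<close>

lemma dlgr_add_one:
  assumes "0 < x" "0 < a" "a \<le> 2"
  shows "dlgr a x + dlgr a (x + 1) = lgr (x / a) + ln a / 2"
proof -
  define F where "F j = lgr (x / a + real j) + ln a / 2" for j :: nat
  have pos: "x + real j * a > 0" for j using assms by (simp add: add_pos_nonneg)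
  have F: "F j + F (Suc j) = ln ((x + real j * a) / 2)" for j
  proof -
    have "F j + F (Suc j) = ln ((x / a + real j) / 2) + ln a"
      using lgr_add_one[of "x / a + real j"] assms
      by (simp add: F_def add.assoc add.commute[of 1] add_pos_nonneg)
    also have "\<dots> = ln ((x / a + real j) / 2 * a)"
      using assms by (subst ln_mult_pos) (auto simp: add_pos_nonneg)
    also have "(x / a + real j) / 2 * a = (x + real j * a) / 2" using assms by (simp add: field_simps)
    finally show ?thesis .
  qed
  have "(\<lambda>j. F (Suc j) - F j) \<longlonglongrightarrow> 0"
    using lgr_diff_tendsto_zero[of "x / a" 1 1] assms by (simp add: F_def add_ac)
  from alternating_differences_sums[OF this]
  have s: "(\<lambda>j. (-1) ^ j * (ln ((x + real j * a) / 2) - ln ((x + real (Suc j) * a) / 2))) sums (F 0 - F 1)"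
    by (simp only: F)
  have *: "lgr (x + real j * a) + lgr (x + 1 + real j * a) = ln ((x + real j * a) / 2)" for j
    using lgr_add_one[OF pos[of j]] by (simp add: add_ac)
  have "dlgr a x + dlgr a (x + 1) = (lgr x + lgr (x + 1) +
      (\<Sum>j. (-1) ^ j * (lgr (x + real j * a) - lgr (x + real (Suc j) * a))
         + (-1) ^ j * (lgr (x + 1 + real j * a) - lgr (x + 1 + real (Suc j) * a)))) / 2"
    using assms by (subst suminf_add[symmetric, OF summable_dlgr summable_dlgr])
      (auto simp: dlgr_def field_simps)
  also have "(\<lambda>j. (-1) ^ j * (lgr (x + real j * a) - lgr (x + real (Suc j) * a))
         + (-1) ^ j * (lgr (x + 1 + real j * a) - lgr (x + 1 + real (Suc j) * a)))
      = (\<lambda>j. (-1) ^ j * (ln ((x + real j * a) / 2) - ln ((x + real (Suc j) * a) / 2)))"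
    unfolding *[symmetric] by (rule ext) (simp only: ring_distribs add_diff_add)
  also have "(\<Sum>j. (-1) ^ j * (ln ((x + real j * a) / 2) - ln ((x + real (Suc j) * a) / 2))) = F 0 - F 1"
    using s by (rule sums_unique[symmetric])
  also have "lgr x + lgr (x + 1) = F 0 + F 1"
    using *[of 0] F[of 0] by simp
  finally show ?thesis by (simp add: F_def)
qed

text \<open>The difference is the alternating series of the increments of \<open>lgr\<close> from x
  + j a to y + j a. These decrease to 0, so Leibniz bounds the series by 0 and by its first
  term.\<close>

lemma dlgr_diff_bounds:
  assumes "0 < x" "x \<le> y" "y \<le> x + 2" "0 < a" "a \<le> 2"
  shows "0 \<le> dlgr a y - dlgr a x" "dlgr a y - dlgr a x \<le> lgr y - lgr x"
proof -
  let ?d = "\<lambda>j. lgr (y + real j * a) - lgr (x + real j * a)"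
  have d0: "?d \<longlonglongrightarrow> 0"
    using lgr_diff_tendsto_zero[of x a "y - x"] assms by (simp add: algebra_simps)
  have pos: "0 \<le> ?d n" for n using assms by (auto intro!: lgr_mono add_pos_nonneg)
  have mono: "?d (Suc n) \<le> ?d n" for n
    using lgr_diff_antimono[of "x + real n * a" "x + real (Suc n) * a" "y - x"] assms
    by (simp add: algebra_simps add_pos_nonneg)
  note L = summable_Leibniz'[OF d0 pos mono]
  let ?S = "\<Sum>n. (-1) ^ n * ?d n"
  have S: "0 \<le> ?S" "?S \<le> ?d 0" using L(2)[of 0] L(4)[of 0] by auto
  \<comment> \<open>Adding the series to its own shift produces the differenced series that occurs
    in \<open>dlgr\<close>.\<close>
  have "(\<lambda>n. (-1) ^ n * ?d n) sums ?S" using L(1) by (rule summable_sums)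
  moreover from this have "(\<lambda>n. (-1) ^ Suc n * ?d (Suc n)) sums (?S - ?d 0)"
    by (subst sums_Suc_iff) simp
  ultimately have "(\<lambda>n. (-1) ^ n * ?d n + (-1) ^ Suc n * ?d (Suc n)) sums (?S + (?S - ?d 0))"
    by (rule sums_add)
  moreover have "(\<lambda>n. (-1) ^ n * ?d n + (-1) ^ Suc n * ?d (Suc n)) =
     (\<lambda>j. (-1) ^ j * (lgr (y + real j * a) - lgr (y + real (Suc j) * a))
        - (-1) ^ j * (lgr (x + real j * a) - lgr (x + real (Suc j) * a)))"
    by (rule ext) (simp add: algebra_simps)
  ultimately have "(\<lambda>j. (-1) ^ j * (lgr (y + real j * a) - lgr (y + real (Suc j) * a))
        - (-1) ^ j * (lgr (x + real j * a) - lgr (x + real (Suc j) * a))) sums (?S + (?S - ?d 0))"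
    by simp
  from sums_unique[OF this]
  have "(\<Sum>j. (-1) ^ j * (lgr (y + real j * a) - lgr (y + real (Suc j) * a)))
        - (\<Sum>j. (-1) ^ j * (lgr (x + real j * a) - lgr (x + real (Suc j) * a))) = ?S + (?S - ?d 0)"
    using assms by (subst suminf_diff[OF summable_dlgr summable_dlgr]) auto
  then have "dlgr a y - dlgr a x = ?S" by (simp add: dlgr_def field_simps)
  then show "0 \<le> dlgr a y - dlgr a x" "dlgr a y - dlgr a x \<le> lgr y - lgr x"
    using S by auto
qed

section \<open>Reflection formulas for the logarithms of tangent and sine\<close>

lemma Gamma_reflection_real:
  fixes x :: real assumes "0 < x" "x < 1"
  shows "Gamma x * Gamma (1 - x) = pi / sin (pi * x)"
proof -
  have "complex_of_real (Gamma x * Gamma (1 - x)) = Gamma (of_real x) * Gamma (1 - of_real x)"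
    by (simp add: Gamma_complex_of_real[symmetric])
  also have "\<dots> = complex_of_real (pi / sin (pi * x))"
    by (simp add: Gamma_reflection_complex sin_of_real[symmetric])
  finally have "complex_of_real (Gamma x * Gamma (1 - x)) = complex_of_real (pi / sin (pi * x))" .
  then show ?thesis using of_real_eq_iff by blast
qed

lemma ln_Gamma_reflection:
  fixes x :: real assumes "0 < x" "x < 1"
  shows "ln_Gamma x + ln_Gamma (1 - x) = ln pi - ln (sin (pi * x))"
proof -
  have "sin (pi * x) > 0" using assms by (intro sin_gt_zero) auto
  then have "ln (pi / sin (pi * x)) = ln pi - ln (sin (pi * x))" by (simp add: ln_div)
  moreover have "ln (Gamma x * Gamma (1 - x)) = ln (Gamma x) + ln (Gamma (1 - x))"
    using assms by (intro ln_mult_pos) auto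
  ultimately show ?thesis
    using Gamma_reflection_real[OF assms] assms by (simp add: ln_Gamma_real_pos)
qed

definition ltan :: "real \<Rightarrow> real" where
  "ltan x = ln \<bar>sin (pi * x / 2)\<bar> - ln \<bar>cos (pi * x / 2)\<bar>"

definition lsin :: "real \<Rightarrow> real" where
  "lsin x = ln \<bar>2 * sin (pi * x)\<bar>"

lemma ltan_add_one: "ltan (x + 1) = - ltan x"
proof -
  have "pi * (x + 1) / 2 = pi * x / 2 + pi / 2" by (simp add: field_simps)
  then show ?thesis by (simp only: ltan_def) (simp add: sin_add cos_add)
qed

lemma ltan_add_even: "ltan (x + 2 * real m) = ltan x"
proof (induction m)
  case (Suc m)
  have "ltan (x + 2 * real (Suc m)) = ltan ((x + 2 * real m + 1) + 1)" by (simp add: algebra_simps)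
  also have "\<dots> = ltan (x + 2 * real m)" by (simp only: ltan_add_one minus_minus)
  finally show ?case using Suc by simp
qed simp

lemma ltan_add_nat: "ltan (x + real m) = (-1) ^ m * ltan x"
proof (induction m)
  case (Suc m)
  have "ltan (x + real (Suc m)) = ltan ((x + real m) + 1)" by (simp add: algebra_simps)
  then show ?case using Suc by (simp only: ltan_add_one) simp
qed simp

lemma lsin_add_one: "lsin (x + 1) = lsin x"
  by (simp add: lsin_def distrib_left sin_add)

text \<open>Quotient of the reflection formulas at x / 2 and (x + 1) / 2, since sin (pi (x + 1) / 2)
  = cos (pi x / 2).\<close>

lemma ltan_eq_lgr:
  assumes "0 < x" "x < 1" shows "ltan x = lgr x - lgr (1 - x)"
proof -
  have s: "sin (pi * x / 2) > 0" using assms by (intro sin_gt_zero) (auto simp: field_simps)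
  have c: "cos (pi * x / 2) > 0" using assms by (intro cos_gt_zero) (auto simp: field_simps)
  have "sin (pi * ((x + 1) / 2)) = cos (pi * x / 2)"
    by (simp add: add_divide_distrib distrib_left sin_add)
  then have "ln_Gamma ((x + 1) / 2) + ln_Gamma (1 - (x + 1) / 2) = ln pi - ln (cos (pi * x / 2))"
    using ln_Gamma_reflection[of "(x + 1) / 2"] assms by simp
  moreover have "ln_Gamma (x / 2) + ln_Gamma (1 - x / 2) = ln pi - ln (sin (pi * x / 2))"
    using ln_Gamma_reflection[of "x / 2"] assms by simp
  moreover have "(1 - x + 1) / 2 = 1 - x / 2" "(1 - x) / 2 = 1 - (x + 1) / 2" by (simp_all add: field_simps)
  ultimately show ?thesis
    unfolding ltan_def lgr_def by (simp only: abs_of_pos[OF s] abs_of_pos[OF c])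
qed

lemma not_Ints_diff_one: "(x::real) - 1 \<notin> \<int>" if "x \<notin> \<int>"
  using that by (metis Ints_1 Ints_add diff_add_cancel)

text \<open>Passing from k to k + 1 either peels one logarithm off the last \<open>lgr\<close> by
  its difference equation or, once x is beyond k + 1, moves x back by 1, which flips the sign of
  \<open>ltan\<close>. The explicit logarithms of \<bar>x - i\<bar> are what the sums for a and for
  1 / a have in common.\<close>

lemma ltan_expansion:
  assumes "0 < x" "x \<notin> \<int>" "x < real k + 1"
  shows "ltan x = lgr x + (\<Sum>i=1..k. (-1) ^ i * ln (\<bar>x - real i\<bar> / 2)) - (-1) ^ k * lgr (real k + 1 - x)"
  using assms
proof (induction k arbitrary: x)
  case 0
  then show ?case using ltan_eq_lgr[of x] by simp
next
  case (Suc k)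
  show ?case
  proof (cases "x < real k + 1")
    case True
    define y where "y = real k + 1 - x"
    have "ln (y / 2) = lgr y + lgr (y + 1)"
      using True by (intro lgr_add_one[symmetric]) (simp add: y_def)
    moreover have "\<bar>x - real (Suc k)\<bar> = y" using True by (simp add: y_def)
    moreover have "real (Suc k) + 1 - x = y + 1" by (simp add: y_def)
    ultimately show ?thesis
      by (simp only: Suc.IH[OF Suc.prems(1,2) True, folded y_def] sum.cl_ivl_Suc) (simp add: algebra_simps)
  next
    case False
    then have *: "0 < x - 1" using Suc.prems by (cases k; cases "x = 1") auto
    have "(\<Sum>i=1..Suc k. (-1) ^ i * ln (\<bar>x - real i\<bar> / 2))
        = (\<Sum>i=0..k. (-1) ^ Suc i * ln (\<bar>x - real (Suc i)\<bar> / 2))"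
      using sum.shift_bounds_cl_Suc_ivl[of "\<lambda>i. (-1) ^ i * ln (\<bar>x - real i\<bar> / 2)" 0 k] by simp
    also have "\<dots> = (\<Sum>i=0..k. - ((-1) ^ i * ln (\<bar>x - 1 - real i\<bar> / 2)))"
      by (intro sum.cong) (auto simp: algebra_simps)
    also have "\<dots> = - ln ((x - 1) / 2) - (\<Sum>i=1..k. (-1) ^ i * ln (\<bar>x - 1 - real i\<bar> / 2))"
      using * by (simp add: sum.atLeast_Suc_atMost[of 0 k] sum_negf)
    finally have 1: "(\<Sum>i=1..Suc k. (-1) ^ i * ln (\<bar>x - real i\<bar> / 2)) = \<dots>" .
    have "ltan x = - ltan (x - 1)" using ltan_add_one[of "x - 1"] by simp
    also have "ltan (x - 1) = lgr (x - 1) + (\<Sum>i=1..k. (-1) ^ i * ln (\<bar>x - 1 - real i\<bar> / 2))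
        - (-1) ^ k * lgr (real k + 1 - (x - 1))"
      using * Suc.prems not_Ints_diff_one[of x] by (intro Suc.IH) auto
    also have "real k + 1 - (x - 1) = real (Suc k) + 1 - x" by simp
    also have "lgr (x - 1) = ln ((x - 1) / 2) - lgr x" using lgr_add_one[OF *] by simp
    finally show ?thesis unfolding 1 by simp
  qed
qed

text \<open>The same induction with \<open>ln_Gamma\<close> in place of \<open>lgr\<close>. No signs
  alternate here because \<bar>sin (pi x)\<bar> has period 1.\<close>

lemma lsin_expansion:
  assumes "0 < x" "x \<notin> \<int>" "x < real k + 1"
  shows "lsin x = ln (2 * pi) - ln_Gamma x - ln_Gamma (real k + 1 - x) + (\<Sum>i=1..k. ln \<bar>x - real i\<bar>)"
  using assms
proof (induction k arbitrary: x)
  case 0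
  then have "sin (pi * x) > 0" by (intro sin_gt_zero) auto
  then show ?case using ln_Gamma_reflection[of x] 0 by (simp add: lsin_def ln_mult_pos)
next
  case (Suc k)
  show ?case
  proof (cases "x < real k + 1")
    case True
    define y where "y = real k + 1 - x"
    have "ln_Gamma (y + 1) = ln y + ln_Gamma y"
      using True by (intro ln_Gamma_add_one) (simp add: y_def)
    moreover have "\<bar>x - real (Suc k)\<bar> = y" using True by (simp add: y_def)
    moreover have "real (Suc k) + 1 - x = y + 1" by (simp add: y_def)
    ultimately show ?thesis
      by (simp only: Suc.IH[OF Suc.prems(1,2) True, folded y_def] sum.cl_ivl_Suc) simp
  next
    case False
    then have *: "0 < x - 1" using Suc.prems by (cases k; cases "x = 1") auto
    have "(\<Sum>i=1..Suc k. ln \<bar>x - real i\<bar>) = (\<Sum>i=0..k. ln \<bar>x - real (Suc i)\<bar>)"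
      using sum.shift_bounds_cl_Suc_ivl[of "\<lambda>i. ln \<bar>x - real i\<bar>" 0 k] by simp
    also have "\<dots> = (\<Sum>i=0..k. ln \<bar>x - 1 - real i\<bar>)"
      by (intro sum.cong) (auto simp: algebra_simps)
    also have "\<dots> = ln (x - 1) + (\<Sum>i=1..k. ln \<bar>x - 1 - real i\<bar>)"
      using * by (simp add: sum.atLeast_Suc_atMost[of 0 k])
    finally have 1: "(\<Sum>i=1..Suc k. ln \<bar>x - real i\<bar>) = \<dots>" .
    have "lsin x = lsin (x - 1)" using lsin_add_one[of "x - 1"] by simp
    also have "\<dots> = ln (2 * pi) - ln_Gamma (x - 1) - ln_Gamma (real k + 1 - (x - 1))
        + (\<Sum>i=1..k. ln \<bar>x - 1 - real i\<bar>)"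
      using * Suc.prems not_Ints_diff_one[of x] by (intro Suc.IH) auto
    also have "real k + 1 - (x - 1) = real (Suc k) + 1 - x" by simp
    also have "ln_Gamma (x - 1) = ln_Gamma x - ln (x - 1)" using ln_Gamma_add_one[OF *] by simp
    finally show ?thesis unfolding 1 by simp
  qed
qed

section \<open>Reciprocity for alternating sums of ln |tan|\<close>

definition alt_ltan :: "real \<Rightarrow> nat \<Rightarrow> real" where
  "alt_ltan a n = (\<Sum>i=1..n. (-1) ^ i * ltan (real i * a))"

lemma alternating_telescope:
  fixes g :: "nat \<Rightarrow> real"
  shows "(\<Sum>i=1..n. (-1) ^ i * (g i + g (Suc i))) = - g 1 + (-1) ^ n * g (Suc n)"
  by (induction n) (auto simp: algebra_simps)

lemma alternating_sum_one: "(\<Sum>i=1..n. (-1) ^ i) = ((-1) ^ n - 1) / (2 :: real)"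
  by (induction n) (auto simp: field_simps)

text \<open>Multiplying all arguments by \<open>1 / a\<close> exchanges the two shifts \<open>1\<close> and \<open>a\<close> in the functional
  equations of \<open>dlgr\<close>. This relates the sum for \<open>a\<close> to a shorter sum for \<open>1 / a\<close>, which only depends on
  \<open>1 / a\<close> modulo \<open>2\<close>: the reason why even partial quotients are favourable.\<close>

lemma alt_ltan_reciprocity:
  fixes a :: real and n k :: nat
  assumes a: "0 < a" "a \<le> 2"
    and A: "real n * a < real k + 1" and B: "real k < (real n + 1) * a"
    and n: "\<And>i. i \<in> {1..n} \<Longrightarrow> real i * a \<notin> \<int>" and k: "\<And>i. i \<in> {1..k} \<Longrightarrow> real i / a \<notin> \<int>"
  shows "alt_ltan a n - alt_ltan (1 / a) k = dlgr a 1 - dlgr a a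
    + (-1) ^ (n + k) * (dlgr a ((real n + 1) * a - real k) - dlgr a (real k + 1 - real n * a))"
proof -
  define D where "D = dlgr a"
  \<comment> \<open>The double sum over lattice points (i, j) that arises from expanding either
    side; up to multiples of ln a it is the same for a and 1 / a and cancels in the
    difference.\<close>
  define Bx where "Bx = (\<Sum>i=1..n. \<Sum>j=1..k. (-1) ^ i * (-1) ^ j * ln (\<bar>real i * a - real j\<bar> / 2))"
  define sk sn :: real where "sk = ((-1) ^ k - 1) / 2" and "sn = ((-1) ^ n - 1) / 2"
  have le_n: "real i * a \<le> real n * a" if "i \<le> n" for i
    using that a by (intro mult_right_mono) auto
  have le_k: "real i / a < real n + 1" if "i \<le> k" for i
    using that a B by (simp add: field_simps)
  have "alt_ltan a n = (\<Sum>i=1..n. (-1) ^ i * lgr (real i * a)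
      + (\<Sum>j=1..k. (-1) ^ i * (-1) ^ j * ln (\<bar>real i * a - real j\<bar> / 2))
      - (-1) ^ k * ((-1) ^ i * lgr (real k + 1 - real i * a)))"
    unfolding alt_ltan_def
  proof (intro sum.cong refl)
    fix i assume i: "i \<in> {1..n}"
    have le_lt: "real i * a < real k + 1" using le_n[of i] A i by simp
    show "(-1) ^ i * ltan (real i * a) = (-1) ^ i * lgr (real i * a)
      + (\<Sum>j=1..k. (-1) ^ i * (-1) ^ j * ln (\<bar>real i * a - real j\<bar> / 2))
      - (-1) ^ k * ((-1) ^ i * lgr (real k + 1 - real i * a))"
      by (subst ltan_expansion[of _ k]) (use n[OF i] le_lt a i in
        \<open>auto simp: distrib_left right_diff_distrib sum_distrib_left mult.assoc mult.left_commute[of "(-1) ^ i"]\<close>)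
  qed
  also have "\<dots> = (\<Sum>i=1..n. (-1) ^ i * lgr (real i * a)) + Bx
      - (-1) ^ k * (\<Sum>i=1..n. (-1) ^ i * lgr (real k + 1 - real i * a))"
    by (simp add: sum.distrib sum_subtractf sum_distrib_left Bx_def)
  \<comment> \<open>Each \<open>lgr (i a)\<close> is a sum of two values of \<open>dlgr a\<close>
    one step a apart, so the alternating sum telescopes.\<close>
  also have "(\<Sum>i=1..n. (-1) ^ i * lgr (real i * a))
      = (\<Sum>i=1..n. (-1) ^ i * (D (real i * a) + D (real (Suc i) * a)))"
  proof (intro sum.cong refl)
    fix i assume i: "i \<in> {1..n}"
    have "dlgr a (real i * a) + dlgr a (real i * a + a) = lgr (real i * a)"
      using a i by (intro dlgr_add_step) auto
    moreover have "real i * a + a = real (Suc i) * a" by (simp add: distrib_right)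
    ultimately show "(-1) ^ i * lgr (real i * a) = (-1) ^ i * (D (real i * a) + D (real (Suc i) * a))"
      by (simp only: D_def)
  qed
  also have "\<dots> = - D a + (-1) ^ n * D ((real n + 1) * a)"
    using alternating_telescope[of "\<lambda>i. D (real i * a)" n] by (simp add: algebra_simps)
  also have "(\<Sum>i=1..n. (-1) ^ i * lgr (real k + 1 - real i * a))
      = (\<Sum>i=1..n. (-1) ^ i * (D (real k + 1 - (real i - 1) * a) + D (real k + 1 - (real (Suc i) - 1) * a)))"
  proof (intro sum.cong refl)
    fix i assume i: "i \<in> {1..n}"
    have "dlgr a (real k + 1 - real i * a) + dlgr a (real k + 1 - real i * a + a) = lgr (real k + 1 - real i * a)"
    proof (intro dlgr_add_step)
      show "0 < real k + 1 - real i * a" using le_n[of i] A i by simp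
    qed (use a in auto)
    moreover have "real k + 1 - real i * a + a = real k + 1 - (real i - 1) * a"
      "real k + 1 - real i * a = real k + 1 - (real (Suc i) - 1) * a" by (simp_all add: algebra_simps)
    ultimately show "(-1) ^ i * lgr (real k + 1 - real i * a) =
        (-1) ^ i * (D (real k + 1 - (real i - 1) * a) + D (real k + 1 - (real (Suc i) - 1) * a))"
      by (simp only: D_def add.commute)
  qed
  also have "\<dots> = - D (real k + 1) + (-1) ^ n * D (real k + 1 - real n * a)"
    using alternating_telescope[of "\<lambda>i. D (real k + 1 - (real i - 1) * a)" n] by simp
  finally have 1: "alt_ltan a n = - D a + (-1) ^ n * D ((real n + 1) * a) + Bx
      - (-1) ^ k * (- D (real k + 1) + (-1) ^ n * D (real k + 1 - real n * a))" .

  have "alt_ltan (1 / a) k = (\<Sum>j=1..k. (-1) ^ j * lgr (real j / a)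
      + (\<Sum>i=1..n. (-1) ^ i * (-1) ^ j * ln (\<bar>real i * a - real j\<bar> / 2))
      - (\<Sum>i=1..n. (-1) ^ i * ((-1) ^ j * ln a))
      - (-1) ^ n * ((-1) ^ j * lgr (real n + 1 - real j / a)))"
    unfolding alt_ltan_def
  proof (intro sum.cong refl)
    fix j assume j: "j \<in> {1..k}"
    have l: "ln (\<bar>real j / a - real i\<bar> / 2) = ln (\<bar>real i * a - real j\<bar> / 2) - ln a" for i
    proof -
      have "real j / a \<noteq> real i" using k[OF j] by auto
      then have "real i * a - real j \<noteq> 0" using a by (auto simp: field_simps)
      moreover have "real j / a - real i = - (real i * a - real j) / a"
        using a by (simp add: field_simps)
      then have eq: "\<bar>real j / a - real i\<bar> / 2 = (\<bar>real i * a - real j\<bar> / 2) / a"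
        using a by (simp only: abs_divide abs_minus_cancel) simp
      ultimately show ?thesis using a by (simp only: eq ln_div) (simp add: ln_div ln_mult_pos)
    qed
    show "(-1) ^ j * ltan (real j * (1 / a)) = (-1) ^ j * lgr (real j / a)
      + (\<Sum>i=1..n. (-1) ^ i * (-1) ^ j * ln (\<bar>real i * a - real j\<bar> / 2))
      - (\<Sum>i=1..n. (-1) ^ i * ((-1) ^ j * ln a))
      - (-1) ^ n * ((-1) ^ j * lgr (real n + 1 - real j / a))"
    proof -
      have "real j * (1 / a) = real j / a" by simp
      moreover have "ltan (real j / a) = lgr (real j / a) + ((\<Sum>i=1..n. (-1) ^ i * ln (\<bar>real i * a - real j\<bar> / 2))
          - (\<Sum>i=1..n. (-1) ^ i * ln a)) - (-1) ^ n * lgr (real n + 1 - real j / a)"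
        by (subst ltan_expansion[of _ n]) (use k[OF j] le_k[of j] a j in \<open>auto simp: l right_diff_distrib sum_subtractf\<close>)
      ultimately show ?thesis
        by (simp only: distrib_left right_diff_distrib sum_distrib_left
            mult.assoc mult.left_commute[of "(-1) ^ j"])
    qed
  qed
  also have "\<dots> = (\<Sum>j=1..k. (-1) ^ j * lgr (real j / a)) + Bx - sn * (sk * ln a)
      - (-1) ^ n * (\<Sum>j=1..k. (-1) ^ j * lgr (real n + 1 - real j / a))"
  proof -
    have "(\<Sum>j=1..k. \<Sum>i=1..n. (-1) ^ i * ((-1) ^ j * ln a)) = sn * (sk * ln a)"
      unfolding sn_def sk_def alternating_sum_one[symmetric] sum_distrib_right sum_distrib_left
      by (rule refl)
    moreover have "Bx = (\<Sum>j=1..k. \<Sum>i=1..n. (-1) ^ i * (-1) ^ j * ln (\<bar>real i * a - real j\<bar> / 2))"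
      unfolding Bx_def by (rule sum.swap)
    ultimately show ?thesis by (simp add: sum.distrib sum_subtractf sum_distrib_left)
  qed
  \<comment> \<open>On this side the telescoping uses the other difference equation of
    \<open>dlgr a\<close>, with step 1.\<close>
  also have "(\<Sum>j=1..k. (-1) ^ j * lgr (real j / a)) =
      (\<Sum>j=1..k. (-1) ^ j * (D (real j) + D (real (Suc j))) - (-1) ^ j * (ln a / 2))"
  proof (intro sum.cong refl)
    fix j assume j: "j \<in> {1..k}"
    show "(-1) ^ j * lgr (real j / a) = (-1) ^ j * (D (real j) + D (real (Suc j))) - (-1) ^ j * (ln a / 2)"
    proof -
      have "dlgr a (real j) + dlgr a (real j + 1) = lgr (real j / a) + ln a / 2"
        using a j by (intro dlgr_add_one) auto
      then have "lgr (real j / a) = (D (real j) + D (real (Suc j))) - ln a / 2"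
        by (simp add: D_def add.commute)
      then show ?thesis by (simp only: right_diff_distrib)
    qed
  qed
  also have "\<dots> = - D 1 + (-1) ^ k * D (real k + 1) - sk * (ln a / 2)"
    unfolding sum_subtractf sum_distrib_right[symmetric] alternating_sum_one sk_def
    using alternating_telescope[of "\<lambda>i. D (real i)" k] by (simp add: add.commute)
  also have "(\<Sum>j=1..k. (-1) ^ j * lgr (real n + 1 - real j / a)) =
      (\<Sum>j=1..k. (-1) ^ j * (D ((real n + 1) * a - real j + 1) + D ((real n + 1) * a - real (Suc j) + 1)) - (-1) ^ j * (ln a / 2))"
  proof (intro sum.cong refl)
    fix j assume j: "j \<in> {1..k}"
    have 1: "dlgr a ((real n + 1) * a - real j) + dlgr a ((real n + 1) * a - real j + 1)
        = lgr (((real n + 1) * a - real j) / a) + ln a / 2"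
      using B a j by (intro dlgr_add_one) auto
    have 2: "((real n + 1) * a - real j) / a = real n + 1 - real j / a"
      using a by (simp add: field_simps)
    have 3: "(real n + 1) * a - real (Suc j) + 1 = (real n + 1) * a - real j" by simp
    have "lgr (real n + 1 - real j / a) =
        (D ((real n + 1) * a - real j + 1) + D ((real n + 1) * a - real (Suc j) + 1)) - ln a / 2"
      using 1 unfolding 2 3 D_def by linarith
    then show "(-1) ^ j * lgr (real n + 1 - real j / a) =
        (-1) ^ j * (D ((real n + 1) * a - real j + 1) + D ((real n + 1) * a - real (Suc j) + 1)) - (-1) ^ j * (ln a / 2)"
      by (simp only: right_diff_distrib)
  qed
  also have "\<dots> = - D ((real n + 1) * a) + (-1) ^ k * D ((real n + 1) * a - real k) - sk * (ln a / 2)"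
    unfolding sum_subtractf sum_distrib_right[symmetric] alternating_sum_one sk_def
    using alternating_telescope[of "\<lambda>i. D ((real n + 1) * a - real i + 1)" k] by (simp add: add.commute)
  finally have 2: "alt_ltan (1 / a) k = - D 1 + (-1) ^ k * D (real k + 1) - sk * (ln a / 2) + Bx - sn * (sk * ln a)
      - (-1) ^ n * (- D ((real n + 1) * a) + (-1) ^ k * D ((real n + 1) * a - real k) - sk * (ln a / 2))" .
  \<comment> \<open>With this the coefficients - 1/2, - sn and (-1)^n / 2 of sk ln a add up to
    0.\<close>
  have "(-1) ^ n = 2 * sn + 1" by (simp add: sn_def field_simps)
  then show ?thesis unfolding 1 2 D_def[symmetric] power_add
    by (simp add: algebra_simps)
qed

section \<open>The defect of the reciprocity\<close>

lemma lgr_diff_le_ln: assumes "0 < x" "x \<le> y" shows "lgr y - lgr x \<le> ln (y / x)"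
proof -
  have "lgr y = ln (y / 2) - lgr (y + 1)" "lgr x = ln (x / 2) - lgr (x + 1)"
    using lgr_add_one[of x] lgr_add_one[of y] assms by auto
  moreover have "lgr (x + 1) \<le> lgr (y + 1)" using assms by (intro lgr_mono) auto
  moreover have "ln (y / 2) - ln (x / 2) = ln (y / x)" using assms by (simp add: ln_div)
  ultimately show ?thesis by simp
qed

lemma lgr_le_half_ln: assumes "0 < x" shows "lgr x \<le> ln (x / 2) / 2"
  using lgr_add_one[OF assms] lgr_mono[of x "x + 1"] assms by simp

lemma dlgr_near_one:
  assumes "0 < a" "a \<le> 1/2" "1 \<le> x" "x \<le> 1 + a / 2"
  shows "dlgr a x - dlgr a 1 \<le> ln (5/4)"
proof -
  have "dlgr a x - dlgr a 1 \<le> lgr x - lgr 1" using assms by (intro dlgr_diff_bounds) auto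
  also have "\<dots> \<le> ln x" using lgr_diff_le_ln[of 1 x] assms by simp
  also have "\<dots> \<le> ln (5/4)" using assms by (subst ln_le_cancel_iff) auto
  finally show ?thesis .
qed

lemma dlgr_near_step:
  assumes "0 < a" "a \<le> 1/2" "a / 2 \<le> x" "x \<le> a"
  shows "dlgr a a - dlgr a x \<le> ln 2"
proof -
  have "dlgr a a - dlgr a x \<le> lgr a - lgr x" using assms by (intro dlgr_diff_bounds) auto
  also have "\<dots> \<le> ln (a / x)" using assms by (intro lgr_diff_le_ln) auto
  also have "\<dots> \<le> ln 2" using assms by (subst ln_le_cancel_iff) (auto simp: field_simps)
  finally show ?thesis .
qed

text \<open>For k = floor (n a) and A = k + 1 - n a the bracket is D (1 + a - A) - D A with D =
  \<open>dlgr a\<close>. If n + k is even, monotonicity of D makes the defect nonnegative. If n + k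
  is odd, trouble arises only for A near 0, where D A is very negative; there k + 1 is used instead,
  which changes the parity. The loss 5/2 is a factor 5/4 near the argument 1 times a factor 2 near
  the argument a. The bound k < (n + 1/2) a keeps k below the denominator of the next
  fraction.\<close>

lemma reciprocity_defect_ge:
  fixes a :: real and n :: nat
  assumes a: "0 < a" "a \<le> 1/2"
  obtains k :: nat where "real n * a < real k + 1" "real k < (real n + 1/2) * a"
    "dlgr a 1 - dlgr a a
       + (-1) ^ (n + k) * (dlgr a ((real n + 1) * a - real k) - dlgr a (real k + 1 - real n * a)) \<ge> - ln (5/2)"
proof -
  define k where "k = nat \<lfloor>real n * a\<rfloor>"
  have k: "real k \<le> real n * a" "real n * a < real k + 1"
    using a by (auto simp: k_def)
  define A where "A = real k + 1 - real n * a"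
  have A: "0 < A" "A \<le> 1" using k by (auto simp: A_def)
  have eqB: "(real n + 1) * a - real k = 1 + a - A" by (simp add: A_def algebra_simps)
  have mono: "dlgr a x \<le> dlgr a y" if "0 < x" "x \<le> y" "y \<le> x + 2" for x y
    using dlgr_diff_bounds(1)[of x y a] that a by simp
  have ln: "ln (5/2) = ln 2 + ln (5/4 :: real)"
    by (subst ln_mult_pos[symmetric]) auto
  have ln0: "0 \<le> ln (5/2 :: real)" by simp
  consider "even (n + k)" | "odd (n + k)" "a / 2 \<le> A" | "odd (n + k)" "A < a / 2" by linarith
  then show ?thesis
  proof cases
    case 1
    have "dlgr a A \<le> dlgr a 1" "dlgr a a \<le> dlgr a (1 + a - A)"
      using A a by (auto intro!: mono)
    then have "- ln (5/2) \<le> dlgr a 1 - dlgr a a + (dlgr a (1 + a - A) - dlgr a A)" using ln0 by linarith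
    then show ?thesis
      using k a 1 by (intro that[of k]; (unfold eqB A_def[symmetric])?) (simp_all add: distrib_right)
  next
    case 2
    have "dlgr a (1 + a - A) - dlgr a 1 + (dlgr a a - dlgr a A) \<le> ln (5/2)"
    proof (cases "a \<le> A")
      case True
      then have "dlgr a (1 + a - A) \<le> dlgr a 1" "dlgr a a \<le> dlgr a A"
        using A a by (auto intro!: mono)
      then show ?thesis using ln0 by linarith
    next
      case False
      then show ?thesis
        using dlgr_near_one[of a "1 + a - A"] dlgr_near_step[of a A] 2 A a ln by simp
    qed
    then show ?thesis
      using k a 2 by (intro that[of k]; (unfold eqB A_def[symmetric])?) (simp_all add: distrib_right)
  next
    case 3
    have "dlgr a (1 + A) - dlgr a 1 + (dlgr a a - dlgr a (a - A)) \<le> ln (5/2)"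
      using dlgr_near_one[of a "1 + A"] dlgr_near_step[of a "a - A"] 3 A a ln by simp
    moreover have eq: "(real n + 1) * a - real (Suc k) = a - A" "real (Suc k) + 1 - real n * a = 1 + A"
      by (auto simp: A_def algebra_simps)
    moreover have "real (Suc k) < (real n + 1/2) * a" using 3 by (simp add: A_def algebra_simps)
    ultimately show ?thesis
      using k 3 by (intro that[of "Suc k"]; (unfold eq)?) simp_all
  qed
qed

section \<open>Descent along the continued fraction\<close>

fun cf_pair :: "nat list \<Rightarrow> nat \<times> nat" where
  "cf_pair [] = (0, 1)"
| "cf_pair (a # as) = (snd (cf_pair as), a * snd (cf_pair as) + fst (cf_pair as))"

lemma cf_pair_coprime: "coprime (fst (cf_pair as)) (snd (cf_pair as))"
proof (induction as)
  case (Cons a as)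
  have "gcd (snd (cf_pair as)) (a * snd (cf_pair as) + fst (cf_pair as)) = gcd (snd (cf_pair as)) (fst (cf_pair as))"
    by (rule gcd_add_mult)
  then show ?case using Cons by (simp add: coprime_iff_gcd_eq_1 gcd.commute)
qed auto

lemma cf_pair_den_pos: "\<forall>x\<in>set as. x > 0 \<Longrightarrow> snd (cf_pair as) > 0"
  by (induction as) auto

text \<open>Bounds the number of descent steps by the binary logarithm of the denominator, which is
  what makes a constant cost per step affordable.\<close>

lemma cf_pair_den_ge: "\<forall>x\<in>set as. x \<ge> 2 \<Longrightarrow> 2 ^ length as \<le> snd (cf_pair as)"
proof (induction as)
  case (Cons a as)
  then have "2 * 2 ^ length as \<le> a * snd (cf_pair as)" by (intro mult_mono) auto
  then show ?case by simp
qed auto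

lemma multiple_not_Ints:
  fixes p q i :: nat
  assumes "coprime p q" "0 < i" "i < q"
  shows "real i * (real p / real q) \<notin> \<int>"
proof
  assume "real i * (real p / real q) \<in> \<int>"
  then obtain z :: int where "real i * (real p / real q) = of_int z" by (auto elim: Ints_cases)
  then have "real i * real p = of_int z * real q" using assms by (simp add: field_simps)
  then have "int i * int p = z * int q"
    by (metis of_int_eq_iff of_int_mult of_int_of_nat_eq)
  then have "int q dvd int i * int p" by simp
  then have "q dvd i * p" by (metis int_dvd_int_iff of_nat_mult)
  then have "q dvd i" using assms(1) by (simp add: coprime_commute coprime_dvd_mult_left_iff)
  then show False using assms by (auto dest: dvd_imp_le)
qed

lemma inverse_step:
  fixes p q a :: nat
  assumes "q > 0"
  shows "real (a * q + p) / real q = real a + real p / real q"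
  using assms by (simp add: field_simps)

text \<open>An even partial quotient b makes i / a and i p / q differ by the even number i b, a
  period of \<open>ltan\<close>. So reciprocity leads to a sum of the same kind for the tail p / q,
  at the cost ln (5/2).\<close>

lemma alt_ltan_ge:
  assumes "\<forall>x\<in>set as. even x \<and> x > 0" "n < snd (cf_pair as)"
  shows "alt_ltan (real (fst (cf_pair as)) / real (snd (cf_pair as))) n \<ge> - real (length as) * ln (5/2)"
  using assms
proof (induction as arbitrary: n)
  case Nil
  then show ?case by (simp add: alt_ltan_def)
next
  case (Cons b as)
  define p q where "p = fst (cf_pair as)" and "q = snd (cf_pair as)"
  define a where "a = real q / real (b * q + p)"
  have q: "q > 0" using Cons.prems cf_pair_den_pos[of as] by (auto simp: q_def)
  obtain c where c: "b = 2 * c" using Cons.prems by (auto elim: evenE)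
  have b: "b \<ge> 2" using Cons.prems c by auto
  have "2 * q \<le> b * q" using b by simp
  then have "real (2 * q) \<le> real (b * q + p)" by (simp only: of_nat_le_iff)
  then have a: "0 < a" "a \<le> 1/2" using q by (auto simp: a_def field_simps)
  have inv: "1 / a = real b + real p / real q"
    using inverse_step[OF q, of b p] by (simp add: a_def)
  have cop: "coprime q (b * q + p)" using cf_pair_coprime[of "b # as"] by (simp add: p_def q_def)
  have n: "n < b * q + p" using Cons.prems by (simp add: p_def q_def)
  obtain k where k: "real n * a < real k + 1" "real k < (real n + 1/2) * a"
    and ge: "dlgr a 1 - dlgr a a
       + (-1) ^ (n + k) * (dlgr a ((real n + 1) * a - real k) - dlgr a (real k + 1 - real n * a)) \<ge> - ln (5/2)"
    using reciprocity_defect_ge[OF a, of n] by blast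
  \<comment> \<open>n + 1/2 is below the denominator b q + p of a, and a (b q + p) = q; so k is in
    the range of the induction hypothesis.\<close>
  have "real k < real q"
  proof -
    have "real (n + 1) \<le> real (b * q + p)" using n by (simp only: of_nat_le_iff)
    then have "(real n + 1/2) * a \<le> real (b * q + p) * a"
      using a by (intro mult_right_mono) auto
    also have "\<dots> = real q" using n q b by (simp add: a_def del: of_nat_add of_nat_mult)
    finally show ?thesis using k by linarith
  qed
  then have kq: "k < q" by simp
  have "alt_ltan (1 / a) k = alt_ltan (real p / real q) k"
    unfolding alt_ltan_def
  proof (intro sum.cong refl)
    fix i
    have "real i * (1 / a) = real i * (real p / real q) + 2 * real (i * c)"
      unfolding inv c by (simp add: algebra_simps)
    then show "(-1) ^ i * ltan (real i * (1 / a)) = (-1) ^ i * ltan (real i * (real p / real q))"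
      by (simp only: ltan_add_even)
  qed
  moreover have "alt_ltan (real p / real q) k \<ge> - real (length as) * ln (5/2)"
    unfolding p_def q_def using Cons.prems kq by (intro Cons.IH) (auto simp: q_def)
  moreover have "alt_ltan a n - alt_ltan (1 / a) k = dlgr a 1 - dlgr a a
       + (-1) ^ (n + k) * (dlgr a ((real n + 1) * a - real k) - dlgr a (real k + 1 - real n * a))"
  proof (rule alt_ltan_reciprocity)
    show "real k < (real n + 1) * a" using k a by (simp add: algebra_simps)
    show "real i * a \<notin> \<int>" if "i \<in> {1..n}" for i
      unfolding a_def using multiple_not_Ints[OF cop] that n by simp
    show "real i / a \<notin> \<int>" if "i \<in> {1..k}" for i
    proof -
      have "coprime (b * q + p) q" using cop by (simp add: coprime_commute)
      from multiple_not_Ints[OF this, of i] show ?thesis using that kq by (simp add: a_def)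
    qed
  qed (use a k in auto)
  ultimately have "alt_ltan a n \<ge> - real (Suc (length as)) * ln (5/2)"
    using ge by (simp add: algebra_simps)
  then show ?case by (simp add: a_def p_def q_def)
qed

section \<open>From alternating sums of ln |sin| to sums of ln |tan|\<close>

definition alt_lsin :: "real \<Rightarrow> nat \<Rightarrow> real" where
  "alt_lsin a n = (\<Sum>i=1..n. (-1) ^ i * lsin (real i * a))"

text \<open>Expanding \<open>lsin\<close> puts a sign on the index i of ln \<bar>i a - j\<bar> but
  none on j. Summing over i first therefore reassembles \<open>ltan (j / a)\<close> without a sign
  in front. For even n the constants ln (2 pi) and ln (2 a) drop out.\<close>

lemma alt_lsin_expansion:
  fixes a :: real and n k :: nat
  assumes a: "0 < a" and ev: "even n"
    and A: "real n * a < real k + 1" and B: "real k < (real n + 1) * a"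
    and n: "\<And>i. i \<in> {1..n} \<Longrightarrow> real i * a \<notin> \<int>" and k: "\<And>i. i \<in> {1..k} \<Longrightarrow> real i / a \<notin> \<int>"
  shows "alt_lsin a n = (\<Sum>j=1..k. ltan (real j / a))
    - (\<Sum>j=1..k. lgr (real j / a) - lgr (real n + 1 - real j / a))
    - (\<Sum>i=1..n. (-1) ^ i * (ln_Gamma (real i * a) + ln_Gamma (real k + 1 - real i * a)))"
proof -
  define Bx where "Bx = (\<Sum>i=1..n. \<Sum>j=1..k. (-1) ^ i * ln \<bar>real i * a - real j\<bar>)"
  have zero: "(\<Sum>i=1..n. (-1) ^ i) = (0 :: real)" using ev unfolding alternating_sum_one by simp
  have "alt_lsin a n = (\<Sum>i=1..n. (-1) ^ i * ln (2 * pi)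
      - (-1) ^ i * (ln_Gamma (real i * a) + ln_Gamma (real k + 1 - real i * a))
      + (\<Sum>j=1..k. (-1) ^ i * ln \<bar>real i * a - real j\<bar>))"
    unfolding alt_lsin_def
  proof (intro sum.cong refl)
    fix i assume i: "i \<in> {1..n}"
    have "real i * a \<le> real n * a" using i a by (intro mult_right_mono) auto
    then have le: "real i * a < real k + 1" using A by simp
    show "(-1) ^ i * lsin (real i * a) = (-1) ^ i * ln (2 * pi)
      - (-1) ^ i * (ln_Gamma (real i * a) + ln_Gamma (real k + 1 - real i * a))
      + (\<Sum>j=1..k. (-1) ^ i * ln \<bar>real i * a - real j\<bar>)"
      by (subst lsin_expansion[of _ k]) (use n[OF i] le a i in
        \<open>auto simp: distrib_left right_diff_distrib sum_distrib_left\<close>)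
  qed
  also have "\<dots> = Bx - (\<Sum>i=1..n. (-1) ^ i * (ln_Gamma (real i * a) + ln_Gamma (real k + 1 - real i * a)))"
    unfolding sum.distrib sum_subtractf sum_distrib_right[symmetric] zero Bx_def by simp
  finally have 1: "alt_lsin a n = \<dots>" .
  have "(\<Sum>j=1..k. ltan (real j / a)) = (\<Sum>j=1..k. (lgr (real j / a) - lgr (real n + 1 - real j / a))
      + (\<Sum>i=1..n. (-1) ^ i * ln \<bar>real i * a - real j\<bar>))"
  proof (intro sum.cong refl)
    fix j assume j: "j \<in> {1..k}"
    have "real j < (real n + 1) * a" using B j by auto
    then have le: "real j / a < real n + 1" using a by (simp add: field_simps)
    have l: "ln (\<bar>real j / a - real i\<bar> / 2) = ln \<bar>real i * a - real j\<bar> - ln (2 * a)" for i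
    proof -
      have "real j / a \<noteq> real i" using k[OF j] by auto
      then have "real i * a - real j \<noteq> 0" using a by (auto simp: field_simps)
      moreover have "real j / a - real i = - (real i * a - real j) / a"
        using a by (simp add: field_simps)
      then have eq: "\<bar>real j / a - real i\<bar> / 2 = \<bar>real i * a - real j\<bar> / (2 * a)"
        using a by (simp only: abs_divide abs_minus_cancel) simp
      ultimately show ?thesis using a by (simp only: eq) (subst ln_div, auto)
    qed
    have "ltan (real j / a) = lgr (real j / a)
        + ((\<Sum>i=1..n. (-1) ^ i * ln \<bar>real i * a - real j\<bar>) - (\<Sum>i=1..n. (-1) ^ i) * ln (2 * a))
        - lgr (real n + 1 - real j / a)"
      by (subst ltan_expansion[of _ n])
        (use k[OF j] le a j ev in \<open>auto simp: l right_diff_distrib sum_subtractf sum_distrib_right\<close>)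
    then show "ltan (real j / a) = (lgr (real j / a) - lgr (real n + 1 - real j / a))
      + (\<Sum>i=1..n. (-1) ^ i * ln \<bar>real i * a - real j\<bar>)"
      by (simp only: zero)
  qed
  also have "\<dots> = (\<Sum>j=1..k. lgr (real j / a) - lgr (real n + 1 - real j / a)) + Bx"
    unfolding sum.distrib Bx_def by (subst sum.swap) (rule refl)
  finally show ?thesis using 1 by simp
qed

lemma ln_Gamma_diff_mono:
  fixes x y s :: real
  assumes "0 < x" "x \<le> y" "0 \<le> s"
  shows "ln_Gamma (x + s) - ln_Gamma x \<le> ln_Gamma (y + s) - ln_Gamma y"
proof (rule DERIV_nonneg_imp_nondecreasing[OF assms(2), where f = "\<lambda>t. ln_Gamma (t + s) - ln_Gamma t"])
  fix t assume t: "x \<le> t" "t \<le> y"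
  have "((\<lambda>t. ln_Gamma (t + s) - ln_Gamma t) has_real_derivative (Digamma (t + s) - Digamma t)) (at t)"
    using t assms by (auto intro!: derivative_eq_intros)
  moreover have "Digamma t \<le> Digamma (t + s)" using t assms by (intro Digamma_real_mono) auto
  ultimately show "\<exists>d. ((\<lambda>t. ln_Gamma (t + s) - ln_Gamma t) has_real_derivative d) (at t) \<and> 0 \<le> d"
    by (intro exI[of _ "Digamma (t + s) - Digamma t"]) auto
qed

text \<open>By convexity the slope of \<open>ln_Gamma\<close> left of x is at most its mean slope
  over [x, x + 1], which is ln x by the functional equation.\<close>

lemma ln_Gamma_increment_le:
  fixes x s :: real
  assumes "0 \<le> s" "s < x"
  shows "ln_Gamma x - ln_Gamma (x - s) \<le> s * ln x"
proof (cases "s = 0")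
  case False
  have "\<exists>z>x - s. z < x \<and> ln_Gamma x - ln_Gamma (x - s) = (x - (x - s)) * Digamma z"
    using assms False by (intro MVT2) (auto intro!: derivative_eq_intros)
  then obtain z where z: "x - s < z" "z < x" "ln_Gamma x - ln_Gamma (x - s) = s * Digamma z" by auto
  have "\<exists>y>x. y < x + 1 \<and> ln_Gamma (x + 1) - ln_Gamma x = (x + 1 - x) * Digamma y"
    using assms by (intro MVT2) (auto intro!: derivative_eq_intros)
  then obtain y where y: "x < y" "ln_Gamma (x + 1) - ln_Gamma x = Digamma y" by auto
  have "Digamma z \<le> Digamma y" using z y assms by (intro Digamma_real_mono) auto
  moreover have "Digamma y = ln x" using y ln_Gamma_add_one[of x] assms by simp
  ultimately show ?thesis using z assms by (simp add: mult_left_mono)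
qed simp

text \<open>The upper bound is log-convexity with Gamma 1 = Gamma 2 = 1. For the lower bound the
  increments of length 2 - x ending and starting at 2 are compared, the latter being at most ln (3 -
  x).\<close>

lemma ln_Gamma_between_1_2:
  fixes x :: real assumes "1 \<le> x" "x \<le> 2"
  shows "ln_Gamma x \<le> 0" "- ln 2 \<le> ln_Gamma x"
proof -
  have le: "ln_Gamma y \<le> 0" if "1 \<le> y" "y \<le> 2" for y :: real
  proof -
    have "convex_on {1..2} (ln \<circ> Gamma :: real \<Rightarrow> real)"
      using log_convex_Gamma_real by (rule convex_on_subset) auto
    from convex_onD_Icc'[OF this, of y] that
    have "ln (Gamma y) \<le> (ln (Gamma 2) - ln (Gamma 1)) / (2 - 1) * (y - 1) + ln (Gamma (1::real))" by simp
    moreover have "Gamma (2 :: real) = 1" using Gamma_plus1[of "1::real"] by simp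
    ultimately show ?thesis using that by (simp add: ln_Gamma_real_pos)
  qed
  show "ln_Gamma x \<le> 0" by (rule le) fact+
  have "ln_Gamma (x + (2 - x)) - ln_Gamma x \<le> ln_Gamma (2 + (2 - x)) - ln_Gamma 2"
    using assms by (intro ln_Gamma_diff_mono) auto
  also have "2 + (2 - x) = (3 - x) + 1" by simp
  also have "ln_Gamma (3 - x + 1) = ln (3 - x) + ln_Gamma (3 - x)" using assms by (intro ln_Gamma_add_one) auto
  finally have "- ln_Gamma x \<le> ln (3 - x) + ln_Gamma (3 - x) - 2 * ln_Gamma 2" by simp
  moreover have "ln_Gamma (2 :: real) = 0" using ln_Gamma_real_conv_fact[of 2] by simp
  moreover have "ln_Gamma (3 - x) \<le> 0" using assms by (intro le) auto
  moreover have "ln (3 - x) \<le> ln 2" using assms by (subst ln_le_cancel_iff) auto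
  ultimately show "- ln 2 \<le> ln_Gamma x" by linarith
qed

lemma alternating_sum_even_bounds:
  fixes f :: "nat \<Rightarrow> real"
  assumes "even n" and "\<And>i j. 1 \<le> i \<Longrightarrow> i \<le> j \<Longrightarrow> j \<le> n \<Longrightarrow> f i \<le> f j"
  shows "0 \<le> (\<Sum>i=1..n. (-1) ^ i * f i)" "0 < n \<Longrightarrow> (\<Sum>i=1..n. (-1) ^ i * f i) \<le> f n - f 1"
proof -
  obtain m where m: "n = 2 * m" using assms(1) by (auto elim: evenE)
  have "0 \<le> (\<Sum>i=1..2*l. (-1) ^ i * f i) \<and> (0 < l \<longrightarrow> (\<Sum>i=1..2*l. (-1) ^ i * f i) \<le> f (2*l) - f 1)"
    if "l \<le> m" for l
    using that
  proof (induction l)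
    case (Suc l)
    have *: "(\<Sum>i=1..2*Suc l. (-1) ^ i * f i) = (\<Sum>i=1..2*l. (-1) ^ i * f i) - f (2*l+1) + f (2*l+2)" by simp
    have "f (2*l+1) \<le> f (2*l+2)" using Suc.prems by (intro assms(2)) (auto simp: m)
    moreover have "f (2*l) \<le> f (2*l+1)" if "0 < l" using Suc.prems that by (intro assms(2)) (auto simp: m)
    ultimately show ?case using Suc unfolding * by (cases "l = 0") (auto simp: numeral_2_eq_2)
  qed simp
  from this[of m] show "0 \<le> (\<Sum>i=1..n. (-1) ^ i * f i)" "0 < n \<Longrightarrow> (\<Sum>i=1..n. (-1) ^ i * f i) \<le> f n - f 1"
    by (auto simp: m)
qed

lemma lgr_half_ge: "- ln 4 \<le> lgr (1/2)"
proof -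
  have "lgr (3/2) \<le> ln (3/2/2) / 2" by (rule lgr_le_half_ln) simp
  also have "\<dots> \<le> 0" by simp
  finally have "lgr (3/2) \<le> 0" .
  moreover have "lgr (1/2) + lgr (1/2 + 1) = ln (1/2/2)" by (rule lgr_add_one) simp
  moreover have "ln (1/2/2) = - ln (4::real)" by (simp add: ln_div)
  ultimately show ?thesis by simp
qed

text \<open>Reversing the order of summation turns the second terms into
  \<open>lgr ((j - c) / a)\<close> and \<open>ln_Gamma (i a + c)\<close> with one offset c = k + 1 -
  (n + 1) a. For c \<ge> 0 the Gamma sum is nonpositive and the \<open>lgr\<close> sum is dominated
  by its ends; for c < 0 the roles are exchanged. Replacing floor (n a) by its successor where
  necessary keeps c \<ge> - a / 2, away from the singularity of \<open>ln_Gamma (a + c)\<close> at c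
  = - a.\<close>

lemma lsin_remainder_le:
  fixes a :: real and n :: nat
  assumes a: "0 < a" "a \<le> 1" and ev: "even n"
  obtains k :: nat where "real n * a < real k + 1" "real k < (real n + 1/2) * a"
    "(\<Sum>j=1..k. lgr (real j / a) - lgr (real n + 1 - real j / a))
      + (\<Sum>i=1..n. (-1) ^ i * (ln_Gamma (real i * a) + ln_Gamma (real k + 1 - real i * a)))
      \<le> ln (real n + 1) / 2 + ln 4"
proof -
  have main: "(\<Sum>j=1..k. lgr (real j / a) - lgr (real n + 1 - real j / a))
      + (\<Sum>i=1..n. (-1) ^ i * (ln_Gamma (real i * a) + ln_Gamma (real k + 1 - real i * a)))
      \<le> ln (real n + 1) / 2 + ln 4"
    if k: "real n * a < real k + 1" "real k < (real n + 1/2) * a"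
      and half: "a / 2 \<le> real k + 1 - real n * a" for k
  proof -
    define c where "c = real k + 1 - (real n + 1) * a"
    have c: "c \<le> 1 - a / 2" "- a / 2 \<le> c" using k half by (auto simp: c_def algebra_simps)
    have F1: "(\<Sum>j=1..k. lgr (real j / a) - lgr (real n + 1 - real j / a))
        = (\<Sum>j=1..k. lgr (real j / a) - lgr ((real j - c) / a))"
    proof -
      have "(\<Sum>j=1..k. lgr (real n + 1 - real j / a)) = (\<Sum>j=1..k. lgr (real n + 1 - real (k + 1 - j) / a))"
        by (rule sum.atLeastAtMost_rev)
      also have "\<dots> = (\<Sum>j=1..k. lgr ((real j - c) / a))"
      proof (intro sum.cong refl arg_cong[of _ _ lgr])
        fix j assume "j \<in> {1..k}"
        then have "real (k + 1 - j) = real k + 1 - real j" by simp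
        then show "real n + 1 - real (k + 1 - j) / a = (real j - c) / a"
          using a by (simp add: c_def field_simps)
      qed
      finally show ?thesis by (simp add: sum_subtractf)
    qed
    have F2: "(\<Sum>i=1..n. (-1) ^ i * (ln_Gamma (real i * a) + ln_Gamma (real k + 1 - real i * a)))
        = (\<Sum>i=1..n. (-1) ^ i * (ln_Gamma (real i * a) - ln_Gamma (real i * a + c)))"
    proof -
      have "(\<Sum>i=1..n. (-1) ^ i * ln_Gamma (real k + 1 - real i * a))
          = (\<Sum>i=1..n. (-1) ^ (n + 1 - i) * ln_Gamma (real k + 1 - real (n + 1 - i) * a))"
        by (rule sum.atLeastAtMost_rev)
      also have "\<dots> = (\<Sum>i=1..n. - ((-1) ^ i * ln_Gamma (real i * a + c)))"
      proof (intro sum.cong refl)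
        fix i assume i: "i \<in> {1..n}"
        then have "real (n + 1 - i) = real n + 1 - real i" by simp
        then have "real k + 1 - real (n + 1 - i) * a = real i * a + c"
          by (simp add: c_def algebra_simps)
        moreover have "(-1) ^ (n + 1 - i) = (- ((-1) ^ i) :: real)"
          using i ev by (auto simp: minus_one_power_iff)
        ultimately show "(-1) ^ (n + 1 - i) * ln_Gamma (real k + 1 - real (n + 1 - i) * a)
            = - ((-1) ^ i * ln_Gamma (real i * a + c))" by (simp only: mult_minus_left)
      qed
      finally show ?thesis by (simp add: sum.distrib sum_subtractf distrib_left right_diff_distrib sum_negf)
    qed
    have ln0: "0 \<le> ln (real n + 1)" by simp
    show ?thesis
    proof (cases "0 \<le> c")
      case True
      have "0 \<le> (\<Sum>i=1..n. (-1) ^ i * (ln_Gamma (real i * a + c) - ln_Gamma (real i * a)))"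
        using ev True a by (intro alternating_sum_even_bounds(1) ln_Gamma_diff_mono mult_right_mono) auto
      moreover have "(\<Sum>i=1..n. (-1) ^ i * (ln_Gamma (real i * a) - ln_Gamma (real i * a + c)))
          = - (\<Sum>i=1..n. (-1) ^ i * (ln_Gamma (real i * a + c) - ln_Gamma (real i * a)))"
        by (simp add: sum_negf[symmetric] algebra_simps)
      moreover have "(\<Sum>j=1..k. lgr (real j / a) - lgr ((real j - c) / a)) \<le> ln (real n + 1) / 2 + ln 4"
      proof (cases "k = 0")
        case False
        \<comment> \<open>Since c \<le> 1, the positive part of one term is covered by the negative
          part of the next, and only the two ends remain.\<close>
        have "(\<Sum>j=1..Suc l. lgr (real j / a) - lgr ((real j - c) / a)) \<le> lgr (real (Suc l) / a) - lgr ((1 - c) / a)" for l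
        proof (induction l)
          case (Suc l)
          have "lgr (real (Suc l) / a) \<le> lgr ((real (Suc (Suc l)) - c) / a)"
            using c a by (intro lgr_mono divide_right_mono) auto
          then show ?case using Suc by simp
        qed simp
        from this[of "k - 1"] False
        have "(\<Sum>j=1..k. lgr (real j / a) - lgr ((real j - c) / a)) \<le> lgr (real k / a) - lgr ((1 - c) / a)" by simp
        also have "lgr (real k / a) \<le> ln (real k / a / 2) / 2" using False a by (intro lgr_le_half_ln) auto
        also have "ln (real k / a / 2) \<le> ln (real n + 1)"
        proof (subst ln_le_cancel_iff)
          have "real k \<le> (real n + 1/2) * a" using k by simp
          then have "real k / a \<le> real n + 1/2" using a by (simp add: field_simps)
          then show "real k / a / 2 \<le> real n + 1" by simp
        qed (use False a in auto)
        finally have "(\<Sum>j=1..k. lgr (real j / a) - lgr ((real j - c) / a)) \<le> ln (real n + 1) / 2 - lgr ((1 - c) / a)"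
          by simp
        moreover have "lgr (1/2) \<le> lgr ((1 - c) / a)"
          using c a by (intro lgr_mono) (auto simp: field_simps)
        ultimately show ?thesis using lgr_half_ge by linarith
      qed (use ln0 in simp)
      ultimately show ?thesis unfolding F1 F2 by linarith
    next
      case False
      define s where "s = - c"
      have s: "0 < s" "s \<le> a / 2" using False c by (auto simp: s_def)
      have "(\<Sum>j=1..k. lgr (real j / a) - lgr ((real j - c) / a)) \<le> 0"
        using s a by (intro sum_nonpos) (auto intro!: lgr_mono divide_right_mono simp: s_def)
      moreover have "(\<Sum>i=1..n. (-1) ^ i * (ln_Gamma (real i * a) - ln_Gamma (real i * a + c))) \<le> ln (real n + 1) / 2 + ln 4"
      proof (cases "n = 0")
        case False
        have "(\<Sum>i=1..n. (-1) ^ i * (ln_Gamma (real i * a) - ln_Gamma (real i * a + c)))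
            \<le> (ln_Gamma (real n * a) - ln_Gamma (real n * a + c)) - (ln_Gamma (real 1 * a) - ln_Gamma (real 1 * a + c))"
        proof (intro alternating_sum_even_bounds(2) ev)
          fix i j :: nat assume ij: "1 \<le> i" "i \<le> j" "j \<le> n"
          have "1 * a \<le> real i * a" using ij a by (intro mult_right_mono) auto
          then have "0 < real i * a + c" using c a by linarith
          moreover have "real i * a \<le> real j * a" using ij a by (intro mult_right_mono) auto
          ultimately show "ln_Gamma (real i * a) - ln_Gamma (real i * a + c) \<le> ln_Gamma (real j * a) - ln_Gamma (real j * a + c)"
            using ln_Gamma_diff_mono[of "real i * a + c" "real j * a + c" s] s a by (simp add: s_def)
        qed (use False in auto)
        also have "ln_Gamma (real n * a) - ln_Gamma (real n * a + c) \<le> s * ln (real n * a)"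
        proof -
          have "1 * a \<le> real n * a" using False a by (intro mult_right_mono) auto
          then have "s < real n * a" using s a by linarith
          then show ?thesis using ln_Gamma_increment_le[of s "real n * a"] s a by (simp add: s_def)
        qed
        also have "s * ln (real n * a) \<le> s * ln (real n + 1)"
        proof -
          have "real n * a \<le> real n * 1" using a by (intro mult_left_mono) auto
          then have "real n * a \<le> real n + 1" by linarith
          then show ?thesis using s a False by (intro mult_left_mono) auto
        qed
        also have "s * ln (real n + 1) \<le> 1 / 2 * ln (real n + 1)"
          using s a ln0 by (intro mult_right_mono) auto
        finally have "(\<Sum>i=1..n. (-1) ^ i * (ln_Gamma (real i * a) - ln_Gamma (real i * a + c)))
            \<le> 1 / 2 * ln (real n + 1) - (ln_Gamma (real 1 * a) - ln_Gamma (real 1 * a + c))"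
          by simp
        \<comment> \<open>Of the factor 4, one 2 comes from a \<le> 2 (a - s) and the other from
          Gamma (a + 1) \<ge> 1/2.\<close>
        moreover have "- (ln_Gamma (real 1 * a) - ln_Gamma (real 1 * a + c)) \<le> ln 4"
        proof -
          have "ln_Gamma (a - s + 1) = ln (a - s) + ln_Gamma (a - s)" "ln_Gamma (a + 1) = ln a + ln_Gamma a"
            using s a by (auto intro!: ln_Gamma_add_one)
          moreover have "ln_Gamma (a - s + 1) \<le> 0" "- ln 2 \<le> ln_Gamma (a + 1)"
            using s a by (auto intro!: ln_Gamma_between_1_2)
          moreover have "ln a \<le> ln (2 * (a - s))" using s a by (subst ln_le_cancel_iff) auto
          moreover have "ln (2 * (a - s)) = ln 2 + ln (a - s)" using s a by (subst ln_mult_pos) auto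
          moreover have "ln (4::real) = 2 * ln 2" using ln_realpow[of "2::real" 2] by simp
          ultimately show ?thesis by (simp add: s_def)
        qed
        ultimately show ?thesis by linarith
      qed (use ln0 in simp)
      ultimately show ?thesis unfolding F1 F2 by linarith
    qed
  qed
  define k where "k = nat \<lfloor>real n * a\<rfloor>"
  have k: "real k \<le> real n * a" "real n * a < real k + 1"
    using a by (auto simp: k_def)
  show ?thesis
  proof (cases "a / 2 \<le> real k + 1 - real n * a")
    case True
    have "real k < (real n + 1/2) * a" using k a by (simp add: algebra_simps)
    with True k show ?thesis using main by (intro that[of k]) auto
  next
    case False
    have "real n * a < real (Suc k) + 1" "real (Suc k) < (real n + 1/2) * a" "a / 2 \<le> real (Suc k) + 1 - real n * a"
      using k a False by (auto simp: algebra_simps)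
    then show ?thesis by (intro that[of "Suc k"] main)
  qed
qed


text \<open>The odd first quotient b supplies the missing sign: i / a and i p / q differ by i b, so
  \<open>ltan (i / a)\<close> is (-1)^i times \<open>ltan (i p / q)\<close>, and the unsigned sum
  becomes \<open>alt_ltan\<close> of the tail, whose quotients are all even.\<close>

lemma alt_lsin_ge:
  assumes "odd b" "\<forall>x\<in>set as. even x \<and> x > 0" "even n" "n < snd (cf_pair (b # as))"
  shows "alt_lsin (real (fst (cf_pair (b # as))) / real (snd (cf_pair (b # as)))) n
    \<ge> - ln (real (snd (cf_pair (b # as)))) / 2 - ln 4 - real (length as) * ln (5/2)"
proof -
  define p q where "p = fst (cf_pair as)" and "q = snd (cf_pair as)"
  define a where "a = real q / real (b * q + p)"
  have q: "q > 0" using assms cf_pair_den_pos[of as] by (auto simp: q_def)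
  have b: "b \<ge> 1" using assms by (cases b) auto
  have "1 * q \<le> b * q" using b by (intro mult_right_mono) auto
  then have "q \<le> b * q + p" by linarith
  then have "real q \<le> real (b * q + p)" by (simp only: of_nat_le_iff)
  then have a: "0 < a" "a \<le> 1" using q by (auto simp: a_def field_simps)
  have inv: "1 / a = real b + real p / real q"
    using inverse_step[OF q, of b p] by (simp add: a_def)
  have cop: "coprime q (b * q + p)" using cf_pair_coprime[of "b # as"] by (simp add: p_def q_def)
  have n: "n < b * q + p" using assms by (simp add: p_def q_def)
  obtain k where k: "real n * a < real k + 1" "real k < (real n + 1/2) * a"
    and le: "(\<Sum>j=1..k. lgr (real j / a) - lgr (real n + 1 - real j / a))
      + (\<Sum>i=1..n. (-1) ^ i * (ln_Gamma (real i * a) + ln_Gamma (real k + 1 - real i * a)))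
      \<le> ln (real n + 1) / 2 + ln 4"
    using lsin_remainder_le[OF a assms(3)] by blast
  have n1: "real n + 1 \<le> real (b * q + p)"
  proof -
    have "real (n + 1) \<le> real (b * q + p)" using n by (simp only: of_nat_le_iff)
    then show ?thesis by simp
  qed
  have "real k < real q"
  proof -
    have "(real n + 1/2) * a \<le> real (b * q + p) * a"
      using n1 a by (intro mult_right_mono) auto
    also have "\<dots> = real q" using n q b by (simp add: a_def del: of_nat_add of_nat_mult)
    finally show ?thesis using k by linarith
  qed
  then have kq: "k < q" by simp
  have "(\<Sum>j=1..k. ltan (real j / a)) = alt_ltan (real p / real q) k"
    unfolding alt_ltan_def
  proof (intro sum.cong refl)
    fix i
    have "real i / a = real i * (1 / a)" by simp
    also have "\<dots> = real i * (real p / real q) + real (i * b)"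
      unfolding inv by (simp add: algebra_simps)
    finally have "ltan (real i / a) = (-1) ^ (i * b) * ltan (real i * (real p / real q))"
      by (simp only: ltan_add_nat)
    moreover have "(-1) ^ (i * b) = ((-1) ^ i :: real)" using assms(1) by (simp add: minus_one_power_iff)
    ultimately show "ltan (real i / a) = (-1) ^ i * ltan (real i * (real p / real q))" by simp
  qed
  moreover have "alt_ltan (real p / real q) k \<ge> - real (length as) * ln (5/2)"
    unfolding p_def q_def using assms kq by (intro alt_ltan_ge) (auto simp: q_def)
  moreover have "alt_lsin a n = (\<Sum>j=1..k. ltan (real j / a))
    - (\<Sum>j=1..k. lgr (real j / a) - lgr (real n + 1 - real j / a))
    - (\<Sum>i=1..n. (-1) ^ i * (ln_Gamma (real i * a) + ln_Gamma (real k + 1 - real i * a)))"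
  proof (rule alt_lsin_expansion)
    show "real k < (real n + 1) * a" using k a by (simp add: algebra_simps)
    show "real i * a \<notin> \<int>" if "i \<in> {1..n}" for i
      unfolding a_def using multiple_not_Ints[OF cop] that n by simp
    show "real i / a \<notin> \<int>" if "i \<in> {1..k}" for i
    proof -
      have "coprime (b * q + p) q" using cop by (simp add: coprime_commute)
      from multiple_not_Ints[OF this, of i] show ?thesis using that kq by (simp add: a_def)
    qed
  qed (use a k assms in auto)
  moreover have "ln (real n + 1) \<le> ln (real (b * q + p))" using n1 by (subst ln_le_cancel_iff) auto
  ultimately have "alt_lsin a n \<ge> - ln (real (b * q + p)) / 2 - ln 4 - real (length as) * ln (5/2)"
    using le by linarith
  then show ?thesis by (simp add: a_def p_def q_def)
qed

section \<open>Squared products of sine quotients\<close>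

definition sine_ratio :: "real \<Rightarrow> nat \<Rightarrow> real" where
  "sine_ratio a l = (\<Prod>i=1..l. (sin (pi * (real (2 * i - 1) * a)) / sin (pi * (real (2 * i) * a)))\<^sup>2)"

lemma sine_ratio_eq_exp:
  assumes "\<And>i. i \<in> {1..2*l} \<Longrightarrow> real i * a \<notin> \<int>"
  shows "sine_ratio a l = exp (- 2 * alt_lsin a (2 * l))"
  using assms
proof (induction l)
  case 0
  then show ?case by (simp add: sine_ratio_def alt_lsin_def)
next
  case (Suc l)
  define x y where "x = sin (pi * (real (2 * l + 1) * a))" and "y = sin (pi * (real (2 * l + 2) * a))"
  have ne: "x \<noteq> 0" "y \<noteq> 0"
    using Suc.prems[of "2*l+1"] Suc.prems[of "2*l+2"]
      sin_times_pi_eq_0[of "real (2*l+1) * a"] sin_times_pi_eq_0[of "real (2*l+2) * a"]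
    by (auto simp: x_def y_def mult.commute[of pi])
  have "alt_lsin a (2 * Suc l) = alt_lsin a (2 * l) - ln \<bar>2 * x\<bar> + ln \<bar>2 * y\<bar>"
    by (simp add: alt_lsin_def x_def y_def lsin_def mult.commute)
  also have "\<dots> = alt_lsin a (2 * l) - ln \<bar>x\<bar> + ln \<bar>y\<bar>"
    using ne by (simp add: abs_mult ln_mult_pos)
  finally have "exp (- 2 * alt_lsin a (2 * Suc l)) = exp (- 2 * alt_lsin a (2 * l)) * exp (2 * ln \<bar>x\<bar>) / exp (2 * ln \<bar>y\<bar>)"
    by (simp add: exp_add[symmetric] exp_diff[symmetric] algebra_simps)
  also have "exp (2 * ln \<bar>x\<bar>) = x\<^sup>2" using ne by (simp add: exp_double)
  also have "exp (2 * ln \<bar>y\<bar>) = y\<^sup>2" using ne by (simp add: exp_double)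
  also have "exp (- 2 * alt_lsin a (2 * l)) = sine_ratio a l" using Suc by simp
  finally show ?case
    by (simp add: sine_ratio_def x_def y_def power_divide)
qed

text \<open>Exponentiation gives 16 q for the first quotient and 25/4 for each even one; 25/4 \<le>
  2^3 together with 2^(length as) \<le> q turns the product into 16 q^4.\<close>

lemma sine_ratio_le:
  assumes "odd b" "\<forall>x\<in>set as. even x \<and> x > 0" "2 * l < snd (cf_pair (b # as))"
  shows "sine_ratio (real (fst (cf_pair (b # as))) / real (snd (cf_pair (b # as)))) l
    \<le> 16 * real (snd (cf_pair (b # as))) ^ 4"
proof -
  define p q where "p = fst (cf_pair (b # as))" and "q = snd (cf_pair (b # as))"
  have q: "q > 0" using assms(3) unfolding q_def by linarith
  have pow: "2 ^ length as \<le> q"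
  proof -
    have "\<forall>x\<in>set as. 2 \<le> x" using assms by (auto dest!: bspec elim!: evenE)
    then have "2 ^ length as \<le> snd (cf_pair as)" by (rule cf_pair_den_ge)
    also have "\<dots> \<le> q" using assms(1) by (cases b) (auto simp: q_def)
    finally show ?thesis .
  qed
  have "sine_ratio (real p / real q) l = exp (- 2 * alt_lsin (real p / real q) (2 * l))"
    using multiple_not_Ints[of p q] cf_pair_coprime[of "b # as"] assms(3)
    by (intro sine_ratio_eq_exp) (auto simp: p_def q_def)
  also have "\<dots> \<le> exp (ln (real q) + 2 * ln 4 + real (length as) * (2 * ln (5/2)))"
    using alt_lsin_ge[OF assms(1,2) _ assms(3)] unfolding p_def q_def
    by (subst exp_le_cancel_iff) (simp add: algebra_simps)
  also have "\<dots> = real q * exp (2 * ln 4) * exp (2 * ln (5/2)) ^ length as"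
    using q by (simp add: exp_add exp_of_nat_mult)
  also have "exp (2 * ln 4) = (16 :: real)" by (simp add: exp_double)
  also have "exp (2 * ln (5/2)) = (25 / 4 :: real)" by (simp add: exp_double power2_eq_square)
  also have "real q * 16 * (25 / 4) ^ length as \<le> real q * 16 * 8 ^ length as"
    by (intro mult_left_mono power_mono) auto
  also have "(8::real) ^ length as = (2 ^ length as) ^ 3"
    by (simp add: power_mult[symmetric] mult.commute[of _ 3]) (simp add: power_mult)
  also have "real q * 16 * (2 ^ length as) ^ 3 \<le> real q * 16 * real q ^ 3"
  proof (intro mult_left_mono power_mono)
    have "real (2 ^ length as) \<le> real q" using pow by (simp only: of_nat_le_iff)
    then show "2 ^ length as \<le> real q" by simp
  qed auto
  also have "\<dots> = 16 * real q ^ 4" by (simp add: eval_nat_numeral)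
  finally show ?thesis by (simp add: p_def q_def)
qed

section \<open>Recurrences with periodic coefficients\<close>

text \<open>Continuants: \<open>n \<mapsto> contin w k (n - k)\<close> is the solution of \<open>x (n + 1) + x (n - 1) = w n * x n\<close> with
  values \<open>0\<close> at \<open>k\<close> and \<open>1\<close> at \<open>k + 1\<close>; \<open>green\<close> extends it to \<open>n < k\<close>.\<close>

fun contin :: "(int \<Rightarrow> 'a::comm_ring_1) \<Rightarrow> int \<Rightarrow> nat \<Rightarrow> 'a" where
  "contin w k 0 = 0"
| "contin w k (Suc 0) = 1"
| "contin w k (Suc (Suc m)) = w (k + 1 + int m) * contin w k (Suc m) - contin w k m"

text \<open>A continuant can be expanded from either end. The left end is what shows that
  \<open>green\<close> solves the recurrence also to the left of its base point.\<close>

lemma contin_lower: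
  "contin w k (Suc (Suc m)) = w (k + 1) * contin w (k + 1) (Suc m) - contin w (k + 2) m"
proof (induction m rule: less_induct)
  case (less m)
  consider "m = 0" | "m = 1" | l where "m = Suc (Suc l)" by (metis One_nat_def not0_implies_Suc)
  then show ?case
  proof cases
    case 3
    have "contin w k (Suc (Suc m)) = w (k + 1 + int m) * contin w k (Suc (Suc (Suc l))) - contin w k (Suc (Suc l))"
      using 3 by simp
    also have "contin w k (Suc (Suc (Suc l))) = w (k + 1) * contin w (k + 1) (Suc (Suc l)) - contin w (k + 2) (Suc l)"
      using less[of "Suc l"] 3 by simp
    also have "contin w k (Suc (Suc l)) = w (k + 1) * contin w (k + 1) (Suc l) - contin w (k + 2) l"
      using less[of l] 3 by simp
    finally show ?thesis using 3 by (simp add: algebra_simps del: contin.simps(3)) (simp add: algebra_simps)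
  qed (simp_all add: algebra_simps)
qed

definition green :: "(int \<Rightarrow> 'a::comm_ring_1) \<Rightarrow> int \<Rightarrow> int \<Rightarrow> 'a" where
  "green w k n = (if k \<le> n then contin w k (nat (n - k)) else - contin w n (nat (k - n)))"

definition sol :: "(int \<Rightarrow> 'a::comm_ring_1) \<Rightarrow> (int \<Rightarrow> 'a) \<Rightarrow> bool" where
  "sol w x \<longleftrightarrow> (\<forall>n. x (n + 1) + x (n - 1) = w n * x n)"

lemma solD: "sol w x \<Longrightarrow> x (n + 1) + x (n - 1) = w n * x n"
  by (simp add: sol_def)

lemma green_self [simp]: "green w k k = 0"
  by (simp add: green_def)

lemma green_succ [simp]: "green w k (k + 1) = 1" "green w k (1 + k) = 1"
  by (simp_all add: green_def)

lemma green_antisym: "green w n k = - green w k n"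
  by (cases k n rule: linorder_cases) (auto simp: green_def)

lemma green_add: "green w k (k + int m) = contin w k m"
  by (simp add: green_def)

lemma sol_green: "sol w (green w k)"
  unfolding sol_def
proof
  fix n
  consider "n = k" | m where "n = k + 1 + int m" | m where "n = k - 1 - int m"
  proof (cases n k rule: linorder_cases)
    case less then show ?thesis using that(3)[of "nat (k - 1 - n)"] by simp
  next
    case greater then show ?thesis using that(2)[of "nat (n - 1 - k)"] by simp
  qed (use that in simp)
  then show "green w k (n + 1) + green w k (n - 1) = w n * green w k n"
  proof cases
    case 1
    have "green w k (k - 1) = - 1" using green_antisym[of w k "k - 1"] green_succ(1)[of w "k - 1"] by simp
    then show ?thesis using 1 by simp
  next
    case 2
    have "green w k (n + 1) = contin w k (Suc (Suc m))" "green w k (n - 1) = contin w k m"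
        "green w k n = contin w k (Suc m)"
      using 2 by (auto simp: green_def nat_add_distrib Suc_nat_eq_nat_zadd1 algebra_simps)
    then show ?thesis using 2 by simp
  next
    case 3
    have "green w k (n + 1) = - contin w (n + 1) m" "green w k (n - 1) = - contin w (n - 1) (Suc (Suc m))"
        "green w k n = - contin w n (Suc m)"
      using 3 by (auto simp: green_def nat_add_distrib Suc_nat_eq_nat_zadd1 algebra_simps)
    moreover have "contin w (n - 1) (Suc (Suc m)) = w n * contin w n (Suc m) - contin w (n + 1) m"
      using contin_lower[of w "n - 1" m] by (simp del: contin.simps add: add.commute)
    ultimately show ?thesis by (simp del: contin.simps)
  qed
qed

lemma sol_zero:
  assumes "sol w x" "x k = 0" "x (k + 1) = 0" shows "x n = 0"
proof -
  have "x (k + int m) = 0 \<and> x (k + int m + 1) = 0" for m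
  proof (induction m)
    case (Suc m)
    then show ?case using solD[OF assms(1), of "k + int m + 1"] by (simp add: add_ac)
  qed (use assms in simp)
  moreover have "x (k - int m) = 0 \<and> x (k - int m + 1) = 0" for m
  proof (induction m)
    case (Suc m)
    then show ?case using solD[OF assms(1), of "k - int m"] by (simp add: algebra_simps)
  qed (use assms in simp)
  ultimately show ?thesis
    by (cases "k \<le> n") (metis add.commute diff_add_cancel zle_iff_zadd nonneg_int_cases
      diff_ge_0_iff_ge, metis diff_diff_cancel nle_le nonneg_int_cases diff_ge_0_iff_ge add_diff_cancel_left' diff_diff_eq2)
qed

lemma sol_lincomb: "sol w x \<Longrightarrow> sol w y \<Longrightarrow> sol w (\<lambda>n. a * x n - b * y n)"
  unfolding sol_def
proof
  fix n assume "\<forall>n. x (n + 1) + x (n - 1) = w n * x n" "\<forall>n. y (n + 1) + y (n - 1) = w n * y n"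
  then have "a * (x (n + 1) + x (n - 1)) - b * (y (n + 1) + y (n - 1)) = a * (w n * x n) - b * (w n * y n)" by simp
  then show "a * x (n + 1) - b * y (n + 1) + (a * x (n - 1) - b * y (n - 1)) = w n * (a * x n - b * y n)"
    by (simp add: algebra_simps)
qed

lemma sol_eqI:
  assumes "sol w x" "sol w y" "x k = y k" "x (k + 1) = y (k + 1)" shows "x n = y n"
proof -
  have "sol w (\<lambda>n. 1 * x n - 1 * y n)" using assms by (intro sol_lincomb)
  from sol_zero[OF this, of k n] assms show ?thesis by simp
qed

lemma sol_expand:
  assumes "sol w x"
  shows "x n = x (k + 1) * green w k n - x k * green w (k + 1) n"
proof (rule sol_eqI[OF assms, of _ k])
  show "sol w (\<lambda>n. x (k + 1) * green w k n - x k * green w (k + 1) n)"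
    by (intro sol_lincomb sol_green)
  show "x k = x (k + 1) * green w k k - x k * green w (k + 1) k"
    using green_antisym[of w "k + 1" k] by simp
qed simp

section \<open>Wronskians\<close>

definition wronski :: "(int \<Rightarrow> 'a::comm_ring_1) \<Rightarrow> (int \<Rightarrow> 'a) \<Rightarrow> int \<Rightarrow> 'a" where
  "wronski x y n = x n * y (n + 1) - x (n + 1) * y n"

lemma wronski_const:
  assumes "sol w x" "sol w y" shows "wronski x y n = wronski x y m"
proof -
  have step: "wronski x y (n + 1) = wronski x y n" for n
  proof -
    have "x (n + 1 + 1) = w (n + 1) * x (n + 1) - x n" "y (n + 1 + 1) = w (n + 1) * y (n + 1) - y n"
      using solD[OF assms(1), of "n + 1"] solD[OF assms(2), of "n + 1"] by (simp_all add: algebra_simps)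
    then show ?thesis unfolding wronski_def by (simp only:) (simp add: algebra_simps)
  qed
  have "wronski x y (n + int l) = wronski x y n" for l n
  proof (induction l)
    case (Suc l) then show ?case using step[of "n + int l"] by (simp add: add_ac)
  qed simp
  from this[of n "nat (m - n)"] this[of m "nat (n - m)"] show ?thesis
    by (cases "n \<le> m") auto
qed

text \<open>Proportionality of two solutions, phrased as a vanishing 2 by 2 minor so that it makes
  sense without division in a commutative ring.\<close>

lemma sol_minor:
  assumes "sol w x" "sol w y" "wronski x y n = 0" shows "x i * y j = x j * y i"
proof -
  have "sol w (\<lambda>j. x i * y j - y i * x j)" using assms by (intro sol_lincomb)
  moreover have "x i * y (i + 1) - y i * x (i + 1) = 0"
    using wronski_const[OF assms(1,2), of i n] assms(3) by (simp add: wronski_def mult.commute)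
  ultimately have "x i * y j - y i * x j = 0"
    using sol_zero[of w "\<lambda>j. x i * y j - y i * x j" i j] by (simp add: mult.commute)
  then show ?thesis by (simp add: mult.commute)
qed

section \<open>Monodromy of a periodic recurrence\<close>

locale periodic_recurrence =
  fixes w :: "int \<Rightarrow> 'a::comm_ring_1" and q :: nat
  assumes periodic: "w (n + int q) = w n"
begin

text \<open>Trace of the monodromy matrix over q steps, in the basis given by the values of a
  solution at 0 and 1.\<close>

definition tr :: 'a where "tr = green w 0 (int q + 1) - green w 1 (int q)"

lemma contin_shift: "contin w (k + int q) m = contin w k m"
proof (induction m rule: induct_nat_012)
  case (ge2 m)
  have "k + int q + 1 + int m = (k + 1 + int m) + int q" by simp
  then have "w (k + int q + 1 + int m) = w (k + 1 + int m)" by (simp only: periodic)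
  then show ?case using ge2 by simp
qed simp_all

lemma green_shift: "green w (k + int q) (n + int q) = green w k n"
  by (simp add: green_def contin_shift)

lemma sol_shift: "sol w x \<Longrightarrow> sol w (\<lambda>n. x (n + int q))"
  unfolding sol_def
proof
  fix n assume "\<forall>n. x (n + 1) + x (n - 1) = w n * x n"
  then have "x (n + int q + 1) + x (n + int q - 1) = w (n + int q) * x (n + int q)" by blast
  moreover have "n + 1 + int q = n + int q + 1" "n - 1 + int q = n + int q - 1" by simp_all
  ultimately show "x (n + 1 + int q) + x (n - 1 + int q) = w n * x (n + int q)"
    by (simp only: periodic)
qed

lemma green_lower: "green w k n = w (k + 1) * green w (k + 1) n - green w (k + 2) n"
proof -
  have "green w n (k + 1 + 1) + green w n (k + 1 - 1) = w (k + 1) * green w n (k + 1)"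
    by (rule solD[OF sol_green])
  then have "green w n (k + 2) + green w n k = w (k + 1) * green w n (k + 1)" by (simp add: add.assoc)
  then have "- green w (k + 2) n - green w k n = - (w (k + 1) * green w (k + 1) n)"
    using green_antisym[of w n k] green_antisym[of w n "k + 1"] green_antisym[of w n "k + 2"] by simp
  then show ?thesis by (simp add: algebra_simps)
qed

lemma green_upper: "green w k (n + 1) = w n * green w k n - green w k (n - 1)"
  using solD[OF sol_green, of w k n] by (simp add: eq_diff_eq)

text \<open>Cyclic invariance of the trace: moving the base point by one site adds and removes the
  same product, because w takes equal values at both ends of the period.\<close>

lemma tr_at: "green w k (k + int q + 1) - green w (k + 1) (k + int q) = tr"
proof -
  have step: "green w (k + 1) (k + 1 + int q + 1) - green w (k + 1 + 1) (k + 1 + int q)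
      = green w k (k + int q + 1) - green w (k + 1) (k + int q)" for k
  proof -
    have "green w (k + 1) (k + int q + 1 + 1) = w (k + 1 + int q) * green w (k + 1) (k + int q + 1) - green w (k + 1) (k + int q)"
      using green_upper[of "k + 1" "k + int q + 1"] by (simp add: add_ac)
    moreover have "green w k (k + int q + 1) = w (k + 1) * green w (k + 1) (k + int q + 1) - green w (k + 2) (k + int q + 1)"
      by (rule green_lower)
    moreover have "k + 1 + int q + 1 = k + int q + 1 + 1" "k + 1 + 1 = k + 2" "k + 1 + int q = k + int q + 1" by simp_all
    ultimately show ?thesis using periodic[of "k + 1"] by (simp only:) (simp add: algebra_simps)
  qed
  show ?thesis
  proof (induction k rule: int_induct[of _ 0])
    case base show ?case by (simp add: tr_def)
  next
    case (step1 i) then show ?case using step[of i] by simp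
  next
    case (step2 i) then show ?case using step[of "i - 1"] by simp
  qed
qed

text \<open>Cayley-Hamilton for a monodromy matrix M of determinant 1: M plus its inverse is the
  trace times the identity.\<close>

lemma sol_period:
  assumes "sol w x" shows "x (n + int q) + x (n - int q) = tr * x n"
proof -
  have "x (n + int q) = x (n + 1) * green w n (n + int q) - x n * green w (n + 1) (n + int q)"
    "x (n - int q) = x (n + 1) * green w n (n - int q) - x n * green w (n + 1) (n - int q)"
    by (rule sol_expand[OF assms])+
  moreover have "green w n (n - int q) = - green w n (n + int q)"
    using green_antisym[of w n "n - int q"] green_shift[of "n - int q" n] by simp
  moreover have "green w (n + 1) (n - int q) = - green w n (n + int q + 1)"
    using green_antisym[of w "n + 1" "n - int q"] green_shift[of "n - int q" "n + 1"] by (simp add: add_ac)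
  ultimately show ?thesis unfolding tr_at[of n, symmetric] by (simp add: algebra_simps)
qed

section \<open>Variation of constants over one period\<close>

lemma forced_forward:
  fixes u f :: "int \<Rightarrow> 'a"
  assumes f: "\<And>n. f n = u (n + 1) + u (n - 1) - w n * u n"
  shows "u (n + int m) = u (n + 1) * green w n (n + int m) - u n * green w (n + 1) (n + int m)
    + (\<Sum>j=1..<m. contin w (n + int j) (m - j) * f (n + int j))"
proof (induction m rule: induct_nat_012)
  case 0
  show ?case using green_antisym[of w "n + 1" n] by simp
next
  case 1
  show ?case by simp
next
  case (ge2 m)
  let ?S = "\<lambda>m. \<Sum>j=1..<m. contin w (n + int j) (m - j) * f (n + int j)"
  have S: "?S (Suc (Suc m)) = w (n + int m + 1) * ?S (Suc m) - ?S m + f (n + int m + 1)"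
  proof (cases m)
    case (Suc l)
    define A B where "A = (\<Sum>j=1..<m. contin w (n + int j) (Suc m - j) * f (n + int j))"
      and "B = (\<Sum>j=1..<m. contin w (n + int j) (m - j) * f (n + int j))"
    have "?S (Suc (Suc m)) = (\<Sum>j=1..<m. contin w (n + int j) (Suc (Suc m) - j) * f (n + int j))
        + w (n + int m + 1) * f (n + int m) + f (n + int m + 1)"
      using Suc by (simp add: add_ac Suc_diff_le)
    also have "(\<Sum>j=1..<m. contin w (n + int j) (Suc (Suc m) - j) * f (n + int j))
        = (\<Sum>j=1..<m. w (n + int m + 1) * (contin w (n + int j) (Suc m - j) * f (n + int j))
             - contin w (n + int j) (m - j) * f (n + int j))"
    proof (intro sum.cong refl)
      fix j assume "j \<in> {1..<m}"
      then have "Suc (Suc m) - j = Suc (Suc (m - j))" "Suc m - j = Suc (m - j)"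
        "n + int j + 1 + int (m - j) = n + int m + 1" by auto
      then show "contin w (n + int j) (Suc (Suc m) - j) * f (n + int j) =
          w (n + int m + 1) * (contin w (n + int j) (Suc m - j) * f (n + int j)) - contin w (n + int j) (m - j) * f (n + int j)"
        by (simp only: contin.simps) (simp add: algebra_simps)
    qed
    also have "\<dots> = w (n + int m + 1) * A - B"
      by (simp only: A_def B_def sum_subtractf sum_distrib_left)
    finally have "?S (Suc (Suc m)) = w (n + int m + 1) * A - B + w (n + int m + 1) * f (n + int m) + f (n + int m + 1)" .
    moreover have "?S (Suc m) = A + f (n + int m)" using Suc by (simp add: A_def)
    moreover have "?S m = B" by (simp add: B_def)
    ultimately show ?thesis by (simp only:) (simp add: algebra_simps)
  qed simp
  define M where "M = n + int m + 1"
  have M: "n + int (Suc (Suc m)) = M + 1" "n + int (Suc m) = M" "n + int m = M - 1" by (simp_all add: M_def)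
  have "u (M + 1) = w M * u M - u (M - 1) + f M"
    using f[of M] by (simp add: algebra_simps)
  also have "u M = u (n + 1) * green w n M - u n * green w (n + 1) M + ?S (Suc m)"
    using ge2(2) unfolding M .
  also have "u (M - 1) = u (n + 1) * green w n (M - 1) - u n * green w (n + 1) (M - 1) + ?S m"
    using ge2(1) unfolding M .
  also have "w M * (u (n + 1) * green w n M - u n * green w (n + 1) M + ?S (Suc m))
      - (u (n + 1) * green w n (M - 1) - u n * green w (n + 1) (M - 1) + ?S m) + f M
      = u (n + 1) * (w M * green w n M - green w n (M - 1))
        - u n * (w M * green w (n + 1) M - green w (n + 1) (M - 1))
        + (w M * ?S (Suc m) - ?S m + f M)"
    by (simp only: ring_distribs mult.left_commute) (simp only: ac_simps diff_conv_add_uminus minus_add_distrib minus_minus)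
  finally have "u (M + 1) = u (n + 1) * green w n (M + 1) - u n * green w (n + 1) (M + 1) + (w M * ?S (Suc m) - ?S m + f M)"
    unfolding green_upper[of _ M, symmetric] .
  then show ?case by (simp only: M S diff_add_cancel)
qed

lemma forced_backward:
  fixes u f :: "int \<Rightarrow> 'a"
  assumes f: "\<And>n. f n = u (n + 1) + u (n - 1) - w n * u n"
  shows "u (n - int m) = u (n - 1) * green w (n - int m) n - u n * green w (n - int m) (n - 1)
    + (\<Sum>j=1..<m. contin w (n - int m) (m - j) * f (n - int j))"
proof (induction m rule: induct_nat_012)
  case 0
  show ?case using green_antisym[of w n "n - 1"] green_succ(1)[of w "n - 1"] by simp
next
  case 1
  show ?case using green_succ(1)[of w "n - 1"] by simp
next
  case (ge2 m)
  define N where "N = n - int (Suc (Suc m))"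
  have N: "n - int (Suc m) = N + 1" "n - int m = N + 2" by (simp_all add: N_def)
  let ?S = "\<lambda>m. \<Sum>j=1..<m. contin w (n - int m) (m - j) * f (n - int j)"
  have S: "?S (Suc (Suc m)) = w (N + 1) * ?S (Suc m) - ?S m + f (N + 1)"
  proof (cases m)
    case (Suc l)
    define A B where "A = (\<Sum>j=1..<m. contin w (N + 1) (Suc m - j) * f (n - int j))"
      and "B = (\<Sum>j=1..<m. contin w (N + 2) (m - j) * f (n - int j))"
    have "?S (Suc (Suc m)) = (\<Sum>j=1..<m. contin w N (Suc (Suc m) - j) * f (n - int j))
        + w (N + 1) * f (N + 2) + f (N + 1)"
      using Suc by (simp add: Suc_diff_le N_def algebra_simps)
    also have "(\<Sum>j=1..<m. contin w N (Suc (Suc m) - j) * f (n - int j))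
        = (\<Sum>j=1..<m. w (N + 1) * (contin w (N + 1) (Suc m - j) * f (n - int j))
             - contin w (N + 2) (m - j) * f (n - int j))"
    proof (intro sum.cong refl)
      fix j assume "j \<in> {1..<m}"
      then have "Suc (Suc m) - j = Suc (Suc (m - j))" "Suc m - j = Suc (m - j)" by auto
      then show "contin w N (Suc (Suc m) - j) * f (n - int j) =
          w (N + 1) * (contin w (N + 1) (Suc m - j) * f (n - int j)) - contin w (N + 2) (m - j) * f (n - int j)"
        by (simp only: contin_lower) (simp add: algebra_simps)
    qed
    also have "\<dots> = w (N + 1) * A - B"
      by (simp only: A_def B_def sum_subtractf sum_distrib_left)
    finally have "?S (Suc (Suc m)) = w (N + 1) * A - B + w (N + 1) * f (N + 2) + f (N + 1)" .
    moreover have "?S (Suc m) = A + f (N + 2)" using Suc unfolding N by (simp add: A_def N(2)[symmetric])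
    moreover have "?S m = B" unfolding N by (simp add: B_def)
    ultimately show ?thesis by (simp only:) (simp add: algebra_simps)
  qed (simp add: N_def)
  have "u N = w (N + 1) * u (N + 1) - u (N + 2) + f (N + 1)"
    using f[of "N + 1"] by (simp add: algebra_simps)
  also have "u (N + 1) = u (n - 1) * green w (N + 1) n - u n * green w (N + 1) (n - 1) + ?S (Suc m)"
    using ge2(2) unfolding N .
  also have "u (N + 2) = u (n - 1) * green w (N + 2) n - u n * green w (N + 2) (n - 1) + ?S m"
    using ge2(1) unfolding N .
  also have "w (N + 1) * (u (n - 1) * green w (N + 1) n - u n * green w (N + 1) (n - 1) + ?S (Suc m))
      - (u (n - 1) * green w (N + 2) n - u n * green w (N + 2) (n - 1) + ?S m) + f (N + 1)
      = u (n - 1) * (w (N + 1) * green w (N + 1) n - green w (N + 2) n)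
        - u n * (w (N + 1) * green w (N + 1) (n - 1) - green w (N + 2) (n - 1))
        + (w (N + 1) * ?S (Suc m) - ?S m + f (N + 1))"
    by (simp only: ring_distribs mult.left_commute) (simp only: ac_simps diff_conv_add_uminus minus_add_distrib minus_minus)
  finally have "u N = u (n - 1) * green w N n - u n * green w N (n - 1) + (w (N + 1) * ?S (Suc m) - ?S m + f (N + 1))"
    unfolding green_lower[of N, symmetric] .
  then show ?case by (simp only: N_def[symmetric] S[unfolded N_def[symmetric]])
qed

text \<open>The homogeneous parts of the forward and backward formulas cancel against
  \<open>tr * u n\<close> by periodicity, leaving a combination of f over fewer than q sites on
  either side. Thus a lower bound for the sum of the two q-fold shifts minus the trace passes to the
  one-step operator producing f; this replaces a resolvent formula.\<close>

lemma forced_period: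
  fixes u f :: "int \<Rightarrow> 'a"
  assumes f: "\<And>n. f n = u (n + 1) + u (n - 1) - w n * u n"
  shows "u (n + int q) + u (n - int q) - tr * u n = contin w n q * f n
    + (\<Sum>j=1..<q. contin w (n + int j) (q - j) * f (n + int j))
    + (\<Sum>j=1..<q. contin w (n - int q) (q - j) * f (n - int j))"
proof -
  note F = forced_forward[of f u, OF f, of n q] forced_backward[of f u, OF f, of n q]
  have g1: "green w (n - int q) n = green w n (n + int q)"
    using green_shift[of "n - int q" n] by simp
  have g2: "green w (n - int q) (n - 1) = green w n (n + int q - 1)"
    using green_shift[of "n - int q" "n - 1"] by (simp add: algebra_simps)
  have g3: "tr = w n * green w n (n + int q) - green w n (n + int q - 1) - green w (n + 1) (n + int q)"
    using tr_at[of n] green_upper[of n "n + int q"] periodic[of n] by simp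
  have "u (n + 1) * contin w n q = f n * contin w n q - u (n - 1) * contin w n q + w n * u n * contin w n q"
    unfolding f by (simp add: algebra_simps)
  then show ?thesis unfolding F g1 g2 g3 green_add by (simp add: algebra_simps)
qed

end

section \<open>Bloch solutions as a rank one kernel\<close>

context periodic_recurrence
begin

text \<open>The monodromy minus y, applied to the solution based at k. When y and z are the two
  multipliers, Cayley-Hamilton leaves only the part with multiplier z, so this is an unnormalised
  projection kernel that remains meaningful when y = z.\<close>

definition bloch :: "'a \<Rightarrow> int \<Rightarrow> int \<Rightarrow> 'a" where
  "bloch y k n = green w k (n + int q) - y * green w k n"

lemma sol_bloch: "sol w (bloch y k)"
  using sol_lincomb[OF sol_shift[OF sol_green[of w k]] sol_green[of w k], of 1 y]
  by (simp add: bloch_def[abs_def])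

lemma bloch_diag: "bloch y k k = contin w k q"
  by (simp add: bloch_def green_add)

text \<open>For odd q the entry at distance N splits into continuants of the half lengths N + 1 and
  N. This keeps its frequencies in the phase between - N and N, one residue system modulo q.\<close>

lemma bloch_middle:
  assumes "q = 2 * N + 1"
  shows "bloch y k (k - int N) = contin w k (N + 1) + y * contin w (k - int N) N"
proof -
  have "green w k (k - int N) = - contin w (k - int N) N"
    using green_antisym[of w k "k - int N"] by (simp add: green_def)
  moreover have "k - int N + int q = k + int (N + 1)" using assms by simp
  ultimately show ?thesis by (simp only: bloch_def green_add) simp
qed

lemma wronski_shift:
  assumes "sol w x" "sol w x'"
  shows "wronski (\<lambda>n. x (n + int q)) (\<lambda>n. x' (n + int q)) n = wronski x x' n"
proof -
  have "wronski (\<lambda>n. x (n + int q)) (\<lambda>n. x' (n + int q)) n = wronski x x' (n + int q)"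
    by (simp add: wronski_def algebra_simps)
  then show ?thesis using wronski_const[OF assms] by metis
qed

lemma wronski_shift_sum:
  assumes "sol w x" "sol w x'"
  shows "wronski (\<lambda>n. x (n + int q)) x' n + wronski x (\<lambda>n. x' (n + int q)) n = tr * wronski x x' n"
proof -
  have "wronski x (\<lambda>n. x' (n + int q)) n = tr * wronski x x' n - wronski x (\<lambda>n. x' (n - int q)) n"
  proof -
    have "x' (m + int q) = tr * x' m - x' (m - int q)" for m
      using sol_period[OF assms(2), of m] by (simp add: algebra_simps)
    then show ?thesis unfolding wronski_def by (simp only:) (simp add: algebra_simps)
  qed
  also have "wronski x (\<lambda>n. x' (n - int q)) n = wronski (\<lambda>n. x (n + int q)) x' (n - int q)"
    by (simp add: wronski_def algebra_simps)
  also have "\<dots> = wronski (\<lambda>n. x (n + int q)) x' n"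
    by (rule wronski_const[OF sol_shift[OF assms(1)] assms(2)])
  finally show ?thesis by simp
qed

context
  fixes z y :: 'a
  assumes zy: "z * y = 1" and zy_tr: "z + y = tr"
begin

lemma bloch_period: "bloch y k (n + int q) = z * bloch y k n"
proof -
  have "green w k (n + int q + int q) = (z + y) * green w k (n + int q) - green w k n"
    using sol_period[OF sol_green[of w k], of "n + int q"] zy_tr by (simp add: algebra_simps)
  then have "bloch y k (n + int q) = z * green w k (n + int q) - 1 * green w k n"
    by (simp add: bloch_def algebra_simps)
  then show ?thesis by (simp only: zy[symmetric]) (simp add: bloch_def algebra_simps)
qed

text \<open>Exchanging base point and argument exchanges the multipliers. For real coefficients and
  conjugate multipliers this becomes Hermitian symmetry.\<close>

lemma bloch_swap: "bloch y k n = bloch z n k"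
proof -
  have "green w n (k + int q) = - green w k (n - int q)"
    using green_antisym[of w n "k + int q"] green_shift[of k "n - int q"] by simp
  also have "green w k (n - int q) = (z + y) * green w k n - green w k (n + int q)"
    using sol_period[OF sol_green[of w k], of n] zy_tr by (simp add: algebra_simps)
  finally show ?thesis
    using green_antisym[of w n k] by (simp add: bloch_def algebra_simps)
qed

text \<open>Subtracting y from the monodromy multiplies Wronskians by the determinant 1 - y tr +
  y^2, which vanishes at a multiplier; so all columns of the kernel are parallel.\<close>

lemma bloch_minor: "bloch y k i * bloch y n j = bloch y k j * bloch y n i"
proof (rule sol_minor[OF sol_bloch sol_bloch])
  let ?x = "green w k" and ?x' = "green w n"
  let ?Tx = "\<lambda>n. ?x (n + int q)" and ?Tx' = "\<lambda>n. ?x' (n + int q)"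
  have "wronski (bloch y k) (bloch y n) 0 =
      wronski ?Tx ?Tx' 0 - y * (wronski ?Tx ?x' 0 + wronski ?x ?Tx' 0) + y * y * wronski ?x ?x' 0"
    by (simp add: wronski_def bloch_def algebra_simps)
  also have "\<dots> = (1 - y * tr + y * y) * wronski ?x ?x' 0"
    unfolding wronski_shift[OF sol_green sol_green] wronski_shift_sum[OF sol_green sol_green]
    by (simp add: algebra_simps)
  also have "1 - y * tr + y * y = 0" unfolding zy_tr[symmetric] zy[symmetric] by (simp add: algebra_simps)
  finally show "wronski (bloch y k) (bloch y n) 0 = 0" by simp
qed

text \<open>The monodromy preserves Wronskians, and u equals y times its own shift by q; so in the
  Wronskian of \<open>bloch y k\<close> with u the two terms agree. No distinction between simple
  and double multipliers enters.\<close>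

lemma bloch_proportional:
  assumes "sol w u" "\<And>n. u (n + int q) = z * u n"
  shows "bloch y k i * u j = bloch y k j * u i"
proof (rule sol_minor[OF sol_bloch assms(1)])
  let ?x = "green w k"
  have u: "u n = y * u (n + int q)" for n
    using assms(2)[of n] zy by (metis mult.assoc mult.commute mult.left_neutral)
  have "wronski (bloch y k) u 0 = wronski (\<lambda>n. ?x (n + int q)) u 0 - y * wronski ?x u 0"
    by (simp add: wronski_def bloch_def algebra_simps)
  also have "wronski (\<lambda>n. ?x (n + int q)) u 0 = y * wronski (\<lambda>n. ?x (n + int q)) (\<lambda>n. u (n + int q)) 0"
    unfolding wronski_def by (subst (1 2) u) (simp add: algebra_simps)
  also have "\<dots> = y * wronski ?x u 0" by (simp only: wronski_shift[OF sol_green assms(1)])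
  finally show "wronski (bloch y k) u 0 = 0" by simp
qed

end

lemma contin_expand: "contin w j q = green w j (int q + 1) * green w 0 j - green w j (int q) * green w 1 j"
proof -
  have "contin w j q = green w j (j + int q)" by (simp add: green_add)
  also have "\<dots> = green w j (int q + 1) * green w (int q) (j + int q) - green w j (int q) * green w (int q + 1) (j + int q)"
    by (rule sol_expand[OF sol_green])
  also have "green w (int q) (j + int q) = green w 0 j" using green_shift[of 0 j] by simp
  also have "green w (int q + 1) (j + int q) = green w 1 j" using green_shift[of 1 j] by (simp add: add.commute)
  finally show ?thesis .
qed

text \<open>Brings the sum of the diagonal kernel entries into the shape obtained by differentiating
  the two continuants of the trace.\<close>

lemma sum_contin_expand:
  assumes "0 < q"
  shows "(\<Sum>j=1..q. contin w (int j) q) =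
    (\<Sum>j=1..q. contin w 0 j * contin w (int j) (q + 1 - j)) - (\<Sum>j=1..<q - 1. contin w 1 j * contin w (1 + int j) (q - 1 - j))"
proof -
  have "(\<Sum>j=1..q. contin w (int j) q) =
      (\<Sum>j=1..q. contin w 0 j * contin w (int j) (q + 1 - j) - contin w 1 (j - 1) * contin w (int j) (q - j))"
  proof (intro sum.cong refl)
    fix j assume j: "j \<in> {1..q}"
    have "green w (int j) (int q + 1) = contin w (int j) (q + 1 - j)" "green w 0 (int j) = contin w 0 j"
      "green w (int j) (int q) = contin w (int j) (q - j)" "green w 1 (int j) = contin w 1 (j - 1)"
      using j by (auto simp: green_def nat_diff_distrib' nat_add_distrib Suc_diff_le)
    then show "contin w (int j) q = contin w 0 j * contin w (int j) (q + 1 - j) - contin w 1 (j - 1) * contin w (int j) (q - j)"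
      using contin_expand[of "int j"] by (simp only:) (simp add: mult.commute)
  qed
  also have "\<dots> = (\<Sum>j=1..q. contin w 0 j * contin w (int j) (q + 1 - j)) - (\<Sum>j=1..q. contin w 1 (j - 1) * contin w (int j) (q - j))"
    by (rule sum_subtractf)
  also have "(\<Sum>j=1..q. contin w 1 (j - 1) * contin w (int j) (q - j)) = (\<Sum>j=0..<q. contin w 1 j * contin w (int (Suc j)) (q - Suc j))"
    using sum.shift_bounds_Suc_ivl[of "\<lambda>j. contin w 1 (j - 1) * contin w (int j) (q - j)" 0 q]
    by (simp add: atLeastLessThanSuc_atLeastAtMost)
  also have "\<dots> = (\<Sum>j=1..<q - 1. contin w 1 j * contin w (int (Suc j)) (q - Suc j))"
  proof (rule sum.mono_neutral_right)
    show "\<forall>i\<in>{0..<q} - {1..<q - 1}. contin w 1 i * contin w (int (Suc i)) (q - Suc i) = 0"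
    proof
      fix i assume "i \<in> {0..<q} - {1..<q - 1}"
      then have "i = 0 \<or> q - Suc i = 0" by auto
      then show "contin w 1 i * contin w (int (Suc i)) (q - Suc i) = 0" by (elim disjE) auto
    qed
  qed auto
  finally show ?thesis by (simp add: add.commute)
qed

end

section \<open>Continuants as polynomials in the energy\<close>

lemma poly_contin:
  fixes v :: "int \<Rightarrow> 'a::field"
  shows "poly (contin (\<lambda>n. [:- v n, 1:]) k m) x = contin (\<lambda>n. x - v n) k m"
  by (induction m rule: induct_nat_012) (auto simp: algebra_simps)

text \<open>Product rule: differentiating the coefficient at site k + j removes this site and cuts
  the continuant into the pieces on either side.\<close>

lemma pderiv_contin:
  fixes v :: "int \<Rightarrow> 'a::field"
  defines "w \<equiv> (\<lambda>n. [:- v n, 1:])"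
  shows "pderiv (contin w k m) = (\<Sum>j=1..<m. contin w k j * contin w (k + int j) (m - j))"
proof (induction m rule: induct_nat_012)
  case (ge2 m)
  define W where "W = w (k + 1 + int m)"
  have dW: "pderiv W = 1" by (simp add: W_def w_def pderiv_pCons)
  have "pderiv (contin w k (Suc (Suc m))) = W * pderiv (contin w k (Suc m)) + contin w k (Suc m) - pderiv (contin w k m)"
    by (simp add: W_def[symmetric] pderiv_diff pderiv_mult dW)
  also have "pderiv (contin w k (Suc m)) = (\<Sum>j=1..<Suc m. contin w k j * contin w (k + int j) (Suc m - j))" by (rule ge2)
  also have "pderiv (contin w k m) = (\<Sum>j=1..<Suc m. contin w k j * contin w (k + int j) (m - j))"
    unfolding ge2 by (cases m) auto
  also have "W * (\<Sum>j=1..<Suc m. contin w k j * contin w (k + int j) (Suc m - j)) + contin w k (Suc m)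
      - (\<Sum>j=1..<Suc m. contin w k j * contin w (k + int j) (m - j))
      = (\<Sum>j=1..<Suc m. W * (contin w k j * contin w (k + int j) (Suc m - j)) - contin w k j * contin w (k + int j) (m - j)) + contin w k (Suc m)"
    by (simp only: sum_subtractf sum_distrib_left) simp
  also have "(\<Sum>j=1..<Suc m. W * (contin w k j * contin w (k + int j) (Suc m - j)) - contin w k j * contin w (k + int j) (m - j))
      = (\<Sum>j=1..<Suc m. contin w k j * contin w (k + int j) (Suc (Suc m) - j))"
  proof (intro sum.cong refl)
    fix j assume "j \<in> {1..<Suc m}"
    then have "Suc (Suc m) - j = Suc (Suc (m - j))" "Suc m - j = Suc (m - j)" "k + int j + 1 + int (m - j) = k + 1 + int m" by auto
    then show "W * (contin w k j * contin w (k + int j) (Suc m - j)) - contin w k j * contin w (k + int j) (m - j)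
        = contin w k j * contin w (k + int j) (Suc (Suc m) - j)"
      by (simp only: contin.simps W_def) (simp only: ring_distribs mult.left_commute)
  qed
  finally show ?case by simp
qed (simp_all add: pderiv_1)

section \<open>The discriminant\<close>

definition pot :: "real \<Rightarrow> real \<Rightarrow> int \<Rightarrow> real" where
  "pot a t n = 2 * cos (2 * pi * (a * of_int n + t))"

definition phase :: "real \<Rightarrow> int \<Rightarrow> complex" where
  "phase a n = cis (2 * pi * a * of_int n)"

lemma phase_add: "phase a (m + n) = phase a m * phase a n"
  by (simp add: phase_def cis_mult algebra_simps)

lemma phase_0 [simp]: "phase a 0 = 1"
  by (simp add: phase_def)

lemma norm_phase [simp]: "norm (phase a n) = 1"
  by (simp add: phase_def)

lemma phase_ne_0 [simp]: "phase a n \<noteq> 0"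
  by (simp add: phase_def)

lemma phase_minus: "phase a (- n) = inverse (phase a n)"
  by (simp add: phase_def cis_inverse)

lemma cnj_phase: "cnj (phase a n) = phase a (- n)"
  by (simp add: phase_def complex_eq_iff)

lemma phase_power: "phase a n ^ k = phase a (n * int k)"
  by (induction k) (simp_all add: phase_add[symmetric] algebra_simps)

lemma of_real_pot: "complex_of_real (pot a t n) = cis (2 * pi * t) * phase a n + inverse (cis (2 * pi * t) * phase a n)"
proof -
  define x where "x = 2 * pi * (a * of_int n + t)"
  have "cis (2 * pi * t) * phase a n = cis x"
    by (simp add: phase_def cis_mult algebra_simps x_def)
  moreover have "complex_of_real (pot a t n) = cis x + cis (- x)"
    by (simp add: pot_def x_def complex_eq_iff)
  ultimately show ?thesis by (simp add: cis_inverse)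
qed

text \<open>The variable \<open>X = cis (2 * pi * \<theta>)\<close> encodes the phase of the potential, and the trace of the monodromy
  matrix becomes a Laurent polynomial in \<open>X\<close>.\<close>

definition wt :: "real \<Rightarrow> complex \<Rightarrow> complex \<Rightarrow> int \<Rightarrow> complex" where
  "wt a E X n = E - (X * phase a n + inverse (X * phase a n))"

lemma wt_cis: "wt a E (cis (2 * pi * t)) n = E - of_real (pot a t n)"
  by (simp only: wt_def of_real_pot)

lemma contin_cong: "(\<And>n. w n = w' n) \<Longrightarrow> contin w k m = contin w' k m"
  by (induction w k m rule: contin.induct) simp_all

lemma contin_translate: "contin (\<lambda>n. w (n + s)) k m = contin w (k + s) m"
  by (induction m rule: induct_nat_012) (simp_all add: add_ac)

text \<open>Rotating X by the phase of s sites is the same as translating the potential by s, which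
  turns sums over base points into averages over roots of unity.\<close>

lemma contin_wt_phase: "contin (wt a E (X * phase a s)) k m = contin (wt a E X) (k + s) m"
proof -
  have "wt a E (X * phase a s) n = wt a E X (n + s)" for n
    by (simp add: wt_def phase_add mult_ac)
  then show ?thesis using contin_translate[of "wt a E X" s k m] by (metis contin_cong)
qed

text \<open>\<open>X ^ m\<close> times the continuant of length m + 1, as an honest polynomial in X:
  each step multiplies the coefficient E - X e - 1 / (X e) by X, and skipping a step costs
  X^2.\<close>

fun tpoly :: "real \<Rightarrow> complex \<Rightarrow> int \<Rightarrow> nat \<Rightarrow> complex poly" where
  "tpoly a E k 0 = 0"
| "tpoly a E k (Suc 0) = 1"
| "tpoly a E k (Suc (Suc m)) = [:- inverse (phase a (k + 1 + int m)), E, - phase a (k + 1 + int m):] * tpoly a E k (Suc m)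
     - pCons 0 (pCons 0 (tpoly a E k m))"

declare tpoly.simps(3) [simp del]

lemma poly_tpoly:
  assumes "X \<noteq> 0"
  shows "poly (tpoly a E k (Suc m)) X = X ^ m * contin (wt a E X) k (Suc m)"
proof (induction m rule: induct_nat_012)
  case 1
  show ?case using assms by (simp add: wt_def tpoly.simps(3) field_simps)
next
  case (ge2 m)
  let ?e = "phase a (k + 1 + int (Suc m))"
  have "poly (tpoly a E k (Suc (Suc (Suc m)))) X =
      (- inverse ?e + X * (E - X * ?e)) * poly (tpoly a E k (Suc (Suc m))) X - X * X * poly (tpoly a E k (Suc m)) X"
    by (simp add: tpoly.simps(3)[of _ _ _ "Suc m"] algebra_simps)
  also have "- inverse ?e + X * (E - X * ?e) = X * wt a E X (k + 1 + int (Suc m))"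
    using assms by (simp add: wt_def field_simps)
  finally show ?case unfolding ge2 by (simp add: algebra_simps)
qed simp

lemma degree_tpoly: "degree (tpoly a E k (Suc m)) \<le> 2 * m"
proof (induction m rule: induct_nat_012)
  case 1 show ?case by (simp add: tpoly.simps(3) degree_pCons_eq_if)
next
  case (ge2 m)
  let ?e = "phase a (k + 1 + int (Suc m))"
  have "degree ([:- inverse ?e, E, - ?e:] * tpoly a E k (Suc (Suc m))) \<le> 2 + 2 * Suc m"
    using ge2(2) by (intro order.trans[OF degree_mult_le] add_mono) auto
  moreover have "degree (pCons 0 (pCons 0 (tpoly a E k (Suc m)))) \<le> Suc (Suc (2 * m))"
    by (intro order.trans[OF degree_pCons_le] Suc_le_mono[THEN iffD2] ge2(1))
  ultimately show ?case
    unfolding tpoly.simps(3)[of a E k "Suc m"] by (intro degree_diff_le) auto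
qed simp

lemma coeff_tpoly:
  "coeff (tpoly a E k (Suc m)) (2 * m) = (\<Prod>j=1..m. - phase a (k + int j))"
  "coeff (tpoly a E k (Suc m)) 0 = (\<Prod>j=1..m. - inverse (phase a (k + int j)))"
proof (induction m rule: induct_nat_012)
  case (ge2 m)
  let ?e = "phase a (k + 1 + int (Suc m))"
  case 1
  have "coeff (tpoly a E k (Suc (Suc m))) (2 * Suc m + 1) = 0" "coeff (tpoly a E k (Suc (Suc m))) (2 * Suc m + 2) = 0"
    using degree_tpoly[of a E k "Suc m"] by (auto intro!: coeff_eq_0 elim: order.strict_trans1)
  moreover have "coeff (tpoly a E k (Suc m)) (2 * m + 2) = 0"
    using degree_tpoly[of a E k m] by (auto intro!: coeff_eq_0 elim: order.strict_trans1)
  ultimately show ?case unfolding tpoly.simps(3)[of a E k "Suc m"]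
    using ge2 by (simp add: numeral_2_eq_2 algebra_simps)
next
  case (ge2 m)
  case 2
  show ?case unfolding tpoly.simps(3)[of a E k "Suc m"]
    using ge2 by (simp add: algebra_simps)
qed (simp_all add: tpoly.simps(3) numeral_2_eq_2)

section \<open>Characters modulo an odd denominator and the phase dependence of the trace\<close>

locale odd_fraction =
  fixes p q N :: nat
  assumes coprime_pq: "coprime p q" and q_def: "q = 2 * N + 1"
begin

abbreviation e :: "int \<Rightarrow> complex" where "e \<equiv> phase (real p / real q)"
abbreviation W :: "complex \<Rightarrow> complex \<Rightarrow> int \<Rightarrow> complex" where "W \<equiv> wt (real p / real q)"

lemma q_pos: "0 < q" by (simp add: q_def)

lemma e_period: "e (int q * n) = 1"
proof -
  have "2 * pi * (real p / real q) * of_int (int q * n) = 2 * pi * of_int (int p * n)"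
    using q_pos by simp
  then show ?thesis by (simp only: phase_def) (simp add: cis_multiple_2pi)
qed

lemma e_add_q: "e (n + int q) = e n"
  using e_period[of 1] by (simp add: phase_add)

lemma e_eq_1_iff: "e n = 1 \<longleftrightarrow> int q dvd n"
proof
  assume "e n = 1"
  then have "cis (2 * pi * (real p / real q) * of_int n) = 1" by (simp add: phase_def)
  then obtain z :: int where "2 * pi * (real p / real q) * of_int n = 2 * pi * of_int z"
    by (auto simp: complex_eq_iff cos_one_2pi_int)
  then have "real p * of_int n = of_int z * real q" using q_pos by (simp add: field_simps)
  then have "int p * n = z * int q" by (metis of_int_eq_iff of_int_mult of_int_of_nat_eq)
  then have "int q dvd int p * n" by simp
  moreover have "coprime (int q) (int p)" using coprime_pq by (simp add: coprime_commute)
  ultimately show "int q dvd n" by (simp add: coprime_dvd_mult_right_iff)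
qed (auto simp: e_period)

lemma sum_e: "(\<Sum>s<q. e (int s * n)) = (if int q dvd n then of_nat q else 0)"
proof (cases "int q dvd n")
  case True
  then have "e (int s * n) = 1" for s by (simp add: e_eq_1_iff)
  then show ?thesis using True by simp
next
  case False
  then have ne: "e n \<noteq> 1" by (simp add: e_eq_1_iff)
  have "(\<Sum>s<q. e (int s * n)) = (\<Sum>s<q. e n ^ s)" by (simp add: phase_power mult.commute)
  also have "\<dots> = (e n ^ q - 1) / (e n - 1)" by (rule geometric_sum[OF ne])
  also have "e n ^ q = 1" using e_period[of n] by (simp add: phase_power mult.commute)
  finally show ?thesis using False by simp
qed

lemma wt_periodic: "periodic_recurrence (W E X) q"
  by standard (simp add: wt_def e_add_q)

end

context odd_fraction
begin

definition trc :: "complex \<Rightarrow> complex \<Rightarrow> complex" where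
  "trc E X = periodic_recurrence.tr (W E X) q"

lemma trc_eq: "trc E X = contin (W E X) 0 (q + 1) - contin (W E X) 1 (q - 1)"
  unfolding trc_def periodic_recurrence.tr_def[OF wt_periodic]
  using q_pos by (simp add: green_def nat_add_distrib nat_diff_distrib')

text \<open>The rotated phase is a translated potential, and the trace does not depend on the base
  point.\<close>

lemma trc_phase: "trc E (X * e s) = trc E X"
proof -
  have eq: "periodic_recurrence.tr (W E X) q = green (W E X) s (s + int q + 1) - green (W E X) (s + 1) (s + int q)"
    using periodic_recurrence.tr_at[OF wt_periodic] by simp
  have g: "green (W E X) s (s + int q + 1) = contin (W E X) s (q + 1)"
    "green (W E X) (s + 1) (s + int q) = contin (W E X) (s + 1) (q - 1)"
    using q_pos by (simp_all add: green_def nat_add_distrib nat_diff_distrib')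
  show ?thesis
    unfolding trc_eq contin_wt_phase
    unfolding trc_eq[symmetric] trc_def eq g by (simp add: add.commute)
qed

text \<open>The exponents 1, ..., q add up to q (N + 1), so the phases cancel and odd q leaves the
  sign. These are the extreme coefficients of the trace polynomial.\<close>

lemma e_prod: "(\<Prod>j=1..q. - e (int j)) = -1" "(\<Prod>j=1..q. - inverse (e (int j))) = -1"
proof -
  have *: "(\<Prod>j=1..m. - e (int j)) = (-1) ^ m * e (\<Sum>j=1..m. int j)" for m
    by (induction m) (simp_all add: phase_add)
  have "(\<Sum>j=1..m. int j) * 2 = int m * (int m + 1)" for m
    by (induction m) (simp_all add: algebra_simps)
  from this[of q] have "(\<Sum>j=1..q. int j) = int q * (int N + 1)" by (simp add: q_def algebra_simps)
  then have "e (\<Sum>j=1..q. int j) = 1" by (simp only: e_period)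
  moreover have "odd q" by (simp add: q_def)
  ultimately show 1: "(\<Prod>j=1..q. - e (int j)) = -1" unfolding * by simp
  have "(\<Prod>j=1..q. - inverse (e (int j))) = inverse (\<Prod>j=1..q. - e (int j))"
    by (simp add: prod_inversef[symmetric] o_def)
  then show "(\<Prod>j=1..q. - inverse (e (int j))) = -1" using 1 by simp
qed

definition trpoly :: "complex \<Rightarrow> complex poly" where
  "trpoly E = tpoly (real p / real q) E 0 (q + 1) - pCons 0 (pCons 0 (tpoly (real p / real q) E 1 (q - 1)))"

lemma poly_trpoly: assumes "X \<noteq> 0" shows "poly (trpoly E) X = X ^ q * trc E X"
proof (cases "q - 1")
  case 0
  then show ?thesis using poly_tpoly[OF assms, of "real p / real q" E 0 q]
    by (simp add: trpoly_def trc_eq)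
next
  case (Suc m)
  then have "X ^ q = X * X * X ^ m" using q_pos by (cases q) auto
  then show ?thesis
    using poly_tpoly[OF assms, of "real p / real q" E 0 q] poly_tpoly[OF assms, of "real p / real q" E 1 m] Suc
    by (simp add: trpoly_def trc_eq algebra_simps)
qed

lemma degree_trpoly_aux: "degree (pCons 0 (pCons 0 (tpoly (real p / real q) E 1 (q - 1)))) < 2 * q"
proof (cases "q - 1")
  case (Suc m)
  then show ?thesis using degree_tpoly[of "real p / real q" E 1 m]
    by (auto simp: degree_pCons_eq_if)
qed (use q_pos in simp)

lemma degree_trpoly: "degree (trpoly E) \<le> 2 * q"
  unfolding trpoly_def using degree_trpoly_aux degree_tpoly[of "real p / real q" E 0 q]
  by (intro degree_diff_le) (auto simp: less_imp_le)

lemma coeff_trpoly: "coeff (trpoly E) (2 * q) = -1" "coeff (trpoly E) 0 = -1"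
proof -
  have "coeff (pCons 0 (pCons 0 (tpoly (real p / real q) E 1 (q - 1)))) (2 * q) = 0"
    by (rule coeff_eq_0[OF degree_trpoly_aux])
  then show "coeff (trpoly E) (2 * q) = -1" "coeff (trpoly E) 0 = -1"
    using coeff_tpoly[of "real p / real q" E 0 q] e_prod by (simp_all add: trpoly_def)
qed

text \<open>Orthogonality of characters: the average over q-th roots of unity filters the
  coefficients by their residue modulo q.\<close>

lemma sum_phase_poly:
  assumes "degree P \<le> D" "X \<noteq> 0"
  shows "(\<Sum>s<q. poly P (X * e (int s)) * e (- int s * l)) =
    (\<Sum>i\<le>D. coeff P i * X ^ i * (if int q dvd int i - l then of_nat q else 0))"
proof -
  have "poly P (X * e (int s)) * e (- int s * l) = (\<Sum>i\<le>D. coeff P i * X ^ i * e (int s * (int i - l)))" for s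
  proof -
    have "poly P (X * e (int s)) = (\<Sum>i\<le>D. coeff P i * (X * e (int s)) ^ i)"
      using assms(1) by (subst poly_altdef) (auto intro!: sum.mono_neutral_left simp: le_degree)
    moreover have "(X * e (int s)) ^ i * e (- int s * l) = X ^ i * e (int s * (int i - l))" for i
      by (simp add: power_mult_distrib phase_power phase_add[symmetric] algebra_simps)
    ultimately show ?thesis by (simp add: sum_distrib_right mult.assoc)
  qed
  then have "(\<Sum>s<q. poly P (X * e (int s)) * e (- int s * l)) = (\<Sum>i\<le>D. \<Sum>s<q. coeff P i * X ^ i * e (int s * (int i - l)))"
    by (simp add: sum.swap[of _ _ "{..<q}"])
  also have "\<dots> = (\<Sum>i\<le>D. coeff P i * X ^ i * (if int q dvd int i - l then of_nat q else 0))"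
    by (simp only: sum_distrib_left[symmetric] sum_e)
  finally show ?thesis .
qed

definition dsc :: "complex \<Rightarrow> complex" where "dsc E = - coeff (trpoly E) q"

text \<open>The trace is invariant under \<open>X \<mapsto> X * e s\<close>, so only the powers \<open>- q, 0, q\<close> of \<open>X\<close> survive.\<close>

theorem chambers:
  assumes "norm X = 1" shows "trc E X = - dsc E - (X ^ q + inverse X ^ q)"
proof -
  have X: "X \<noteq> 0" using assms by auto
  have eq1: "e (int s) ^ q = 1" for s using e_period[of "int s"] by (simp add: phase_power mult.commute)
  have "(\<Sum>s<q. poly (trpoly E) (X * e (int s)) * e (- int s * int q)) = (\<Sum>s<q. X ^ q * trc E X)"
  proof (intro sum.cong refl)
    fix s
    have "X * e (int s) \<noteq> 0" using X by simp
    then show "poly (trpoly E) (X * e (int s)) * e (- int s * int q) = X ^ q * trc E X"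
      using e_period[of "- int s"] by (simp add: poly_trpoly power_mult_distrib eq1 trc_phase mult.commute)
  qed
  then have "of_nat q * (X ^ q * trc E X) = (\<Sum>i\<le>2 * q. coeff (trpoly E) i * X ^ i * (if int q dvd int i - int q then of_nat q else 0))"
    using sum_phase_poly[OF degree_trpoly X, of E "int q"] by simp
  also have "\<dots> = (\<Sum>i\<in>{0, q, 2 * q}. coeff (trpoly E) i * X ^ i * (if int q dvd int i - int q then of_nat q else 0))"
  proof (rule sum.mono_neutral_right)
    show "\<forall>i\<in>{..2 * q} - {0, q, 2 * q}. coeff (trpoly E) i * X ^ i * (if int q dvd int i - int q then of_nat q else 0) = 0"
    proof
      fix i assume i: "i \<in> {..2 * q} - {0, q, 2 * q}"
      have "\<not> int q dvd int i - int q"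
      proof
        assume "int q dvd int i - int q"
        then have "int q dvd int i - int q + int q" by (rule dvd_add) simp
        then have "int q dvd int i" by simp
        then obtain k where k: "i = q * k" by (metis int_dvd_int_iff dvdE)
        with i have "k \<le> 2" using q_pos by simp
        then have "k = 0 \<or> k = 1 \<or> k = 2" by auto
        then show False using i k by auto
      qed
      then show "coeff (trpoly E) i * X ^ i * (if int q dvd int i - int q then of_nat q else 0) = 0" by simp
    qed
  qed auto
  also have "\<dots> = of_nat q * (-1 - dsc E * X ^ q - X ^ (2 * q))"
    using q_pos by (simp add: coeff_trpoly dsc_def right_diff_distrib)
  finally have "X ^ q * trc E X = -1 - dsc E * X ^ q - X ^ (2 * q)" using q_pos by simp
  also have "\<dots> = X ^ q * (- dsc E) - (X ^ q * X ^ q + X ^ q * inverse X ^ q)"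
    using X by (simp add: power_inverse power_add mult_2)
  also have "\<dots> = X ^ q * (- dsc E - (X ^ q + inverse X ^ q))"
    by (simp only: right_diff_distrib distrib_left)
  finally have "X ^ q * trc E X = X ^ q * (- dsc E - (X ^ q + inverse X ^ q))" .
  then show ?thesis using X by simp
qed

text \<open>The middle entry of a Bloch solution is a trigonometric polynomial in its base point with highest
  frequency \<open>N\<close>, whose coefficient there is unimodular.\<close>

lemma bloch_fourier:
  assumes X: "norm X = 1"
  shows "norm (\<Sum>s<q. e (- int s * int N) * periodic_recurrence.bloch (W E X) q y (int s) (int s - int N)) = real q"
proof -
  interpret periodic_recurrence "W E X" q by (rule wt_periodic)
  define P where "P = tpoly (real p / real q) E 0 (Suc N)"
  define Q where "Q = smult y (pCons 0 (tpoly (real p / real q) E (- int N) N))"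
  have X0: "X \<noteq> 0" using X by auto
  have degQ: "degree Q < 2 * N \<or> Q = 0"
  proof (cases N)
    case (Suc m)
    then show ?thesis using degree_tpoly[of "real p / real q" E "- int N" m]
      unfolding Q_def Suc by (auto simp: degree_pCons_eq_if intro: le_less_trans[OF degree_smult_le])
  qed (simp add: Q_def)
  have deg: "degree (P + Q) \<le> 2 * N"
    unfolding P_def using degQ degree_tpoly[of "real p / real q" E 0 N]
    by (intro degree_add_le) (auto simp: less_imp_le)
  have "coeff Q (2 * N) = 0" using degQ by (auto intro: coeff_eq_0)
  then have lead: "coeff (P + Q) (2 * N) = (\<Prod>j=1..N. - e (int j))"
    using coeff_tpoly(1)[of "real p / real q" E 0 N] by (simp add: P_def)
  have bl: "X ^ N * e (int s * int N) * bloch y (int s) (int s - int N) = poly (P + Q) (X * e (int s))" for s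
  proof -
    have Xs: "X * e (int s) \<noteq> 0" using X0 by simp
    have "bloch y (int s) (int s - int N) = contin (W E X) (int s) (N + 1) + y * contin (W E X) (int s - int N) N"
      by (rule bloch_middle[OF q_def])
    also have "contin (W E X) (int s) (N + 1) = contin (W E (X * e (int s))) 0 (N + 1)"
      by (simp add: contin_wt_phase)
    also have "contin (W E X) (int s - int N) N = contin (W E (X * e (int s))) (- int N) N"
      by (simp add: contin_wt_phase)
    finally have b: "bloch y (int s) (int s - int N) = contin (W E (X * e (int s))) 0 (N + 1) + y * contin (W E (X * e (int s))) (- int N) N" .
    have "X ^ N * e (int s * int N) = (X * e (int s)) ^ N" by (simp add: power_mult_distrib phase_power)
    moreover have "(X * e (int s)) ^ N * contin (W E (X * e (int s))) 0 (N + 1) = poly P (X * e (int s))"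
      unfolding P_def poly_tpoly[OF Xs] by simp
    moreover have "(X * e (int s)) ^ N * (y * contin (W E (X * e (int s))) (- int N) N) = poly Q (X * e (int s))"
    proof (cases N)
      case (Suc m)
      then show ?thesis unfolding Q_def using poly_tpoly[OF Xs, of "real p / real q" E "- int N" m]
        by (simp add: algebra_simps)
    qed (simp add: Q_def)
    ultimately show ?thesis by (simp only: b distrib_left poly_add)
  qed
  \<comment> \<open>The degrees 0, ..., 2N form a complete residue system modulo q, so the character
    singles out the top coefficient, a signed product of phases to which the summand Q does not
    contribute.\<close>
  have "X ^ N * (\<Sum>s<q. e (- int s * int N) * bloch y (int s) (int s - int N))
      = (\<Sum>s<q. poly (P + Q) (X * e (int s)) * e (- int s * (2 * int N)))"
    unfolding sum_distrib_left
  proof (intro sum.cong refl)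
    fix s
    have "e (- int s * int N) = e (int s * int N) * e (- int s * (2 * int N))"
      by (simp add: phase_add[symmetric] algebra_simps)
    then show "X ^ N * (e (- int s * int N) * bloch y (int s) (int s - int N)) = poly (P + Q) (X * e (int s)) * e (- int s * (2 * int N))"
      unfolding bl[symmetric] by (simp only: mult_ac)
  qed
  also have "\<dots> = (\<Sum>i\<le>2 * N. coeff (P + Q) i * X ^ i * (if int q dvd int i - 2 * int N then of_nat q else 0))"
    by (rule sum_phase_poly[OF deg X0])
  also have "\<dots> = (\<Sum>i\<in>{2 * N}. coeff (P + Q) i * X ^ i * (if int q dvd int i - 2 * int N then of_nat q else 0))"
  proof (rule sum.mono_neutral_right)
    show "\<forall>i\<in>{..2 * N} - {2 * N}. coeff (P + Q) i * X ^ i * (if int q dvd int i - 2 * int N then of_nat q else 0) = 0"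
    proof
      fix i assume i: "i \<in> {..2 * N} - {2 * N}"
      have "\<not> int q dvd int i - 2 * int N"
      proof
        assume "int q dvd int i - 2 * int N"
        then have "int q dvd 2 * int N - int i" by (simp add: dvd_diff_commute)
        moreover have "0 < 2 * int N - int i" "2 * int N - int i < int q" using i by (auto simp: q_def)
        ultimately show False by (auto dest: zdvd_imp_le)
      qed
      then show "coeff (P + Q) i * X ^ i * (if int q dvd int i - 2 * int N then of_nat q else 0) = 0" by simp
    qed
  qed auto
  also have "\<dots> = (\<Prod>j=1..N. - e (int j)) * X ^ (2 * N) * of_nat q" using lead by simp
  finally have "norm (X ^ N * (\<Sum>s<q. e (- int s * int N) * bloch y (int s) (int s - int N))) = real q"
    by (simp add: norm_mult norm_power X prod_norm[symmetric])
  then show ?thesis by (simp add: norm_mult norm_power X)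
qed

end

section \<open>A lower bound for the derivative of the trace\<close>

lemma cnj_contin: "cnj (contin w k m) = contin (\<lambda>n. cnj (w n)) k m"
  by (induction w k m rule: contin.induct) simp_all

lemma cnj_wt_real:
  assumes "norm X = 1" shows "cnj (wt a (complex_of_real E) X n) = wt a (complex_of_real E) X n"
proof -
  have "inverse (X * phase a n) = cnj (X * phase a n)"
    using complex_norm_square[of "X * phase a n"] assms by (intro inverse_unique) (simp add: norm_mult)
  then show ?thesis by (simp add: wt_def)
qed

lemma cnj_green_real:
  assumes "norm X = 1" shows "cnj (green (wt a (complex_of_real E) X) k n) = green (wt a (complex_of_real E) X) k n"
  by (simp add: green_def cnj_contin cnj_wt_real[OF assms])

lemma sum_periodic_shift:
  fixes f :: "int \<Rightarrow> 'a::cancel_comm_monoid_add"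
  assumes "\<And>n. f (n + int q) = f n" "0 < q"
  shows "(\<Sum>s<q. f (int s + l)) = (\<Sum>s<q. f (int s))"
proof -
  have step: "(\<Sum>s<q. f (int s + (l + 1))) = (\<Sum>s<q. f (int s + l))" for l
  proof -
    have "(\<Sum>s<q. f (int s + l)) + f (int q + l) = f l + (\<Sum>s<q. f (int s + (l + 1)))"
      using sum.lessThan_Suc_shift[of "\<lambda>s. f (int s + l)" q] sum.lessThan_Suc[of "\<lambda>s. f (int s + l)" q]
      by (simp add: add_ac)
    moreover have "f (int q + l) = f l" using assms(1)[of l] by (simp add: add.commute)
    ultimately show ?thesis by (simp add: add.commute)
  qed
  show ?thesis
  proof (induction l rule: int_induct[of _ 0])
    case (step1 i) then show ?case using step[of i] by simp
  next
    case (step2 i) then show ?case using step[of "i - 1"] by simp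
  qed simp
qed


context odd_fraction
begin

lemma contin_W_shift: "contin (W E X) (k + int q) m = contin (W E X) k m"
  using periodic_recurrence.contin_shift[OF wt_periodic] .

text \<open>The diagonal entries \<open>r k\<close> of the rank one Hermitian kernel \<open>bloch (cnj z)\<close> have one sign, so their sum dominates
  the \<open>N\<close>-th Fourier coefficient of the entries at distance \<open>N\<close> from the diagonal.\<close>

lemma contin_sum_ge:
  fixes E :: real
  assumes X: "norm X = 1" and z: "norm z = 1" "z + cnj z = trc (of_real E) X"
  shows "real q \<le> norm (\<Sum>s<q. contin (W (of_real E) X) (int s) q)"
proof -
  interpret periodic_recurrence "W (of_real E) X" q by (rule wt_periodic)
  have zy: "z * cnj z = 1" using complex_norm_square[of z] z by simp
  have tr: "z + cnj z = tr" using z by (simp add: trc_def)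
  let ?A = "bloch (cnj z)"
  define r where "r k = Re (contin (W (of_real E) X) k q)" for k
  have r: "?A k k = of_real (r k)" for k
  proof -
    have "cnj (contin (W (of_real E) X) k q) = contin (W (of_real E) X) k q"
      using cnj_green_real[OF X, of "real p / real q" E k "k + int q"] by (simp only: green_add)
    then show ?thesis by (simp add: bloch_diag r_def complex_eq_iff)
  qed
  have herm: "?A n k = cnj (?A k n)" for k n
    unfolding bloch_swap[OF zy tr, of n k] by (simp add: bloch_def cnj_green_real[OF X])
  \<comment> \<open>A minor of the rank one kernel combined with Hermitian symmetry. A single
    positive r k forces every r n to be nonnegative.\<close>
  have minor: "r k * r n = (norm (?A k n))\<^sup>2" for k n
  proof -
    have "?A k k * ?A n n = ?A k n * ?A n k"
      by (rule bloch_minor[OF zy tr])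
    then have "complex_of_real (r k * r n) = complex_of_real ((norm (?A k n))\<^sup>2)"
      unfolding herm[of n k] r complex_norm_square by simp
    then show ?thesis by (simp only: of_real_eq_iff)
  qed
  have sgn: "\<bar>\<Sum>s<m. r (int s)\<bar> = (\<Sum>s<m. \<bar>r (int s)\<bar>)" for m
  proof (cases "\<exists>k. r k > 0")
    case True
    then obtain k where "r k > 0" by blast
    then have "r n \<ge> 0" for n using minor[of k n] by (metis zero_le_mult_iff zero_le_power2 not_le)
    then show ?thesis by (simp add: sum_nonneg)
  next
    case False
    then have "r n \<le> 0" for n by (metis not_le)
    then show ?thesis by (simp add: sum_nonpos sum_negf)
  qed
  have per: "r (n + int q) = r n" for n by (simp add: r_def contin_W_shift)
  have "real q = norm (\<Sum>s<q. e (- int s * int N) * ?A (int s) (int s - int N))"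
    using bloch_fourier[OF X] by simp
  also have "\<dots> \<le> (\<Sum>s<q. norm (e (- int s * int N) * ?A (int s) (int s - int N)))"
    by (rule norm_sum)
  also have "\<dots> = (\<Sum>s<q. norm (?A (int s) (int s - int N)))" by (simp add: norm_mult)
  also have "\<dots> \<le> (\<Sum>s<q. (\<bar>r (int s)\<bar> + \<bar>r (int s - int N)\<bar>) / 2)"
  proof (rule sum_mono)
    fix s
    have "(norm (?A (int s) (int s - int N)))\<^sup>2 = \<bar>r (int s)\<bar> * \<bar>r (int s - int N)\<bar>"
      using minor[of "int s" "int s - int N"] by (simp add: abs_mult[symmetric])
    also have "\<dots> \<le> ((\<bar>r (int s)\<bar> + \<bar>r (int s - int N)\<bar>) / 2)\<^sup>2"
      using sum_squares_bound[of "\<bar>r (int s)\<bar>" "\<bar>r (int s - int N)\<bar>"]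
      by (simp add: power2_eq_square field_simps)
    finally show "norm (?A (int s) (int s - int N)) \<le> (\<bar>r (int s)\<bar> + \<bar>r (int s - int N)\<bar>) / 2"
      by (rule power2_le_imp_le) simp
  qed
  also have "\<dots> = ((\<Sum>s<q. \<bar>r (int s)\<bar>) + (\<Sum>s<q. \<bar>r (int s - int N)\<bar>)) / 2"
    by (simp add: sum.distrib sum_divide_distrib[symmetric] add_divide_distrib)
  also have "(\<Sum>s<q. \<bar>r (int s - int N)\<bar>) = (\<Sum>s<q. \<bar>r (int s)\<bar>)"
    using sum_periodic_shift[of "\<lambda>n. \<bar>r n\<bar>" q "- int N"] per q_pos by simp
  also have "((\<Sum>s<q. \<bar>r (int s)\<bar>) + (\<Sum>s<q. \<bar>r (int s)\<bar>)) / 2 = \<bar>\<Sum>s<q. r (int s)\<bar>"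
    by (simp add: sgn)
  also have "\<dots> = norm (complex_of_real (\<Sum>s<q. r (int s)))" by (simp only: norm_of_real)
  also have "complex_of_real (\<Sum>s<q. r (int s)) = (\<Sum>s<q. contin (W (of_real E) X) (int s) q)"
    by (simp add: r[symmetric] bloch_diag)
  finally show ?thesis .
qed

definition Wp :: "complex \<Rightarrow> int \<Rightarrow> complex poly" where
  "Wp X n = [:- (X * e n + inverse (X * e n)), 1:]"

definition tr_poly_E :: "complex \<Rightarrow> complex poly" where
  "tr_poly_E X = contin (Wp X) 0 (q + 1) - contin (Wp X) 1 (q - 1)"

lemma poly_contin_W:
  "poly (contin (Wp X) k m) E = contin (W E X) k m"
  unfolding Wp_def[abs_def] wt_def[abs_def] by (rule poly_contin)

lemma poly_tr_poly_E: "poly (tr_poly_E X) E = trc E X"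
  by (simp add: tr_poly_E_def poly_contin_W trc_eq)

lemma poly_pderiv_tr_poly_E: "poly (pderiv (tr_poly_E X)) E = (\<Sum>s<q. contin (W E X) (int s) q)"
proof -
  have "pderiv (tr_poly_E X) = (\<Sum>j=1..<q + 1. contin (Wp X) 0 j * contin (Wp X) (int j) (q + 1 - j))
      - (\<Sum>j=1..<q - 1. contin (Wp X) 1 j * contin (Wp X) (1 + int j) (q - 1 - j))"
    unfolding tr_poly_E_def pderiv_diff Wp_def[abs_def] pderiv_contin by simp
  then have "poly (pderiv (tr_poly_E X)) E = (\<Sum>j=1..q. contin (W E X) 0 j * contin (W E X) (int j) (q + 1 - j))
      - (\<Sum>j=1..<q - 1. contin (W E X) 1 j * contin (W E X) (1 + int j) (q - 1 - j))"
    by (simp add: poly_sum poly_contin_W atLeastLessThanSuc_atLeastAtMost)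
  also have "\<dots> = (\<Sum>j=1..q. contin (W E X) (int j) q)"
    using periodic_recurrence.sum_contin_expand[OF wt_periodic q_pos] by simp
  also have "\<dots> = (\<Sum>s<q. contin (W E X) (int s + 1) q)"
    using sum.shift_bounds_Suc_ivl[of "\<lambda>j. contin (W E X) (int j) q" 0 q]
    by (simp add: atLeastLessThanSuc_atLeastAtMost atLeast0LessThan add.commute)
  also have "\<dots> = (\<Sum>s<q. contin (W E X) (int s) q)"
    using sum_periodic_shift[of "\<lambda>n. contin (W E X) n q" q 1] q_pos by (simp add: contin_W_shift)
  finally show ?thesis .
qed

text \<open>The phase enters the trace only as an additive constant, so the sum of the diagonal
  entries is the same for all X on the unit circle, and X may be chosen to suit the energy.\<close>

lemma dsc_has_derivative:
  assumes "norm X = 1"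
  shows "(dsc has_field_derivative - (\<Sum>s<q. contin (W E X) (int s) q)) (at E)"
proof -
  have "dsc E = - poly (tr_poly_E X) E - (X ^ q + inverse X ^ q)" for E
    using chambers[OF assms, of E] by (simp add: poly_tr_poly_E)
  then have "dsc = (\<lambda>E. - poly (tr_poly_E X) E - (X ^ q + inverse X ^ q))" by blast
  moreover have "((\<lambda>E. - poly (tr_poly_E X) E - (X ^ q + inverse X ^ q)) has_field_derivative - poly (pderiv (tr_poly_E X)) E) (at E)"
    by (auto intro!: derivative_eq_intros poly_DERIV)
  ultimately show ?thesis by (simp add: poly_pderiv_tr_poly_E)
qed

definition dsc_poly :: "complex poly" where
  "dsc_poly = - tr_poly_E (cis (2 * pi / (4 * real q)))"

text \<open>This is the phase pi / (2 q) built into the discriminant: X^q is the imaginary unit, so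
  the phase term vanishes and the trace equals - \<open>dsc\<close>.\<close>

lemma quarter_phase: "cis (2 * pi / (4 * real q)) ^ q + inverse (cis (2 * pi / (4 * real q))) ^ q = 0"
proof -
  have "real q * (2 * pi / (4 * real q)) = pi / 2" using q_pos by simp
  then have "cis (2 * pi / (4 * real q)) ^ q = cis (pi / 2)"
    using Complex.DeMoivre[of "2 * pi / (4 * real q)" q] by metis
  moreover have "inverse (cis x) ^ q = inverse (cis x ^ q)" for x by (simp only: power_inverse)
  ultimately show ?thesis by (simp add: complex_eq_iff)
qed

lemma poly_dsc_poly: "poly dsc_poly E = dsc E"
  using chambers[of "cis (2 * pi / (4 * real q))" E] quarter_phase
  by (simp add: dsc_poly_def poly_tr_poly_E)

lemma degree_contin_poly:
  fixes v :: "int \<Rightarrow> complex"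
  shows "degree (contin (\<lambda>n. [:- v n, 1:]) k (Suc m)) = m \<and> lead_coeff (contin (\<lambda>n. [:- v n, 1:]) k (Suc m)) = 1"
proof (induction m rule: induct_nat_012)
  case (ge2 m)
  let ?c = "contin (\<lambda>n. [:- v n, 1:]) k"
  define a where "a = [:- v (k + 1 + int (Suc m)), 1:] * ?c (Suc (Suc m))"
  have c: "?c (Suc (Suc (Suc m))) = a - ?c (Suc m)" by (simp add: a_def)
  have ne: "?c (Suc (Suc m)) \<noteq> 0" using ge2(2) by (metis leading_coeff_0_iff zero_neq_one)
  have d: "degree a = Suc (Suc m)" unfolding a_def using ge2(2) ne by (subst degree_mult_eq) auto
  have l: "lead_coeff a = 1" unfolding a_def using ge2(2) by (subst lead_coeff_mult) auto
  have lt: "degree (?c (Suc m)) < degree a" using ge2(1) d by simp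
  have "degree (a - ?c (Suc m)) = degree a"
    using degree_add_eq_left[of "- ?c (Suc m)" a] lt by simp
  then show ?case unfolding c using d l lt by (simp add: coeff_eq_0)
qed simp_all

lemma degree_dsc_poly: "degree dsc_poly = q" "lead_coeff dsc_poly = -1"
proof -
  define c where "c = contin (Wp (cis (2 * pi / (4 * real q))))"
  have deg: "degree (c k (Suc m)) = m \<and> lead_coeff (c k (Suc m)) = 1" for k m
    unfolding c_def Wp_def[abs_def] by (rule degree_contin_poly)
  have lt: "degree (c 1 (q - 1)) < q"
  proof (cases "q - 1")
    case (Suc m)
    then show ?thesis using deg[of 1 m] by simp
  qed (use q_pos in \<open>simp add: c_def\<close>)
  then have d: "degree (c 0 (q + 1) - c 1 (q - 1)) = q"
    using deg[of 0 q] degree_add_eq_left[of "- c 1 (q - 1)" "c 0 (q + 1)"] by simp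
  show "degree dsc_poly = q"
    unfolding dsc_poly_def tr_poly_E_def c_def[symmetric] degree_minus by (rule d)
  have "coeff (c 0 (q + 1)) q = 1" using deg[of 0 q] by (metis Suc_eq_plus1)
  then show "lead_coeff dsc_poly = -1"
    unfolding dsc_poly_def tr_poly_E_def c_def[symmetric] degree_minus d
    using lt by (simp add: coeff_eq_0)
qed

end

section \<open>The real discriminant and its zeros\<close>

lemma contin_of_real: "contin (\<lambda>n. of_real (w n)) k m = of_real (contin w k m)"
  by (induction w k m rule: contin.induct) simp_all

lemma green_of_real: "green (\<lambda>n. of_real (w n)) k m = of_real (green w k m)"
  by (simp add: green_def contin_of_real)

lemma matrix_mult_vector_2:
  fixes a b c d a' b' c' d' :: real
  shows "(vector [vector [a, b], vector [c, d]] :: real^2^2) ** (vector [vector [a', b'], vector [c', d']] :: real^2^2)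
    = vector [vector [a * a' + b * c', a * b' + b * d'], vector [c * a' + d * c', c * b' + d * d']]"
  by (simp add: vec_eq_iff matrix_matrix_mult_def sum_2 forall_2)

context odd_fraction
begin

definition wr :: "real \<Rightarrow> int \<Rightarrow> real" where
  "wr E n = E - pot (real p / real q) (1 / (4 * real q)) n"

lemma wr_periodic: "periodic_recurrence (wr E) q"
proof
  fix n
  have "2 * pi * (real p / real q * of_int (n + int q) + 1 / (4 * real q))
      = 2 * pi * (real p / real q * of_int n + 1 / (4 * real q)) + 2 * pi * of_int (int p)"
    using q_pos by (simp add: field_simps)
  moreover have "cos (x + 2 * pi * of_int m) = cos x" for x :: real and m :: int
    by (simp add: cos_add)
  ultimately show "wr E (n + int q) = wr E n"
    unfolding wr_def pot_def by (simp only:)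
qed

text \<open>The transfer matrix of the lowest site stands on the left of the product, so the
  induction prepends a site and uses \<open>green_lower\<close>.\<close>

lemma foldr_transfer:
  "foldr (**) (map (transfer p q E) [Suc k..<Suc (k + m)]) (mat 1) =
    vector [vector [green (wr E) (int k) (int (k + m) + 1), - green (wr E) (int k) (int (k + m))],
            vector [green (wr E) (int k + 1) (int (k + m) + 1), - green (wr E) (int k + 1) (int (k + m))]]"
proof (induction m arbitrary: k)
  case 0
  have "green (wr E) (int k + 1) (int k) = - 1"
    using green_antisym[of "wr E" "int k" "int k + 1"] by simp
  then show ?case by (simp add: vec_eq_iff mat_def forall_2)
next
  case (Suc m)
  interpret periodic_recurrence "wr E" q by (rule wr_periodic)
  have t: "transfer p q E (Suc k) = vector [vector [wr E (int k + 1), -1], vector [1, 0]]"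
  proof -
    have "2 * pi * real (Suc k * p) / real q + pi / (2 * real q) = 2 * pi * (real p / real q * of_int (int k + 1) + 1 / (4 * real q))"
      using q_pos by (simp add: field_simps)
    then show ?thesis unfolding transfer_def wr_def pot_def by (simp only:)
  qed
  have "[Suc k..<Suc (k + Suc m)] = Suc k # [Suc (Suc k)..<Suc (Suc k + m)]"
    by (simp add: upt_conv_Cons del: upt_Suc)
  then have "foldr (**) (map (transfer p q E) [Suc k..<Suc (k + Suc m)]) (mat 1) =
      transfer p q E (Suc k) ** foldr (**) (map (transfer p q E) [Suc (Suc k)..<Suc (Suc k + m)]) (mat 1)"
    by (simp del: upt_Suc)
  also have "\<dots> = vector [vector [wr E (int k + 1) * green (wr E) (int k + 1) (int (Suc k + m) + 1) - green (wr E) (int k + 2) (int (Suc k + m) + 1),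
        - (wr E (int k + 1) * green (wr E) (int k + 1) (int (Suc k + m)) - green (wr E) (int k + 2) (int (Suc k + m)))],
      vector [green (wr E) (int k + 1) (int (Suc k + m) + 1), - green (wr E) (int k + 1) (int (Suc k + m))]]"
    unfolding Suc.IH t matrix_mult_vector_2 by (simp add: add_ac)
  finally show ?case unfolding green_lower[symmetric] by simp
qed

lemma of_real_discriminant: "complex_of_real (discriminant p q E) = dsc (of_real E)"
proof -
  have "discriminant p q E = - (green (wr E) 0 (int q + 1) - green (wr E) 1 (int q))"
    using foldr_transfer[of E 0 q] by (simp add: discriminant_def trace_def sum_2)
  moreover have "complex_of_real (green (wr E) k n) = green (W (of_real E) (cis (2 * pi / (4 * real q)))) k n" for k n
  proof -
    have "W (of_real E) (cis (2 * pi * (1 / (4 * real q)))) = (\<lambda>n. of_real (wr E n))"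
      unfolding wt_cis wr_def by (rule ext) simp
    then show ?thesis by (simp add: green_of_real)
  qed
  ultimately have "complex_of_real (discriminant p q E) = - trc (of_real E) (cis (2 * pi / (4 * real q)))"
    unfolding trc_def periodic_recurrence.tr_def[OF wt_periodic] by simp
  then show ?thesis
    using poly_dsc_poly[of "of_real E"] by (simp add: dsc_poly_def poly_tr_poly_E)
qed

lemma unit_root_sum:
  assumes "\<bar>c\<bar> \<le> 1" obtains X where "norm X = 1" "X ^ q + inverse X ^ q = complex_of_real (2 * c)"
proof (rule that[of "cis (arccos c / real q)"])
  have "real q * (arccos c / real q) = arccos c" using q_pos by simp
  then have "cis (arccos c / real q) ^ q = cis (arccos c)"
    using Complex.DeMoivre[of "arccos c / real q" q] by metis
  moreover have "inverse (cis (arccos c / real q)) ^ q = inverse (cis (arccos c / real q) ^ q)"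
    by (simp only: power_inverse)
  ultimately have "cis (arccos c / real q) ^ q + inverse (cis (arccos c / real q)) ^ q = cis (arccos c) + cis (- arccos c)"
    by (simp only:) (simp only: cis_inverse)
  also have "\<dots> = complex_of_real (2 * c)" using assms by (simp add: complex_eq_iff cos_arccos_abs)
  finally show "cis (arccos c / real q) ^ q + inverse (cis (arccos c / real q)) ^ q = complex_of_real (2 * c)" .
qed simp

lemma discriminant_has_derivative:
  "(discriminant p q has_real_derivative deriv (discriminant p q) E) (at E)"
  and of_real_deriv_discriminant:
  "norm X = 1 \<Longrightarrow> complex_of_real (deriv (discriminant p q) E) = - (\<Sum>s<q. contin (W (of_real E) X) (int s) q)"
proof -
  define g where "g E = Re (- (\<Sum>s<q. contin (W (of_real E) 1) (int s) q))" for E :: real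
  have "discriminant p q = (\<lambda>x. Re (dsc (of_real x)))"
    by (rule ext) (simp add: of_real_discriminant[symmetric])
  moreover have "((\<lambda>x. Re (dsc (of_real x))) has_real_derivative g E) (at E)" for E
  proof -
    have "(dsc has_field_derivative - (\<Sum>s<q. contin (W (of_real E) 1) (int s) q)) (at (of_real E))"
      by (rule dsc_has_derivative) simp
    then have "((\<lambda>x. dsc (of_real x)) has_vector_derivative - (\<Sum>s<q. contin (W (of_real E) 1) (int s) q)) (at E)"
      by (rule has_vector_derivative_real_field)
    from bounded_linear.has_vector_derivative[OF bounded_linear_Re this] show ?thesis
      by (simp add: g_def has_real_derivative_iff_has_vector_derivative)
  qed
  ultimately have d: "(discriminant p q has_real_derivative g E) (at E)" for E by simp
  then show "(discriminant p q has_real_derivative deriv (discriminant p q) E) (at E)"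
    using DERIV_imp_deriv[OF d[of E]] d[of E] by simp
  assume X: "norm X = 1"
  have "(dsc has_field_derivative - (\<Sum>s<q. contin (W (of_real E) X) (int s) q)) (at (of_real E))"
    by (rule dsc_has_derivative[OF X])
  then have "((\<lambda>x. dsc (of_real x)) has_vector_derivative - (\<Sum>s<q. contin (W (of_real E) X) (int s) q)) (at E)"
    by (rule has_vector_derivative_real_field)
  then have "((\<lambda>x. complex_of_real (discriminant p q x)) has_vector_derivative - (\<Sum>s<q. contin (W (of_real E) X) (int s) q)) (at E)"
    by (simp add: of_real_discriminant)
  moreover have "((\<lambda>x. complex_of_real (discriminant p q x)) has_vector_derivative of_real (deriv (discriminant p q) E)) (at E)"
    using d[of E] by (auto intro!: has_vector_derivative_of_real simp: DERIV_imp_deriv has_real_derivative_iff_has_vector_derivative)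
  ultimately show "complex_of_real (deriv (discriminant p q) E) = - (\<Sum>s<q. contin (W (of_real E) X) (int s) q)"
    by (metis vector_derivative_at)
qed

text \<open>With c = - \<sigma>(E) / 4 a phase satisfying X^q + X^(-q) = 2 c leaves the trace 4 c -
  2 c = 2 c. Both quantities are in range precisely when \<bar>\<sigma>(E)\<bar> \<le> 4, and then
  the multipliers are unimodular.\<close>

lemma deriv_discriminant_ge:
  assumes "\<bar>discriminant p q E\<bar> \<le> 4"
  shows "real q \<le> \<bar>deriv (discriminant p q) E\<bar>"
proof -
  define c where "c = - discriminant p q E / 4"
  have c: "\<bar>c\<bar> \<le> 1" using assms by (simp add: c_def)
  obtain X where X: "norm X = 1" "X ^ q + inverse X ^ q = complex_of_real (2 * c)"
    using unit_root_sum[OF c] .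
  define z where "z = cis (arccos c)"
  have z: "norm z = 1" "z + cnj z = of_real (2 * c)"
    using c by (auto simp: z_def complex_eq_iff cos_arccos_abs)
  have "trc (of_real E) X = - dsc (of_real E) - (X ^ q + inverse X ^ q)" by (rule chambers[OF X(1)])
  also have "\<dots> = of_real (2 * c)"
    unfolding X of_real_discriminant[symmetric] by (simp add: c_def)
  finally have "real q \<le> norm (\<Sum>s<q. contin (W (of_real E) X) (int s) q)"
    using z by (intro contin_sum_ge[OF X(1)]) auto
  also have "\<dots> = norm (complex_of_real (deriv (discriminant p q) E))"
    unfolding of_real_deriv_discriminant[OF X(1)] by simp
  finally show ?thesis by simp
qed

lemma minus_one_power_q: "(-1) ^ q + inverse (-1) ^ q = (-2 :: complex)"
  by (simp add: q_def)

text \<open>At X = -1 a zero of \<open>dsc\<close> has trace 2, hence multiplier 1 and a q-periodic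
  solution; E is then an eigenvalue of a Hermitian problem on a cycle of q sites. That some Bloch
  solution is nonzero follows from the Fourier coefficient of modulus q.\<close>

lemma dsc_root_real:
  assumes "dsc E = 0" shows "Im E = 0"
proof -
  interpret periodic_recurrence "W E (-1)" q by (rule wt_periodic)
  have "trc E (-1) = 2" using chambers[of "-1" E] assms minus_one_power_q by simp
  then have tr: "1 + 1 = tr" by (simp add: trc_def)
  have "(\<Sum>s<q. e (- int s * int N) * bloch 1 (int s) (int s - int N)) \<noteq> 0"
    using bloch_fourier[of "-1" E 1] q_pos by auto
  then obtain s where "bloch 1 (int s) (int s - int N) \<noteq> 0"
    by (metis (no_types, lifting) mult_zero_right sum.neutral)
  define u where "u = bloch 1 (int s)"
  have sol: "sol (W E (-1)) u" unfolding u_def by (rule sol_bloch)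
  have per: "u (n + int q) = u n" for n
    unfolding u_def using bloch_period[OF _ tr, of "int s" n] by simp
  have ne: "u (int s - int N) \<noteq> 0" unfolding u_def by fact
  define v where "v n = - (e n + inverse (e n))" for n
  have v: "cnj (v n) = v n" for n
    by (simp add: v_def cnj_phase phase_minus)
  have eq: "E * u n = u (n + 1) + u (n - 1) + v n * u n" for n
    using solD[OF sol, of n] by (simp add: wt_def v_def algebra_simps)
  let ?T = "\<Sum>s<q. cnj (u (int s)) * u (int s + 1)"
  have "(\<Sum>s<q. cnj (u (int s)) * u (int s - 1)) = (\<Sum>s<q. cnj (u (int s + 1)) * u (int s))"
    using sum_periodic_shift[of "\<lambda>n. cnj (u n) * u (n - 1)" q 1] per q_pos
    by (metis (no_types, lifting) add_diff_cancel_right' diff_add_eq sum.cong)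
  then have T: "(\<Sum>s<q. cnj (u (int s)) * u (int s - 1)) = cnj ?T"
    by (simp add: mult.commute)
  have "E * of_real (\<Sum>s<q. (norm (u (int s)))\<^sup>2) = (\<Sum>s<q. cnj (u (int s)) * (E * u (int s)))"
    by (simp add: complex_norm_square sum_distrib_left algebra_simps del: of_real_power)
  also have "\<dots> = ?T + cnj ?T + (\<Sum>s<q. v (int s) * of_real ((norm (u (int s)))\<^sup>2))"
    unfolding eq T[symmetric] complex_norm_square by (simp add: sum.distrib[symmetric] algebra_simps)
  finally have *: "E * of_real (\<Sum>s<q. (norm (u (int s)))\<^sup>2) = \<dots>" .
  have "Im (?T + cnj ?T + (\<Sum>s<q. v (int s) * of_real ((norm (u (int s)))\<^sup>2))) = 0"
  proof -
    have "Im (v n) = 0" for n using v[of n] by (simp add: complex_eq_iff)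
    then have "Im (\<Sum>s<q. v (int s) * of_real ((norm (u (int s)))\<^sup>2)) = 0" by simp
    moreover have "Im (x + cnj x + y) = Im y" for x y by simp
    ultimately show ?thesis by (simp only:)
  qed
  then have "Im E * (\<Sum>s<q. (norm (u (int s)))\<^sup>2) = 0" unfolding *[symmetric] by simp
  moreover have "(\<Sum>s<q. (norm (u (int s)))\<^sup>2) > 0"
  proof -
    have "(\<Sum>s'<q. (norm (u (int s' + (int s - int N))))\<^sup>2) = (\<Sum>s<q. (norm (u (int s)))\<^sup>2)"
      using sum_periodic_shift[of "\<lambda>n. (norm (u n))\<^sup>2" q "int s - int N"] per q_pos by simp
    moreover have "(\<Sum>s'<q. (norm (u (int s' + (int s - int N))))\<^sup>2) > 0"
      by (rule sum_pos2[of _ 0]) (use ne q_pos in auto)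
    ultimately show ?thesis by simp
  qed
  ultimately show ?thesis by simp
qed

text \<open>Replacing X by - X negates the potential, and for odd q it exchanges the phase terms 2
  and - 2.\<close>

lemma dsc_minus: "dsc (- E) = - dsc E"
proof -
  have c: "contin (W (- E) X) k m = (-1) ^ (m + 1) * contin (W E (- X)) k m" for X k m
  proof (induction m rule: induct_nat_012)
    case (ge2 m)
    have "W (- E) X n = - W E (- X) n" for n by (simp add: wt_def)
    then show ?case using ge2 by (simp add: algebra_simps)
  qed simp_all
  have "trc (- E) X = - trc E (- X)" for X
    unfolding trc_eq c by (simp add: q_def)
  from this[of 1] have "- dsc (- E) - 2 = - (- dsc E + 2)"
    using chambers[of 1 "- E"] chambers[of "-1" E] minus_one_power_q by simp
  then show ?thesis by (simp add: algebra_simps) (metis minus_minus)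
qed

lemma discriminant_minus: "discriminant p q (- E) = - discriminant p q E"
proof -
  have "complex_of_real (discriminant p q (- E)) = complex_of_real (- discriminant p q E)"
    unfolding of_real_discriminant by (simp add: of_real_discriminant dsc_minus)
  then show ?thesis by (simp only: of_real_eq_iff)
qed

text \<open>All complex zeros are real, and they are simple because \<bar>\<sigma>'\<bar> \<ge> q
  wherever \<sigma> = 0; so q distinct real zeros exhaust the degree.\<close>

lemma discriminant_roots:
  defines "Z \<equiv> {x. discriminant p q x = 0}"
  shows "finite Z" "card Z = q" "discriminant p q x = - (\<Prod>r\<in>Z. x - r)"
proof -
  define Zc where "Zc = {z. poly dsc_poly z = 0}"
  have "dsc_poly \<noteq> 0" using degree_dsc_poly(2) by auto
  then have finc: "finite Zc" unfolding Zc_def by (rule poly_roots_finite)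
  have Zc: "Zc = complex_of_real ` Z"
  proof (intro equalityI subsetI)
    fix z :: complex assume "z \<in> Zc"
    then have z: "dsc z = 0" by (simp add: Zc_def poly_dsc_poly)
    then have "z = of_real (Re z)" using dsc_root_real[OF z] by (simp add: complex_eq_iff)
    moreover from this z have "discriminant p q (Re z) = 0"
      using of_real_discriminant[of "Re z"] by simp
    ultimately show "z \<in> of_real ` Z" by (auto simp: Z_def)
  next
    fix z :: complex assume "z \<in> of_real ` Z"
    then show "z \<in> Zc" by (auto simp: Zc_def Z_def poly_dsc_poly of_real_discriminant[symmetric])
  qed
  have inj: "inj_on complex_of_real Z" by (simp add: inj_on_def)
  show fin: "finite Z" using finc unfolding Zc by (rule finite_imageD[OF _ inj])
  have "rsquarefree dsc_poly"
    unfolding rsquarefree_roots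
  proof (intro allI notI, elim conjE)
    fix z assume z: "poly dsc_poly z = 0" "poly (pderiv dsc_poly) z = 0"
    then obtain x where x: "z = of_real x" "discriminant p q x = 0" using Zc by (auto simp: Zc_def Z_def)
    have n1: "norm (cis (2 * pi / (4 * real q))) = 1" by simp
    have "poly (pderiv dsc_poly) z = - (\<Sum>s<q. contin (W z (cis (2 * pi / (4 * real q)))) (int s) q)"
      by (simp add: dsc_poly_def pderiv_minus poly_pderiv_tr_poly_E)
    also have "\<dots> = complex_of_real (deriv (discriminant p q) x)"
      unfolding x of_real_deriv_discriminant[OF n1] ..
    finally have "deriv (discriminant p q) x = 0" using z by simp
    then show False using deriv_discriminant_ge[of x] x q_pos by simp
  qed
  from complex_poly_decompose_rsquarefree[OF this]
  have dec: "dsc_poly = - (\<Prod>z\<in>Zc. [:- z, 1:])" by (simp add: degree_dsc_poly(2) Zc_def)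
  have "q = degree dsc_poly" by (simp add: degree_dsc_poly)
  also have "\<dots> = (\<Sum>z\<in>Zc. degree [:- z, 1:])" 
    using arg_cong[OF dec, of degree] degree_prod_eq_sum_degree[of Zc "\<lambda>z. [:- z, 1:]"] by simp
  also have "\<dots> = card Zc" by simp
  finally show "card Z = q" unfolding Zc card_image[OF inj] by simp
  have "complex_of_real (discriminant p q x) = poly dsc_poly (of_real x)"
    by (simp add: of_real_discriminant poly_dsc_poly)
  also have "\<dots> = - (\<Prod>z\<in>Zc. of_real x - z)" by (subst dec) (simp add: poly_prod algebra_simps)
  also have "\<dots> = complex_of_real (- (\<Prod>r\<in>Z. x - r))"
    unfolding Zc prod.reindex[OF inj] by (simp add: o_def)
  finally show "discriminant p q x = - (\<Prod>r\<in>Z. x - r)" by (simp only: of_real_eq_iff)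
qed

end

section \<open>The derivative of the discriminant at zero\<close>

context odd_fraction
begin

text \<open>At energy \<open>0\<close> a Gaussian phase turns the Fourier transformed equation into a two-term recursion, solved by \<open>psi\<close>.
  This makes the periodic zero energy solution explicit.\<close>

definition psi :: "nat \<Rightarrow> complex" where
  "psi l = (\<Prod>i=1..l. - (e (2 * int i - 1) - 1) / (e (- 2 * int i) - 1))"

text \<open>N + 1 is the inverse of 2 modulo q, so this is the Gaussian phase e ((n^2 + n) / 2),
  with quotient e (n + 1) from n to n + 1.\<close>

definition gauss :: "int \<Rightarrow> complex" where
  "gauss n = e ((int N + 1) * (n * n + n))"

definition psi_hat :: "int \<Rightarrow> complex" where
  "psi_hat n = (\<Sum>l\<le>N. psi l * e (2 * n * int l))"

definition zero_mode :: "int \<Rightarrow> complex" where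
  "zero_mode n = gauss n * psi_hat n"

lemma e_ne_1: "0 < n \<Longrightarrow> n < int q \<Longrightarrow> e n \<noteq> 1" "0 < n \<Longrightarrow> n < int q \<Longrightarrow> e (- n) \<noteq> 1"
  by (auto simp: e_eq_1_iff dest!: zdvd_imp_le)

lemma psi_step:
  assumes "l < N"
  shows "psi l * (e (2 * int l + 1) - 1) + psi (Suc l) * (e (- 2 * (int l + 1)) - 1) = 0"
proof -
  have "e (- (2 * int l + 2)) \<noteq> 1" using assms by (intro e_ne_1) (auto simp: q_def)
  then have "e (- 2 * int (Suc l)) - 1 \<noteq> 0" by (simp add: algebra_simps)
  then show ?thesis by (simp add: psi_def field_simps)
qed

lemma e_half: "e ((int N + 1) * (2 * n)) = e n"
proof -
  have "(int N + 1) * (2 * n) = n + int q * n" by (simp add: q_def algebra_simps)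
  then show ?thesis by (simp only: phase_add e_period) simp
qed

lemma gauss_shift: "gauss (n + 1) = gauss n * e (n + 1)" "gauss (n - 1) = gauss n * e (- n)"
proof -
  have "(int N + 1) * ((n + 1) * (n + 1) + (n + 1)) = (int N + 1) * (n * n + n) + (int N + 1) * (2 * (n + 1))"
    "(int N + 1) * ((n - 1) * (n - 1) + (n - 1)) = (int N + 1) * (n * n + n) + (int N + 1) * (2 * (- n))"
    by (simp_all add: algebra_simps)
  then show "gauss (n + 1) = gauss n * e (n + 1)" "gauss (n - 1) = gauss n * e (- n)"
    unfolding gauss_def by (simp_all only: phase_add e_half)
qed

lemma sol_zero_mode: "sol (W 0 (-1)) zero_mode"
  unfolding sol_def
proof
  fix n
  let ?A = "\<lambda>l. psi l * (e (2 * int l + 1) - 1) * e (2 * n * int l + n)"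
  let ?B = "\<lambda>l. psi l * (e (- 2 * int l) - 1) * e (2 * n * int l - n)"
  \<comment> \<open>The frequency 2 l + 1 receives psi l from ?A and psi (l + 1) from ?B, matched by
    \<open>psi_step\<close>. The recursion closes at both ends: ?B vanishes at l = 0, and ?A at l =
    N because e (2 N + 1) = e q = 1.\<close>
  have zero: "(\<Sum>l\<le>N. ?A l) + (\<Sum>l\<le>N. ?B l) = 0"
  proof -
    have A: "(\<Sum>l\<le>N. ?A l) = (\<Sum>l<N. ?A l)"
    proof -
      have "2 * int N + 1 = int q * 1" by (simp add: q_def)
      then have "e (2 * int N + 1) = 1" by (simp only: e_period)
      then show ?thesis by (simp add: lessThan_Suc_atMost[symmetric])
    qed
    have B: "(\<Sum>l\<le>N. ?B l) = (\<Sum>l<N. ?B (Suc l))"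
      by (simp add: lessThan_Suc_atMost[symmetric] sum.lessThan_Suc_shift del: sum.lessThan_Suc)
    have "?A l + ?B (Suc l) = 0" if "l < N" for l
    proof -
      have i: "2 * n * int (Suc l) - n = 2 * n * int l + n" "- 2 * int (Suc l) = - 2 * (int l + 1)"
        by (simp_all add: algebra_simps)
      have "?A l + ?B (Suc l) = (psi l * (e (2 * int l + 1) - 1) + psi (Suc l) * (e (- 2 * (int l + 1)) - 1)) * e (2 * n * int l + n)"
        unfolding i by (simp only: distrib_right)
      then show ?thesis by (simp only: psi_step[OF that]) simp
    qed
    then show ?thesis unfolding A B sum.distrib[symmetric] by simp
  qed
  have "psi_hat (n + 1) * e (n + 1) - psi_hat n * e n = (\<Sum>l\<le>N. ?A l)"
  proof -
    have "psi l * e (2 * (n + 1) * int l) * e (n + 1) - psi l * e (2 * n * int l) * e n = ?A l" for l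
    proof -
      have "e (2 * (n + 1) * int l) * e (n + 1) = e (2 * int l + 1) * e (2 * n * int l + n)"
        by (simp add: phase_add[symmetric] algebra_simps)
      then show ?thesis by (simp add: phase_add algebra_simps)
    qed
    then show ?thesis by (simp only: psi_hat_def sum_distrib_right sum_subtractf[symmetric])
  qed
  moreover have "psi_hat (n - 1) * e (- n) - psi_hat n * e (- n) = (\<Sum>l\<le>N. ?B l)"
  proof -
    have "psi l * e (2 * (n - 1) * int l) * e (- n) - psi l * e (2 * n * int l) * e (- n) = ?B l" for l
    proof -
      have "e (2 * (n - 1) * int l) * e (- n) = e (- 2 * int l) * e (2 * n * int l - n)"
        "e (2 * n * int l - n) = e (2 * n * int l) * e (- n)"
        by (simp_all add: phase_add[symmetric] algebra_simps)
      then show ?thesis by (simp add: algebra_simps)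
    qed
    then show ?thesis by (simp only: psi_hat_def sum_distrib_right sum_subtractf[symmetric])
  qed
  ultimately have "psi_hat (n + 1) * e (n + 1) + psi_hat (n - 1) * e (- n) = (e n + e (- n)) * psi_hat n"
    using zero by (simp add: algebra_simps)
  then have "gauss n * (psi_hat (n + 1) * e (n + 1) + psi_hat (n - 1) * e (- n)) = (e n + e (- n)) * (gauss n * psi_hat n)"
    by simp
  then show "zero_mode (n + 1) + zero_mode (n - 1) = W 0 (-1) n * zero_mode n"
    unfolding zero_mode_def gauss_shift by (simp add: wt_def phase_minus algebra_simps)
qed

lemma zero_mode_period: "zero_mode (n + int q) = zero_mode n"
proof -
  have "(int N + 1) * ((n + int q) * (n + int q) + (n + int q)) = (int N + 1) * (n * n + n) + int q * ((int N + 1) * (2 * n + int q + 1))"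
    by (simp add: algebra_simps)
  then have g: "gauss (n + int q) = gauss n" unfolding gauss_def by (simp only: phase_add e_period) simp
  have "2 * (n + int q) * int l = 2 * n * int l + int q * (2 * int l)" for l by (simp add: algebra_simps)
  then have "e (2 * (n + int q) * int l) = e (2 * n * int l)" for l by (simp only: phase_add e_period) simp
  then show ?thesis unfolding zero_mode_def psi_hat_def g by simp
qed

lemma norm_gauss: "norm (gauss n) = 1"
  by (simp add: gauss_def)

lemma even_dvd_iff:
  assumes "\<bar>d\<bar> \<le> int N" shows "int q dvd 2 * d \<longleftrightarrow> d = 0"
proof
  assume "int q dvd 2 * d"
  moreover have "\<bar>2 * d\<bar> < int q" using assms by (simp add: q_def)
  ultimately have "2 * d = 0" by (metis dvd_imp_le_int not_le abs_of_nat)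
  then show "d = 0" by simp
qed simp

text \<open>Parseval: the Gaussian factor is unimodular, and the frequencies 2 l with l \<le> N are
  distinct modulo the odd number q.\<close>

lemma zero_mode_norm: "(\<Sum>s<q. (norm (zero_mode (int s)))\<^sup>2) = real q * (\<Sum>l\<le>N. (norm (psi l))\<^sup>2)"
proof -
  have "complex_of_real (\<Sum>s<q. (norm (zero_mode (int s)))\<^sup>2) = (\<Sum>s<q. psi_hat (int s) * cnj (psi_hat (int s)))"
    by (simp add: complex_norm_square[symmetric] zero_mode_def norm_mult norm_gauss del: of_real_power)
  also have "\<dots> = (\<Sum>s<q. \<Sum>l\<le>N. \<Sum>l'\<le>N. psi l * cnj (psi l') * e (int s * (2 * (int l - int l'))))"
    unfolding psi_hat_def cnj_sum sum_product
  proof (intro sum.cong refl)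
    fix s l l'
    have "e (2 * int s * int l) * e (- (2 * int s * int l')) = e (int s * (2 * (int l - int l')))"
      by (simp add: phase_add[symmetric] algebra_simps)
    then show "psi l * e (2 * int s * int l) * cnj (psi l' * e (2 * int s * int l')) = psi l * cnj (psi l') * e (int s * (2 * (int l - int l')))"
      by (simp add: cnj_phase algebra_simps)
  qed
  also have "\<dots> = (\<Sum>l\<le>N. \<Sum>l'\<le>N. \<Sum>s<q. psi l * cnj (psi l') * e (int s * (2 * (int l - int l'))))"
    by (subst sum.swap) (simp add: sum.swap[of _ _ "{..<q}"])
  also have "\<dots> = (\<Sum>l\<le>N. \<Sum>l'\<le>N. if l' = l then of_nat q * (psi l * cnj (psi l)) else 0)"
  proof (intro sum.cong refl)
    fix l l' assume "l \<in> {..N}" "l' \<in> {..N}"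
    then have "int q dvd 2 * (int l - int l') \<longleftrightarrow> l' = l" by (subst even_dvd_iff) auto
    then show "(\<Sum>s<q. psi l * cnj (psi l') * e (int s * (2 * (int l - int l')))) = (if l' = l then of_nat q * (psi l * cnj (psi l)) else 0)"
      unfolding sum_distrib_left[symmetric] sum_e by simp
  qed
  also have "\<dots> = complex_of_real (real q * (\<Sum>l\<le>N. (norm (psi l))\<^sup>2))"
    by (simp add: complex_norm_square[symmetric] sum_distrib_left del: of_real_power)
  finally show ?thesis by (simp only: of_real_eq_iff)
qed

text \<open>After the Gaussian phases are combined, the sum over s keeps only pairs with 1 - 2 l + 2
  l' divisible by 2 N + 1. In the range up to N this is the single pair l = 0, l' = N.\<close>

lemma zero_mode_correlation:
  "norm (\<Sum>s<q. e (- int s * int N) * (cnj (zero_mode (int s)) * zero_mode (int s - int N))) = real q * norm (psi N)"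
proof -
  let ?c = "e ((int N + 1) * (int N * int N - int N))"
  have g: "cnj (gauss n) * gauss (n - int N) = ?c * e (- n * int N)" for n
  proof -
    have "- ((int N + 1) * (n * n + n)) + (int N + 1) * ((n - int N) * (n - int N) + (n - int N))
        = (int N + 1) * (int N * int N - int N) + (int N + 1) * (2 * (- n * int N))"
      by (simp add: algebra_simps)
    then show ?thesis unfolding gauss_def cnj_phase phase_add[symmetric] by (simp only: phase_add e_half)
  qed
  have "(\<Sum>s<q. e (- int s * int N) * (cnj (zero_mode (int s)) * zero_mode (int s - int N)))
      = (\<Sum>s<q. \<Sum>l\<le>N. \<Sum>l'\<le>N. ?c * (cnj (psi l) * psi l' * e (- 2 * int N * int l')) * e (int s * (1 - 2 * int l + 2 * int l')))"
  proof (intro sum.cong refl)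
    fix s
    have "e (- int s * int N) * (cnj (zero_mode (int s)) * zero_mode (int s - int N))
      = (e (- int s * int N) * (cnj (gauss (int s)) * gauss (int s - int N))) * (cnj (psi_hat (int s)) * psi_hat (int s - int N))"
      by (simp add: zero_mode_def mult_ac)
    also have "e (- int s * int N) * (cnj (gauss (int s)) * gauss (int s - int N)) = ?c * e (int s)"
    proof -
      have "- int s * int N + - int s * int N = int s + int q * (- int s)" by (simp add: q_def algebra_simps)
      then have "e (- int s * int N) * e (- int s * int N) = e (int s)"
        unfolding phase_add[symmetric] by (simp only: phase_add e_period) simp
      then show ?thesis unfolding g by (simp add: mult_ac)
    qed
    also have "?c * e (int s) * (cnj (psi_hat (int s)) * psi_hat (int s - int N)) =
      (\<Sum>l\<le>N. \<Sum>l'\<le>N. ?c * (cnj (psi l) * psi l' * e (- 2 * int N * int l')) * e (int s * (1 - 2 * int l + 2 * int l')))"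
    proof -
      have "?c * e (int s) * (cnj (psi_hat (int s)) * psi_hat (int s - int N)) =
        (\<Sum>l\<le>N. \<Sum>l'\<le>N. ?c * e (int s) * (cnj (psi l * e (2 * int s * int l)) * (psi l' * e (2 * (int s - int N) * int l'))))"
        by (simp only: psi_hat_def cnj_sum sum_product) (simp only: sum_distrib_left)
      also have "\<dots> = (\<Sum>l\<le>N. \<Sum>l'\<le>N. ?c * (cnj (psi l) * psi l' * e (- 2 * int N * int l')) * e (int s * (1 - 2 * int l + 2 * int l')))"
      proof (intro sum.cong refl)
      fix l l'
      have "e (int s) * e (- (2 * int s * int l)) * e (2 * (int s - int N) * int l') = e (- 2 * int N * int l') * e (int s * (1 - 2 * int l + 2 * int l'))"
        by (simp add: phase_add[symmetric] algebra_simps)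
      then have 1: "?c * (cnj (psi l) * psi l') * (e (int s) * e (- (2 * int s * int l)) * e (2 * (int s - int N) * int l'))
          = ?c * (cnj (psi l) * psi l') * (e (- 2 * int N * int l') * e (int s * (1 - 2 * int l + 2 * int l')))"
        by (simp only:)
      have "?c * e (int s) * (cnj (psi l * e (2 * int s * int l)) * (psi l' * e (2 * (int s - int N) * int l')))
          = ?c * (cnj (psi l) * psi l') * (e (int s) * e (- (2 * int s * int l)) * e (2 * (int s - int N) * int l'))"
        by (simp only: complex_cnj_mult cnj_phase mult_ac)
      also note 1
      finally show "?c * e (int s) * (cnj (psi l * e (2 * int s * int l)) * (psi l' * e (2 * (int s - int N) * int l'))) =
          ?c * (cnj (psi l) * psi l' * e (- 2 * int N * int l')) * e (int s * (1 - 2 * int l + 2 * int l'))"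
        by (simp only: mult.assoc)
      qed
      finally show ?thesis .
    qed
    finally show "e (- int s * int N) * (cnj (zero_mode (int s)) * zero_mode (int s - int N)) =
      (\<Sum>l\<le>N. \<Sum>l'\<le>N. ?c * (cnj (psi l) * psi l' * e (- 2 * int N * int l')) * e (int s * (1 - 2 * int l + 2 * int l')))" .
  qed
  also have "\<dots> = (\<Sum>l\<le>N. \<Sum>l'\<le>N. \<Sum>s<q. ?c * (cnj (psi l) * psi l' * e (- 2 * int N * int l')) * e (int s * (1 - 2 * int l + 2 * int l')))"
    by (subst sum.swap) (simp add: sum.swap[of _ _ "{..<q}"])
  also have "\<dots> = (\<Sum>l\<le>N. \<Sum>l'\<le>N. if l = 0 \<and> l' = N then ?c * (cnj (psi 0) * psi N * e (- 2 * int N * int N)) * of_nat q else 0)"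
  proof (intro sum.cong refl)
    fix l l' assume l: "l \<in> {..N}" "l' \<in> {..N}"
    have "int q dvd 1 - 2 * int l + 2 * int l' \<longleftrightarrow> l = 0 \<and> l' = N"
    proof
      assume "int q dvd 1 - 2 * int l + 2 * int l'"
      then obtain k where k: "1 - 2 * int l + 2 * int l' = int q * k" by (auto elim: dvdE)
      have bnd: "- int q < int q * k" "int q * k \<le> int q"
        unfolding k[symmetric] using l by (auto simp: q_def)
      have "k \<le> 1"
      proof (rule ccontr)
        assume "\<not> k \<le> 1"
        then have "int q * 2 \<le> int q * k" by (intro mult_left_mono) auto
        then show False using bnd q_pos by linarith
      qed
      moreover have "-1 < k"
      proof (rule ccontr)
        assume "\<not> -1 < k"
        then have "int q * k \<le> int q * (-1)" by (intro mult_left_mono) auto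
        then show False using bnd by linarith
      qed
      moreover have "k \<noteq> 0"
      proof
        assume "k = 0"
        then have "1 + 2 * (int l' - int l) = 0" using k by simp
        then show False by presburger
      qed
      ultimately have "k = 1" by simp
      then show "l = 0 \<and> l' = N" using k l by (simp add: q_def)
    qed (simp add: q_def algebra_simps)
    then show "(\<Sum>s<q. ?c * (cnj (psi l) * psi l' * e (- 2 * int N * int l')) * e (int s * (1 - 2 * int l + 2 * int l')))
      = (if l = 0 \<and> l' = N then ?c * (cnj (psi 0) * psi N * e (- 2 * int N * int N)) * of_nat q else 0)"
      unfolding sum_distrib_left[symmetric] sum_e by simp
  qed
  also have "\<dots> = ?c * (cnj (psi 0) * psi N * e (- 2 * int N * int N)) * of_nat q"
  proof -
    have "(\<Sum>l'\<le>N. if l = 0 \<and> l' = N then x else 0) = (if l = 0 then x else 0)" for l :: nat and x :: complex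
      by (cases "l = 0") auto
    then show ?thesis by (simp only:) simp
  qed
  finally show ?thesis by (simp add: norm_mult psi_def)
qed

lemma norm_e_minus_1: "norm (e m - 1) = 2 * \<bar>sin (pi * (of_int m * (real p / real q)))\<bar>"
proof -
  define x where "x = pi * (of_int m * (real p / real q))"
  have "2 * pi * (real p / real q) * of_int m = 2 * x" by (simp add: x_def)
  then have "(norm (e m - 1))\<^sup>2 = (cos (2 * x) - 1)\<^sup>2 + (sin (2 * x))\<^sup>2"
    by (simp only: phase_def) (simp add: cmod_power2)
  also have "\<dots> = 2 - 2 * cos (2 * x)"
    using sin_cos_squared_add[of "2 * x"] by (simp add: power2_eq_square algebra_simps)
  also have "\<dots> = (2 * \<bar>sin x\<bar>)\<^sup>2" by (simp add: cos_double_sin power_mult_distrib)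
  finally have "norm (e m - 1) = 2 * \<bar>sin x\<bar>" by (rule power2_eq_imp_eq) auto
  then show ?thesis by (simp only: x_def)
qed

lemma norm_psi: "(norm (psi l))\<^sup>2 = (\<Prod>i=1..l. (sin (pi * (real (2 * i - 1) * (real p / real q))) / sin (pi * (real (2 * i) * (real p / real q))))\<^sup>2)"
proof -
  have "norm (psi l) = (\<Prod>i=1..l. norm (- (e (2 * int i - 1) - 1) / (e (- 2 * int i) - 1)))"
    by (simp add: psi_def prod_norm)
  then have "(norm (psi l))\<^sup>2 = (\<Prod>i=1..l. (norm (- (e (2 * int i - 1) - 1) / (e (- 2 * int i) - 1)))\<^sup>2)"
    by (simp add: prod_power_distrib)
  also have "\<dots> = (\<Prod>i=1..l. (sin (pi * (real (2 * i - 1) * (real p / real q))) / sin (pi * (real (2 * i) * (real p / real q))))\<^sup>2)"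
  proof (intro prod.cong refl)
    fix i assume "i \<in> {1..l}"
    then have "real_of_int (2 * int i - 1) = real (2 * i - 1)" by (simp add: of_nat_diff)
    then have "norm (e (2 * int i - 1) - 1) = 2 * \<bar>sin (pi * (real (2 * i - 1) * (real p / real q)))\<bar>"
      unfolding norm_e_minus_1 by (simp only:)
    moreover have "norm (e (- 2 * int i) - 1) = 2 * \<bar>sin (pi * (real (2 * i) * (real p / real q)))\<bar>"
    proof -
      have "pi * (of_int (- 2 * int i) * (real p / real q)) = - (pi * (real (2 * i) * (real p / real q)))" by simp
      then show ?thesis unfolding norm_e_minus_1 by (simp only: sin_minus abs_minus_cancel)
    qed
    ultimately show "(norm (- (e (2 * int i - 1) - 1) / (e (- 2 * int i) - 1)))\<^sup>2 =
        (sin (pi * (real (2 * i - 1) * (real p / real q))) / sin (pi * (real (2 * i) * (real p / real q))))\<^sup>2"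
      by (simp only: norm_divide norm_minus_cancel power_divide power_mult_distrib power2_abs) simp
  qed
  finally show ?thesis .
qed

text \<open>The reflection i to N + 1 - i carries - 2 i to 2 i - 1 modulo q, so numerators and
  denominators consist of the same factors.\<close>

lemma norm_psi_N: "norm (psi N) = 1"
proof -
  have "norm (psi N) = (\<Prod>i=1..N. norm (e (2 * int i - 1) - 1)) / (\<Prod>i=1..N. norm (e (- 2 * int i) - 1))"
    by (simp add: psi_def prod_norm[symmetric] norm_divide prod_dividef norm_minus_commute)
  also have "(\<Prod>i=1..N. norm (e (- 2 * int i) - 1)) = (\<Prod>i=1..N. norm (e (- 2 * int (N + 1 - i)) - 1))"
    by (rule prod.atLeastAtMost_rev)
  also have "\<dots> = (\<Prod>i=1..N. norm (e (2 * int i - 1) - 1))"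
  proof (intro prod.cong refl)
    fix i assume "i \<in> {1..N}"
    then have "- 2 * int (N + 1 - i) = (2 * int i - 1) + int q * (-1)" by (simp add: q_def of_nat_diff)
    then have "e (- 2 * int (N + 1 - i)) = e (2 * int i - 1)" by (simp only: phase_add e_period) simp
    then show "norm (e (- 2 * int (N + 1 - i)) - 1) = norm (e (2 * int i - 1) - 1)" by simp
  qed
  also have "(\<Prod>i=1..N. norm (e (2 * int i - 1) - 1)) / (\<Prod>i=1..N. norm (e (2 * int i - 1) - 1)) = 1"
  proof -
    have "e (2 * int i - 1) \<noteq> 1" if "i \<in> {1..N}" for i using that by (intro e_ne_1) (auto simp: q_def)
    then have "(\<Prod>i=1..N. norm (e (2 * int i - 1) - 1)) \<noteq> 0" by (auto simp: prod_zero_iff)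
    then show ?thesis by simp
  qed
  finally show ?thesis .
qed

text \<open>At X = -1 both multipliers are 1 and the kernel is lam times the rank one kernel of the
  explicit solution. The Fourier coefficient at distance N has modulus q on one side and
  \<bar>lam\<bar> q on the other, so \<bar>lam\<bar> = 1, and the sum of the diagonal entries has
  modulus the squared norm of that solution over one period.\<close>

lemma deriv_discriminant_zero:
  "\<bar>deriv (discriminant p q) 0\<bar> = real q * (\<Sum>l\<le>N. (norm (psi l))\<^sup>2)"
proof -
  interpret periodic_recurrence "W 0 (-1)" q by (rule wt_periodic)
  have "dsc 0 = 0" using dsc_minus[of 0] by simp
  then have "trc 0 (-1) = 2" using chambers[of "-1" 0] minus_one_power_q by simp
  then have tr: "1 + 1 = tr" by (simp add: trc_def)
  let ?A = "bloch 1" and ?u = zero_mode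
  have cnj_A: "cnj (?A k n) = ?A k n" for k n
    using cnj_green_real[of "-1" "real p / real q" 0] by (simp add: bloch_def)
  have swap: "?A k n = ?A n k" for k n using bloch_swap[OF _ tr] by simp
  have prp: "?A k i * ?u j = ?A k j * ?u i" for k i j
    using bloch_proportional[OF _ tr sol_zero_mode, of k i j] zero_mode_period by simp
  have "(\<Sum>s<q. (norm (?u (int s)))\<^sup>2) > 0"
  proof -
    have "(\<Sum>l\<le>N. (norm (psi l))\<^sup>2) > 0" by (rule sum_pos2[of _ 0]) (auto simp: psi_def)
    then show ?thesis unfolding zero_mode_norm using q_pos by simp
  qed
  then obtain j where j: "?u j \<noteq> 0" by (metis (no_types, lifting) less_irrefl norm_zero power_zero_numeral sum.neutral)
  define lam where "lam = ?A j j / of_real ((norm (?u j))\<^sup>2)"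
  have A: "?A k n = lam * cnj (?u k) * ?u n" for k n
  proof -
    have "?A k n * ?u j = ?A k j * ?u n" by (rule prp)
    moreover have "?A k j * cnj (?u j) = ?A j j * cnj (?u k)"
      using arg_cong[OF prp[of j k j], of cnj] unfolding complex_cnj_mult cnj_A swap[of k j] .
    ultimately have "?A k n * ?u j * cnj (?u j) = ?A j j * cnj (?u k) * ?u n" by (metis mult.assoc mult.commute)
    then show ?thesis using j by (simp only: lam_def complex_norm_square) (simp add: field_simps)
  qed
  have "real q = norm (\<Sum>s<q. e (- int s * int N) * ?A (int s) (int s - int N))"
    using bloch_fourier[of "-1" 0 1] by simp
  also have "(\<Sum>s<q. e (- int s * int N) * ?A (int s) (int s - int N)) =
      lam * (\<Sum>s<q. e (- int s * int N) * (cnj (?u (int s)) * ?u (int s - int N)))"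
    unfolding A sum_distrib_left by (simp add: mult_ac)
  also have "norm \<dots> = norm lam * real q"
    unfolding norm_mult zero_mode_correlation by (simp add: norm_psi_N)
  finally have lam: "norm lam = 1" using q_pos by simp
  have "norm (complex_of_real (deriv (discriminant p q) 0)) = norm (\<Sum>s<q. ?A (int s) (int s))"
    using of_real_deriv_discriminant[of "-1" 0] by (simp add: bloch_diag)
  also have "(\<Sum>s<q. ?A (int s) (int s)) = lam * of_real (\<Sum>s<q. (norm (?u (int s)))\<^sup>2)"
    unfolding A by (simp add: complex_norm_square sum_distrib_left mult_ac del: of_real_power)
  also have "norm \<dots> = (\<Sum>s<q. (norm (?u (int s)))\<^sup>2)"
    unfolding norm_mult lam by (simp only: norm_of_real) (simp add: sum_nonneg)
  finally show ?thesis by (simp add: zero_mode_norm)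
qed

end

section \<open>The operators on the sequence space\<close>

lemma norm_diff_scaleR_squared:
  fixes d g :: "'a::real_inner"
  shows "(norm (d - t *\<^sub>R g))\<^sup>2 = (norm d)\<^sup>2 - 2 * t * inner d g + t\<^sup>2 * (norm g)\<^sup>2"
  unfolding power2_norm_eq_inner
  by (simp add: inner_diff_left inner_diff_right inner_commute power2_eq_square algebra_simps)

text \<open>For small \<open>t > 0\<close> the map \<open>u \<mapsto> u - t T (T u - f)\<close> is a contraction.\<close>

lemma selfadjoint_surj:
  fixes T :: "'a::{real_inner,complete_space} \<Rightarrow> 'a"
  assumes T: "bounded_linear T" and sa: "\<And>x y. inner (T x) y = inner x (T y)"
    and c: "0 < c" and below: "\<And>x. c * norm x \<le> norm (T x)"
  shows "\<exists>x. T x = f"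
proof -
  interpret T: bounded_linear T by fact
  obtain M0 where M0: "\<And>x. norm (T x) \<le> norm x * M0" using T.bounded by blast
  define M where "M = max M0 c"
  have M: "norm (T x) \<le> M * norm x" for x
    using M0[of x] mult_left_mono[of M0 M "norm x"] by (simp add: M_def mult.commute)
  have Mpos: "0 < M" "c \<le> M" using c by (auto simp: M_def)
  \<comment> \<open>This t makes t^2 M^2 equal to t, so the quadratic term eats only half of the
    gain. Taking M at least c keeps 1 - t c^2 nonnegative under the root.\<close>
  define t where "t = 1 / M\<^sup>2"
  define F where "F u = u - t *\<^sub>R T (T u - f)" for u
  define k where "k = sqrt (1 - t * c\<^sup>2)"
  have tc: "0 < t * c\<^sup>2" "t * c\<^sup>2 \<le> 1" using Mpos c by (auto simp: t_def field_simps intro: power_mono)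
  have contr: "dist (F u) (F v) \<le> k * dist u v" for u v
  proof -
    let ?d = "u - v"
    have F: "F u - F v = ?d - t *\<^sub>R T (T ?d)"
      by (simp add: F_def T.diff algebra_simps)
    have "(norm (F u - F v))\<^sup>2 = (norm ?d)\<^sup>2 - 2 * t * (norm (T ?d))\<^sup>2 + t\<^sup>2 * (norm (T (T ?d)))\<^sup>2"
    proof -
      have "inner ?d (T (T ?d)) = (norm (T ?d))\<^sup>2" by (simp add: sa[symmetric] power2_norm_eq_inner)
      then show ?thesis unfolding F norm_diff_scaleR_squared by simp
    qed
    also have "t\<^sup>2 * (norm (T (T ?d)))\<^sup>2 \<le> t * (norm (T ?d))\<^sup>2"
    proof -
      have "(norm (T (T ?d)))\<^sup>2 \<le> (M * norm (T ?d))\<^sup>2" by (intro power_mono M) simp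
      then have "t\<^sup>2 * (norm (T (T ?d)))\<^sup>2 \<le> t\<^sup>2 * (M * norm (T ?d))\<^sup>2" by (intro mult_left_mono) auto
      also have "\<dots> = t * (norm (T ?d))\<^sup>2" using Mpos by (simp add: t_def power_mult_distrib power2_eq_square)
      finally show ?thesis .
    qed
    also have "(norm ?d)\<^sup>2 - 2 * t * (norm (T ?d))\<^sup>2 + t * (norm (T ?d))\<^sup>2 = (norm ?d)\<^sup>2 - t * (norm (T ?d))\<^sup>2" by simp
    also have "\<dots> \<le> (norm ?d)\<^sup>2 - t * (c * norm ?d)\<^sup>2"
      using below[of ?d] c Mpos by (intro diff_left_mono mult_left_mono power_mono) (auto simp: t_def)
    also have "\<dots> = (k * norm ?d)\<^sup>2" using tc by (simp add: k_def power_mult_distrib algebra_simps)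
    finally have "(norm (F u - F v))\<^sup>2 \<le> (k * norm ?d)\<^sup>2" by simp
    moreover have "0 \<le> k * norm ?d" using tc by (simp add: k_def)
    ultimately have "norm (F u - F v) \<le> k * norm ?d" by (rule power2_le_imp_le)
    then show ?thesis by (simp add: dist_norm)
  qed
  have "\<exists>!x. F x = x"
    by (rule banach_fix_type[of k F]) (use contr tc in \<open>auto simp: k_def\<close>)
  then obtain x where "F x = x" by auto
  then have "T (T x - f) = 0" using Mpos by (simp add: F_def t_def)
  then have "norm (T x - f) = 0" using below[of "T x - f"] c by (auto simp: mult_le_0_iff)
  then show ?thesis by auto
qed

text \<open>With \<open>m\<close> the largest lower bound of \<open>B = T - E\<close>, the form of \<open>B\<^sup>2 - m\<^sup>2\<close> is nonnegative; were \<open>B - m\<close> and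
  \<open>B + m\<close> both bounded below, Cauchy-Schwarz for this form would improve \<open>m\<close>.\<close>

lemma selfadjoint_near_spectrum:
  fixes T :: "'a::real_inner \<Rightarrow> 'a"
  assumes T: "bounded_linear T" and sa: "\<And>x y. inner (T x) y = inner x (T y)"
    and x0: "x0 \<noteq> 0" "norm (T x0 - E *\<^sub>R x0) \<le> \<eta> * norm x0"
  obtains E' where "\<bar>E' - E\<bar> \<le> \<eta>" "\<not> (\<exists>c>0. \<forall>x. c * norm x \<le> norm (T x - E' *\<^sub>R x))"
proof -
  interpret T: bounded_linear T by fact
  define B where "B x = T x - E *\<^sub>R x" for x
  have B: "bounded_linear B" unfolding B_def
    by (intro bounded_linear_sub T bounded_linear_scaleR_right bounded_linear_ident bounded_linear_const_scaleR)
  interpret B: bounded_linear B by fact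
  have saB: "inner (B x) y = inner x (B y)" for x y
    by (simp add: B_def inner_diff_left inner_diff_right sa)
  define Q where "Q = (\<lambda>x. norm (B x) / norm x) ` (- {0})"
  define m where "m = Inf Q"
  have bdd: "bdd_below Q" by (rule bdd_belowI[of _ 0]) (auto simp: Q_def)
  have mQ: "m \<le> q" if "q \<in> Q" for q unfolding m_def using bdd that by (rule cInf_lower[rotated])
  have ne: "Q \<noteq> {}" using x0 by (auto simp: Q_def)
  have m0: "0 \<le> m" unfolding m_def by (rule cInf_greatest[OF ne]) (auto simp: Q_def)
  have "m \<le> norm (B x0) / norm x0" using x0 by (intro mQ) (auto simp: Q_def)
  also have "\<dots> \<le> \<eta>" using x0 by (simp add: B_def field_simps)
  finally have m\<eta>: "m \<le> \<eta>" .
  have Bm: "m * norm x \<le> norm (B x)" for x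
  proof (cases "x = 0")
    case False
    then have "m \<le> norm (B x) / norm x" by (intro mQ) (auto simp: Q_def)
    then show ?thesis using False by (simp add: field_simps)
  qed simp
  show ?thesis
  proof (rule ccontr)
    assume not: "\<not> thesis"
    have "\<exists>c>0. \<forall>x. c * norm x \<le> norm (T x - (E + m) *\<^sub>R x)" using not that[of "E + m"] m0 m\<eta> by auto
    then obtain c1 where c1: "c1 > 0" "\<And>x. c1 * norm x \<le> norm (B x - m *\<^sub>R x)"
      by (auto simp: B_def algebra_simps)
    have "\<exists>c>0. \<forall>x. c * norm x \<le> norm (T x - (E - m) *\<^sub>R x)" using not that[of "E - m"] m0 m\<eta> by auto
    then obtain c2 where c2: "c2 > 0" "\<And>x. c2 * norm x \<le> norm (B x + m *\<^sub>R x)"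
      by (auto simp: B_def algebra_simps)
    \<comment> \<open>A is the product of B - m and B + m, hence bounded below by c1 c2, while its
      quadratic form is nonnegative by the choice of m.\<close>
    define A where "A x = B (B x) - m\<^sup>2 *\<^sub>R x" for x
    have A: "bounded_linear A" unfolding A_def
      by (intro bounded_linear_sub bounded_linear_compose[OF B B] bounded_linear_const_scaleR bounded_linear_ident)
    interpret A: bounded_linear A by fact
    obtain K0 where K0: "\<And>x. norm (A x) \<le> norm x * K0" using A.bounded by blast
    define K where "K = max K0 1"
    have K: "K > 0" "norm (A x) \<le> K * norm x" for x
      using K0[of x] mult_left_mono[of K0 K "norm x"] by (auto simp: K_def mult.commute)
    have Ax: "c1 * c2 * norm x \<le> norm (A x)" for x
    proof -
      have "A x = B (B x + m *\<^sub>R x) - m *\<^sub>R (B x + m *\<^sub>R x)"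
        by (simp add: A_def B.add B.scaleR algebra_simps power2_eq_square)
      then have "c1 * norm (B x + m *\<^sub>R x) \<le> norm (A x)" using c1(2)[of "B x + m *\<^sub>R x"] by simp
      moreover have "c1 * (c2 * norm x) \<le> c1 * norm (B x + m *\<^sub>R x)" using c2(2) c1(1) by (intro mult_left_mono) auto
      ultimately show ?thesis by (simp add: mult.assoc)
    qed
    have form: "inner (A x) x = (norm (B x))\<^sup>2 - m\<^sup>2 * (norm x)\<^sup>2" for x
      by (simp add: A_def inner_diff_left saB power2_norm_eq_inner)
    have pos: "0 \<le> inner (A x) x" for x
    proof -
      have "(m * norm x)\<^sup>2 \<le> (norm (B x))\<^sup>2" using Bm[of x] m0 by (intro power_mono) auto
      then show ?thesis by (simp add: form power_mult_distrib)
    qed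
    have saA: "inner (A x) y = inner x (A y)" for x y
      by (simp add: A_def inner_diff_left inner_diff_right saB)
    \<comment> \<open>The Cauchy-Schwarz inequality for the form of A, obtained by evaluating the
      form at x - A x / K.\<close>
    have CS: "(norm (A x))\<^sup>2 \<le> K * inner (A x) x" for x
    proof -
      define t where "t = 1 / K"
      have "inner (A (A x)) (A x) \<le> norm (A (A x)) * norm (A x)" by (rule norm_cauchy_schwarz)
      also have "\<dots> \<le> K * norm (A x) * norm (A x)" by (intro mult_right_mono K) simp
      finally have AA: "inner (A (A x)) (A x) \<le> K * (norm (A x))\<^sup>2" by (simp add: power2_eq_square)
      have "0 \<le> inner (A (x - t *\<^sub>R A x)) (x - t *\<^sub>R A x)" by (rule pos)
      also have "\<dots> = inner (A x) x - 2 * t * (norm (A x))\<^sup>2 + t\<^sup>2 * inner (A (A x)) (A x)"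
        unfolding power2_norm_eq_inner using saA[of "A x" x]
        by (simp add: A.diff A.scaleR inner_diff_left inner_diff_right power2_eq_square algebra_simps inner_commute)
      also have "\<dots> \<le> inner (A x) x - 2 * t * (norm (A x))\<^sup>2 + t\<^sup>2 * (K * (norm (A x))\<^sup>2)"
        by (intro add_left_mono mult_left_mono AA) simp
      also have "\<dots> = inner (A x) x - (norm (A x))\<^sup>2 / K"
        using K(1) by (simp add: t_def power2_eq_square field_simps)
      finally show ?thesis using K(1) by (simp add: field_simps)
    qed
    define \<delta> where "\<delta> = (c1 * c2)\<^sup>2 / K"
    have \<delta>: "\<delta> > 0" using c1 c2 K by (simp add: \<delta>_def)
    have low: "sqrt (m\<^sup>2 + \<delta>) * norm x \<le> norm (B x)" for x
    proof (rule power2_le_imp_le)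
      have "(c1 * c2 * norm x)\<^sup>2 \<le> (norm (A x))\<^sup>2" using Ax[of x] c1 c2 by (intro power_mono) auto
      also have "\<dots> \<le> K * ((norm (B x))\<^sup>2 - m\<^sup>2 * (norm x)\<^sup>2)" using CS[of x] form[of x] by simp
      finally show "(sqrt (m\<^sup>2 + \<delta>) * norm x)\<^sup>2 \<le> (norm (B x))\<^sup>2"
        using K(1) \<delta> by (simp add: power_mult_distrib \<delta>_def field_simps)
    qed simp
    have "sqrt (m\<^sup>2 + \<delta>) \<le> Inf Q"
    proof (rule cInf_greatest[OF ne])
      fix r assume "r \<in> Q"
      then obtain x where x: "x \<noteq> 0" "r = norm (B x) / norm x" by (auto simp: Q_def)
      then show "sqrt (m\<^sup>2 + \<delta>) \<le> r" using low[of x] by (simp add: pos_le_divide_eq)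
    qed
    then have "sqrt (m\<^sup>2 + \<delta>) \<le> m" by (simp only: m_def[symmetric])
    then have "(sqrt (m\<^sup>2 + \<delta>))\<^sup>2 \<le> m\<^sup>2" using \<delta> by (intro power_mono) auto
    then show False using \<delta> by simp
  qed
qed

section \<open>The sequence space as a real Hilbert space\<close>

lemma nonneg_bounded_infsum:
  fixes f :: "'a \<Rightarrow> real"
  assumes "\<And>n. 0 \<le> f n" "\<And>F. finite F \<Longrightarrow> sum f F \<le> B"
  shows "f summable_on UNIV" "infsum f UNIV \<le> B"
proof -
  show s: "f summable_on UNIV"
    by (rule nonneg_bdd_above_summable_on) (use assms in \<open>auto intro!: bdd_aboveI2[of _ _ B]\<close>)
  show "infsum f UNIV \<le> B" by (rule infsum_le_finite_sums[OF s]) (use assms in auto)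
qed

lemma l2_iff: "\<phi> \<in> l2 \<longleftrightarrow> (\<lambda>n. (cmod (\<phi> n))\<^sup>2) summable_on UNIV"
  by (simp add: l2_def)

lemma l2_add: assumes "\<phi> \<in> l2" "\<psi> \<in> l2" shows "(\<lambda>n. \<phi> n + \<psi> n) \<in> l2"
  unfolding l2_iff
proof (rule summable_on_comparison_test)
  show "(\<lambda>n. 2 * (cmod (\<phi> n))\<^sup>2 + 2 * (cmod (\<psi> n))\<^sup>2) summable_on UNIV"
    using assms by (intro summable_on_add summable_on_cmult_right) (auto simp: l2_iff)
  fix n
  have "(cmod (\<phi> n + \<psi> n))\<^sup>2 \<le> (cmod (\<phi> n) + cmod (\<psi> n))\<^sup>2" by (intro power_mono norm_triangle_ineq) simp
  also have "\<dots> \<le> 2 * (cmod (\<phi> n))\<^sup>2 + 2 * (cmod (\<psi> n))\<^sup>2"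
    using sum_squares_bound[of "cmod (\<phi> n)" "cmod (\<psi> n)"] by (simp add: power2_eq_square algebra_simps)
  finally show "(cmod (\<phi> n + \<psi> n))\<^sup>2 \<le> 2 * (cmod (\<phi> n))\<^sup>2 + 2 * (cmod (\<psi> n))\<^sup>2" .
qed simp

lemma l2_bounded_mult:
  assumes "\<phi> \<in> l2" "\<And>n. cmod (v n) \<le> B" shows "(\<lambda>n. v n * \<phi> n) \<in> l2"
  unfolding l2_iff
proof (rule summable_on_comparison_test)
  show "(\<lambda>n. B\<^sup>2 * (cmod (\<phi> n))\<^sup>2) summable_on UNIV"
    using assms by (intro summable_on_cmult_right) (auto simp: l2_iff)
  show "(cmod (v n * \<phi> n))\<^sup>2 \<le> B\<^sup>2 * (cmod (\<phi> n))\<^sup>2" for n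
    using assms(2)[of n] unfolding norm_mult power_mult_distrib by (intro mult_right_mono power_mono) auto
qed simp

lemma l2_shift: assumes "\<phi> \<in> l2" shows "(\<lambda>n. \<phi> (n + k)) \<in> l2"
  using assms summable_on_reindex_bij_betw[OF bij_plus_right[of k], of "\<lambda>n. (cmod (\<phi> n))\<^sup>2"]
  by (simp add: l2_iff)

lemma l2_finite_support: assumes "finite {n. \<phi> n \<noteq> 0}" shows "\<phi> \<in> l2"
  unfolding l2_iff
  by (rule summable_on_cong_neutral[THEN iffD1, OF _ _ _ summable_on_finite[OF assms, of "\<lambda>n. (cmod (\<phi> n))\<^sup>2"]]) auto

text \<open>A real inner product suffices, since only real spectral values matter.\<close>

typedef ell2 = "l2 :: (int \<Rightarrow> complex) set"
  morphisms entries Ell2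
  by (rule exI[of _ "\<lambda>_. 0"]) (simp add: l2_iff)

setup_lifting type_definition_ell2

lemma entries_l2 [simp]: "entries x \<in> l2" by (rule entries)

lemma ell2_eqI: "(\<And>n. entries x n = entries y n) \<Longrightarrow> x = y"
  by (metis entries_inject ext)

lemma inner_summable: 
  assumes "\<phi> \<in> l2" "\<psi> \<in> l2" shows "(\<lambda>n. inner (\<phi> n) (\<psi> n)) summable_on UNIV"
proof (rule abs_summable_summable, rule Infinite_Sum.abs_summable_on_comparison_test')
  show "(\<lambda>n. (cmod (\<phi> n))\<^sup>2 + (cmod (\<psi> n))\<^sup>2) summable_on UNIV"
    using assms by (intro summable_on_add) (auto simp: l2_iff)
  fix n
  have "norm (inner (\<phi> n) (\<psi> n)) \<le> cmod (\<phi> n) * cmod (\<psi> n)" by (simp add: Cauchy_Schwarz_ineq2)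
  also have "\<dots> \<le> (cmod (\<phi> n))\<^sup>2 + (cmod (\<psi> n))\<^sup>2"
    using sum_squares_bound[of "cmod (\<phi> n)" "cmod (\<psi> n)"] mult_nonneg_nonneg[of "cmod (\<phi> n)" "cmod (\<psi> n)"]
    by (simp add: power2_eq_square del: mult_nonneg_nonneg)
  finally show "norm (inner (\<phi> n) (\<psi> n)) \<le> (cmod (\<phi> n))\<^sup>2 + (cmod (\<psi> n))\<^sup>2" .
qed

instantiation ell2 :: real_vector
begin

lift_definition zero_ell2 :: ell2 is "\<lambda>_. 0" by (simp add: l2_iff)
lift_definition plus_ell2 :: "ell2 \<Rightarrow> ell2 \<Rightarrow> ell2" is "\<lambda>\<phi> \<psi> n. \<phi> n + \<psi> n" by (rule l2_add)
lift_definition scaleR_ell2 :: "real \<Rightarrow> ell2 \<Rightarrow> ell2" is "\<lambda>c \<phi> n. of_real c * \<phi> n"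
  by (rule l2_bounded_mult[of _ _ "\<bar>c\<bar>" for c]) auto
lift_definition uminus_ell2 :: "ell2 \<Rightarrow> ell2" is "\<lambda>\<phi> n. - \<phi> n" by (simp add: l2_iff)
definition minus_ell2 :: "ell2 \<Rightarrow> ell2 \<Rightarrow> ell2" where "minus_ell2 x y = x + - y"

instance
proof
  fix x y z :: ell2 and a b :: real
  show "x + y + z = x + (y + z)" by transfer (simp add: add.assoc)
  show "x + y = y + x" by transfer (simp add: add.commute)
  show "0 + x = x" by transfer simp
  show "- x + x = 0" by transfer simp
  show "x - y = x + - y" by (rule minus_ell2_def)
  show "a *\<^sub>R (x + y) = a *\<^sub>R x + a *\<^sub>R y" by transfer (simp add: distrib_left)
  show "(a + b) *\<^sub>R x = a *\<^sub>R x + b *\<^sub>R x" by transfer (simp add: distrib_right)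
  show "a *\<^sub>R b *\<^sub>R x = (a * b) *\<^sub>R x" by transfer (simp add: mult.assoc)
  show "1 *\<^sub>R x = x" by transfer simp
qed

end

lemma entries_simps [simp]:
  "entries 0 n = 0" "entries (x + y) n = entries x n + entries y n" "entries (x - y) n = entries x n - entries y n"
  "entries (c *\<^sub>R x) n = of_real c * entries x n"
  unfolding minus_ell2_def by (simp_all only: zero_ell2.rep_eq plus_ell2.rep_eq scaleR_ell2.rep_eq uminus_ell2.rep_eq) simp

instantiation ell2 :: real_inner
begin

definition inner_ell2 :: "ell2 \<Rightarrow> ell2 \<Rightarrow> real" where
  "inner_ell2 x y = (\<Sum>\<^sub>\<infinity>n. inner (entries x n) (entries y n))"
definition norm_ell2 :: "ell2 \<Rightarrow> real" where "norm_ell2 x = sqrt (inner x x)"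
definition sgn_ell2 :: "ell2 \<Rightarrow> ell2" where "sgn_ell2 x = x /\<^sub>R norm x"
definition dist_ell2 :: "ell2 \<Rightarrow> ell2 \<Rightarrow> real" where "dist_ell2 x y = norm (x - y)"
definition uniformity_ell2 :: "(ell2 \<times> ell2) filter" where
  "uniformity_ell2 = (INF e\<in>{0<..}. principal {(x, y). dist x y < e})"
definition open_ell2 :: "ell2 set \<Rightarrow> bool" where
  "open_ell2 U \<longleftrightarrow> (\<forall>x\<in>U. \<forall>\<^sub>F (x', y) in uniformity. x' = x \<longrightarrow> y \<in> U)"

instance
proof
  fix x y z :: ell2 and a b :: real
  show "sgn x = x /\<^sub>R norm x" by (rule sgn_ell2_def)
  show "dist x y = norm (x - y)" by (rule dist_ell2_def)
  show "(uniformity :: (ell2 \<times> ell2) filter) = (INF e\<in>{0<..}. principal {(x, y). dist x y < e})"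
    by (rule uniformity_ell2_def)
  show "open U \<longleftrightarrow> (\<forall>x\<in>U. \<forall>\<^sub>F (x', y) in uniformity. x' = x \<longrightarrow> y \<in> U)" for U :: "ell2 set"
    by (rule open_ell2_def)
  show "inner x y = inner y x" unfolding inner_ell2_def by (subst inner_commute) (rule refl)
  show "inner (x + y) z = inner x z + inner y z"
    unfolding inner_ell2_def entries_simps inner_add_left
    by (intro infsum_add inner_summable entries_l2)
  show "inner (a *\<^sub>R x) y = a * inner x y"
  proof -
    have "inner (of_real a * u) v = a * inner u v" for u v :: complex
      by (simp only: scaleR_conv_of_real[symmetric] inner_scaleR_left)
    then show ?thesis
      unfolding inner_ell2_def entries_simps by (simp only: infsum_cmult_right')
  qed
  show nn: "0 \<le> inner x x" unfolding inner_ell2_def by (rule infsum_nonneg) simp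
  show "inner x x = 0 \<longleftrightarrow> x = 0"
  proof
    assume "inner x x = 0"
    then have "inner (entries x n) (entries x n) = 0" for n
      using nonneg_infsum_le_0D[of "\<lambda>n. inner (entries x n) (entries x n)" UNIV n] inner_summable[of "entries x" "entries x"]
      unfolding inner_ell2_def by (simp only: entries_l2 inner_ge_zero simp_thms UNIV_I order_refl)
    then show "x = 0" by (intro ell2_eqI) simp
  next
    assume "x = 0" then show "inner x x = 0" by (simp add: inner_ell2_def)
  qed
  show "norm x = sqrt (inner x x)" by (rule norm_ell2_def)
qed

end

lemma norm_ell2_eq: "norm x = l2_norm (entries x)"
  by (simp add: norm_ell2_def inner_ell2_def l2_norm_def power2_norm_eq_inner)

lemma norm_ell2_squared: "(norm x)\<^sup>2 = (\<Sum>\<^sub>\<infinity>n. (cmod (entries x n))\<^sup>2)"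
  unfolding norm_ell2_eq l2_norm_def by (simp add: infsum_nonneg)

lemma norm_ell2_finite_le: assumes "finite F" shows "(\<Sum>n\<in>F. (cmod (entries x n))\<^sup>2) \<le> (norm x)\<^sup>2"
  unfolding norm_ell2_squared using assms entries_l2[of x] by (intro finite_sum_le_infsum) (auto simp: l2_iff)

lemma cmod_entries_le: "cmod (entries x n) \<le> norm x"
  using norm_ell2_finite_le[of "{n}" x] by (simp add: power_mono_iff[symmetric] power2_le_iff_abs_le)

instance ell2 :: complete_space
proof
  fix X :: "nat \<Rightarrow> ell2"
  assume X: "Cauchy X"
  have "convergent (\<lambda>i. entries (X i) n)" for n
  proof -
    have "Cauchy (\<lambda>i. entries (X i) n)"
    proof (rule metric_CauchyI)
      fix r :: real assume "r > 0"
      then obtain M where M: "\<forall>i\<ge>M. \<forall>j\<ge>M. dist (X i) (X j) < r" using X by (auto simp: Cauchy_def)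
      have "dist (entries (X i) n) (entries (X j) n) \<le> dist (X i) (X j)" for i j
        using cmod_entries_le[of "X i - X j" n] by (simp add: dist_norm)
      then show "\<exists>M. \<forall>i\<ge>M. \<forall>j\<ge>M. dist (entries (X i) n) (entries (X j) n) < r"
        using M by (meson le_less_trans)
    qed
    then show ?thesis by (rule Cauchy_convergent)
  qed
  then obtain \<phi> where \<phi>: "\<And>n. (\<lambda>i. entries (X i) n) \<longlonglongrightarrow> \<phi> n" unfolding convergent_def by metis
  have tail: "(\<lambda>n. entries (X i) n - \<phi> n) \<in> l2 \<and> (\<Sum>\<^sub>\<infinity>n. (cmod (entries (X i) n - \<phi> n))\<^sup>2) \<le> r\<^sup>2"
    if M: "\<forall>j\<ge>M. dist (X i) (X j) < r" for i M r
  proof -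
    have "(\<Sum>n\<in>F. (cmod (entries (X i) n - \<phi> n))\<^sup>2) \<le> r\<^sup>2" if "finite F" for F
    proof (rule tendsto_upperbound)
      show "(\<lambda>j. \<Sum>n\<in>F. (cmod (entries (X i) n - entries (X j) n))\<^sup>2) \<longlonglongrightarrow> (\<Sum>n\<in>F. (cmod (entries (X i) n - \<phi> n))\<^sup>2)"
        by (intro tendsto_intros \<phi>)
      show "\<forall>\<^sub>F j in sequentially. (\<Sum>n\<in>F. (cmod (entries (X i) n - entries (X j) n))\<^sup>2) \<le> r\<^sup>2"
        unfolding eventually_sequentially
      proof (intro exI allI impI)
        fix j assume "M \<le> j"
        then have "norm (X i - X j) < r" using M by (simp add: dist_norm)
        then have "(norm (X i - X j))\<^sup>2 \<le> r\<^sup>2" by (intro power_mono) auto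
        then show "(\<Sum>n\<in>F. (cmod (entries (X i) n - entries (X j) n))\<^sup>2) \<le> r\<^sup>2"
          using norm_ell2_finite_le[OF that, of "X i - X j"] by simp
      qed
    qed simp
    then show ?thesis using nonneg_bounded_infsum[of "\<lambda>n. (cmod (entries (X i) n - \<phi> n))\<^sup>2" "r\<^sup>2"]
      by (simp add: l2_iff)
  qed
  have mem: "\<phi> \<in> l2"
  proof -
    obtain M where "\<forall>i\<ge>M. \<forall>j\<ge>M. dist (X i) (X j) < 1" using X zero_less_one unfolding Cauchy_def by blast
    then have "(\<lambda>n. entries (X M) n - \<phi> n) \<in> l2" using tail[of M M 1] by auto
    then have "(\<lambda>n. -1 * (entries (X M) n - \<phi> n)) \<in> l2" by (rule l2_bounded_mult[of _ _ 1]) simp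
    from l2_add[OF entries_l2[of "X M"] this] show ?thesis by simp
  qed
  have "X \<longlonglongrightarrow> Ell2 \<phi>"
  proof (rule metric_LIMSEQ_I)
    fix r :: real assume r: "r > 0"
    then obtain M where M: "\<forall>i\<ge>M. \<forall>j\<ge>M. dist (X i) (X j) < r / 2" using X half_gt_zero unfolding Cauchy_def by blast
    have "dist (X i) (Ell2 \<phi>) < r" if "i \<ge> M" for i
    proof -
      have "(norm (X i - Ell2 \<phi>))\<^sup>2 \<le> (r / 2)\<^sup>2"
        using tail[of M i "r / 2"] M that mem by (simp add: norm_ell2_squared Ell2_inverse)
      then have "norm (X i - Ell2 \<phi>) \<le> r / 2" by (rule power2_le_imp_le) (use r in simp)
      then show ?thesis using r by (simp add: dist_norm)
    qed
    then show "\<exists>no. \<forall>n\<ge>no. dist (X n) (Ell2 \<phi>) < r" by blast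
  qed
  then show "convergent X" by (auto simp: convergent_def)
qed

section \<open>Shifts, potentials and the Hamiltonian\<close>

lift_definition ell2_shift :: "int \<Rightarrow> ell2 \<Rightarrow> ell2" is "\<lambda>k \<phi> n. \<phi> (n + k)" by (rule l2_shift)

lemma entries_shift [simp]: "entries (ell2_shift k x) n = entries x (n + k)"
  by (simp add: ell2_shift.rep_eq)

lemma norm_ell2_shift [simp]: "norm (ell2_shift k x) = norm x"
  unfolding norm_ell2_eq l2_norm_def entries_shift
  using infsum_reindex_bij_betw[OF bij_plus_right[of k], of "\<lambda>n. (cmod (entries x n))\<^sup>2"] by simp

lemma inner_ell2_shift: "inner (ell2_shift k x) y = inner x (ell2_shift (-k) y)"
  unfolding inner_ell2_def entries_shift
  using infsum_reindex_bij_betw[OF bij_plus_right[of k], of "\<lambda>n. inner (entries x n) (entries y (n - k))"] by simp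

lemma bounded_linear_shift: "bounded_linear (ell2_shift k)"
  by (rule bounded_linear_intro[of _ 1]) (auto intro: ell2_eqI)

lift_definition ell2_pot :: "real \<Rightarrow> real \<Rightarrow> ell2 \<Rightarrow> ell2"
  is "\<lambda>a t \<phi> n. of_real (2 * cos (2 * pi * (a * of_int n + t))) * \<phi> n"
  by (rule l2_bounded_mult[of _ _ 2]) (auto simp: norm_mult)

lemma entries_pot [simp]: "entries (ell2_pot a t x) n = of_real (2 * cos (2 * pi * (a * of_int n + t))) * entries x n"
  by (simp add: ell2_pot.rep_eq)

lemma norm_ell2_mono: assumes "\<And>n. cmod (entries x n) \<le> B * cmod (entries y n)" "0 \<le> B" shows "norm x \<le> B * norm y"
proof (rule power2_le_imp_le)
  have "(norm x)\<^sup>2 \<le> (\<Sum>\<^sub>\<infinity>n. B\<^sup>2 * (cmod (entries y n))\<^sup>2)"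
    unfolding norm_ell2_squared
  proof (rule infsum_mono)
    show "(\<lambda>n. (cmod (entries x n))\<^sup>2) summable_on UNIV" using entries_l2[of x] by (simp only: l2_iff)
    show "(\<lambda>n. B\<^sup>2 * (cmod (entries y n))\<^sup>2) summable_on UNIV"
      using entries_l2[of y] by (intro summable_on_cmult_right) (simp only: l2_iff)
    show "(cmod (entries x n))\<^sup>2 \<le> B\<^sup>2 * (cmod (entries y n))\<^sup>2" for n
      unfolding power_mult_distrib[symmetric] by (intro power_mono assms) simp
  qed
  then show "(norm x)\<^sup>2 \<le> (B * norm y)\<^sup>2"
    by (simp add: infsum_cmult_right' power_mult_distrib norm_ell2_squared)
qed (use assms in simp)

lemma bounded_linear_pot: "bounded_linear (ell2_pot a t)"
proof (rule bounded_linear_intro[of _ 2])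
  show "norm (ell2_pot a t x) \<le> norm x * 2" for x
  proof -
    have "cmod (entries (ell2_pot a t x) n) \<le> 2 * cmod (entries x n)" for n
      unfolding entries_pot norm_mult by (intro mult_right_mono) auto
    then show ?thesis using norm_ell2_mono[of "ell2_pot a t x" 2 x] by (simp only: mult.commute)
  qed
qed (auto intro!: ell2_eqI simp: algebra_simps)

lemma inner_ell2_pot: "inner (ell2_pot a t x) y = inner x (ell2_pot a t y)"
  unfolding inner_ell2_def entries_pot
  by (simp only: scaleR_conv_of_real[symmetric] inner_scaleR_left inner_scaleR_right)

definition hop :: "real \<Rightarrow> real \<Rightarrow> ell2 \<Rightarrow> ell2" where
  "hop a t x = ell2_shift (-1) x + ell2_shift 1 x + ell2_pot a t x"

lemma entries_hop: "entries (hop a t x) n = H_op a t (entries x) n"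
  by (simp add: hop_def H_op_def)

lemma bounded_linear_hop: "bounded_linear (hop a t)"
  unfolding hop_def by (intro bounded_linear_add bounded_linear_shift bounded_linear_pot)

lemma inner_hop: "inner (hop a t x) y = inner x (hop a t y)"
  by (simp add: hop_def inner_add_left inner_add_right inner_ell2_shift inner_ell2_pot)

lemma hop_add_int: "hop a (t + of_int k) = hop a t"
proof (rule ext, rule ell2_eqI)
  fix x n
  have "cos (2 * pi * (a * real_of_int n + (t + of_int k))) = cos (2 * pi * (a * real_of_int n + t))"
    using cos.plus_of_int[of "2 * pi * (a * real_of_int n + t)" k] by (simp add: algebra_simps)
  then show "entries (hop a (t + of_int k) x) n = entries (hop a t x) n"
    by (simp add: entries_hop H_op_def)
qed

definition approx_eigen :: "real \<Rightarrow> real \<Rightarrow> real \<Rightarrow> bool" where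
  "approx_eigen a t E \<longleftrightarrow> \<not> (\<exists>c>0. \<forall>x. c * norm x \<le> norm (hop a t x - E *\<^sub>R x))"

text \<open>For a bounded self-adjoint operator on a complete space a lower bound already implies
  surjectivity, so invertibility with bounded inverse is nothing but a lower bound.\<close>

lemma spectrum_iff_approx_eigen:
  "complex_of_real E \<in> l2_spectrum (H_op a t) \<longleftrightarrow> approx_eigen a t E"
proof -
  let ?A = "\<lambda>\<phi> n. H_op a t \<phi> n - complex_of_real E * \<phi> n"
  define T where "T x = hop a t x - E *\<^sub>R x" for x
  have T: "bounded_linear T" unfolding T_def
    by (intro bounded_linear_sub bounded_linear_hop bounded_linear_const_scaleR bounded_linear_ident)
  have saT: "inner (T x) y = inner x (T y)" for x y
    by (simp add: T_def inner_diff_left inner_diff_right inner_hop)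
  have eT: "entries (T x) = ?A (entries x)" for x
    by (rule ext) (simp add: T_def entries_hop)
  have rng: "\<phi> \<in> l2 \<longleftrightarrow> (\<exists>x. \<phi> = entries x)" for \<phi> by (metis entries_l2 Ell2_inverse)
  have "(bij_betw ?A l2 l2 \<and> (\<exists>C. \<forall>\<phi>\<in>l2. l2_norm \<phi> \<le> C * l2_norm (?A \<phi>)))
    \<longleftrightarrow> (\<exists>c>0. \<forall>x. c * norm x \<le> norm (T x))" (is "?L = ?R")
  proof
    assume ?L
    then obtain C where C: "l2_norm \<phi> \<le> C * l2_norm (?A \<phi>)" if "\<phi> \<in> l2" for \<phi> by blast
    have "1 / max C 1 * norm x \<le> norm (T x)" for x
    proof -
      have "norm x \<le> C * norm (T x)" using C[OF entries_l2[of x]] by (simp add: norm_ell2_eq eT)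
      also have "\<dots> \<le> max C 1 * norm (T x)" by (intro mult_right_mono) auto
      finally show ?thesis by (simp add: field_simps)
    qed
    moreover have "0 < 1 / max C 1" by simp
    ultimately show ?R by blast
  next
    assume ?R
    then obtain c where c: "c > 0" "\<And>x. c * norm x \<le> norm (T x)" by blast
    have "bij_betw ?A l2 l2"
    proof (rule bij_betwI')
      fix \<phi> \<psi> assume "\<phi> \<in> l2" "\<psi> \<in> l2"
      then obtain x y where xy: "\<phi> = entries x" "\<psi> = entries y" using rng by blast
      interpret T: bounded_linear T by fact
      show "?A \<phi> = ?A \<psi> \<longleftrightarrow> \<phi> = \<psi>"
      proof
        assume "?A \<phi> = ?A \<psi>"
        then have "T x = T y" by (simp only: xy eT[symmetric] entries_inject)
        then have "norm (x - y) = 0" using c(2)[of "x - y"] c(1) by (simp add: T.diff mult_le_0_iff)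
        then show "\<phi> = \<psi>" by (simp add: xy)
      qed simp
    next
      fix \<phi> :: "int \<Rightarrow> complex" assume "\<phi> \<in> l2"
      then obtain x where "\<phi> = entries x" using rng by blast
      then show "?A \<phi> \<in> l2" using entries_l2[of "T x"] by (simp only: eT)
    next
      fix \<phi> :: "int \<Rightarrow> complex" assume "\<phi> \<in> l2"
      then obtain f where f: "\<phi> = entries f" using rng by blast
      obtain x where "T x = f" using selfadjoint_surj[OF T saT c] by blast
      then show "\<exists>\<psi>\<in>l2. \<phi> = ?A \<psi>" by (intro bexI[of _ "entries x"]) (simp_all add: f eT[symmetric])
    qed
    moreover have "l2_norm \<phi> \<le> 1 / c * l2_norm (?A \<phi>)" if "\<phi> \<in> l2" for \<phi>
    proof -
      obtain x where x: "\<phi> = entries x" using rng \<open>\<phi> \<in> l2\<close> by blast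
      have "c * norm x \<le> norm (T x)" by (rule c)
      then show ?thesis using c(1) by (simp only: x eT[symmetric] norm_ell2_eq[symmetric]) (simp add: field_simps)
    qed
    ultimately show ?L by blast
  qed
  then show ?thesis unfolding l2_spectrum_def approx_eigen_def T_def mem_Collect_eq by (rule arg_cong[of _ _ Not])
qed

text \<open>Bloch waves and truncations produce arbitrary real phases; an integer shift, which does
  not change the operator, brings them into the interval used by \<open>S\<close>.\<close>

lemma S_iff: "E \<in> S a \<longleftrightarrow> (\<exists>t. approx_eigen a t E)"
proof
  assume "\<exists>t. approx_eigen a t E"
  then obtain t where t: "approx_eigen a t E" by blast
  define k where "k = \<lceil>t\<rceil> - 1"
  have "approx_eigen a (t - of_int k) E"
    using t hop_add_int[of a "t - of_int k" k] by (simp add: approx_eigen_def)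
  moreover have "t - of_int k \<in> {0<..1}" by (simp add: k_def) linarith
  ultimately show "E \<in> S a" by (auto simp: S_def spectrum_iff_approx_eigen)
qed (auto simp: S_def spectrum_iff_approx_eigen)

section \<open>Approximate eigenvectors of finite support\<close>

lift_definition ell2_restrict :: "int set \<Rightarrow> ell2 \<Rightarrow> ell2" is "\<lambda>F \<phi> n. of_bool (n \<in> F) * \<phi> n"
  by (rule l2_bounded_mult[of _ _ 1]) auto

lemma entries_restrict [simp]: "entries (ell2_restrict F x) n = of_bool (n \<in> F) * entries x n"
  by (simp add: ell2_restrict.rep_eq)

lemma norm_ell2_sum:
  assumes "finite F" "\<And>n. n \<notin> F \<Longrightarrow> entries x n = 0"
  shows "(norm x)\<^sup>2 = (\<Sum>n\<in>F. (cmod (entries x n))\<^sup>2)"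
proof -
  have "(norm x)\<^sup>2 = infsum (\<lambda>n. (cmod (entries x n))\<^sup>2) F"
    unfolding norm_ell2_squared by (rule infsum_cong_neutral) (use assms in auto)
  then show ?thesis using assms(1) by simp
qed

lemma finite_support_dense:
  fixes x :: ell2
  assumes "e > 0"
  obtains y where "finite {n. entries y n \<noteq> 0}" "norm (x - y) < e"
proof -
  have s: "(\<lambda>n. (cmod (entries x n))\<^sup>2) summable_on UNIV" using entries_l2[of x] by (simp only: l2_iff)
  have "((\<lambda>n. (cmod (entries x n))\<^sup>2) has_sum (norm x)\<^sup>2) UNIV"
    unfolding norm_ell2_squared using s by (rule has_sum_infsum)
  then have "((sum (\<lambda>n. (cmod (entries x n))\<^sup>2)) \<longlongrightarrow> (norm x)\<^sup>2) (finite_subsets_at_top UNIV)"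
    by (simp add: has_sum_def)
  then have "\<forall>\<^sub>F F in finite_subsets_at_top UNIV. dist (\<Sum>n\<in>F. (cmod (entries x n))\<^sup>2) ((norm x)\<^sup>2) < e\<^sup>2"
    by (rule tendstoD) (use assms in simp)
  then obtain F where F: "finite F" "dist (\<Sum>n\<in>F. (cmod (entries x n))\<^sup>2) ((norm x)\<^sup>2) < e\<^sup>2"
    by (auto simp: eventually_finite_subsets_at_top)
  define y where "y = ell2_restrict F x"
  have "(norm (x - y))\<^sup>2 = infsum (\<lambda>n. (cmod (entries x n))\<^sup>2) (UNIV - F)"
    unfolding norm_ell2_squared by (rule infsum_cong_neutral) (auto simp: y_def)
  also have "\<dots> = (norm x)\<^sup>2 - (\<Sum>n\<in>F. (cmod (entries x n))\<^sup>2)"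
    using infsum_Diff[OF s, of F] F(1) by (simp add: norm_ell2_squared)
  also have "\<dots> < e\<^sup>2" using F(2) by (simp add: dist_real_def)
  finally have "norm (x - y) < e" using assms by (rule_tac power2_less_imp_less) auto
  moreover have "finite {n. entries y n \<noteq> 0}" by (rule finite_subset[OF _ F(1)]) (auto simp: y_def)
  ultimately show ?thesis by (rule that[rotated])
qed

lemma approx_eigen_finite_support:
  assumes "approx_eigen a t E" "0 < e"
  obtains x where "x \<noteq> 0" "finite {n. entries x n \<noteq> 0}" "norm (hop a t x - E *\<^sub>R x) \<le> e * norm x"
proof -
  interpret T: bounded_linear "\<lambda>x. hop a t x - E *\<^sub>R x"
    by (intro bounded_linear_sub bounded_linear_hop bounded_linear_const_scaleR bounded_linear_ident)
  obtain K where K: "K > 0" "\<And>x. norm (hop a t x - E *\<^sub>R x) \<le> norm x * K" using T.pos_bounded by blast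
  obtain x where x: "norm (hop a t x - E *\<^sub>R x) < e / 2 * norm x"
    using assms unfolding approx_eigen_def by (metis not_le half_gt_zero)
  then have x0: "0 < norm x" using assms(2) by (smt (verit) norm_ge_zero mult_nonneg_nonpos half_gt_zero zero_less_mult_iff)
  \<comment> \<open>Solves e \<bar>x\<bar> / 2 + r K = e (\<bar>x\<bar> - r) with \<bar>x\<bar> the
    norm, which balances the error of the truncation against the loss of norm.\<close>
  define r where "r = e * norm x / (2 * (K + e))"
  have "0 < r" using x0 assms K by (simp add: r_def)
  then obtain y where y: "finite {n. entries y n \<noteq> 0}" "norm (x - y) < r" using finite_support_dense by blast
  have nx: "norm x \<le> norm y + norm (x - y)" using norm_triangle_ineq[of y "x - y"] by simp
  have "r * (2 * (K + e)) = e * norm x" using K(1) assms(2) by (simp add: r_def)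
  then have r: "r * K + r * e = e / 2 * norm x" by (simp add: algebra_simps)
  have "norm (hop a t y - E *\<^sub>R y) \<le> norm (hop a t x - E *\<^sub>R x) + norm (hop a t (x - y) - E *\<^sub>R (x - y))"
    using norm_triangle_ineq4[of "hop a t x - E *\<^sub>R x" "hop a t (x - y) - E *\<^sub>R (x - y)"] T.diff[of x "x - y"] by simp
  also have "\<dots> \<le> e / 2 * norm x + r * K" using x K(2)[of "x - y"] y(2) K(1) mult_right_mono[of "norm (x - y)" r K] by linarith
  also have "\<dots> = e * (norm x - r)" using r by (simp add: algebra_simps)
  also have "\<dots> \<le> e * norm y" using nx y(2) assms by (intro mult_left_mono) auto
  finally have "norm (hop a t y - E *\<^sub>R y) \<le> e * norm y" .
  moreover have "y \<noteq> 0"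
  proof
    assume "y = 0"
    then have "norm x < r" using y(2) by simp
    moreover have "r * e < norm x * e"
      using r mult_pos_pos[OF \<open>0 < r\<close> K(1)] mult_pos_pos[OF x0 assms(2)] by (simp add: mult.commute)
    ultimately show False using assms(2) by (simp add: mult_less_cancel_right)
  qed
  ultimately show ?thesis using that y(1) by blast
qed

lemma S_near:
  assumes "x \<noteq> 0" "norm (hop a t x - E *\<^sub>R x) \<le> \<eta> * norm x"
  shows "\<exists>E'\<in>S a. \<bar>E' - E\<bar> \<le> \<eta>"
proof -
  obtain E' where "\<bar>E' - E\<bar> \<le> \<eta>" "approx_eigen a t E'"
    using selfadjoint_near_spectrum[OF bounded_linear_hop inner_hop assms] unfolding approx_eigen_def by blast
  then show ?thesis using S_iff by blast
qed

section \<open>Hoelder continuity of the spectrum\<close>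

definition tent :: "nat \<Rightarrow> int \<Rightarrow> real" where
  "tent M k = max 0 (1 - \<bar>of_int k\<bar> / real M)"

lemma tent_bounds: "0 \<le> tent M k" "tent M k \<le> 1"
  by (auto simp: tent_def)

lemma tent_eq_0: assumes "M > 0" "int M \<le> \<bar>k\<bar>" shows "tent M k = 0"
proof -
  have "real M \<le> \<bar>real_of_int k\<bar>" using assms(2) by (metis of_int_abs of_int_le_iff of_int_of_nat_eq)
  then show ?thesis using assms(1) by (simp add: tent_def field_simps)
qed

lemma tent_lipschitz: assumes "M > 0" shows "\<bar>tent M j - tent M k\<bar> \<le> \<bar>of_int (j - k)\<bar> / real M"
proof -
  have "\<bar>tent M j - tent M k\<bar> \<le> \<bar>\<bar>of_int j\<bar> / real M - \<bar>of_int k\<bar> / real M\<bar>"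
    by (auto simp: tent_def max_def)
  also have "\<dots> = \<bar>\<bar>of_int j\<bar> - \<bar>of_int k\<bar>\<bar> / real M" by (simp add: diff_divide_distrib[symmetric])
  also have "\<dots> \<le> \<bar>of_int (j - k)\<bar> / real M" using assms by (intro divide_right_mono) auto
  finally show ?thesis .
qed

lemma sum_squares_ge: "real M ^ 3 \<le> 3 * (\<Sum>i\<le>M. (real i)\<^sup>2)"
  by (induction M) (auto simp: algebra_simps power2_eq_square power3_eq_cube)

definition tent_mass :: "nat \<Rightarrow> real" where
  "tent_mass M = (\<Sum>k\<in>{- int M..int M}. (tent M k)\<^sup>2)"

text \<open>The rising half of the tent suffices: it contributes the sum of (i / M)^2 for i \<le>
  M.\<close>

lemma tent_mass_ge: assumes "M > 0" shows "real M / 3 \<le> tent_mass M"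
proof -
  have "real M / 3 = real M ^ 3 / (3 * real M ^ 2)" using assms by (simp add: power2_eq_square power3_eq_cube)
  also have "\<dots> \<le> (3 * (\<Sum>i\<le>M. (real i)\<^sup>2)) / (3 * real M ^ 2)" by (intro divide_right_mono sum_squares_ge) simp
  also have "\<dots> = (\<Sum>i\<le>M. (tent M (int i - int M))\<^sup>2)"
  proof -
    have "tent M (int i - int M) = real i / real M" if "i \<le> M" for i
      using assms that by (simp add: tent_def field_simps)
    then show ?thesis by (simp add: power_divide sum_divide_distrib)
  qed
  also have "\<dots> = (\<Sum>k\<in>(\<lambda>i. int i - int M) ` {..M}. (tent M k)\<^sup>2)"
    by (subst sum.reindex) (auto simp: inj_on_def)
  also have "\<dots> \<le> tent_mass M" unfolding tent_mass_def by (rule sum_mono2) auto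
  finally show ?thesis .
qed

lemma sum_tent:
  assumes "M > 0" "{n - int M..n + int M} \<subseteq> C" "finite C"
  shows "(\<Sum>c\<in>C. (tent M (n - c))\<^sup>2) = tent_mass M"
proof -
  have "(\<Sum>c\<in>C. (tent M (n - c))\<^sup>2) = (\<Sum>c\<in>{n - int M..n + int M}. (tent M (n - c))\<^sup>2)"
    by (rule sum.mono_neutral_right) (use assms in \<open>auto simp: tent_eq_0\<close>)
  also have "\<dots> = tent_mass M" unfolding tent_mass_def
    by (rule sum.reindex_bij_witness[of _ "\<lambda>k. n - k" "\<lambda>c. n - c"]) auto
  finally show ?thesis .
qed

lemma sum_near:
  fixes n :: int
  assumes "{n - int M..n + int M} \<subseteq> C" "finite C"
  shows "(\<Sum>c\<in>C. of_bool (\<bar>n - c\<bar> \<le> int M)) = 2 * real M + 1"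
proof -
  have "(\<Sum>c\<in>C. of_bool (\<bar>n - c\<bar> \<le> int M)) = (\<Sum>c\<in>{n - int M..n + int M}. (1::real))"
    by (rule sum.mono_neutral_cong_right) (use assms in auto)
  then show ?thesis by simp
qed

lift_definition ell2_cut :: "nat \<Rightarrow> int \<Rightarrow> ell2 \<Rightarrow> ell2" is "\<lambda>M c \<phi> n. of_real (tent M (n - c)) * \<phi> n"
  by (rule l2_bounded_mult[of _ _ 1]) (auto simp: tent_bounds)

lemma entries_cut [simp]: "entries (ell2_cut M c x) n = of_real (tent M (n - c)) * entries x n"
  by (simp add: ell2_cut.rep_eq)

lemma norm_add4_squared:
  fixes a b c d :: complex
  shows "(cmod (a + b + c + d))\<^sup>2 \<le> 4 * ((cmod a)\<^sup>2 + (cmod b)\<^sup>2 + (cmod c)\<^sup>2 + (cmod d)\<^sup>2)"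
proof -
  have "cmod (a + b + c + d) \<le> cmod a + cmod b + cmod c + cmod d"
    by (meson norm_add_leD norm_triangle_ineq order_trans add_right_mono)
  then have "(cmod (a + b + c + d))\<^sup>2 \<le> (cmod a + cmod b + cmod c + cmod d)\<^sup>2" by (intro power_mono) auto
  also have "\<dots> \<le> 4 * ((cmod a)\<^sup>2 + (cmod b)\<^sup>2 + (cmod c)\<^sup>2 + (cmod d)\<^sup>2)"
  proof -
    have "(p + q + r + s)\<^sup>2 \<le> 4 * (p\<^sup>2 + q\<^sup>2 + r\<^sup>2 + s\<^sup>2)" for p q r s :: real
    proof -
      have "0 \<le> (p - q)\<^sup>2 + (p - r)\<^sup>2 + (p - s)\<^sup>2 + (q - r)\<^sup>2 + (q - s)\<^sup>2 + (r - s)\<^sup>2" by simp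
      then show ?thesis by (simp add: power2_eq_square algebra_simps)
    qed
    then show ?thesis .
  qed
  finally show ?thesis .
qed

lemma cos_lipschitz: "\<bar>cos x - cos y\<bar> \<le> \<bar>x - y\<bar>" for x y :: real
proof -
  have "cos x - cos y = 2 * sin ((x + y) / 2) * sin ((y - x) / 2)" by (rule cos_diff_cos)
  then have "\<bar>cos x - cos y\<bar> = 2 * \<bar>sin ((x + y) / 2)\<bar> * \<bar>sin ((y - x) / 2)\<bar>" by (simp add: abs_mult)
  also have "\<dots> \<le> 2 * 1 * \<bar>(y - x) / 2\<bar>" by (intro mult_mono) (use abs_sin_x_le_abs_x[of "(y - x) / 2"] in auto)
  finally show ?thesis by (simp add: abs_minus_commute)
qed

text \<open>The tent commutes with the potential, so besides the old residual there remain the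
  increments of the tent towards the two neighbours and the difference of the two
  potentials.\<close>

lemma entries_cut_hop:
  "entries (hop b t' (ell2_cut M c x) - E *\<^sub>R ell2_cut M c x) n
    = of_real (tent M (n - c)) * entries (hop a t x - E *\<^sub>R x) n
      + of_real (tent M (n - 1 - c) - tent M (n - c)) * entries x (n - 1)
      + of_real (tent M (n + 1 - c) - tent M (n - c)) * entries x (n + 1)
      + of_real ((2 * cos (2 * pi * (b * of_int n + t')) - 2 * cos (2 * pi * (a * of_int n + t))) * tent M (n - c)) * entries x n"
  by (simp add: entries_hop H_op_def algebra_simps)

lemma entries_cut_hop_le:
  assumes M: "M > 0"
  shows "(cmod (entries (hop b ((a - b) * of_int c + t) (ell2_cut M c x) - E *\<^sub>R ell2_cut M c x) n))\<^sup>2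
    \<le> 4 * ((tent M (n - c))\<^sup>2 * (cmod (entries (hop a t x - E *\<^sub>R x) n))\<^sup>2
        + of_bool (\<bar>n - c\<bar> \<le> int M) * ((cmod (entries x (n - 1)))\<^sup>2 + (cmod (entries x (n + 1)))\<^sup>2) / real M ^ 2
        + (4 * pi * \<bar>a - b\<bar> * real M)\<^sup>2 * ((tent M (n - c))\<^sup>2 * (cmod (entries x n))\<^sup>2))"
proof -
  have tt: "(tent M (n + d - c) - tent M (n - c))\<^sup>2 \<le> of_bool (\<bar>n - c\<bar> \<le> int M) / real M ^ 2" if "\<bar>d\<bar> = 1" for d
  proof (cases "\<bar>n - c\<bar> \<le> int M")
    case True
    have "\<bar>tent M (n + d - c) - tent M (n - c)\<bar> \<le> 1 / real M"
      using tent_lipschitz[OF M, of "n + d - c" "n - c"] that by (simp add: of_int_abs[symmetric] del: of_int_abs)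
    then have "\<bar>tent M (n + d - c) - tent M (n - c)\<bar>\<^sup>2 \<le> (1 / real M)\<^sup>2" by (intro power_mono) auto
    then show ?thesis using True by (simp add: power_divide)
  next
    case False
    then have "tent M (n + d - c) = 0" "tent M (n - c) = 0" using that by (auto intro!: tent_eq_0[OF M])
    then show ?thesis by simp
  qed
  \<comment> \<open>The new phase makes the arguments differ by 2 pi (b - a) (n - c), where \<bar>n
    - c\<bar> < M on the support of the tent; the cosine is 1-Lipschitz.\<close>
  have v: "((2 * cos (2 * pi * (b * of_int n + ((a - b) * of_int c + t))) - 2 * cos (2 * pi * (a * of_int n + t))) * tent M (n - c))\<^sup>2
      \<le> (4 * pi * \<bar>a - b\<bar> * real M)\<^sup>2 * (tent M (n - c))\<^sup>2"
  proof (cases "\<bar>n - c\<bar> < int M")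
    case True
    then have nc: "\<bar>real_of_int (n - c)\<bar> \<le> real M" by (metis of_int_abs of_int_less_iff of_int_of_nat_eq less_imp_le)
    let ?x = "2 * pi * (b * of_int n + ((a - b) * of_int c + t))" and ?y = "2 * pi * (a * of_int n + t)"
    have "\<bar>?x - ?y\<bar> = 2 * pi * \<bar>a - b\<bar> * \<bar>real_of_int (n - c)\<bar>"
    proof -
      have "?x - ?y = - (2 * pi * (a - b) * real_of_int (n - c))" by (simp add: algebra_simps)
      then show ?thesis by (simp add: abs_mult)
    qed
    also have "\<dots> \<le> 2 * pi * \<bar>a - b\<bar> * real M" using nc by (intro mult_left_mono) auto
    finally have "\<bar>2 * cos ?x - 2 * cos ?y\<bar> \<le> 4 * pi * \<bar>a - b\<bar> * real M"
      using cos_lipschitz[of ?x ?y] by linarith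
    then have "\<bar>2 * cos ?x - 2 * cos ?y\<bar>\<^sup>2 \<le> (4 * pi * \<bar>a - b\<bar> * real M)\<^sup>2" by (intro power_mono) auto
    then show ?thesis unfolding power_mult_distrib[of "2 * cos ?x - 2 * cos ?y"] by (intro mult_right_mono) auto
  next
    case False
    then have "tent M (n - c) = 0" by (intro tent_eq_0[OF M]) auto
    then show ?thesis by simp
  qed
  let ?p = "(cmod (entries x (n - 1)))\<^sup>2" and ?q = "(cmod (entries x (n + 1)))\<^sup>2"
  let ?d = "2 * cos (2 * pi * (b * of_int n + ((a - b) * of_int c + t))) - 2 * cos (2 * pi * (a * of_int n + t))"
  have "(tent M (n - 1 - c) - tent M (n - c))\<^sup>2 * ?p \<le> of_bool (\<bar>n - c\<bar> \<le> int M) / real M ^ 2 * ?p"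
    using tt[of "-1"] by (intro mult_right_mono) auto
  moreover have "(tent M (n + 1 - c) - tent M (n - c))\<^sup>2 * ?q \<le> of_bool (\<bar>n - c\<bar> \<le> int M) / real M ^ 2 * ?q"
    using tt[of 1] by (intro mult_right_mono) auto
  moreover have "(?d * tent M (n - c))\<^sup>2 * (cmod (entries x n))\<^sup>2
      \<le> (4 * pi * \<bar>a - b\<bar> * real M)\<^sup>2 * (tent M (n - c))\<^sup>2 * (cmod (entries x n))\<^sup>2"
    using v by (intro mult_right_mono) auto
  ultimately have "(tent M (n - c))\<^sup>2 * (cmod (entries (hop a t x - E *\<^sub>R x) n))\<^sup>2
      + (tent M (n - 1 - c) - tent M (n - c))\<^sup>2 * ?p + (tent M (n + 1 - c) - tent M (n - c))\<^sup>2 * ?q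
      + (?d * tent M (n - c))\<^sup>2 * (cmod (entries x n))\<^sup>2
    \<le> (tent M (n - c))\<^sup>2 * (cmod (entries (hop a t x - E *\<^sub>R x) n))\<^sup>2
        + of_bool (\<bar>n - c\<bar> \<le> int M) * (?p + ?q) / real M ^ 2
        + (4 * pi * \<bar>a - b\<bar> * real M)\<^sup>2 * ((tent M (n - c))\<^sup>2 * (cmod (entries x n))\<^sup>2)"
    unfolding distrib_left add_divide_distrib mult.assoc times_divide_eq_left by linarith
  then have "4 * ((cmod (of_real (tent M (n - c)) * entries (hop a t x - E *\<^sub>R x) n))\<^sup>2
      + (cmod (of_real (tent M (n - 1 - c) - tent M (n - c)) * entries x (n - 1)))\<^sup>2
      + (cmod (of_real (tent M (n + 1 - c) - tent M (n - c)) * entries x (n + 1)))\<^sup>2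
      + (cmod (of_real (?d * tent M (n - c)) * entries x n))\<^sup>2)
    \<le> 4 * ((tent M (n - c))\<^sup>2 * (cmod (entries (hop a t x - E *\<^sub>R x) n))\<^sup>2
        + of_bool (\<bar>n - c\<bar> \<le> int M) * (?p + ?q) / real M ^ 2
        + (4 * pi * \<bar>a - b\<bar> * real M)\<^sup>2 * ((tent M (n - c))\<^sup>2 * (cmod (entries x n))\<^sup>2))"
    by (simp only: norm_mult norm_of_real power_mult_distrib[of "cmod _"] power_mult_distrib[of "\<bar>_\<bar>"] power2_abs mult_le_cancel_left_pos zero_less_numeral)
  then show ?thesis
    unfolding entries_cut_hop[where a = a and t = t] by (rule order_trans[OF norm_add4_squared])
qed

text \<open>The new phase makes both potentials agree at \<open>c\<close>, so they stay close where the tent around \<open>c\<close> lives. Averaging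
  over \<open>c\<close> shows that some truncation \<open>ell2_cut M c x\<close> is an approximate eigenvector.\<close>

lemma hop_cut_near:
  assumes x: "x \<noteq> 0" "finite {n. entries x n \<noteq> 0}" "norm (hop a t x - E *\<^sub>R x) \<le> e * norm x" and e: "0 \<le> e"
    and M: "M > 0" and \<eta>: "4 * (e\<^sup>2 + 18 / real M ^ 2 + (4 * pi * \<bar>a - b\<bar> * real M)\<^sup>2) < \<eta>\<^sup>2" "0 < \<eta>"
  shows "\<exists>c. ell2_cut M c x \<noteq> 0 \<and>
    norm (hop b ((a - b) * of_int c + t) (ell2_cut M c x) - E *\<^sub>R ell2_cut M c x) \<le> \<eta> * norm (ell2_cut M c x)"
proof -
  define y where "y c = ell2_cut M c x" for c
  define g where "g c = hop b ((a - b) * of_int c + t) (y c) - E *\<^sub>R y c" for c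
  define f where "f = hop a t x - E *\<^sub>R x"
  define X where "X n = (cmod (entries x n))\<^sup>2" for n
  obtain R0 where R0: "\<And>n. entries x n \<noteq> 0 \<Longrightarrow> \<bar>n\<bar> \<le> R0"
  proof -
    have fin: "finite (abs ` {n. entries x n \<noteq> 0})" using x(2) by simp
    show ?thesis by (rule that[of "Max (insert 0 (abs ` {n. entries x n \<noteq> 0}))"]) (use fin in auto)
  qed
  define I where "I = {- R0 - 1..R0 + 1}"
  define C where "C = {- R0 - 1 - int M..R0 + 1 + int M}"
  have fin: "finite I" "finite C" by (auto simp: I_def C_def)
  have x0: "entries x n = 0" if "n \<notin> I" for n using R0[of n] that by (force simp: I_def abs_le_iff)
  have xpm: "entries x (n - 1) = 0" "entries x (n + 1) = 0" if "n \<notin> I" for n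
    using R0[of "n - 1"] R0[of "n + 1"] that by (force simp: I_def abs_le_iff)+
  have CI: "{n - int M..n + int M} \<subseteq> C" if "n \<in> I" for n using that by (auto simp: C_def I_def)
  have nx: "(norm x)\<^sup>2 = (\<Sum>n\<in>I. X n)" unfolding X_def by (rule norm_ell2_sum) (use fin x0 in auto)
  have nf: "(norm f)\<^sup>2 = (\<Sum>n\<in>I. (cmod (entries f n))\<^sup>2)"
    by (rule norm_ell2_sum) (use fin x0 xpm in \<open>auto simp: f_def entries_hop H_op_def\<close>)
  have ny: "(norm (y c))\<^sup>2 = (\<Sum>n\<in>I. (tent M (n - c))\<^sup>2 * X n)" for c
    by (subst norm_ell2_sum[of I]) (use fin x0 in \<open>auto simp: y_def X_def norm_mult power_mult_distrib\<close>)
  have ng: "(norm (g c))\<^sup>2 = (\<Sum>n\<in>I. (cmod (entries (g c) n))\<^sup>2)" for c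
    by (rule norm_ell2_sum) (use fin x0 xpm in \<open>auto simp: g_def y_def entries_hop H_op_def\<close>)
  have ynorm: "(\<Sum>c\<in>C. (norm (y c))\<^sup>2) = tent_mass M * (norm x)\<^sup>2"
  proof -
    have "(\<Sum>c\<in>C. (norm (y c))\<^sup>2) = (\<Sum>n\<in>I. (\<Sum>c\<in>C. (tent M (n - c))\<^sup>2) * X n)"
      unfolding ny sum_distrib_right by (rule sum.swap)
    also have "\<dots> = (\<Sum>n\<in>I. tent_mass M * X n)"
      by (intro sum.cong refl) (simp add: sum_tent[OF M CI fin(2)])
    finally show ?thesis by (simp add: nx sum_distrib_left)
  qed
  define D where "D = (4 * pi * \<bar>a - b\<bar> * real M)\<^sup>2"
  have shift: "(\<Sum>n\<in>I. X (n + k)) \<le> (norm x)\<^sup>2" for k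
    using norm_ell2_finite_le[OF fin(1), of "ell2_shift k x"] by (simp add: X_def)
  have "(\<Sum>c\<in>C. (norm (g c))\<^sup>2) = (\<Sum>n\<in>I. \<Sum>c\<in>C. (cmod (entries (g c) n))\<^sup>2)"
    unfolding ng by (rule sum.swap)
  also have "\<dots> \<le> (\<Sum>n\<in>I. \<Sum>c\<in>C. 4 * ((tent M (n - c))\<^sup>2 * (cmod (entries f n))\<^sup>2
        + of_bool (\<bar>n - c\<bar> \<le> int M) * (X (n - 1) + X (n + 1)) / real M ^ 2
        + D * ((tent M (n - c))\<^sup>2 * X n)))"
    unfolding g_def y_def f_def X_def D_def by (intro sum_mono entries_cut_hop_le M)
  also have "\<dots> = (\<Sum>n\<in>I. 4 * (tent_mass M * (cmod (entries f n))\<^sup>2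
        + (2 * real M + 1) * (X (n - 1) + X (n + 1)) / real M ^ 2 + D * (tent_mass M * X n)))"
  proof (intro sum.cong refl)
    fix n assume n: "n \<in> I"
    have t: "(\<Sum>c\<in>C. (tent M (n - c))\<^sup>2 * k) = tent_mass M * k" for k
      by (simp only: sum_distrib_right[symmetric] sum_tent[OF M CI[OF n] fin(2)])
    have nn: "(\<Sum>c\<in>C. of_bool (\<bar>n - c\<bar> \<le> int M) * k / l) = (2 * real M + 1) * k / l" for k l :: real
      by (simp only: sum_distrib_right[symmetric] sum_divide_distrib[symmetric] sum_near[OF CI[OF n] fin(2)])
    show "(\<Sum>c\<in>C. 4 * ((tent M (n - c))\<^sup>2 * (cmod (entries f n))\<^sup>2
        + of_bool (\<bar>n - c\<bar> \<le> int M) * (X (n - 1) + X (n + 1)) / real M ^ 2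
        + D * ((tent M (n - c))\<^sup>2 * X n))) = 4 * (tent_mass M * (cmod (entries f n))\<^sup>2
        + (2 * real M + 1) * (X (n - 1) + X (n + 1)) / real M ^ 2 + D * (tent_mass M * X n))"
      by (simp only: sum_distrib_left[symmetric] sum.distrib t nn)
  qed
  also have "\<dots> = 4 * (tent_mass M * (norm f)\<^sup>2
      + (2 * real M + 1) * ((\<Sum>n\<in>I. X (n + (-1))) + (\<Sum>n\<in>I. X (n + 1))) / real M ^ 2 + D * (tent_mass M * (norm x)\<^sup>2))"
    by (simp only: sum_distrib_left[symmetric] sum.distrib nf nx sum_divide_distrib[symmetric] diff_conv_add_uminus)
  also have "\<dots> \<le> 4 * (tent_mass M * (e * norm x)\<^sup>2
      + (9 * tent_mass M) * ((norm x)\<^sup>2 + (norm x)\<^sup>2) / real M ^ 2 + D * (tent_mass M * (norm x)\<^sup>2))"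
  proof -
    \<comment> \<open>Each site is within distance M of 2 M + 1 \<le> 3 M centres, compared here
      with the mass M / 3 of one tent; the factor 9 and the two neighbours give the 18 of the
      hypothesis.\<close>
    have tm: "2 * real M + 1 \<le> 9 * tent_mass M" "0 \<le> tent_mass M" using tent_mass_ge[OF M] M by auto
    have "(norm f)\<^sup>2 \<le> (e * norm x)\<^sup>2" using x(3) by (intro power_mono) (auto simp: f_def)
    then show ?thesis
      using tm by (intro mult_left_mono add_mono divide_right_mono mult_mono shift) (auto intro!: add_nonneg_nonneg sum_nonneg simp: X_def D_def)
  qed
  also have "\<dots> = 4 * (e\<^sup>2 + 18 / real M ^ 2 + D) * (tent_mass M * (norm x)\<^sup>2)"
    by (simp add: algebra_simps power_mult_distrib)
  also have "\<dots> < \<eta>\<^sup>2 * (tent_mass M * (norm x)\<^sup>2)"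
  proof -
    have "0 < tent_mass M" using tent_mass_ge[OF M] M by (smt (verit) of_nat_0_less_iff divide_pos_pos)
    then show ?thesis using \<eta>(1) x(1) by (intro mult_strict_right_mono) (auto simp: D_def)
  qed
  also have "\<dots> = (\<Sum>c\<in>C. (\<eta> * norm (y c))\<^sup>2)"
    by (simp add: power_mult_distrib sum_distrib_left[symmetric] ynorm)
  finally have "\<exists>c\<in>C. (norm (g c))\<^sup>2 < (\<eta> * norm (y c))\<^sup>2"
    by (meson not_le sum_mono)
  then obtain c where c: "(norm (g c))\<^sup>2 < (\<eta> * norm (y c))\<^sup>2" by blast
  have "norm (g c) < \<eta> * norm (y c)" using c by (rule power2_less_imp_less) (use \<eta> in simp)
  moreover from this have "y c \<noteq> 0" by auto
  ultimately show ?thesis unfolding g_def y_def by (intro exI[of _ c]) auto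
qed

text \<open>A cutoff length M near 1 / sqrt d balances the localisation error 18 / M^2 against the
  drift (4 pi d M)^2 of the potential. Both are O(d) in the squared norm, hence the exponent 1/2.
  For the constant: 4 (1 + 18 + 640) < 60^2, where 640 = 16 * 10 * 4 uses pi^2 \<le> 10 and M^2 d
  \<le> 4.\<close>

lemma S_hoelder:
  assumes "E \<in> S a" "a \<noteq> b" "\<bar>a - b\<bar> \<le> 1"
  shows "\<exists>E'\<in>S b. \<bar>E' - E\<bar> \<le> 60 * sqrt \<bar>a - b\<bar>"
proof -
  define d where "d = \<bar>a - b\<bar>"
  have d: "0 < d" "d \<le> 1" using assms by (auto simp: d_def)
  define M where "M = nat \<lceil>1 / sqrt d\<rceil>"
  have s: "1 / sqrt d \<ge> 1" using d by (simp add: real_sqrt_le_1_iff)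
  have M: "1 / sqrt d \<le> real M" "real M \<le> 2 / sqrt d" "M > 0"
  proof -
    have "real M = of_int \<lceil>1 / sqrt d\<rceil>" using s by (simp add: M_def)
    then show "1 / sqrt d \<le> real M" "real M \<le> 2 / sqrt d"
      using s ceiling_correct[of "1 / sqrt d"] by (auto simp: add_divide_distrib)
    then have "0 < real M" using s by linarith
    then show "M > 0" by simp
  qed
  define e where "e = sqrt d"
  have e: "0 < e" "e\<^sup>2 = d" using d by (auto simp: e_def)
  obtain t where "approx_eigen a t E" using assms(1) S_iff by blast
  then obtain x where x: "x \<noteq> 0" "finite {n. entries x n \<noteq> 0}" "norm (hop a t x - E *\<^sub>R x) \<le> e * norm x"
    using approx_eigen_finite_support e(1) by blast
  have b1: "18 / real M ^ 2 \<le> 18 * d"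
  proof -
    have "1 \<le> real M * e" using M(1) e by (simp add: e_def[symmetric] field_simps)
    then have "1 \<le> (real M * e)\<^sup>2" by simp
    then show ?thesis using M(3) by (simp add: power_mult_distrib e(2) field_simps)
  qed
  have b2: "(4 * pi * \<bar>a - b\<bar> * real M)\<^sup>2 \<le> 640 * d"
  proof -
    have "real M * e \<le> 2" using M(2) e by (simp add: e_def[symmetric] field_simps)
    then have "(real M * e)\<^sup>2 \<le> 2\<^sup>2" using e by (intro power_mono) auto
    then have Md: "(real M)\<^sup>2 * d \<le> 4" by (simp add: power_mult_distrib e(2))
    have pi: "pi\<^sup>2 \<le> 10"
    proof -
      have "pi \<le> 3.15" using pi_approx by simp
      then have "pi\<^sup>2 \<le> 3.15\<^sup>2" by (intro power_mono) auto
      then show ?thesis by (simp add: power2_eq_square)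
    qed
    have "(4 * pi * \<bar>a - b\<bar> * real M)\<^sup>2 = 16 * (pi\<^sup>2 * ((real M)\<^sup>2 * d)) * d"
      by (simp add: d_def[symmetric] power_mult_distrib power2_eq_square)
    also have "\<dots> \<le> 16 * (10 * 4) * d"
      using d pi Md by (intro mult_right_mono mult_left_mono mult_mono) auto
    finally show ?thesis by simp
  qed
  have "4 * (d + A + B) < 3600 * d" if "A \<le> 18 * d" "B \<le> 640 * d" for A B :: real
    using that d(1) by (simp add: algebra_simps)
  from this[OF b1 b2] have "4 * (e\<^sup>2 + 18 / real M ^ 2 + (4 * pi * \<bar>a - b\<bar> * real M)\<^sup>2) < (60 * e)\<^sup>2"
    unfolding power_mult_distrib[of 60 e] e(2) by (simp only: power2_eq_square)
  then obtain c where "ell2_cut M c x \<noteq> 0"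
    "norm (hop b ((a - b) * of_int c + t) (ell2_cut M c x) - E *\<^sub>R ell2_cut M c x) \<le> (60 * e) * norm (ell2_cut M c x)"
    using hop_cut_near[OF x _ M(3)] e by (metis less_imp_le mult_pos_pos zero_less_numeral)
  then show ?thesis using S_near unfolding e_def d_def by blast
qed

section \<open>The spectrum at fractions with odd denominator\<close>

lift_definition ell2_abs :: "ell2 \<Rightarrow> ell2" is "\<lambda>\<phi> n. of_real (cmod (\<phi> n))"
  by (simp add: l2_iff)

lemma entries_abs [simp]: "entries (ell2_abs x) n = of_real (cmod (entries x n))"
  by (simp add: ell2_abs.rep_eq)

lemma norm_ell2_abs [simp]: "norm (ell2_abs x) = norm x"
  by (simp add: norm_ell2_eq l2_norm_def)

lemma entries_sum: "entries (\<Sum>i\<in>A. f i) n = (\<Sum>i\<in>A. entries (f i) n)"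
  by (induction A rule: infinite_finite_induct) auto

text \<open>Taking absolute values entrywise turns the pointwise hypothesis into domination by a sum
  of isometric shifts.\<close>

lemma norm_le_sum_shifts:
  assumes le: "\<And>n. cmod (entries y n) \<le> B * (\<Sum>j\<in>J. cmod (entries f (n + j)))" and "0 \<le> B"
  shows "norm y \<le> B * (real (card J) * norm f)"
proof -
  have "norm y \<le> B * norm (\<Sum>j\<in>J. ell2_shift j (ell2_abs f))"
  proof (rule norm_ell2_mono)
    fix n
    have "cmod (entries (\<Sum>j\<in>J. ell2_shift j (ell2_abs f)) n) = (\<Sum>j\<in>J. cmod (entries f (n + j)))"
      by (simp add: entries_sum sum_nonneg flip: of_real_sum)
    then show "cmod (entries y n) \<le> B * cmod (entries (\<Sum>j\<in>J. ell2_shift j (ell2_abs f)) n)" using le by simp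
  qed fact
  also have "\<dots> \<le> B * (\<Sum>j\<in>J. norm f)"
    using norm_sum[of "\<lambda>j. ell2_shift j (ell2_abs f)" J] \<open>0 \<le> B\<close> by (intro mult_left_mono) auto
  finally show ?thesis by simp
qed

lemma (in periodic_recurrence) periodic_mod: "w n = w (n mod int q)" if "q > 0"
proof -
  have nn: "w (m + int q * int k) = w m" for m k
  proof (induction k)
    case (Suc k)
    have "m + int q * int (Suc k) = (m + int q * int k) + int q" by (simp add: algebra_simps)
    then show ?case using Suc periodic[of "m + int q * int k"] by (simp only:)
  qed simp
  have p: "w (m + int q * k) = w m" for m k
  proof (cases "k \<ge> 0")
    case True
    then show ?thesis using nn[of m "nat k"] by simp
  next
    case False
    then show ?thesis using nn[of "m + int q * k" "nat (- k)"] by simp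
  qed
  show ?thesis using p[of "n mod int q" "n div int q"] by simp
qed

lemma (in periodic_recurrence) contin_mod: assumes "q > 0" shows "contin w n m = contin w (n mod int q) m"
proof -
  interpret c: periodic_recurrence "\<lambda>k. contin w k m" q by standard (rule contin_shift)
  show ?thesis by (rule c.periodic_mod[OF assms])
qed

context odd_fraction
begin

text \<open>The phase term is at most 2 in modulus, so \<bar>\<sigma>(E)\<bar> > 4 leaves a trace of
  modulus above 2 at every phase. The shifts by q and - q are isometries, so their sum minus the
  trace is bounded below by \<bar>tr\<bar> - 2, and \<open>forced_period\<close> transfers the bound
  to H - E. The constant is finite since periodicity leaves finitely many continuants.\<close>

lemma not_approx_eigen:
  assumes "4 < \<bar>discriminant p q E\<bar>"
  shows "\<not> approx_eigen (real p / real q) t E"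
proof -
  define X where "X = cis (2 * pi * t)"
  interpret periodic_recurrence "W (of_real E) X" q by (rule wt_periodic)
  let ?c = "contin (W (of_real E) X)"
  define tr0 where "tr0 = - discriminant p q E - Re (X ^ q + inverse (X ^ q))"
  have X1: "norm X = 1" by (simp add: X_def)
  have Xq: "X ^ q + inverse (X ^ q) = of_real (2 * Re (X ^ q))"
  proof -
    have "X ^ q = cis (real q * (2 * pi * t))" unfolding X_def by (rule Complex.DeMoivre)
    then show ?thesis by (simp add: complex_eq_iff cis_inverse)
  qed
  have tr: "tr = of_real tr0"
    using chambers[OF X1, of "of_real E"] unfolding trc_def
    by (simp add: power_inverse Xq of_real_discriminant[symmetric] tr0_def)
  have "\<bar>Re (X ^ q)\<bar> \<le> 1" using abs_Re_le_cmod[of "X ^ q"] by (simp add: X1 norm_power)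
  then have tr0: "2 < \<bar>tr0\<bar>" using assms unfolding tr0_def Xq by (simp add: abs_if split: if_splits)
  define B where "B = (\<Sum>i<q. \<Sum>m\<le>q. cmod (?c (int i) m))"
  have B: "cmod (?c n m) \<le> B" if "m \<le> q" for n m
  proof -
    define i where "i = nat (n mod int q)"
    have i: "i < q" "int i = n mod int q" using q_pos by (auto simp: i_def nat_less_iff)
    have "cmod (?c n m) = cmod (?c (int i) m)" using contin_mod[OF q_pos, of n m] i by simp
    also have "\<dots> \<le> (\<Sum>m\<le>q. cmod (?c (int i) m))" using that by (intro member_le_sum) auto
    also have "\<dots> \<le> B" unfolding B_def using i
      by (intro member_le_sum[of i _ "\<lambda>i. \<Sum>m\<le>q. cmod (?c (int i) m)"]) (auto intro: sum_nonneg)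
    finally show ?thesis .
  qed
  have B0: "0 \<le> B" unfolding B_def by (intro sum_nonneg) auto
  define J where "J = {- int q<..<int q}"
  define K where "K = B * real (card J) + 1"
  have K: "K > 0" using B0 by (simp add: K_def add_nonneg_pos)
  have "(\<bar>tr0\<bar> - 2) / K * norm x \<le> norm (hop (real p / real q) t x - E *\<^sub>R x)" for x
  proof -
    define f where "f = hop (real p / real q) t x - E *\<^sub>R x"
    define y where "y = ell2_shift (int q) x + ell2_shift (- int q) x - tr0 *\<^sub>R x"
    have f: "entries f n = entries x (n + 1) + entries x (n - 1) - W (of_real E) X n * entries x n" for n
      unfolding X_def wt_cis by (simp add: f_def entries_hop H_op_def pot_def algebra_simps)
    have "norm y \<le> B * (real (card J) * norm f)"
    proof (rule norm_le_sum_shifts)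
      fix n
      let ?f = "\<lambda>j. cmod (entries f (n + j))"
      define S1 S2 where "S1 = (\<Sum>j=1..<q. ?c (n + int j) (q - j) * entries f (n + int j))"
        and "S2 = (\<Sum>j=1..<q. ?c (n - int q) (q - j) * entries f (n - int j))"
      have 0: "cmod (?c n q * entries f n) \<le> B * ?f 0"
        unfolding norm_mult add_0_right by (intro mult_right_mono B norm_ge_zero order_refl)
      have 1: "cmod S1 \<le> (\<Sum>j=1..<q. B * ?f (int j))" unfolding S1_def
      proof (rule sum_norm_le)
        show "cmod (?c (n + int j) (q - j) * entries f (n + int j)) \<le> B * ?f (int j)" for j
          unfolding norm_mult by (intro mult_right_mono B norm_ge_zero diff_le_self)
      qed
      have 2: "cmod S2 \<le> (\<Sum>j=1..<q. B * ?f (- int j))" unfolding S2_def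
      proof (rule sum_norm_le)
        show "cmod (?c (n - int q) (q - j) * entries f (n - int j)) \<le> B * ?f (- int j)" for j
          unfolding norm_mult diff_conv_add_uminus[of n "int j"] by (intro mult_right_mono B norm_ge_zero diff_le_self)
      qed
      have "entries y n = entries x (n + int q) + entries x (n - int q) - tr * entries x n"
        unfolding y_def tr entries_simps entries_shift by (simp only: diff_conv_add_uminus)
      also have "\<dots> = ?c n q * entries f n + S1 + S2"
        unfolding S1_def S2_def by (rule forced_period[of "entries f" "entries x", OF f])
      also have "cmod \<dots> \<le> B * ?f 0 + (\<Sum>j=1..<q. B * ?f (int j)) + (\<Sum>j=1..<q. B * ?f (- int j))"
        by (intro norm_triangle_le add_mono 0 1 2)
      also have "\<dots> = B * (?f 0 + (\<Sum>j=1..<q. ?f (int j)) + (\<Sum>j=1..<q. ?f (- int j)))"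
        by (simp only: distrib_left sum_distrib_left)
      also have "?f 0 + (\<Sum>j=1..<q. ?f (int j)) + (\<Sum>j=1..<q. ?f (- int j)) = (\<Sum>j\<in>J. ?f j)"
      proof -
        have J: "J = {0} \<union> int ` {1..<q} \<union> (\<lambda>j. - int j) ` {1..<q}"
        proof -
          have "j \<in> {0} \<union> int ` {1..<q} \<union> (\<lambda>j. - int j) ` {1..<q}" if "j \<in> J" for j
          proof (cases j "0::int" rule: linorder_cases)
            case less
            then have "j = - int (nat (- j))" "nat (- j) \<in> {1..<q}" using that by (auto simp: J_def)
            then show ?thesis by blast
          next
            case greater
            then have "j = int (nat j)" "nat j \<in> {1..<q}" using that by (auto simp: J_def)
            then show ?thesis by blast
          qed simp
          then have "J \<subseteq> {0} \<union> int ` {1..<q} \<union> (\<lambda>j. - int j) ` {1..<q}" by blast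
          moreover have "{0} \<union> int ` {1..<q} \<union> (\<lambda>j. - int j) ` {1..<q} \<subseteq> J" using q_pos by (auto simp: J_def)
          ultimately show ?thesis by (rule equalityI)
        qed
        have "(\<Sum>j\<in>J. ?f j) = (\<Sum>j\<in>{0} \<union> int ` {1..<q}. ?f j) + (\<Sum>j\<in>(\<lambda>j. - int j) ` {1..<q}. ?f j)"
          unfolding J by (rule sum.union_disjoint) auto
        also have "(\<Sum>j\<in>{0} \<union> int ` {1..<q}. ?f j) = ?f 0 + (\<Sum>j\<in>int ` {1..<q}. ?f j)"
          by (subst sum.union_disjoint) auto
        also have "(\<Sum>j\<in>int ` {1..<q}. ?f j) = (\<Sum>j=1..<q. ?f (int j))"
          by (subst sum.reindex) (auto simp: inj_on_def)
        also have "(\<Sum>j\<in>(\<lambda>j. - int j) ` {1..<q}. ?f j) = (\<Sum>j=1..<q. ?f (- int j))"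
          by (subst sum.reindex) (auto simp: inj_on_def)
        finally show ?thesis by simp
      qed
      finally show "cmod (entries y n) \<le> B * (\<Sum>j\<in>J. cmod (entries f (n + j)))" .
    qed (rule B0)
    also have "\<dots> \<le> K * norm f" by (simp add: K_def algebra_simps)
    finally have yK: "norm y \<le> K * norm f" .
    have "\<bar>tr0\<bar> * norm x = norm (ell2_shift (int q) x + ell2_shift (- int q) x - y)"
      by (simp add: y_def)
    also have "\<dots> \<le> norm x + norm x + norm y"
      using norm_triangle_ineq4[of "ell2_shift (int q) x + ell2_shift (- int q) x" y]
        norm_triangle_ineq[of "ell2_shift (int q) x" "ell2_shift (- int q) x"] by simp
    finally have "(\<bar>tr0\<bar> - 2) * norm x \<le> K * norm f" using yK by (simp add: algebra_simps)
    then show ?thesis using K unfolding f_def[symmetric] by (simp add: field_simps)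
  qed
  moreover have "0 < (\<bar>tr0\<bar> - 2) / K" using K tr0 by simp
  ultimately show ?thesis unfolding approx_eigen_def by blast
qed

text \<open>A Bloch solution with unimodular multiplier, cut off to L periods, has squared norm L P.
  The cut produces errors at four sites only, of total square at most 4 P, so a lower bound fails
  for large L.\<close>

lemma approx_eigen_of_discriminant:
  assumes "\<bar>discriminant p q E\<bar> \<le> 4"
  shows "\<exists>t. approx_eigen (real p / real q) t E"
proof -
  define c where "c = - discriminant p q E / 4"
  have c: "\<bar>c\<bar> \<le> 1" using assms by (simp add: c_def)
  obtain X where X: "norm X = 1" "X ^ q + inverse X ^ q = complex_of_real (2 * c)"
    using unit_root_sum[OF c] .
  obtain t where t: "X = cis (2 * pi * t)"
  proof -
    obtain s where "X = cis s" using X(1) by (metis cis_Arg norm_zero sgn_eq div_by_1 of_real_1 zero_neq_one)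
    then show ?thesis using that[of "s / (2 * pi)"] by simp
  qed
  define z where "z = cis (arccos c)"
  have z: "norm z = 1" "z * cnj z = 1" "z + cnj z = of_real (2 * c)"
    using c by (auto simp: z_def complex_eq_iff cos_arccos_abs cis_cnj cis_mult)
  interpret periodic_recurrence "W (of_real E) X" q by (rule wt_periodic)
  have "trc (of_real E) X = - dsc (of_real E) - (X ^ q + inverse X ^ q)" by (rule chambers[OF X(1)])
  also have "\<dots> = of_real (2 * c)"
    unfolding X of_real_discriminant[symmetric] by (simp add: c_def)
  finally have tr: "z + cnj z = tr" using z by (simp add: trc_def)
  have "(\<Sum>s<q. e (- int s * int N) * bloch (cnj z) (int s) (int s - int N)) \<noteq> 0"
    using bloch_fourier[of X "of_real E" "cnj z"] X(1) q_pos by auto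
  then obtain s where s: "bloch (cnj z) (int s) (int s - int N) \<noteq> 0"
    by (metis (no_types, lifting) mult_zero_right sum.neutral)
  define u where "u = bloch (cnj z) (int s)"
  have sol: "sol (W (of_real E) X) u" unfolding u_def by (rule sol_bloch)
  define X2 where "X2 n = (cmod (u n))\<^sup>2" for n
  have per: "X2 (n + int q) = X2 n" for n
    unfolding X2_def u_def using bloch_period[OF z(2) tr, of "int s" n] z(1) by (simp add: norm_mult)
  define P where "P = (\<Sum>s<q. X2 (int s))"
  interpret X2: periodic_recurrence X2 q by standard (rule per)
  have X2_le: "X2 n \<le> P" for n
  proof -
    have "X2 n = X2 (int (nat (n mod int q)))" using X2.periodic_mod[OF q_pos, of n] q_pos by simp
    also have "\<dots> \<le> P" unfolding P_def using q_pos
      by (intro member_le_sum[of "nat (n mod int q)" _ "\<lambda>s. X2 (int s)"]) (auto simp: nat_less_iff X2_def)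
    finally show ?thesis .
  qed
  have "0 < X2 (int s - int N)" using s by (simp add: X2_def u_def)
  then have P: "0 < P" using X2_le by (rule less_le_trans)
  have eq: "u (n - 1) + u (n + 1) + of_real (2 * cos (2 * pi * (real p / real q * of_int n + t))) * u n - of_real E * u n = 0" for n
    using solD[OF sol, of n] unfolding t wt_cis pot_def by (simp add: algebra_simps)
  have "approx_eigen (real p / real q) t E"
    unfolding approx_eigen_def
  proof
    assume "\<exists>c>0. \<forall>x. c * norm x \<le> norm (hop (real p / real q) t x - E *\<^sub>R x)"
    then obtain d where d: "d > 0" "\<And>x. d * norm x \<le> norm (hop (real p / real q) t x - E *\<^sub>R x)" by blast
    obtain L where "max 1 (4 / d\<^sup>2) < real L" using reals_Archimedean2 by blast
    then have L: "4 / d\<^sup>2 < real L" "2 \<le> L" by auto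
    define x where "x = Ell2 (\<lambda>n. of_bool (0 \<le> n \<and> n < int (L * q)) * u n)"
    have ex: "entries x n = of_bool (0 \<le> n \<and> n < int (L * q)) * u n" for n
    proof -
      have "finite {n. of_bool (0 \<le> n \<and> n < int (L * q)) * u n \<noteq> 0}"
        by (rule finite_subset[of _ "{0..<int (L * q)}"]) auto
      then show ?thesis unfolding x_def by (subst Ell2_inverse[OF l2_finite_support]) auto
    qed
    define f where "f = hop (real p / real q) t x - E *\<^sub>R x"
    define m where "m = int (L * q)"
    have m: "m \<ge> 2"
    proof -
      have "2 * 1 \<le> L * q" using L(2) q_pos by (intro mult_mono) auto
      then show ?thesis unfolding m_def by linarith
    qed
    have ef: "entries f n = of_bool (0 \<le> n - 1 \<and> n - 1 < m) * u (n - 1) + of_bool (0 \<le> n + 1 \<and> n + 1 < m) * u (n + 1)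
        + of_bool (0 \<le> n \<and> n < m) * (- u (n - 1) - u (n + 1))" for n
    proof -
      have "of_real (2 * cos (2 * pi * (real p / real q * of_int n + t))) * u n - of_real E * u n = - u (n - 1) - u (n + 1)"
        using eq[of n] by (simp add: algebra_simps)
      then show ?thesis
        unfolding f_def entries_simps entries_hop H_op_def ex m_def by (simp add: algebra_simps split del: if_split)
    qed
    have nx: "(norm x)\<^sup>2 = real L * P"
    proof -
      have "(norm x)\<^sup>2 = (\<Sum>n\<in>{0..<m}. X2 n)"
        by (subst norm_ell2_sum[of "{0..<m}"]) (auto simp: ex m_def X2_def intro!: sum.cong)
      also have "\<dots> = (\<Sum>n<L * q. X2 (int n))" unfolding m_def
        by (rule sum.reindex_bij_witness[of _ int nat]) (auto simp: nat_less_iff simp del: of_nat_mult)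
      also have "\<dots> = real L * P"
      proof -
        have "sum (\<lambda>n. X2 (int n)) {l * q..<l * q + q} = P" for l
        proof -
          have "sum (\<lambda>n. X2 (int n)) {l * q..<l * q + q} = (\<Sum>s<q. X2 (int (l * q + s)))"
            by (rule sum.reindex_bij_witness[of _ "\<lambda>s. l * q + s" "\<lambda>n. n - l * q"]) auto
          also have "\<dots> = P" unfolding P_def
          proof (rule sum.cong[OF refl])
            fix s
            have "int (l * q + s) mod int q = int s mod int q" by (simp flip: of_nat_mod)
            then show "X2 (int (l * q + s)) = X2 (int s)"
              using X2.periodic_mod[OF q_pos, of "int (l * q + s)"] X2.periodic_mod[OF q_pos, of "int s"] by simp
          qed
          finally show ?thesis .
        qed
        then show ?thesis using sum.nat_group[of "\<lambda>n. X2 (int n)" q L] by simp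
      qed
      finally show ?thesis .
    qed
    have nf: "(norm f)\<^sup>2 \<le> 4 * P"
    proof -
      have z: "entries f n = 0" if n: "n \<notin> {-1, 0, m - 1, m}" for n
      proof -
        consider "n < -1" | "0 < n" "n < m - 1" | "m < n" using n by fastforce
        then show ?thesis by cases (auto simp: ef)
      qed
      have le: "(cmod (entries f n))\<^sup>2 \<le> P" if "n \<in> {-1, 0, m - 1, m}" for n
      proof -
        have "entries f (-1) = u 0" "entries f 0 = - u (-1)" "entries f (m - 1) = - u m" "entries f m = u (m - 1)"
          using m by (simp_all add: ef)
        then show ?thesis using that X2_le by (auto simp: X2_def)
      qed
      have "(norm f)\<^sup>2 = (\<Sum>n\<in>{-1, 0, m - 1, m}. (cmod (entries f n))\<^sup>2)"
        by (rule norm_ell2_sum) (use z in auto)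
      also have "\<dots> \<le> (\<Sum>n\<in>{-1, 0, m - 1, m}. P)" by (intro sum_mono le)
      also have "\<dots> = 4 * P" using m by simp
      finally show ?thesis .
    qed
    have "d\<^sup>2 * (real L * P) \<le> 4 * P"
    proof -
      have "(d * norm x)\<^sup>2 \<le> (norm f)\<^sup>2" using d unfolding f_def by (intro power_mono) auto
      then show ?thesis using nf by (simp add: power_mult_distrib nx)
    qed
    then have "d\<^sup>2 * real L \<le> 4" using P by simp
    then show False using L d(1) by (simp add: field_simps)
  qed
  then show ?thesis by blast
qed

lemma S_eq: "S (real p / real q) = {E. \<bar>discriminant p q E\<bar> \<le> 4}"
  using not_approx_eigen approx_eigen_of_discriminant by (force simp: S_iff)

end

section \<open>The central band and its neighbouring gaps\<close>

context odd_fraction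
begin

abbreviation \<sigma> :: "real \<Rightarrow> real" where "\<sigma> \<equiv> discriminant p q"
abbreviation Sp :: "real set" where "Sp \<equiv> S (real p / real q)"

definition Z :: "real set" where "Z = {x. \<sigma> x = 0}"

definition comp :: "real \<Rightarrow> real set" where "comp x = connected_component_set Sp x"

lemma mem_Sp: "x \<in> Sp \<longleftrightarrow> \<bar>\<sigma> x\<bar> \<le> 4"
  by (simp add: S_eq)

lemma Z_Sp: "r \<in> Z \<Longrightarrow> r \<in> Sp"
  by (simp add: Z_def mem_Sp)

lemma continuous_discriminant: "continuous_on A \<sigma>"
  by (rule DERIV_continuous_on[OF DERIV_subset[OF discriminant_has_derivative subset_UNIV]])

lemma component_interval: "C \<in> components Sp \<Longrightarrow> x \<in> C \<Longrightarrow> y \<in> C \<Longrightarrow> {x..y} \<subseteq> C"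
  by (meson atLeastAtMost_iff connectedD_interval in_components_connected subsetI)

lemma component_Sp: "C \<in> components Sp \<Longrightarrow> x \<in> C \<Longrightarrow> x \<in> Sp"
  using in_components_subset by blast

lemma mvt_component:
  assumes "C \<in> components Sp" "x \<in> C" "y \<in> C" "x < y"
  shows "real q * (y - x) \<le> \<bar>\<sigma> y - \<sigma> x\<bar>"
proof -
  obtain z where z: "x < z" "z < y" "\<sigma> y - \<sigma> x = (y - x) * deriv \<sigma> z"
    using MVT2[of x y \<sigma> "deriv \<sigma>"] assms(4) discriminant_has_derivative by auto
  have "z \<in> C" using component_interval[OF assms(1-3)] z by auto
  then have "real q \<le> \<bar>deriv \<sigma> z\<bar>" using component_Sp[OF assms(1)] by (intro deriv_discriminant_ge) (simp add: mem_Sp)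
  then show ?thesis using z assms(4) by (simp add: abs_mult mult.commute)
qed

text \<open>Inside a band \<sigma> moves with speed at least q and has only the range from - 4 to 4.
  The resulting bound 4 / q for the central half width later makes the bands of the next level
  small.\<close>

lemma component_diam:
  assumes "C \<in> components Sp" "x \<in> C" "y \<in> C"
  shows "real q * \<bar>y - x\<bar> \<le> 8"
proof -
  have *: "real q * (v - u) \<le> 8" if "u \<in> C" "v \<in> C" "u < v" for u v
    using mvt_component[OF assms(1) that] component_Sp[OF assms(1) that(1)] component_Sp[OF assms(1) that(2)]
    unfolding mem_Sp by linarith
  show ?thesis using *[of x y] *[of y x] assms by (cases x y rule: linorder_cases) auto
qed

lemma closed_Sp: "closed Sp"
proof -
  have "Sp = \<sigma> -` {-4..4}" by (auto simp: S_eq abs_le_iff)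
  then show ?thesis using closed_vimage[OF closed_real_atLeastAtMost continuous_discriminant[of UNIV]] by simp
qed

lemma compact_component:
  assumes "C \<in> components Sp" shows "compact C"
proof -
  obtain x where x: "x \<in> C" using in_components_nonempty[OF assms] by blast
  have "bounded C"
    unfolding bounded_any_center[of _ x] 
    using component_diam[OF assms x] q_pos by (intro exI[of _ "8 / real q"]) (auto simp: dist_real_def abs_minus_commute field_simps)
  then show ?thesis using closed_components[OF closed_Sp assms] by (simp add: compact_eq_bounded_closed)
qed

text \<open>A minimum of \<open>\<sigma>\<^sup>2\<close> on a component is a zero of \<open>\<sigma>\<close>: otherwise the derivative does not vanish there and
  the component extends into the direction in which \<open>\<sigma>\<^sup>2\<close> decreases.\<close>

lemma zero_in_component:
  assumes "C \<in> components Sp" obtains r where "r \<in> C" "r \<in> Z"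
proof -
  have "continuous_on C (\<lambda>x. (\<sigma> x)\<^sup>2)" by (intro continuous_on_power continuous_discriminant)
  then obtain m where m: "m \<in> C" "\<And>y. y \<in> C \<Longrightarrow> (\<sigma> m)\<^sup>2 \<le> (\<sigma> y)\<^sup>2"
    using continuous_attains_inf[OF compact_component[OF assms] in_components_nonempty[OF assms]] by blast
  have mS: "\<bar>\<sigma> m\<bar> \<le> 4" using component_Sp[OF assms m(1)] by (simp add: mem_Sp)
  have "\<sigma> m = 0"
  proof (rule ccontr)
    assume "\<sigma> m \<noteq> 0"
    define l where "l = 2 * \<sigma> m * deriv \<sigma> m"
    have d: "((\<lambda>x. (\<sigma> x)\<^sup>2) has_real_derivative l) (at m)"
      unfolding l_def using DERIV_power[OF discriminant_has_derivative[of m], of 2] by (simp add: mult_ac)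
    have "l \<noteq> 0" using \<open>\<sigma> m \<noteq> 0\<close> deriv_discriminant_ge[OF mS] q_pos by (auto simp: l_def)
    have ext: "y \<in> C" if "y = m - h \<or> y = m + h" "h > 0" "\<And>z. z \<in> closed_segment m y \<Longrightarrow> z \<noteq> m \<Longrightarrow> (\<sigma> z)\<^sup>2 < (\<sigma> m)\<^sup>2" for y h
    proof -
      have "z \<in> Sp" if "z \<in> closed_segment m y" for z
      proof -
        have "(\<sigma> z)\<^sup>2 \<le> (\<sigma> m)\<^sup>2" using \<open>\<And>z. z \<in> closed_segment m y \<Longrightarrow> z \<noteq> m \<Longrightarrow> (\<sigma> z)\<^sup>2 < (\<sigma> m)\<^sup>2\<close>[OF that] by (cases "z = m") auto
        then show ?thesis using mS by (simp add: mem_Sp power2_le_iff_abs_le abs_le_square_iff[symmetric])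
      qed
      then have "closed_segment m y \<subseteq> C"
        using m(1) by (intro components_maximal[OF assms]) auto
      then show ?thesis by auto
    qed
    show False
    proof (cases "l > 0")
      case True
      obtain h where h: "h > 0" "\<And>k. 0 < k \<Longrightarrow> k < h \<Longrightarrow> (\<sigma> (m - k))\<^sup>2 < (\<sigma> m)\<^sup>2"
        using DERIV_pos_inc_left[OF d True] by blast
      have "m - h / 2 \<in> C"
      proof (rule ext[of _ "h / 2"])
        fix z assume "z \<in> closed_segment m (m - h / 2)" "z \<noteq> m"
        then have "0 < m - z" "m - z < h" using h(1) by (auto simp: closed_segment_eq_real_ivl split: if_splits)
        then show "(\<sigma> z)\<^sup>2 < (\<sigma> m)\<^sup>2" using h(2)[of "m - z"] by simp
      qed (use h in auto)
      then show False using m(2)[of "m - h / 2"] h(2)[of "h / 2"] h(1) by simp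
    next
      case False
      then have "l < 0" using \<open>l \<noteq> 0\<close> by simp
      obtain h where h: "h > 0" "\<And>k. 0 < k \<Longrightarrow> k < h \<Longrightarrow> (\<sigma> m)\<^sup>2 > (\<sigma> (m + k))\<^sup>2"
        using DERIV_neg_dec_right[OF d \<open>l < 0\<close>] by blast
      have "m + h / 2 \<in> C"
      proof (rule ext[of _ "h / 2"])
        fix z assume "z \<in> closed_segment m (m + h / 2)" "z \<noteq> m"
        then have "0 < z - m" "z - m < h" using h(1) by (auto simp: closed_segment_eq_real_ivl split: if_splits)
        then show "(\<sigma> z)\<^sup>2 < (\<sigma> m)\<^sup>2" using h(2)[of "z - m"] by simp
      qed (use h in auto)
      then show False using m(2)[of "m + h / 2"] h(2)[of "h / 2"] h(1) by simp
    qed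
  qed
  then show ?thesis using that m(1) by (simp add: Z_def)
qed

lemma zero_unique:
  assumes "C \<in> components Sp" "r \<in> C" "s \<in> C" "r \<in> Z" "s \<in> Z" shows "r = s"
proof -
  have "\<not> u < v" if "u \<in> C" "v \<in> C" "u \<in> Z" "v \<in> Z" for u v
    using mvt_component[OF assms(1) that(1,2)] that q_pos by (auto simp: Z_def mult_le_0_iff)
  then show ?thesis using assms(2-5) by (meson linorder_neqE)
qed

lemma comp_component: "x \<in> Sp \<Longrightarrow> comp x \<in> components Sp"
  unfolding comp_def by (rule componentsI)

lemma mem_comp: "x \<in> Sp \<Longrightarrow> x \<in> comp x"
  by (simp add: comp_def connected_component_refl)

lemma comp_eqI: "C \<in> components Sp \<Longrightarrow> x \<in> C \<Longrightarrow> C = comp x"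
  using components_eq[of C Sp "comp x"] comp_component[OF component_Sp] mem_comp[OF component_Sp] by blast

text \<open>Zeros of \<sigma> serve as labels of the bands: each band contains one, and since
  \<open>comp\<close> is injective on zeros, counting bands becomes counting zeros.\<close>

lemma components_Sp: "components Sp = comp ` Z"
proof (intro equalityI subsetI)
  fix C assume C: "C \<in> components Sp"
  then obtain r where "r \<in> C" "r \<in> Z" using zero_in_component by blast
  then show "C \<in> comp ` Z" using comp_eqI[OF C] by blast
qed (auto intro: comp_component Z_Sp)

lemma inj_comp: "inj_on comp Z"
proof (rule inj_onI)
  fix r s assume rs: "r \<in> Z" "s \<in> Z" "comp r = comp s"
  show "r = s" using mem_comp[OF Z_Sp[OF rs(1)]] mem_comp[OF Z_Sp[OF rs(2)]] rs
    by (intro zero_unique[OF comp_component[OF Z_Sp[OF rs(1)]]]) auto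
qed

lemma comp_less:
  assumes "r \<in> Z" "s \<in> Z" "r < s" "x \<in> comp r" "y \<in> comp s" shows "x < y"
proof (rule ccontr)
  assume "\<not> x < y"
  have c: "comp r \<in> components Sp" "comp s \<in> components Sp" using assms by (auto intro: comp_component Z_Sp)
  have m: "r \<in> comp r" "s \<in> comp s" using assms by (auto intro: mem_comp Z_Sp)
  have "comp r \<noteq> comp s" using inj_onD[OF inj_comp _ assms(1,2)] assms(3) by auto
  then have disj: "comp r \<inter> comp s = {}" using components_nonoverlap[OF c] by simp
  show False
  proof (cases "s \<le> x")
    case True
    then have "s \<in> comp r" using component_interval[OF c(1) m(1) assms(4)] assms(3) by auto
    then show False using disj m by auto
  next
    case False
    then have "x \<in> {y..s}" using \<open>\<not> x < y\<close> by auto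
    then have "x \<in> comp s" using component_interval[OF c(2) assms(5) m(2)] by auto
    then show False using disj assms(4) by auto
  qed
qed

lemma comp_less_iff:
  assumes "r \<in> Z" "s \<in> Z" shows "(\<forall>x\<in>comp r. \<forall>y\<in>comp s. x < y) \<longleftrightarrow> r < s"
  using comp_less[OF assms] mem_comp[OF Z_Sp] assms by blast

lemma card_left:
  assumes "r \<in> Z"
  shows "card {B' \<in> components Sp. \<forall>x\<in>B'. \<forall>y\<in>comp r. x < y} = card {s \<in> Z. s < r}"
proof -
  have "{B' \<in> components Sp. \<forall>x\<in>B'. \<forall>y\<in>comp r. x < y} = comp ` {s \<in> Z. s < r}"
    using comp_less_iff[OF _ assms] unfolding components_Sp by auto
  moreover have "inj_on comp {s \<in> Z. s < r}" using inj_comp by (rule inj_on_subset) auto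
  ultimately show ?thesis by (simp add: card_image)
qed

lemma finite_Z: "finite Z" and card_Z: "card Z = q"
  unfolding Z_def by (rule discriminant_roots)+

lemma card_less_inj:
  assumes "r \<in> Z" "s \<in> Z" "card {t \<in> Z. t < r} = card {t \<in> Z. t < s}" shows "r = s"
proof -
  have "\<not> u < v" if "u \<in> Z" "card {t \<in> Z. t < u} = card {t \<in> Z. t < v}" for u v
  proof
    assume "u < v"
    then have "{t \<in> Z. t < u} \<subset> {t \<in> Z. t < v}" using that(1) by auto
    then have "card {t \<in> Z. t < u} < card {t \<in> Z. t < v}" by (intro psubset_card_mono) (use finite_Z in auto)
    then show False using that(2) by simp
  qed
  then show ?thesis using assms by (metis linorder_neqE)
qed

lemma band_eq:
  assumes "r \<in> Z" "int (card {s \<in> Z. s < r}) = j + int N" shows "band p q j = comp r"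
proof -
  have N: "(int q - 1) div 2 = int N" by (simp add: q_def)
  show ?thesis unfolding band_def N
  proof (rule the_equality)
    show "comp r \<in> components Sp \<and> int (card {B' \<in> components Sp. \<forall>x\<in>B'. \<forall>y\<in>comp r. x < y}) = j + int N"
      using assms by (simp add: card_left comp_component Z_Sp)
  next
    fix B assume B: "B \<in> components Sp \<and> int (card {B' \<in> components Sp. \<forall>x\<in>B'. \<forall>y\<in>B. x < y}) = j + int N"
    then obtain s where s: "s \<in> Z" "B = comp s" unfolding components_Sp by blast
    then have "card {t \<in> Z. t < s} = card {t \<in> Z. t < r}" using B assms card_left[OF s(1)] by simp
    then show "B = comp r" using card_less_inj[OF s(1) assms(1)] s by simp
  qed
qed

lemma uminus_Z: "- r \<in> Z \<longleftrightarrow> r \<in> Z"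
  by (simp add: Z_def discriminant_minus)

lemma zero_Z: "0 \<in> Z"
  using discriminant_minus[of 0] by (simp add: Z_def)

lemma uminus_Sp: "- x \<in> Sp \<longleftrightarrow> x \<in> Sp"
  by (simp add: mem_Sp discriminant_minus)

lemma uminus_comp: assumes "x \<in> Sp" shows "y \<in> comp (- x) \<longleftrightarrow> - y \<in> comp x"
proof -
  have *: "- v \<in> comp (- u)" if "u \<in> Sp" "v \<in> comp u" for u v
  proof -
    have "uminus ` comp u \<subseteq> comp (- u)"
    proof (rule components_maximal)
      show "comp (- u) \<in> components Sp" using that uminus_Sp by (intro comp_component) auto
      show "connected (uminus ` comp u)"
        using in_components_connected[OF comp_component[OF that(1)]] by (intro connected_continuous_image continuous_intros)
      show "uminus ` comp u \<subseteq> Sp" using component_Sp[OF comp_component[OF that(1)]] uminus_Sp by auto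
      show "comp (- u) \<inter> uminus ` comp u \<noteq> {}" using mem_comp[OF that(1)] mem_comp[of "- u"] uminus_Sp that(1) by auto
    qed
    then show ?thesis using that(2) by auto
  qed
  show ?thesis using *[of x "- y"] *[of "- x" y] assms uminus_Sp by auto
qed

lemma card_Z_neg: "card {s \<in> Z. s < 0} = N"
proof -
  have "bij_betw uminus {s \<in> Z. s < 0} {s \<in> Z. 0 < s}"
    by (rule bij_betwI[of _ _ _ uminus]) (auto simp: uminus_Z)
  then have c: "card {s \<in> Z. 0 < s} = card {s \<in> Z. s < 0}" using bij_betw_same_card by metis
  have "Z = insert 0 ({s \<in> Z. s < 0} \<union> {s \<in> Z. 0 < s})" using zero_Z by auto
  then have "card Z = card (insert 0 ({s \<in> Z. s < 0} \<union> {s \<in> Z. 0 < s}))" by (rule arg_cong)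
  also have "\<dots> = 1 + (card {s \<in> Z. s < 0} + card {s \<in> Z. 0 < s})"
  proof -
    have "card ({s \<in> Z. s < 0} \<union> {s \<in> Z. 0 < s}) = card {s \<in> Z. s < 0} + card {s \<in> Z. 0 < s}"
      by (rule card_Un_disjoint) (use finite_Z in auto)
    then show ?thesis using finite_Z by (subst card_insert_disjoint) auto
  qed
  finally show ?thesis using c card_Z q_def by simp
qed

section \<open>Product formula over the positive zeros\<close>

definition Zp :: "real set" where "Zp = {s \<in> Z. 0 < s}"

lemma abs_discriminant: "\<bar>\<sigma> x\<bar> = \<bar>x\<bar> * (\<Prod>r\<in>Zp. \<bar>r\<^sup>2 - x\<^sup>2\<bar>)"
proof -
  have fin: "finite Zp" using finite_Z by (simp add: Zp_def)
  have "Z = insert 0 (uminus ` Zp \<union> Zp)"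
  proof (intro equalityI subsetI)
    fix r assume r: "r \<in> Z"
    show "r \<in> insert 0 (uminus ` Zp \<union> Zp)"
    proof (cases r "0::real" rule: linorder_cases)
      case less
      then have "- r \<in> Zp" using r by (simp add: Zp_def uminus_Z)
      then show ?thesis by (metis UnI1 image_eqI insertI2 minus_minus)
    qed (use r in \<open>auto simp: Zp_def\<close>)
  qed (auto simp: Zp_def uminus_Z zero_Z)
  then have "\<bar>\<sigma> x\<bar> = \<bar>\<Prod>r\<in>insert 0 (uminus ` Zp \<union> Zp). x - r\<bar>"
    using discriminant_roots(3)[of x] by (simp add: Z_def[symmetric])
  also have "(\<Prod>r\<in>insert 0 (uminus ` Zp \<union> Zp). x - r) = x * ((\<Prod>r\<in>uminus ` Zp. x - r) * (\<Prod>r\<in>Zp. x - r))"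
    using fin by (subst prod.insert) (auto simp: Zp_def intro!: prod.union_disjoint)
  also have "(\<Prod>r\<in>uminus ` Zp. x - r) = (\<Prod>r\<in>Zp. x + r)"
    by (subst prod.reindex) auto
  also have "(\<Prod>r\<in>Zp. x + r) * (\<Prod>r\<in>Zp. x - r) = (\<Prod>r\<in>Zp. x\<^sup>2 - r\<^sup>2)"
    unfolding prod.distrib[symmetric] by (intro prod.cong refl) (simp add: power2_eq_square algebra_simps)
  finally show ?thesis by (simp add: abs_mult abs_prod abs_minus_commute)
qed

lemma abs_deriv_discriminant: "\<bar>deriv \<sigma> 0\<bar> = (\<Prod>r\<in>Zp. r\<^sup>2)"
proof -
  have "((\<lambda>h. \<sigma> h / h) \<longlongrightarrow> deriv \<sigma> 0) (at 0)"
    using discriminant_has_derivative[of 0] zero_Z by (simp add: has_field_derivative_iff Z_def)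
  then have "((\<lambda>h. \<bar>\<sigma> h / h\<bar>) \<longlongrightarrow> \<bar>deriv \<sigma> 0\<bar>) (at 0)" by (rule tendsto_rabs)
  moreover have "((\<lambda>h. \<bar>\<sigma> h / h\<bar>) \<longlongrightarrow> (\<Prod>r\<in>Zp. \<bar>r\<^sup>2 - 0\<^sup>2\<bar>)) (at 0)"
  proof (rule Lim_transform_eventually)
    show "((\<lambda>h. \<Prod>r\<in>Zp. \<bar>r\<^sup>2 - h\<^sup>2\<bar>) \<longlongrightarrow> (\<Prod>r\<in>Zp. \<bar>r\<^sup>2 - 0\<^sup>2\<bar>)) (at (0::real))"
      by (intro tendsto_intros)
    show "\<forall>\<^sub>F h in at 0. (\<Prod>r\<in>Zp. \<bar>r\<^sup>2 - h\<^sup>2\<bar>) = \<bar>\<sigma> h / h\<bar>"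
      by (rule eventually_at_filter[THEN iffD2, OF always_eventually]) (auto simp: abs_divide abs_discriminant)
  qed
  ultimately show ?thesis using LIM_unique by fastforce
qed

end

context odd_fraction
begin

section \<open>Band edges and the width of the central band\<close>

lemma component_endpoint:
  assumes C: "C \<in> components Sp" "b \<in> C" and s: "s \<in> {-1, 1}" and out: "\<And>h. 0 < h \<Longrightarrow> b + s * h \<notin> C"
  shows "\<bar>\<sigma> b\<bar> = 4"
proof (rule ccontr)
  assume "\<bar>\<sigma> b\<bar> \<noteq> 4"
  then have "\<bar>\<sigma> b\<bar> < 4" using component_Sp[OF C] by (simp add: mem_Sp)
  have "((\<lambda>x. \<bar>\<sigma> x\<bar>) \<longlongrightarrow> \<bar>\<sigma> b\<bar>) (at b)"
    using DERIV_isCont[OF discriminant_has_derivative[of b]] unfolding isCont_def by (rule tendsto_rabs)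
  then have "\<forall>\<^sub>F x in at b. \<bar>\<sigma> x\<bar> < 4" using \<open>\<bar>\<sigma> b\<bar> < 4\<close> by (rule order_tendstoD)
  then obtain d where d0: "d > 0" "\<forall>x\<in>UNIV. x \<noteq> b \<and> dist x b < d \<longrightarrow> \<bar>\<sigma> x\<bar> < 4"
    unfolding eventually_at by blast
  note d = d0(1)
  have d2: "\<bar>\<sigma> x\<bar> < 4" if "dist x b < d" for x
    using d0 that \<open>\<bar>\<sigma> b\<bar> < 4\<close> by (cases "x = b") auto
  have "closed_segment b (b + s * (d / 2)) \<subseteq> C"
  proof (rule components_maximal[OF C(1)])
    show "closed_segment b (b + s * (d / 2)) \<subseteq> Sp"
    proof
      fix x assume "x \<in> closed_segment b (b + s * (d / 2))"
      then have "dist x b < d" using s d by (auto simp: closed_segment_eq_real_ivl dist_real_def split: if_splits)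
      then show "x \<in> Sp" using d2[of x] by (simp add: mem_Sp less_imp_le)
    qed
  qed (use C in auto)
  then have "b + s * (d / 2) \<in> C" by auto
  then show False using out[of "d / 2"] d by simp
qed

lemma component_Icc:
  assumes "C \<in> components Sp"
  obtains a b where "C = {a..b}" "a \<le> b" "\<bar>\<sigma> a\<bar> = 4" "\<bar>\<sigma> b\<bar> = 4"
proof -
  obtain a b where ab: "C = {a..b}"
    using connected_compact_interval_1[of C] compact_component[OF assms] in_components_connected[OF assms] by blast
  moreover have "a \<le> b" using ab in_components_nonempty[OF assms] by auto
  moreover have "\<bar>\<sigma> a\<bar> = 4" "\<bar>\<sigma> b\<bar> = 4"
    using component_endpoint[OF assms, of a "-1"] component_endpoint[OF assms, of b 1] ab \<open>a \<le> b\<close> by auto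
  ultimately show ?thesis by (rule that)
qed

lemma band_0: "band p q 0 = comp 0"
  by (rule band_eq) (simp_all add: zero_Z card_Z_neg)

lemma comp_0:
  shows "comp 0 = {- half_width p q..half_width p q}" "0 < half_width p q"
    "\<bar>\<sigma> (half_width p q)\<bar> = 4"
proof -
  have c0: "comp 0 \<in> components Sp" "0 \<in> comp 0" by (auto intro: comp_component mem_comp Z_Sp zero_Z)
  obtain a b where ab: "comp 0 = {a..b}" "a \<le> b" "\<bar>\<sigma> b\<bar> = 4" using component_Icc[OF c0(1)] by metis
  have sym: "- y \<in> comp 0 \<longleftrightarrow> y \<in> comp 0" for y using uminus_comp[of 0 y] Z_Sp[OF zero_Z] by simp
  have "a = - b" using sym[of a] sym[of b] ab by auto
  moreover from this have "half_width p q = b"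
    using ab(2) by (simp add: half_width_def band_0 ab(1) cSup_atLeastAtMost cInf_atLeastAtMost)
  moreover have "b \<noteq> 0" using ab(3) zero_Z by (auto simp: Z_def)
  ultimately show "comp 0 = {- half_width p q..half_width p q}" "0 < half_width p q" "\<bar>\<sigma> (half_width p q)\<bar> = 4"
    using ab by auto
qed

lemma half_width_le: "half_width p q \<le> 4 / real q"
proof -
  have "real q * \<bar>half_width p q - (- half_width p q)\<bar> \<le> 8"
    using comp_0 by (intro component_diam[of "comp 0"] comp_component Z_Sp zero_Z) auto
  then show ?thesis using comp_0(2) q_pos by (simp add: field_simps)
qed

lemma half_width_less: assumes "r \<in> Zp" shows "half_width p q < r"
  using comp_less[OF zero_Z, of r "half_width p q" r] assms mem_comp[OF Z_Sp, of r] comp_0 by (auto simp: Zp_def)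

lemma finite_Zp: "finite Zp"
  using finite_Z by (simp add: Zp_def)

lemma abs_deriv_pos: "0 < \<bar>deriv \<sigma> 0\<bar>"
  unfolding abs_deriv_discriminant by (rule prod_pos) (auto simp: Zp_def)

text \<open>At the edge w the product formula reads 4 = w times the product of \<bar>r^2 -
  w^2\<bar>. As w < r, each factor is at most r^2, and the product of the r^2 is
  \<bar>\<sigma>'(0)\<bar>.\<close>

lemma half_width_ge: "4 / \<bar>deriv \<sigma> 0\<bar> \<le> half_width p q"
proof -
  let ?w = "half_width p q"
  have "4 = ?w * (\<Prod>r\<in>Zp. \<bar>r\<^sup>2 - ?w\<^sup>2\<bar>)" using comp_0(2,3) abs_discriminant[of ?w] by simp
  also have "\<dots> \<le> ?w * (\<Prod>r\<in>Zp. r\<^sup>2)"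
  proof (intro mult_left_mono prod_mono conjI)
    fix r assume "r \<in> Zp"
    then have "?w\<^sup>2 \<le> r\<^sup>2" using half_width_less[of r] comp_0(2) by (intro power_mono) auto
    then show "\<bar>r\<^sup>2 - ?w\<^sup>2\<bar> \<le> r\<^sup>2" by simp
  qed (use comp_0 in auto)
  finally show ?thesis using abs_deriv_pos by (simp add: abs_deriv_discriminant field_simps)
qed

section \<open>The gaps next to the central band\<close>

definition gap_end :: real where "gap_end = Inf (comp (Min Zp))"

context
  assumes N_pos: "0 < N"
begin

lemma Zp_nonempty: "Zp \<noteq> {}"
proof
  assume "Zp = {}"
  moreover have "bij_betw uminus {s \<in> Z. s < 0} Zp"
    by (rule bij_betwI[of _ _ _ uminus]) (auto simp: uminus_Z Zp_def)
  ultimately show False using bij_betw_same_card card_Z_neg N_pos by fastforce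
qed

lemma Min_Zp: "Min Zp \<in> Z" "0 < Min Zp" "\<And>s. s \<in> Zp \<Longrightarrow> Min Zp \<le> s"
  using Min_in[OF finite_Zp Zp_nonempty] finite_Zp by (auto simp: Zp_def)

lemma gap_end:
  obtains e' where "comp (Min Zp) = {gap_end..e'}" "gap_end \<le> e'" "\<bar>\<sigma> gap_end\<bar> = 4"
    "half_width p q < gap_end" "gap_end < Min Zp"
proof -
  have c: "comp (Min Zp) \<in> components Sp" "Min Zp \<in> comp (Min Zp)"
    using Min_Zp by (auto intro: comp_component mem_comp Z_Sp)
  obtain a b where ab: "comp (Min Zp) = {a..b}" "a \<le> b" "\<bar>\<sigma> a\<bar> = 4" using component_Icc[OF c(1)] by metis
  have a: "gap_end = a" using ab by (simp add: gap_end_def)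
  moreover have "half_width p q < a"
    using ab comp_0 by (intro comp_less[OF zero_Z Min_Zp(1,2)]) auto
  moreover have "a \<noteq> Min Zp" using ab(3) Min_Zp(1) by (auto simp: Z_def)
  ultimately show ?thesis using that ab c(2) by auto
qed

lemma band_1: "band p q 1 = comp (Min Zp)"
proof (rule band_eq[OF Min_Zp(1)])
  have "{s \<in> Z. s < Min Zp} = insert 0 {s \<in> Z. s < 0}"
    using zero_Z Min_Zp(2,3) by (force simp: Zp_def)
  then show "int (card {s \<in> Z. s < Min Zp}) = 1 + int N"
    using finite_Z card_Z_neg by simp
qed

lemma band_m1: "band p q (-1) = comp (- Min Zp)"
proof (rule band_eq)
  show "- Min Zp \<in> Z" using Min_Zp by (simp add: uminus_Z)
  have "{s \<in> Z. s < 0} = insert (- Min Zp) {s \<in> Z. s < - Min Zp}"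
  proof (intro equalityI subsetI)
    fix s assume "s \<in> {s \<in> Z. s < 0}"
    then have "s \<in> Z" "- s \<in> Zp" by (auto simp: Zp_def uminus_Z)
    then show "s \<in> insert (- Min Zp) {s \<in> Z. s < - Min Zp}" using Min_Zp(3)[of "- s"] by auto
  qed (use Min_Zp in \<open>auto simp: uminus_Z\<close>)
  then have "N = card (insert (- Min Zp) {s \<in> Z. s < - Min Zp})" using card_Z_neg by simp
  also have "\<dots> = Suc (card {s \<in> Z. s < - Min Zp})" using finite_Z by simp
  finally show "int (card {s \<in> Z. s < - Min Zp}) = - 1 + int N" by simp
qed

lemma band_gap_0: "band_gap p q 0 = {half_width p q<..<gap_end}"
proof -
  obtain e' where e: "comp (Min Zp) = {gap_end..e'}" "gap_end \<le> e'" by (rule gap_end)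
  show ?thesis unfolding band_gap_def add_0 band_0 band_1 e(1) comp_0(1)
    using e(2) comp_0(2) by force
qed

lemma band_gap_m1: "band_gap p q (-1) = {- gap_end<..<- half_width p q}"
proof -
  obtain e' where e: "comp (Min Zp) = {gap_end..e'}" "gap_end \<le> e'" by (rule gap_end)
  have "comp (- Min Zp) = {- e'..- gap_end}"
    using uminus_comp[OF Z_Sp[OF Min_Zp(1)]] e by auto
  then show ?thesis unfolding band_gap_def add.left_inverse band_0 band_m1 comp_0(1)
    using e(2) comp_0(2) by force
qed

lemma gap_not_Sp: assumes "half_width p q < x" "x < gap_end" shows "x \<notin> Sp"
proof
  assume x: "x \<in> Sp"
  obtain e' where e: "comp (Min Zp) = {gap_end..e'}" "gap_end \<le> e'" by (rule gap_end)
  obtain r where r: "r \<in> Z" "comp x = comp r" using comp_component[OF x] components_Sp by auto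
  have xr: "x \<in> comp r" using mem_comp[OF x] r by simp
  have w: "half_width p q \<in> comp 0" using comp_0 by auto
  have g: "gap_end \<in> comp (Min Zp)" using e by auto
  consider "r < 0" | "r = 0" | "r = Min Zp" | "Min Zp < r"
    using Min_Zp(3)[of r] r(1) by (force simp: Zp_def)
  then show False
  proof cases
    case 1 then show ?thesis using comp_less[OF r(1) zero_Z 1 xr w] assms by simp
  next
    case 2 then show ?thesis using xr assms comp_0(1) by simp
  next
    case 3 then show ?thesis using xr assms e(1) by simp
  next
    case 4 then show ?thesis using comp_less[OF Min_Zp(1) r(1) 4 g xr] assms by simp
  qed
qed

lemma gap_end_Sp: "gap_end \<in> Sp"
  using gap_end by (metis mem_Sp order_refl)

definition lgd :: "real \<Rightarrow> real" where "lgd x = ln x + (\<Sum>r\<in>Zp. ln (r\<^sup>2 - x\<^sup>2))"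

lemma Zp_square: assumes "0 < x" "x < Min Zp" "r \<in> Zp" shows "x\<^sup>2 < r\<^sup>2"
proof -
  have "x < r" using assms Min_Zp(3)[of r] by simp
  then show ?thesis using assms(1) by (intro power_strict_mono) auto
qed

lemma lgd_eq: assumes "0 < x" "x < Min Zp" shows "lgd x = ln \<bar>\<sigma> x\<bar>"
proof -
  have "ln \<bar>\<sigma> x\<bar> = ln (x * (\<Prod>r\<in>Zp. r\<^sup>2 - x\<^sup>2))"
    unfolding abs_discriminant using assms Zp_square[OF assms] by (simp add: less_imp_le)
  also have "\<dots> = ln x + ln (\<Prod>r\<in>Zp. r\<^sup>2 - x\<^sup>2)"
    using assms Zp_square[OF assms] by (intro ln_mult_pos prod_pos) auto
  also have "ln (\<Prod>r\<in>Zp. r\<^sup>2 - x\<^sup>2) = (\<Sum>r\<in>Zp. ln (r\<^sup>2 - x\<^sup>2))"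
  proof (rule ln_prod)
    show "r\<^sup>2 - x\<^sup>2 \<noteq> 0" if "r \<in> Zp" for r using Zp_square[OF assms that] by simp
  qed (use Zp_square[OF assms] in \<open>auto simp: finite_Zp less_imp_le\<close>)
  finally show ?thesis by (simp add: lgd_def)
qed

definition recip_sum :: "real \<Rightarrow> real" where "recip_sum x = (\<Sum>r\<in>Zp. 1 / (r\<^sup>2 - x\<^sup>2))"

lemma lgd_has_derivative:
  assumes "0 < x" "x < Min Zp"
  shows "(lgd has_real_derivative 1 / x - 2 * x * recip_sum x) (at x)"
proof -
  have "((\<lambda>x. ln x + (\<Sum>r\<in>Zp. ln (r\<^sup>2 - x\<^sup>2))) has_real_derivative 1 / x + (\<Sum>r\<in>Zp. - 2 * x / (r\<^sup>2 - x\<^sup>2))) (at x)"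
    using assms Zp_square[OF assms] by (auto intro!: derivative_eq_intros sum.cong simp: divide_simps)
  then show ?thesis unfolding lgd_def recip_sum_def
    by (simp add: sum_distrib_left sum_negf)
qed

text \<open>Compare the logarithmic derivative \<open>1 / x - 2 * x * recip_sum x\<close> of \<open>\<sigma>\<close> at the band edge, where it is at least
  \<open>q / 4\<close>, with its zero inside the gap.\<close>

lemma gap_length: "real q * (half_width p q)\<^sup>2 / 12 \<le> gap_end - half_width p q"
proof -
  define w where "w = half_width p q"
  define L where "L = recip_sum"
  have w: "0 < w" "w < gap_end" "gap_end < Min Zp" "\<bar>\<sigma> gap_end\<bar> = 4" "\<bar>\<sigma> w\<bar> = 4"
    using comp_0 gap_end unfolding w_def by metis+
  have d: "(lgd has_real_derivative 1 / x - 2 * x * L x) (at x)" if "w \<le> x" "x \<le> gap_end" for x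
    unfolding L_def using that w by (intro lgd_has_derivative) auto
  obtain c where c: "w < c" "c < gap_end" "1 / c - 2 * c * L c = 0"
  proof -
    have "\<exists>c>w. c < gap_end \<and> lgd gap_end - lgd w = (gap_end - w) * (1 / c - 2 * c * L c)"
      using w(2) d by (intro MVT2) auto
    moreover have "lgd gap_end = lgd w" using w by (simp add: lgd_eq)
    ultimately show ?thesis using that w(2) by auto
  qed
  have Lc: "L c = 1 / (2 * c\<^sup>2)" using c w by (simp add: field_simps power2_eq_square)
  have dw: "real q / 4 \<le> 1 / w - 2 * w * L w"
  proof -
    define l where "l = 1 / w - 2 * w * L w"
    have l: "(lgd has_real_derivative l) (at w)" unfolding l_def using w by (intro d) auto
    \<comment> \<open>Squaring removes the unknown sign of \<sigma>, so the derivative of ln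
      \<bar>\<sigma>\<bar> at w can be compared with \<sigma>'(w).\<close>
    have "((\<lambda>x. exp (lgd x) ^ 2) has_real_derivative 2 * exp (lgd w) ^ 2 * l) (at w)"
      by (rule derivative_eq_intros l refl | simp add: power2_eq_square)+
    then have d1: "((\<lambda>x. (\<sigma> x)\<^sup>2) has_real_derivative 2 * exp (lgd w) ^ 2 * l) (at w)"
    proof (rule DERIV_cong_ev[THEN iffD1, OF refl _ refl, rotated])
      have "\<forall>\<^sub>F x in nhds w. x \<in> {0<..<Min Zp}" using w by (intro eventually_nhds_in_open) auto
      then show "\<forall>\<^sub>F x in nhds w. exp (lgd x) ^ 2 = (\<sigma> x)\<^sup>2"
      proof eventually_elim
        case (elim x)
        then have "\<sigma> x \<noteq> 0" using Min_Zp(3)[of x] by (auto simp: Zp_def Z_def)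
        then show ?case using elim by (simp add: lgd_eq)
      qed
    qed
    have d2: "((\<lambda>x. (\<sigma> x)\<^sup>2) has_real_derivative 2 * \<sigma> w * deriv \<sigma> w) (at w)"
      using DERIV_power[OF discriminant_has_derivative[of w], of 2] by (simp add: mult_ac)
    have "exp (lgd w) = 4" using w by (simp add: lgd_eq)
    then have "32 * l = 2 * (\<sigma> w * deriv \<sigma> w)"
      using DERIV_unique[OF d1 d2] by simp
    then have "\<bar>32 * l\<bar> = \<bar>2 * (\<sigma> w * deriv \<sigma> w)\<bar>" by (rule arg_cong)
    then have "4 * \<bar>l\<bar> = \<bar>deriv \<sigma> w\<bar>" by (simp add: abs_mult w(5))
    then have al: "real q \<le> 4 * \<bar>l\<bar>" using deriv_discriminant_ge[of w] w(5) by simp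
    \<comment> \<open>Otherwise \<bar>\<sigma>\<bar> would exceed 4 just left of w, inside the
      central band.\<close>
    have "\<not> l < 0"
    proof
      assume "l < 0"
      then obtain h where h: "h > 0" "\<And>k. 0 < k \<Longrightarrow> k < h \<Longrightarrow> lgd w < lgd (w - k)" using DERIV_neg_dec_left[OF l] by blast
      define k where "k = min (h / 2) (w / 2)"
      have k: "0 < k" "k < h" "k < w" using h w by (auto simp: k_def min_def)
      have "w - k \<in> comp 0" using comp_0(1) k w unfolding w_def by auto
      then have "\<bar>\<sigma> (w - k)\<bar> \<le> 4" using component_Sp[OF comp_component[OF Z_Sp[OF zero_Z]]] by (simp add: mem_Sp)
      moreover have "\<sigma> (w - k) \<noteq> 0" using Min_Zp(3)[of "w - k"] k w by (auto simp: Zp_def Z_def)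
      ultimately have "ln \<bar>\<sigma> (w - k)\<bar> \<le> ln 4" by simp
      then show False using h(2)[OF k(1,2)] w k by (simp add: lgd_eq)
    qed
    then have "real q / 4 \<le> l" using al by simp
    then show ?thesis by (simp only: l_def)
  qed
  \<comment> \<open>In each term of the difference the factor 1 / (r^2 - c^2) is bounded by the
    whole sum L c, whose value 1 / (2 c^2) is known from the critical point.\<close>
  have LL: "L c - L w \<le> (c\<^sup>2 - w\<^sup>2) * (L c * L w)"
  proof -
    have sq: "0 < r\<^sup>2 - c\<^sup>2" "0 < r\<^sup>2 - w\<^sup>2" if "r \<in> Zp" for r
      using Zp_square[OF _ _ that] c w by auto
    have le: "1 / (r\<^sup>2 - c\<^sup>2) \<le> L c" if "r \<in> Zp" for r unfolding L_def recip_sum_def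
      by (rule member_le_sum[OF that, of "\<lambda>r. 1 / (r\<^sup>2 - c\<^sup>2)"]) (use sq finite_Zp in \<open>auto intro: less_imp_le\<close>)
    have "L c - L w = (\<Sum>r\<in>Zp. (c\<^sup>2 - w\<^sup>2) * (1 / (r\<^sup>2 - c\<^sup>2) * (1 / (r\<^sup>2 - w\<^sup>2))))"
      unfolding L_def recip_sum_def sum_subtractf[symmetric]
    proof (rule sum.cong[OF refl])
      fix r assume "r \<in> Zp"
      then show "1 / (r\<^sup>2 - c\<^sup>2) - 1 / (r\<^sup>2 - w\<^sup>2) = (c\<^sup>2 - w\<^sup>2) * (1 / (r\<^sup>2 - c\<^sup>2) * (1 / (r\<^sup>2 - w\<^sup>2)))"
        using sq[of r] by (simp add: divide_simps)
    qed
    also have "\<dots> \<le> (\<Sum>r\<in>Zp. (c\<^sup>2 - w\<^sup>2) * (L c * (1 / (r\<^sup>2 - w\<^sup>2))))"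
    proof (intro sum_mono mult_left_mono mult_right_mono le)
      show "0 \<le> c\<^sup>2 - w\<^sup>2" using power_mono[of w c 2] c w by simp
    qed (use sq in \<open>auto intro: less_imp_le\<close>)
    also have "\<dots> = (c\<^sup>2 - w\<^sup>2) * (L c * L w)"
      by (simp only: L_def recip_sum_def sum_distrib_left)
    finally show ?thesis .
  qed
  have Lw: "L w \<le> 1 / (2 * w\<^sup>2) - real q / (8 * w)"
    using dw w(1) by (simp add: field_simps power2_eq_square)
  have "1 / (2 * c\<^sup>2) - (1 / (2 * w\<^sup>2) - real q / (8 * w)) \<le> L c - L w" using Lw Lc by simp
  also have "\<dots> \<le> (c\<^sup>2 - w\<^sup>2) * (1 / (2 * c\<^sup>2) * L w)" using LL Lc by simp
  also have "\<dots> \<le> (c\<^sup>2 - w\<^sup>2) * (1 / (2 * c\<^sup>2) * (1 / (2 * w\<^sup>2)))"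
  proof (intro mult_left_mono)
    show "L w \<le> 1 / (2 * w\<^sup>2)" using Lw w(1) by (smt (verit) divide_nonneg_pos of_nat_0_le_iff)
    show "0 \<le> c\<^sup>2 - w\<^sup>2" using power_mono[of w c 2] c w by simp
  qed simp
  finally have "8 * c\<^sup>2 * w\<^sup>2 * (1 / (2 * c\<^sup>2) - (1 / (2 * w\<^sup>2) - real q / (8 * w)))
      \<le> 8 * c\<^sup>2 * w\<^sup>2 * ((c\<^sup>2 - w\<^sup>2) * (1 / (2 * c\<^sup>2) * (1 / (2 * w\<^sup>2))))"
    by (intro mult_left_mono) auto
  also have "\<dots> = 2 * (c\<^sup>2 - w\<^sup>2)" using w c by (simp add: field_simps)
  also have "8 * c\<^sup>2 * w\<^sup>2 * (1 / (2 * c\<^sup>2) - (1 / (2 * w\<^sup>2) - real q / (8 * w))) = 4 * w\<^sup>2 - 4 * c\<^sup>2 + real q * (w * c\<^sup>2)"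
    using w c by (simp add: field_simps power2_eq_square)
  finally have "real q * (w * c\<^sup>2) \<le> 6 * (c\<^sup>2 - w\<^sup>2)" by simp
  also have "\<dots> = 6 * (c + w) * (c - w)" by (simp add: power2_eq_square algebra_simps)
  also have "\<dots> \<le> 12 * c * (c - w)" using c w by (intro mult_right_mono) auto
  finally have "c * (real q * w * c) \<le> c * (12 * (c - w))" by (simp add: power2_eq_square mult_ac)
  then have "real q * w * c \<le> 12 * (c - w)" using c w by (simp add: mult_le_cancel_left_pos)
  moreover have "real q * w * w \<le> real q * w * c" using c w by (intro mult_left_mono) auto
  ultimately have "real q * w\<^sup>2 \<le> 12 * (gap_end - w)" using c(2) by (simp add: power2_eq_square mult_ac)
  then show ?thesis by (simp add: w_def)
qed

end

end

section \<open>Passage to irrational frequencies\<close>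

text \<open>With even quotients numerator and denominator of the tail have opposite parity, so a
  further odd quotient b makes the denominator b q + p odd.\<close>

lemma cf_pair_parity:
  "\<forall>x\<in>set as. even x \<Longrightarrow> odd (fst (cf_pair as) + snd (cf_pair as))"
  by (induction as) auto

lemma cfrac_eq_cf_pair:
  "\<forall>x\<in>set as. x > 0 \<Longrightarrow> cfrac as = of_nat (fst (cf_pair as)) / of_nat (snd (cf_pair as))"
proof (induction as)
  case (Cons a as)
  have "snd (cf_pair as) > 0" using cf_pair_den_pos[of as] Cons.prems by auto
  then have nz: "rat_of_nat (snd (cf_pair as)) \<noteq> 0" by simp
  have "cfrac (a # as) = 1 / (of_nat a + of_nat (fst (cf_pair as)) / of_nat (snd (cf_pair as)))"
    using Cons by simp
  also have "of_nat a + of_nat (fst (cf_pair as)) / of_nat (snd (cf_pair as))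
      = (of_nat (a * snd (cf_pair as) + fst (cf_pair as)) :: rat) / of_nat (snd (cf_pair as))"
    using nz by (simp add: field_simps)
  finally show ?case by simp
qed simp

lemma cf_pair_snoc:
  "c * fst (cf_pair xs) \<le> fst (cf_pair (xs @ [c]))" "c * snd (cf_pair xs) \<le> snd (cf_pair (xs @ [c]))"
proof (induction xs)
  case (Cons a xs)
  case 1 show ?case using Cons by simp
  case 2 
  have "a * (c * snd (cf_pair xs)) \<le> a * snd (cf_pair (xs @ [c]))" using Cons(2) by (intro mult_left_mono) simp_all
  then have "c * fst (cf_pair xs) + a * (c * snd (cf_pair xs)) \<le> fst (cf_pair (xs @ [c])) + a * snd (cf_pair (xs @ [c]))"
    using Cons(1) by (rule add_mono[rotated])
  then show ?case by (simp add: algebra_simps)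
qed simp_all

lemma coprime_fraction_unique:
  fixes p q p' q' :: nat
  assumes "coprime p q" "coprime p' q'" "q > 0" "q' > 0" "real p / real q = real p' / real q'"
  shows "p = p' \<and> q = q'"
proof -
  have "real (p * q') = real (p' * q)" using assms by (simp add: field_simps)
  then have eq: "p * q' = p' * q" by (simp only: of_nat_eq_iff)
  have "q dvd q'" using eq assms(1) by (metis coprime_commute coprime_dvd_mult_right_iff dvd_triv_right)
  moreover have "q' dvd q" using eq assms(2) by (metis coprime_commute coprime_dvd_mult_right_iff dvd_triv_right)
  ultimately have "q = q'" by (rule dvd_antisym)
  then show ?thesis using eq assms by simp
qed

definition admissible :: "nat \<Rightarrow> nat \<Rightarrow> bool" where
  "admissible p q \<longleftrightarrow> (\<exists>b as. odd b \<and> (\<forall>x\<in>set as. even x \<and> x > 0) \<and> (p, q) = cf_pair (b # as))"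

lemma admissible_odd_fraction:
  assumes "admissible p q" obtains N where "odd_fraction p q N"
proof -
  obtain b as where b: "odd b" "\<forall>x\<in>set as. even x \<and> x > 0" "(p, q) = cf_pair (b # as)"
    using assms unfolding admissible_def by blast
  have "q = b * snd (cf_pair as) + fst (cf_pair as)" using b(3) by simp
  then have "odd q" using cf_pair_parity[of as] b by auto
  then have "odd_fraction p q ((q - 1) div 2)"
    using cf_pair_coprime[of "b # as"] unfolding b(3)[symmetric] by unfold_locales auto
  then show ?thesis by (rule that)
qed

text \<open>q times a sum of N + 1 \<le> q squared products, each of them at most 16 q^4.\<close>

lemma abs_deriv_le:
  assumes "admissible p q" shows "\<bar>deriv (discriminant p q) 0\<bar> \<le> 16 * real q ^ 6"
proof -
  obtain b as where b: "odd b" "\<forall>x\<in>set as. even x \<and> x > 0" "(p, q) = cf_pair (b # as)"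
    using assms unfolding admissible_def by blast
  have pq: "fst (cf_pair (b # as)) = p" "snd (cf_pair (b # as)) = q" unfolding b(3)[symmetric] by simp_all
  obtain N where "odd_fraction p q N" using admissible_odd_fraction[OF assms] .
  then interpret odd_fraction p q N .
  have "(norm (psi l))\<^sup>2 \<le> 16 * real q ^ 4" if "l \<le> N" for l
  proof -
    have "2 * l < q" using that q_def by simp
    then have "sine_ratio (real p / real q) l \<le> 16 * real q ^ 4" using sine_ratio_le[OF b(1,2), of l] unfolding pq by simp
    then show ?thesis unfolding norm_psi sine_ratio_def .
  qed
  then have "(\<Sum>l\<le>N. (norm (psi l))\<^sup>2) \<le> (\<Sum>l\<le>N. 16 * real q ^ 4)" by (intro sum_mono) auto
  also have "\<dots> = real (N + 1) * (16 * real q ^ 4)" by simp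
  also have "\<dots> \<le> real q * (16 * real q ^ 4)" using q_def by (intro mult_right_mono) auto
  finally have "real q * (\<Sum>l\<le>N. (norm (psi l))\<^sup>2) \<le> real q * (real q * (16 * real q ^ 4))" by (rule mult_left_mono) simp
  then show ?thesis unfolding deriv_discriminant_zero by (simp add: power_numeral_reduce mult_ac)
qed

lemma half_width_bounds:
  assumes "admissible p q"
  shows "0 < \<bar>deriv (discriminant p q) 0\<bar>" "4 / \<bar>deriv (discriminant p q) 0\<bar> \<le> half_width p q"
    "1 / (4 * real q ^ 6) \<le> half_width p q" "half_width p q \<le> 4 / real q" "0 < half_width p q" "0 < q"
proof -
  obtain N where "odd_fraction p q N" using admissible_odd_fraction[OF assms] .
  then interpret odd_fraction p q N .
  show "0 < \<bar>deriv (discriminant p q) 0\<bar>" "half_width p q \<le> 4 / real q" "0 < half_width p q"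
    "4 / \<bar>deriv (discriminant p q) 0\<bar> \<le> half_width p q" "0 < q"
    by (fact abs_deriv_pos half_width_le comp_0(2) half_width_ge q_pos)+
  have "4 / (16 * real q ^ 6) \<le> 4 / \<bar>deriv (discriminant p q) 0\<bar>"
    using abs_deriv_le[OF assms] abs_deriv_pos q_pos by (intro divide_left_mono mult_pos_pos) auto
  then show "1 / (4 * real q ^ 6) \<le> half_width p q" using half_width_ge by simp
qed

lemma band_zero:
  assumes "admissible p q"
  shows "band p q 0 = {- half_width p q..half_width p q}" "{- half_width p q..half_width p q} \<subseteq> S (real p / real q)"
proof -
  obtain N where "odd_fraction p q N" using admissible_odd_fraction[OF assms] .
  then interpret odd_fraction p q N .
  show "band p q 0 = {- half_width p q..half_width p q}" using band_0 comp_0 by simp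
  show "{- half_width p q..half_width p q} \<subseteq> Sp"
    unfolding comp_0(1)[symmetric] using component_Sp[OF comp_component[OF Z_Sp[OF zero_Z]]] by blast
qed

lemma band_gap_obtain:
  assumes "admissible p q" "3 \<le> q"
  obtains e where "half_width p q < e" "band_gap p q 0 = {half_width p q<..<e}" "band_gap p q (-1) = {-e<..<- half_width p q}"
    "e \<in> S (real p / real q)" "- e \<in> S (real p / real q)" "{half_width p q<..<e} \<inter> S (real p / real q) = {}"
    "{-e<..<- half_width p q} \<inter> S (real p / real q) = {}" "1 / (192 * real q ^ 11) \<le> e - half_width p q"
proof -
  obtain N where "odd_fraction p q N" using admissible_odd_fraction[OF assms(1)] .
  then interpret odd_fraction p q N .
  have N: "0 < N" using assms(2) q_def by simp
  \<comment> \<open>The half width bound 1 / (4 q^6) enters q w^2 / 12 squared, and 12 * 16 =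
    192.\<close>
  have "1 / (192 * real q ^ 11) = real q * (1 / (4 * real q ^ 6))\<^sup>2 / 12"
    using q_pos by (simp add: field_simps power_numeral_reduce)
  also have "\<dots> \<le> real q * (half_width p q)\<^sup>2 / 12"
    using half_width_bounds(3)[OF assms(1)] by (intro divide_right_mono mult_left_mono power_mono) auto
  finally have l: "1 / (192 * real q ^ 11) \<le> gap_end - half_width p q" using gap_length[OF N] by simp
  have n: "{half_width p q<..<gap_end} \<inter> Sp = {}" using gap_not_Sp[OF N] by auto
  have "{-gap_end<..<- half_width p q} \<inter> Sp = {}"
  proof (rule equals0I)
    fix x assume "x \<in> {-gap_end<..<- half_width p q} \<inter> Sp"
    then show False using gap_not_Sp[OF N, of "- x"] uminus_Sp[of x] by auto
  qed
  then show ?thesis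
    using that[of gap_end] gap_end[OF N] band_gap_0[OF N] band_gap_m1[OF N] gap_end_Sp[OF N] uminus_Sp[of gap_end] l n by metis
qed

lemma admissible_odd: assumes "admissible p q" shows "odd q"
proof -
  obtain N where "odd_fraction p q N" using admissible_odd_fraction[OF assms] .
  then have "q = 2 * N + 1" by (rule odd_fraction.q_def)
  then show ?thesis by simp
qed

section \<open>Stability of the central gaps under a change of frequency\<close>

lemma sqrt_close_le:
  assumes "admissible p q" "d \<le> 1 / (20000000 * real q ^ 12)"
  shows "60 * sqrt d \<le> half_width p q / 16" "d \<le> 1"
proof -
  note hw = half_width_bounds[OF assms(1)]
  \<comment> \<open>4000^2 is below 20000000, and 60 / 4000 \<le> 1 / 64; with w \<ge> 1 / (4 q^6)
    the displacement of the spectrum is at most a sixteenth of the half width.\<close>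
  have "sqrt d \<le> sqrt ((1 / (4000 * real q ^ 6))\<^sup>2)"
  proof (rule real_sqrt_le_mono)
    have "(1 / (4000 * real q ^ 6))\<^sup>2 = 1 / (16000000 * real q ^ 12)" by (simp add: power2_eq_square power_numeral_reduce)
    moreover have "1 / (20000000 * real q ^ 12) \<le> 1 / (16000000 * real q ^ 12)"
      using hw(6) by (intro divide_left_mono mult_right_mono mult_pos_pos) auto
    ultimately show "d \<le> (1 / (4000 * real q ^ 6))\<^sup>2" using assms(2) by simp
  qed
  also have "\<dots> = 1 / 4000 * (1 / real q ^ 6)" by simp
  finally have "60 * sqrt d \<le> 60 * (1 / 4000 * (1 / real q ^ 6))" by simp
  also have "\<dots> \<le> 1 / (4 * real q ^ 6) / 16" using hw(6) by (simp add: field_simps)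
  finally show "60 * sqrt d \<le> half_width p q / 16" using hw(3) by simp
  have "1 / (20000000 * real q ^ 12) \<le> 1 / (20000000 * 1)"
    using hw(6) by (intro divide_left_mono mult_left_mono mult_pos_pos one_le_power) auto
  then show "d \<le> 1" using assms(2) by simp
qed

text \<open>Distinct fractions differ by at least 1 / (q q'), so closeness forces q' > 64 q^6 and
  hence w' \<le> 4 / q' < w / 4. The point w / 2 of the first spectrum has a point of the second
  within w / 4 of it; lying beyond w', that point stops the neighbouring gap no later than 3 w /
  4.\<close>

lemma closed_gap_contained:
  assumes ad: "admissible p q" "admissible p' q'" "3 \<le> q'" and ne: "real p / real q \<noteq> real p' / real q'"
    and close: "\<bar>real p / real q - real p' / real q'\<bar> \<le> 1 / (20000000 * real q ^ 12)"
  shows "half_width p' q' < half_width p q / 4"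
    "band_gap p' q' 0 = {half_width p' q'<..<e} \<Longrightarrow> half_width p' q' < e \<Longrightarrow> e \<le> 3 / 4 * half_width p q"
    "band p' q' 0 \<union> closure (band_gap p' q' 0) \<union> closure (band_gap p' q' (-1)) \<subseteq> interior (band p q 0)"
proof -
  define w w' d where "w = half_width p q" and "w' = half_width p' q'" and "d = \<bar>real p / real q - real p' / real q'\<bar>"
  note hw = half_width_bounds[OF ad(1), folded w_def]
  note hw' = half_width_bounds[OF ad(2), folded w'_def]
  have q1: "1 \<le> real q" using hw(6) by simp
  have Q: "1 \<le> real q ^ n" for n using q1 by (rule one_le_power)
  have d0: "0 < d" using ne by (simp add: d_def)
  have dle: "d \<le> 1 / (20000000 * real q ^ 12)" using close by (simp add: d_def)
  have d1: "d \<le> 1" and sq: "60 * sqrt d \<le> w / 4"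
    using sqrt_close_le[OF ad(1) dle] hw(5) by (simp_all add: w_def)
  have frac: "1 / (real q * real q') \<le> d"
  proof -
    have "d = \<bar>real_of_int (int (p * q') - int (p' * q))\<bar> / (real q * real q')"
      using hw(6) hw'(6) by (simp add: d_def field_simps abs_divide flip: abs_mult)
    moreover have "int (p * q') - int (p' * q) \<noteq> 0"
    proof
      assume "int (p * q') - int (p' * q) = 0"
      then have "real (p * q') = real (p' * q)" by (metis eq_iff_diff_eq_0 of_nat_eq_iff)
      then show False using ne hw(6) hw'(6) by (simp add: field_simps)
    qed
    then have "1 \<le> \<bar>int (p * q') - int (p' * q)\<bar>" by simp
    then have "1 \<le> \<bar>real_of_int (int (p * q') - int (p' * q))\<bar>" by linarith
    ultimately show ?thesis by (simp only:) (intro divide_right_mono, auto)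
  qed
  have q': "64 * real q ^ 6 < real q'"
  proof -
    have "1 / (real q * real q') \<le> 1 / (20000000 * real q ^ 12)" using frac dle by simp
    then have "20000000 * real q ^ 12 \<le> real q * real q'" using hw(6) hw'(6) by (simp add: field_simps)
    also have "20000000 * real q ^ 12 = real q * (20000000 * real q ^ 5 * real q ^ 6)" by (simp add: power_numeral_reduce)
    finally have "20000000 * real q ^ 5 * real q ^ 6 \<le> real q'" by (rule mult_left_le_imp_le) (use hw(6) in simp)
    moreover have "64 * real q ^ 6 < 20000000 * real q ^ 5 * real q ^ 6"
    proof -
      have "64 * real q ^ 6 < 20000000 * 1 * real q ^ 6" using q1 by simp
      also have "\<dots> \<le> 20000000 * real q ^ 5 * real q ^ 6" by (intro mult_right_mono mult_left_mono Q) auto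
      finally show ?thesis .
    qed
    ultimately show ?thesis by linarith
  qed
  have "w' \<le> 4 / real q'" by (rule hw'(4))
  also have "\<dots> < 4 / (64 * real q ^ 6)" using q' q1 hw'(6) by (intro divide_strict_left_mono mult_pos_pos) auto
  also have "\<dots> \<le> w / 4" using hw(3) by simp
  finally have ww: "w' < w / 4" .
  then show "half_width p' q' < half_width p q / 4" by (simp add: w_def w'_def)
  have "w / 2 \<in> S (real p / real q)" using band_zero(2)[OF ad(1)] hw(5) by (auto simp: w_def)
  then obtain y where y: "y \<in> S (real p' / real q')" "\<bar>y - w / 2\<bar> \<le> 60 * sqrt d"
    using S_hoelder[of "w / 2" "real p / real q" "real p' / real q'"] ne d1 by (auto simp: d_def)
  obtain e' where e': "w' < e'" "band_gap p' q' 0 = {w'<..<e'}" "band_gap p' q' (-1) = {-e'<..<- w'}"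
    "{w'<..<e'} \<inter> S (real p' / real q') = {}"
    using band_gap_obtain[OF ad(2,3)] unfolding w'_def by metis
  have "y \<notin> {w'<..<e'}" using e'(4) y(1) by blast
  then have ee: "e' \<le> 3 / 4 * w" using y(2) sq ww by (auto simp: abs_le_iff)
  show "e \<le> 3 / 4 * half_width p q" if "band_gap p' q' 0 = {half_width p' q'<..<e}" "half_width p' q' < e"
  proof -
    have "e = e'" using that e'(1,2) unfolding w'_def by (metis cSup_greaterThanLessThan)
    then show ?thesis using ee by (simp add: w_def)
  qed
  have "{-w'..w'} \<union> {w'..e'} \<union> {-e'..-w'} \<subseteq> {-w<..<w}" using ee ww e'(1) hw(5) hw'(5) by auto
  then show "band p' q' 0 \<union> closure (band_gap p' q' 0) \<union> closure (band_gap p' q' (-1)) \<subseteq> interior (band p q 0)"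
    using e'(1) unfolding e'(2,3) band_zero(1)[OF ad(1)] band_zero(1)[OF ad(2)] w_def[symmetric] w'_def[symmetric] by simp
qed

text \<open>Points of T within \<eta> of the old edges u and v stop the component from outside,
  while the old gap shrunk by \<eta> at both ends is free of T and lies inside it.\<close>

lemma gap_of_perturbation:
  fixes T :: "real set"
  assumes uv: "u + 2 * \<eta> < v" and \<eta>: "0 \<le> \<eta>" and free: "{u + \<eta><..<v - \<eta>} \<inter> T = {}"
    and s: "s \<in> T" "\<bar>s - u\<bar> \<le> \<eta>" and t: "t \<in> T" "\<bar>t - v\<bar> \<le> \<eta>"
  defines "G \<equiv> connected_component_set (- T) ((u + v) / 2)"
  shows "G \<in> gaps T" "G \<subseteq> {u - \<eta>..v + \<eta>}" "(u + v) / 2 \<in> G" "G \<inter> {u<..<v} \<noteq> {}"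
    "measure lebesgue (G \<inter> {u<..<v}) \<le> measure lebesgue G"
    "v - u - 2 * \<eta> \<le> measure lebesgue (G \<inter> {u<..<v})"
proof -
  define m where "m = (u + v) / 2"
  have mI: "m \<in> {u + \<eta><..<v - \<eta>}" using uv by (auto simp: m_def field_simps)
  then have mT: "m \<in> - T" using free by auto
  have comp: "G \<in> components (- T)" unfolding G_def m_def[symmetric] by (rule componentsI[OF mT])
  have mG: "m \<in> G" unfolding G_def m_def[symmetric] using mT by (simp add: connected_component_refl)
  have con: "connected G" by (rule in_components_connected[OF comp])
  have GT: "x \<notin> T" if "x \<in> G" for x using in_components_subset[OF comp] that by auto
  have IG: "{u + \<eta><..<v - \<eta>} \<subseteq> G"
    by (rule components_maximal[OF comp]) (use free mG mI in auto)
  have "x \<in> {u - \<eta>..v + \<eta>}" if x: "x \<in> G" for x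
  proof -
    have "s \<le> m" "m \<le> t" using s(2) t(2) mI by (auto simp: abs_le_iff)
    then have "\<not> x \<le> s" "\<not> t \<le> x"
      using connectedD_interval[OF con x mG, of s] connectedD_interval[OF con mG x, of t] GT s(1) t(1) by auto
    then show ?thesis using s(2) t(2) by (auto simp: abs_le_iff)
  qed
  then show sub: "G \<subseteq> {u - \<eta>..v + \<eta>}" by blast
  then have bdd: "bounded G" by (rule bounded_subset[OF bounded_closed_interval])
  then show "G \<in> gaps T" using comp by (simp add: gaps_def)
  show "(u + v) / 2 \<in> G" using mG by (simp add: m_def)
  show "G \<inter> {u<..<v} \<noteq> {}" using mG mI \<eta> by auto
  have lm: "G \<in> lmeasurable"
    using bdd con by (intro measurable_convex) (simp_all add: connected_convex_1)
  show "measure lebesgue (G \<inter> {u<..<v}) \<le> measure lebesgue G"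
    using lm by (intro measure_mono_fmeasurable) (auto simp: fmeasurable_def)
  have "measure lebesgue {u + \<eta><..<v - \<eta>} \<le> measure lebesgue (G \<inter> {u<..<v})"
  proof (rule measure_mono_fmeasurable)
    show "{u + \<eta><..<v - \<eta>} \<subseteq> G \<inter> {u<..<v}" using IG \<eta> by auto
    show "G \<inter> {u<..<v} \<in> lmeasurable" using lm by (intro fmeasurable.Int) auto
  qed simp
  then show "v - u - 2 * \<eta> \<le> measure lebesgue (G \<inter> {u<..<v})" using uv by simp
qed

text \<open>The last clause locates the whole gap by its distance from 0 on the correct side. It
  serves to tell apart the gaps of different levels and of the two sides.\<close>

lemma perturbed_central_gaps:
  assumes ad: "admissible p q" "3 \<le> q" and ne: "\<alpha> \<noteq> real p / real q"
    and close: "\<bar>\<alpha> - real p / real q\<bar> \<le> 1 / (20000000 * real q ^ 12)"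
    and small: "120 * sqrt \<bar>\<alpha> - real p / real q\<bar> < 1 / (192 * real q ^ 11)"
    and j: "j \<in> {1, 2}"
  shows "\<exists>G \<in> gaps (S \<alpha>). G \<noteq> {} \<and> G \<inter> band_gap p q (int j - 2) \<noteq> {} \<and>
    measure lebesgue (G \<inter> band_gap p q (int j - 2)) \<le> measure lebesgue G \<and>
    1 / (192 * real q ^ 11) - 120 * sqrt \<bar>\<alpha> - real p / real q\<bar> \<le> measure lebesgue (G \<inter> band_gap p q (int j - 2)) \<and>
    (\<forall>x\<in>G. 15 / 16 * half_width p q \<le> (if j = 1 then - x else x) \<and>
      (if j = 1 then - x else x) \<le> Sup (band_gap p q 0) + half_width p q / 16)"
proof -
  define w \<eta> where "w = half_width p q" and "\<eta> = 60 * sqrt \<bar>\<alpha> - real p / real q\<bar>"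
  obtain e where e: "w < e" "band_gap p q 0 = {w<..<e}" "band_gap p q (-1) = {-e<..<- w}"
    "e \<in> S (real p / real q)" "- e \<in> S (real p / real q)" "{w<..<e} \<inter> S (real p / real q) = {}"
    "{-e<..<- w} \<inter> S (real p / real q) = {}" "1 / (192 * real q ^ 11) \<le> e - w"
    using band_gap_obtain[OF ad] unfolding w_def by metis
  have w: "0 < w" using half_width_bounds(5)[OF ad(1)] by (simp add: w_def)
  have ww: "w \<in> S (real p / real q)" "- w \<in> S (real p / real q)"
    using band_zero(2)[OF ad(1)] w by (auto simp: w_def)
  have \<eta>: "0 \<le> \<eta>" "\<eta> \<le> w / 16" "2 * \<eta> < e - w" "\<bar>\<alpha> - real p / real q\<bar> \<le> 1"
    using sqrt_close_le[OF ad(1) close] small e(8) by (auto simp: \<eta>_def w_def)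
  have near: "\<exists>E'\<in>S \<alpha>. \<bar>E' - E\<bar> \<le> \<eta>" if "E \<in> S (real p / real q)" for E
    using S_hoelder[OF that, of \<alpha>] ne \<eta>(4) by (simp add: \<eta>_def abs_minus_commute)
  have free: "{u + \<eta><..<v - \<eta>} \<inter> S \<alpha> = {}" if "{u<..<v} \<inter> S (real p / real q) = {}" for u v
  proof (rule equals0I)
    fix E assume E: "E \<in> {u + \<eta><..<v - \<eta>} \<inter> S \<alpha>"
    then obtain E' where "E' \<in> S (real p / real q)" "\<bar>E' - E\<bar> \<le> \<eta>"
      using S_hoelder[of E \<alpha> "real p / real q"] ne \<eta>(4) by (auto simp: \<eta>_def)
    then show False using that E by (auto simp: abs_le_iff disjoint_iff)
  qed
  have Sup: "Sup (band_gap p q 0) = e" using e(1,2) by simp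
  show ?thesis
  proof (cases "j = 1")
    case True
    obtain s t where st: "s \<in> S \<alpha>" "\<bar>s - - e\<bar> \<le> \<eta>" "t \<in> S \<alpha>" "\<bar>t - - w\<bar> \<le> \<eta>"
      using near[OF e(5)] near[OF ww(2)] by blast
    have uv: "- e + 2 * \<eta> < - w" using \<eta>(3) by simp
    note g = gap_of_perturbation[OF uv \<eta>(1) free[OF e(7)] st]
    have j1: "int j - 2 = - 1" using True by simp
    show ?thesis unfolding Sup w_def[symmetric] j1 e(3)
    proof (intro bexI[OF _ g(1)] conjI ballI)
      show "connected_component_set (- S \<alpha>) ((- e + - w) / 2) \<noteq> {}" using g(3) by blast
      show "1 / (192 * real q ^ 11) - 120 * sqrt \<bar>\<alpha> - real p / real q\<bar>
          \<le> measure lebesgue (connected_component_set (- S \<alpha>) ((- e + - w) / 2) \<inter> {-e<..<- w})"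
        using g(6) e(8) by (simp add: \<eta>_def)
      fix x assume "x \<in> connected_component_set (- S \<alpha>) ((- e + - w) / 2)"
      then have x: "x \<in> {- e - \<eta>..- w + \<eta>}" using g(2) by blast
      show "15 / 16 * w \<le> (if j = 1 then - x else x)" using x \<eta>(2) True by simp
      show "(if j = 1 then - x else x) \<le> e + w / 16" using x \<eta>(2) True by simp
    qed (rule g)+
  next
    case False
    obtain s t where st: "s \<in> S \<alpha>" "\<bar>s - w\<bar> \<le> \<eta>" "t \<in> S \<alpha>" "\<bar>t - e\<bar> \<le> \<eta>"
      using near[OF e(4)] near[OF ww(1)] by blast
    have uv: "w + 2 * \<eta> < e" using \<eta>(3) by simp
    note g = gap_of_perturbation[OF uv \<eta>(1) free[OF e(6)] st]
    have j1: "int j - 2 = 0" using False j by simp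
    show ?thesis unfolding Sup unfolding w_def[symmetric] j1 e(2)
    proof (intro bexI[OF _ g(1)] conjI ballI)
      show "connected_component_set (- S \<alpha>) ((w + e) / 2) \<noteq> {}" using g(3) by blast
      show "1 / (192 * real q ^ 11) - 120 * sqrt \<bar>\<alpha> - real p / real q\<bar>
          \<le> measure lebesgue (connected_component_set (- S \<alpha>) ((w + e) / 2) \<inter> {w<..<e})"
        using g(6) e(8) by (simp add: \<eta>_def)
      fix x assume "x \<in> connected_component_set (- S \<alpha>) ((w + e) / 2)"
      then have x: "x \<in> {w - \<eta>..e + \<eta>}" using g(2) by blast
      show "15 / 16 * w \<le> (if j = 1 then - x else x)" using x \<eta>(2) False by simp
      show "(if j = 1 then - x else x) \<le> e + w / 16" using x \<eta>(2) False by simp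
    qed (rule g)+
  qed
qed

text \<open>The gaps belonging to different \<open>n\<close> are told apart by their distance to \<open>0\<close>, which is at least \<open>15/16\<close> of the
  half width at level \<open>n\<close>, while all gaps of higher level lie within \<open>13/16\<close> of it.\<close>

lemma nested_gaps:
  fixes p q :: "nat \<Rightarrow> nat" and B :: "nat \<Rightarrow> real"
  assumes ad: "\<And>n. n0 \<le> n \<Longrightarrow> admissible (p n) (q n)" and inc: "\<And>n. n0 \<le> n \<Longrightarrow> q n < q (Suc n)"
    and irr: "\<alpha> \<notin> \<rat>"
    and close: "\<And>n. n0 \<le> n \<Longrightarrow> \<bar>\<alpha> - real (p n) / real (q n)\<bar> \<le> 1 / (40000000 * real (q n) ^ 12)"
    and B: "\<And>n. n0 \<le> n \<Longrightarrow> 3 \<le> q n \<Longrightarrow> 0 \<le> B n \<and> B n < 1 / (192 * real (q n) ^ 11) - 120 * sqrt \<bar>\<alpha> - real (p n) / real (q n)\<bar>"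
  shows "\<forall>n\<ge>n0. band (p (Suc n)) (q (Suc n)) 0 \<union> closure (band_gap (p (Suc n)) (q (Suc n)) 0)
      \<union> closure (band_gap (p (Suc n)) (q (Suc n)) (-1)) \<subseteq> interior (band (p n) (q n) 0)" (is ?A)
    and "\<exists>G. inj_on (\<lambda>(n, j). G n j) ({n. n0 \<le> n \<and> 3 \<le> q n} \<times> {1, 2::nat}) \<and>
      (\<forall>n j. n0 \<le> n \<and> 3 \<le> q n \<and> j \<in> {1, 2} \<longrightarrow> G n j \<in> gaps (S \<alpha>) \<and>
        G n j \<inter> band_gap (p n) (q n) (int j - 2) \<noteq> {} \<and>
        measure lebesgue (G n j) \<ge> measure lebesgue (G n j \<inter> band_gap (p n) (q n) (int j - 2)) \<and>
        measure lebesgue (G n j \<inter> band_gap (p n) (q n) (int j - 2)) > B n)" (is ?B)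
proof -
  define w where "w n = half_width (p n) (q n)" for n
  have w: "0 < w n" "0 < q n" if "n0 \<le> n" for n
    using half_width_bounds[OF ad[OF that]] by (auto simp: w_def)
  \<comment> \<open>Denominators are odd, so the first one above q n \<ge> 1 is at least 3 and the
    next level does have gaps.\<close>
  have q3: "3 \<le> q (Suc n)" if "n0 \<le> n" for n
    using w(2)[OF that] inc[OF that] admissible_odd[OF ad[of "Suc n"]] that by (cases "q (Suc n) = 2") auto
  have rat: "\<alpha> \<noteq> real k / real l" for k l using irr by (metis Rats_divide Rats_of_nat)
  have close': "\<bar>\<alpha> - real (p n) / real (q n)\<bar> \<le> 1 / (20000000 * real (q n) ^ 12)" if "n0 \<le> n" for n
    using close[OF that] w(2)[OF that] by (rule_tac order_trans) (auto intro!: divide_left_mono mult_right_mono)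
  have nest: "w (Suc n) < w n / 4" "Sup (band_gap (p (Suc n)) (q (Suc n)) 0) \<le> 3 / 4 * w n"
    "band (p (Suc n)) (q (Suc n)) 0 \<union> closure (band_gap (p (Suc n)) (q (Suc n)) 0)
      \<union> closure (band_gap (p (Suc n)) (q (Suc n)) (-1)) \<subseteq> interior (band (p n) (q n) 0)" if n: "n0 \<le> n" for n
  proof -
    have ad': "admissible (p n) (q n)" "admissible (p (Suc n)) (q (Suc n))" using ad n by auto
    have cop: "coprime (p n) (q n)" if "n0 \<le> n" for n
      using admissible_odd_fraction[OF ad[OF that]] odd_fraction.coprime_pq by metis
    have ne: "real (p n) / real (q n) \<noteq> real (p (Suc n)) / real (q (Suc n))"
      using coprime_fraction_unique[OF cop cop w(2) w(2), of n "Suc n"] inc[OF n] n by auto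
    have "\<bar>real (p n) / real (q n) - real (p (Suc n)) / real (q (Suc n))\<bar>
      \<le> \<bar>\<alpha> - real (p n) / real (q n)\<bar> + \<bar>\<alpha> - real (p (Suc n)) / real (q (Suc n))\<bar>" by linarith
    also have "\<dots> \<le> 1 / (40000000 * real (q n) ^ 12) + 1 / (40000000 * real (q (Suc n)) ^ 12)"
      using close n by (intro add_mono) auto
    also have "\<dots> \<le> 1 / (40000000 * real (q n) ^ 12) + 1 / (40000000 * real (q n) ^ 12)"
      using inc[OF n] w(2)[OF n] by (intro add_left_mono divide_left_mono mult_left_mono power_mono mult_pos_pos) auto
    also have "\<dots> = 1 / (20000000 * real (q n) ^ 12)" by simp
    finally have cl: "\<bar>real (p n) / real (q n) - real (p (Suc n)) / real (q (Suc n))\<bar> \<le> 1 / (20000000 * real (q n) ^ 12)" .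
    note * = closed_gap_contained[OF ad' q3[OF n] ne cl]
    obtain e where e: "half_width (p (Suc n)) (q (Suc n)) < e" "band_gap (p (Suc n)) (q (Suc n)) 0 = {half_width (p (Suc n)) (q (Suc n))<..<e}"
      using band_gap_obtain[OF ad'(2) q3[OF n]] by metis
    show "Sup (band_gap (p (Suc n)) (q (Suc n)) 0) \<le> 3 / 4 * w n"
      using *(2)[OF e(2,1)] e(1) unfolding e(2) w_def by simp
    show "w (Suc n) < w n / 4" using *(1) by (simp add: w_def)
    show "band (p (Suc n)) (q (Suc n)) 0 \<union> closure (band_gap (p (Suc n)) (q (Suc n)) 0)
      \<union> closure (band_gap (p (Suc n)) (q (Suc n)) (-1)) \<subseteq> interior (band (p n) (q n) 0)" by (rule *(3))
  qed
  then show ?A by blast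
  have w_le: "w m \<le> w n" if "n0 \<le> n" "n \<le> m" for n m
    using that(2)
  proof (induction m rule: dec_induct)
    case (step m)
    then show ?case using nest(1)[of m] w(1)[of m] that(1) by simp
  qed simp
  define P where "P n j G \<longleftrightarrow> G \<in> gaps (S \<alpha>) \<and> G \<noteq> {} \<and> G \<inter> band_gap (p n) (q n) (int j - 2) \<noteq> {} \<and>
        measure lebesgue (G \<inter> band_gap (p n) (q n) (int j - 2)) \<le> measure lebesgue G \<and>
        measure lebesgue (G \<inter> band_gap (p n) (q n) (int j - 2)) > B n \<and>
        (\<forall>x\<in>G. 15 / 16 * w n \<le> (if j = 1 then - x else x) \<and>
          (if j = 1 then - x else x) \<le> Sup (band_gap (p n) (q n) 0) + w n / 16)" for n j G
  have "\<exists>G. P n j G" if n: "n0 \<le> n" "3 \<le> q n" "j \<in> {1, 2}" for n j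
  proof -
    have "120 * sqrt \<bar>\<alpha> - real (p n) / real (q n)\<bar> < 1 / (192 * real (q n) ^ 11)" using B[OF n(1,2)] by linarith
    from perturbed_central_gaps[OF ad[OF n(1)] n(2) rat close'[OF n(1)] this n(3)]
    show ?thesis using B[OF n(1,2)] unfolding P_def w_def by (meson less_le_trans)
  qed
  then have "\<forall>n j. \<exists>G. n0 \<le> n \<and> 3 \<le> q n \<and> j \<in> {1, 2} \<longrightarrow> P n j G" by blast
  then obtain G where G: "\<And>n j. n0 \<le> n \<Longrightarrow> 3 \<le> q n \<Longrightarrow> j \<in> {1, 2} \<Longrightarrow> P n j (G n j)"
    by metis
  have "inj_on (\<lambda>(n, j). G n j) ({n. n0 \<le> n \<and> 3 \<le> q n} \<times> {1, 2})"
  proof (rule inj_onI, clarify)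
    fix n j m k assume nj: "n0 \<le> n" "3 \<le> q n" "j \<in> {1, 2::nat}" and mk: "n0 \<le> m" "3 \<le> q m" "k \<in> {1, 2::nat}"
      and eq: "G n j = G m k"
    obtain x where x: "x \<in> G n j" using G[OF nj] by (auto simp: P_def)
    define y z where "y = (if j = 1 then - x else x)" and "z = (if k = 1 then - x else x)"
    have y: "15 / 16 * w n \<le> y" "y \<le> Sup (band_gap (p n) (q n) 0) + w n / 16"
      using G[OF nj] x unfolding P_def y_def by blast+
    have z: "15 / 16 * w m \<le> z" "z \<le> Sup (band_gap (p m) (q m) 0) + w m / 16"
      using G[OF mk] x unfolding eq P_def z_def by blast+
    \<comment> \<open>The same point x is positive after the sign changes of both j and k, so the
      signs agree.\<close>
    have "0 < y" "0 < z" using y(1) z(1) w nj mk by (smt (verit) zero_less_divide_iff mult_pos_pos)+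
    then have jk: "j = k" using nj(3) mk(3) by (auto simp: y_def z_def split: if_splits)
    then have yz: "y = z" by (simp add: y_def z_def)
    have no: False if ab: "n0 \<le> a" "a < b" "15 / 16 * w a \<le> t" "t \<le> Sup (band_gap (p b) (q b) 0) + w b / 16" for a b t
    proof -
      obtain c where c: "b = Suc c" "a \<le> c" using ab(2) by (metis less_imp_Suc_add le_add1)
      then have "Sup (band_gap (p b) (q b) 0) \<le> 3 / 4 * w c" "w b < w c / 4" using nest ab(1) by auto
      moreover have "w c \<le> w a" using w_le[OF ab(1) c(2)] .
      moreover have "0 < w a" using w ab(1) by blast
      ultimately show False using ab(3,4) by linarith
    qed
    have "n = m" using no[OF nj(1), of m y] no[OF mk(1), of n y] y z yz by (metis linorder_neqE_nat)
    then show "n = m \<and> j = k" using jk by simp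
  qed
  moreover have "G n j \<in> gaps (S \<alpha>) \<and> G n j \<inter> band_gap (p n) (q n) (int j - 2) \<noteq> {} \<and>
        measure lebesgue (G n j) \<ge> measure lebesgue (G n j \<inter> band_gap (p n) (q n) (int j - 2)) \<and>
        measure lebesgue (G n j \<inter> band_gap (p n) (q n) (int j - 2)) > B n"
    if "n0 \<le> n \<and> 3 \<le> q n \<and> j \<in> {1, 2}" for n j
    using G[of n j] that unfolding P_def by blast
  ultimately show ?B by blast
qed

section \<open>Convergents\<close>

lemma quotient_of_fraction:
  assumes "coprime P Q" "0 < Q" shows "quotient_of (of_nat P / of_nat Q) = (int P, int Q)"
proof -
  have "(of_nat P / of_nat Q :: rat) = Rat.Fract (int P) (int Q)" by (simp add: Fract_of_int_quotient)
  then show ?thesis using assms by (simp add: quotient_of_Fract normalize_stable)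
qed

lemma admissible_cf_pair:
  assumes "as \<noteq> []" "odd (hd as)" "\<forall>x\<in>set (tl as). even x \<and> x > 0"
  shows "admissible (fst (cf_pair as)) (snd (cf_pair as))" "\<forall>x\<in>set as. x > 0"
proof -
  obtain b bs where as: "as = b # bs" using assms(1) by (cases as) auto
  show "admissible (fst (cf_pair as)) (snd (cf_pair as))"
    unfolding admissible_def using assms as by (metis list.sel(1) list.sel(3) prod.collapse)
  show "\<forall>x\<in>set as. x > 0" using assms(2,3) as by (auto intro: odd_pos)
qed

lemma real_of_rat_cfrac:
  assumes "\<forall>x\<in>set as. x > 0"
  shows "real_of_rat (cfrac as) = real (fst (cf_pair as)) / real (snd (cf_pair as))"
  unfolding cfrac_eq_cf_pair[OF assms] by (simp add: of_rat_divide)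

text \<open>From the second one on, partial quotients are even and positive, so at least 2, and
  denominators at least double. The bound 2^(n - 1) does not depend on \<alpha>, which makes n0 in
  the last claim uniform.\<close>

lemma conv_props:
  assumes a: "has_cfrac \<alpha> a" "odd (a 1)" "\<forall>k\<ge>2. even (a k)" and n: "1 \<le> n"
  shows "admissible (conv_num a n) (conv_den a n)"
    and "conv_den a n < conv_den a (Suc n)" "2 ^ (n - 1) \<le> conv_den a n"
proof -
  have pos: "a k > 0" if "k \<ge> 1" for k using a(1) that by (simp add: has_cfrac_def)
  define L where "L n = map a [1..<Suc n]" for n
  have L: "L n \<noteq> []" "odd (hd (L n))" "\<forall>x\<in>set (tl (L n)). even x \<and> x > 0" if n: "1 \<le> n" for n
  proof -
    have "L n = a 1 # map a [2..<Suc n]" using n by (simp add: L_def upt_conv_Cons numeral_2_eq_2 del: upt_Suc)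
    then show "L n \<noteq> []" "odd (hd (L n))" "\<forall>x\<in>set (tl (L n)). even x \<and> x > 0" using a pos by auto
  qed
  have num: "conv_num a n = fst (cf_pair (L n))" and den: "conv_den a n = snd (cf_pair (L n))" if n: "1 \<le> n" for n
  proof -
    note p = admissible_cf_pair(2)[OF L[OF n]]
    have "conv a n = of_nat (fst (cf_pair (L n))) / of_nat (snd (cf_pair (L n)))"
      unfolding conv_def L_def[symmetric] by (rule cfrac_eq_cf_pair[OF p])
    then have "quotient_of (conv a n) = (int (fst (cf_pair (L n))), int (snd (cf_pair (L n))))"
      using quotient_of_fraction[OF cf_pair_coprime cf_pair_den_pos[OF p]] by simp
    then show "conv_num a n = fst (cf_pair (L n))" "conv_den a n = snd (cf_pair (L n))"
      by (simp_all add: conv_num_def conv_den_def)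
  qed
  have dpos: "0 < conv_den a n" if "1 \<le> n" for n
    using cf_pair_den_pos[OF admissible_cf_pair(2)[OF L[OF that]]] den[OF that] by simp
  have double: "2 * conv_den a n \<le> conv_den a (Suc n)" if n: "1 \<le> n" for n
  proof -
    have "2 \<le> a (Suc n)" using a(3) pos[of "Suc n"] n by (auto elim!: evenE dest!: spec[of _ "Suc n"])
    then have "2 * conv_den a n \<le> a (Suc n) * conv_den a n" by (rule mult_right_mono) simp
    also have "\<dots> \<le> snd (cf_pair (L n @ [a (Suc n)]))" unfolding den[OF n] by (rule cf_pair_snoc)
    also have "L n @ [a (Suc n)] = L (Suc n)" by (simp add: L_def)
    finally show ?thesis using den[of "Suc n"] by simp
  qed
  show "admissible (conv_num a n) (conv_den a n)"
    unfolding num[OF n] den[OF n] by (rule admissible_cf_pair(1)[OF L[OF n]])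
  show "conv_den a n < conv_den a (Suc n)" using double[OF n] dpos[OF n] by simp
  show "2 ^ (n - 1) \<le> conv_den a n" using n
  proof (induction n rule: dec_induct)
    case base
    then show ?case using dpos[of 1] by simp
  next
    case (step n)
    have "(2::nat) ^ (Suc n - 1) = 2 * 2 ^ (n - 1)" using step(1) by (cases n) auto
    then show ?case using step double[of n] by linarith
  qed
qed

section \<open>Numerical comparison of the exponents\<close>

lemma sqrt_le_inverse: assumes "d \<le> 1 / x\<^sup>2" "0 < x" shows "sqrt d \<le> 1 / x"
  using assms by (intro real_le_lsqrt) (auto simp: power_divide)

text \<open>The exponent 24 makes sqrt d at most Q^(-12) / 100000, one power of Q better than the
  gap bound. For Q \<ge> 3 that power is worth a factor 3, and 1/1000 + 120/100000 < 3/192.\<close>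

lemma polynomial_closeness:
  assumes Q: "1 \<le> Q" and d: "d < 1 / (10000000000 * Q powr (4 * 6))"
  shows "d \<le> 1 / (40000000 * Q ^ 12)"
    "3 \<le> Q \<Longrightarrow> 1 / (1000 * Q powr (4 * 6 / 2)) < 1 / (192 * Q ^ 11) - 120 * sqrt d"
proof -
  have d': "d \<le> 1 / (100000 * Q ^ 12)\<^sup>2"
    using d Q by (simp add: power2_eq_square power_numeral_reduce)
  have Q12: "1 \<le> Q ^ 12" using Q by (intro one_le_power) auto
  have "40000000 * Q ^ 12 * 1 \<le> 10000000000 * Q ^ 12 * Q ^ 12" using Q12 Q by (intro mult_mono) auto
  then have "40000000 * Q ^ 12 \<le> (100000 * Q ^ 12)\<^sup>2" by (simp add: power_mult_distrib flip: power_mult power_add)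
  then have "1 / (100000 * Q ^ 12)\<^sup>2 \<le> 1 / (40000000 * Q ^ 12)" using Q by (intro divide_left_mono) auto
  then show "d \<le> 1 / (40000000 * Q ^ 12)" using d' by simp
  assume Q3: "3 \<le> Q"
  have "sqrt d \<le> 1 / (100000 * Q ^ 12)" using d' Q by (intro sqrt_le_inverse) auto
  moreover have "1 / (192 * Q ^ 11) = Q * (1 / (192 * Q ^ 12))" using Q by (simp add: power_numeral_reduce)
  moreover have "Q * (1 / (192 * Q ^ 12)) \<ge> 3 * (1 / (192 * Q ^ 12))" using Q3 by (intro mult_right_mono) auto
  moreover have "Q powr (4 * 6 / 2) = Q ^ 12" using Q by simp
  moreover have "1 / (1000 * Q ^ 12) + 120 * (1 / (100000 * Q ^ 12)) < 3 * (1 / (192 * Q ^ 12))"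
    using Q by (simp add: field_simps)
  ultimately show "1 / (1000 * Q powr (4 * 6 / 2)) < 1 / (192 * Q ^ 11) - 120 * sqrt d" by simp
qed

text \<open>Since Euler's constant exceeds 1/2, the exponent 2 (5 + \<gamma>) lies above the
  exponent 11 of the gap bound. The remaining surplus \<open>Q powr \<epsilon>\<close>, at least
  40000, absorbs all constants because 121 * 192 < 40000.\<close>

lemma euler_closeness:
  fixes Q \<epsilon> :: real
  assumes Q: "100 \<le> Q" and \<epsilon>: "0 < \<epsilon>" "40000 \<le> Q powr \<epsilon>"
    and d: "d < 1 / (2 * Q powr (4 * (5 + euler_mascheroni + \<epsilon>)))"
  shows "d \<le> 1 / (40000000 * Q ^ 12)"
    "1 / (2 * Q powr (2 * (5 + euler_mascheroni) + \<epsilon>)) < 1 / (192 * Q ^ 11) - 120 * sqrt d"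
proof -
  have \<gamma>: "1 / 2 < (euler_mascheroni :: real)" using euler_mascheroni_gt_19_over_33 by simp
  have Qp: "Q powr 11 = Q ^ 11" using Q by (simp add: powr_numeral)
  define x where "x = 40000 * Q ^ 11"
  have x: "0 < x" using Q by (simp add: x_def)
  have pw: "x \<le> Q powr (11 + t)" if "\<epsilon> \<le> t" for t
  proof -
    have "x \<le> Q powr \<epsilon> * Q powr 11" unfolding x_def Qp using \<epsilon>(2) Q by (intro mult_right_mono) auto
    also have "\<dots> \<le> Q powr t * Q powr 11" using that Q by (intro mult_right_mono powr_mono) auto
    finally show ?thesis by (simp add: powr_add mult.commute)
  qed
  have e1: "x \<le> Q powr (2 * (5 + euler_mascheroni) + \<epsilon>)"
    using pw[of "2 * euler_mascheroni - 1 + \<epsilon>"] \<gamma> by (simp add: algebra_simps)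
  have "x \<le> Q powr (2 * (5 + euler_mascheroni + \<epsilon>))"
    using pw[of "2 * euler_mascheroni - 1 + 2 * \<epsilon>"] \<gamma> \<epsilon>(1) by (simp add: algebra_simps)
  then have "x\<^sup>2 \<le> (Q powr (2 * (5 + euler_mascheroni + \<epsilon>)))\<^sup>2" using x by (intro power_mono) auto
  also have "\<dots> = Q powr (4 * (5 + euler_mascheroni + \<epsilon>))"
    unfolding power2_eq_square powr_add[symmetric] by (rule arg_cong[of _ _ "(powr) Q"]) simp
  finally have x2: "x\<^sup>2 \<le> Q powr (4 * (5 + euler_mascheroni + \<epsilon>))" .
  have "d \<le> 1 / (2 * x\<^sup>2)"
    using x x2 Q by (intro order_trans[OF less_imp_le[OF d] divide_left_mono]) (auto intro!: mult_pos_pos)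
  then have dx: "d \<le> 1 / x\<^sup>2" using x by (smt (verit) divide_left_mono zero_less_power mult_pos_pos)
  have Q1: "1 \<le> Q ^ 10" using Q by (intro one_le_power) auto
  have "40000000 * Q ^ 12 \<le> x\<^sup>2"
  proof -
    have "40000000 * Q ^ 12 * 1 \<le> 1600000000 * Q ^ 12 * Q ^ 10" using Q1 Q by (intro mult_mono) auto
    then show ?thesis by (simp add: x_def power_mult_distrib flip: power_mult power_add)
  qed
  then have "1 / x\<^sup>2 \<le> 1 / (40000000 * Q ^ 12)" using Q x by (intro divide_left_mono mult_pos_pos) auto
  then show "d \<le> 1 / (40000000 * Q ^ 12)" using dx by simp
  have s: "sqrt d \<le> 1 / x" by (rule sqrt_le_inverse[OF dx x])
  have b: "1 / (2 * Q powr (2 * (5 + euler_mascheroni) + \<epsilon>)) \<le> 1 / x"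
    using e1 x Q by (intro divide_left_mono mult_pos_pos) auto
  have "121 * (1 / x) < 1 / (192 * Q ^ 11)" using Q by (simp add: x_def field_simps)
  then show "1 / (2 * Q powr (2 * (5 + euler_mascheroni) + \<epsilon>)) < 1 / (192 * Q ^ 11) - 120 * sqrt d"
    using s b by linarith
qed

lemma derivative_and_width_bounds:
  assumes "q \<ge> 1 \<and> coprime p q \<and> as \<noteq> [] \<and> odd (hd as) \<and> (\<forall>x\<in>set (tl as). even x \<and> x > 0) \<and>
       real p / real q = real_of_rat (cfrac as)"
  shows "\<bar>deriv (discriminant p q) 0\<bar> < 17 * real q powr 6 \<and>
         half_width p q \<ge> 4 / \<bar>deriv (discriminant p q) 0\<bar> \<and>
         4 / \<bar>deriv (discriminant p q) 0\<bar> > 4 * inverse 17 * real q powr (- 6)"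
proof -
  have as: "as \<noteq> []" "odd (hd as)" "\<forall>x\<in>set (tl as). even x \<and> x > 0" using assms by auto
  note c = admissible_cf_pair[OF as]
  have "p = fst (cf_pair as) \<and> q = snd (cf_pair as)"
    using assms cf_pair_den_pos[OF c(2)] unfolding real_of_rat_cfrac[OF c(2)]
    by (intro coprime_fraction_unique cf_pair_coprime) auto
  then have ad: "admissible p q" using c(1) by simp
  note hw = half_width_bounds[OF ad]
  have pw: "real q powr 6 = real q ^ 6" "real q powr (- 6) = 1 / real q ^ 6"
    using hw(6) by (simp_all add: powr_numeral powr_minus inverse_eq_divide)
  have lt: "\<bar>deriv (discriminant p q) 0\<bar> < 17 * real q ^ 6"
    using abs_deriv_le[OF ad] hw(6) by (intro le_less_trans[OF abs_deriv_le[OF ad]]) simp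
  have "4 / (17 * real q ^ 6) < 4 / \<bar>deriv (discriminant p q) 0\<bar>"
    using lt hw(1,6) by (intro divide_strict_left_mono mult_pos_pos) auto
  then show ?thesis unfolding pw using lt hw(2) by (simp add: inverse_eq_divide)
qed

lemma gaps_of_polynomial_closeness:
  assumes a: "has_cfrac \<alpha> a" "odd (a 1)" "\<forall>k\<ge>2. even (a k)" and irr: "\<alpha> \<notin> \<rat>"
    and close_all: "\<forall>n\<ge>1. \<bar>\<alpha> - real (conv_num a n) / real (conv_den a n)\<bar>
      < 1 / (10000000000 * real (conv_den a n) powr (4 * 6))"
  shows "(\<forall>n\<ge>1. conv_band a (Suc n) 0 \<union> closure (conv_gap a (Suc n) 0)
      \<union> closure (conv_gap a (Suc n) (-1)) \<subseteq> interior (conv_band a n 0)) \<and>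
    (\<exists>G :: nat \<Rightarrow> nat \<Rightarrow> real set.
      inj_on (\<lambda>(n, j). G n j) ({n. n \<ge> 1 \<and> conv_den a n \<ge> 3} \<times> {1, 2}) \<and>
      (\<forall>n j. n \<ge> 1 \<and> conv_den a n \<ge> 3 \<and> j \<in> {1, 2} \<longrightarrow>
        G n j \<in> gaps (S \<alpha>) \<and> G n j \<inter> conv_gap a n (int j - 2) \<noteq> {} \<and>
        measure lebesgue (G n j) \<ge> measure lebesgue (G n j \<inter> conv_gap a n (int j - 2)) \<and>
        measure lebesgue (G n j \<inter> conv_gap a n (int j - 2)) > 1 / (1000 * real (conv_den a n) powr (4 * 6 / 2))))"
proof -
  note close = close_all[rule_format]
  have cl: "\<bar>\<alpha> - real (conv_num a n) / real (conv_den a n)\<bar> \<le> 1 / (40000000 * real (conv_den a n) ^ 12)"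
    if n: "1 \<le> n" for n
    by (rule polynomial_closeness(1)[OF _ close[OF n]]) (use half_width_bounds(6)[OF conv_props(1)[OF a n]] in simp)
  have B: "0 \<le> 1 / (1000 * real (conv_den a n) powr (4 * 6 / 2)) \<and> 1 / (1000 * real (conv_den a n) powr (4 * 6 / 2))
      < 1 / (192 * real (conv_den a n) ^ 11) - 120 * sqrt \<bar>\<alpha> - real (conv_num a n) / real (conv_den a n)\<bar>"
    if n: "1 \<le> n" "3 \<le> conv_den a n" for n
    using polynomial_closeness(2)[OF _ close[OF n(1)]] n(2) by simp
  note N = nested_gaps[of 1 "conv_num a" "conv_den a" \<alpha> "\<lambda>n. 1 / (1000 * real (conv_den a n) powr (4 * 6 / 2))",
      OF conv_props(1)[OF a] conv_props(2)[OF a] irr cl B]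
  show ?thesis by (rule conjI[OF N])
qed

lemma gaps_of_euler_closeness:
  fixes \<epsilon> :: real
  assumes \<epsilon>: "0 < \<epsilon>"
  obtains n0 :: nat where "2 \<le> n0"
    "\<And>\<alpha> a. has_cfrac \<alpha> a \<Longrightarrow> odd (a 1) \<Longrightarrow> \<forall>k\<ge>2. even (a k) \<Longrightarrow> \<alpha> \<notin> \<rat> \<Longrightarrow>
      \<forall>n\<ge>1. \<bar>\<alpha> - real (conv_num a n) / real (conv_den a n)\<bar>
        < 1 / (2 * real (conv_den a n) powr (4 * (5 + euler_mascheroni + \<epsilon>))) \<Longrightarrow>
      (\<forall>n\<ge>n0. conv_band a (Suc n) 0 \<union> closure (conv_gap a (Suc n) 0)
        \<union> closure (conv_gap a (Suc n) (-1)) \<subseteq> interior (conv_band a n 0)) \<and>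
      (\<exists>G :: nat \<Rightarrow> nat \<Rightarrow> real set.
        inj_on (\<lambda>(n, j). G n j) ({n. n \<ge> n0} \<times> {1, 2}) \<and>
        (\<forall>n j. n \<ge> n0 \<and> j \<in> {1, 2} \<longrightarrow>
          G n j \<in> gaps (S \<alpha>) \<and> G n j \<inter> conv_gap a n (int j - 2) \<noteq> {} \<and>
          measure lebesgue (G n j) \<ge> measure lebesgue (G n j \<inter> conv_gap a n (int j - 2)) \<and>
          measure lebesgue (G n j \<inter> conv_gap a n (int j - 2))
            > 1 / (2 * real (conv_den a n) powr (2 * (5 + euler_mascheroni) + \<epsilon>))))"
proof -
  \<comment> \<open>k depends on \<epsilon> alone; the denominators reach 2^k at the latest at index
    k + 1, whatever \<alpha> is.\<close>
  obtain k where k: "max 100 (40000 powr (1 / \<epsilon>)) < (2::real) ^ k"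
    using real_arch_pow[of 2 "max 100 (40000 powr (1 / \<epsilon>))"] by (metis one_less_numeral_iff semiring_norm(76))
  define n0 where "n0 = k + 2"
  show ?thesis
  proof (rule that[of n0])
    show "2 \<le> n0" by (simp add: n0_def)
  next
    fix \<alpha> :: real and a :: "nat \<Rightarrow> nat"
    assume a: "has_cfrac \<alpha> a" "odd (a 1)" "\<forall>k\<ge>2. even (a k)" and irr: "\<alpha> \<notin> \<rat>"
      and close_all: "\<forall>n\<ge>1. \<bar>\<alpha> - real (conv_num a n) / real (conv_den a n)\<bar>
        < 1 / (2 * real (conv_den a n) powr (4 * (5 + euler_mascheroni + \<epsilon>)))"
    note close = close_all[rule_format]
    have Q: "100 \<le> real (conv_den a n)" "40000 \<le> real (conv_den a n) powr \<epsilon>" if n: "n0 \<le> n" for n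
    proof -
      have "(2::nat) ^ k \<le> 2 ^ (n - 1)" using n by (intro power_increasing) (auto simp: n0_def)
      also have "\<dots> \<le> conv_den a n" using n by (intro conv_props(3)[OF a]) (auto simp: n0_def)
      finally have "2 ^ k \<le> real (conv_den a n)" by (metis of_nat_le_iff of_nat_numeral of_nat_power)
      then have q: "100 \<le> real (conv_den a n)" "40000 powr (1 / \<epsilon>) \<le> real (conv_den a n)" using k by linarith+
      show "100 \<le> real (conv_den a n)" by (rule q)
      have "40000 = (40000 powr (1 / \<epsilon>)) powr \<epsilon>" using \<epsilon> by (simp add: powr_powr)
      also have "\<dots> \<le> real (conv_den a n) powr \<epsilon>" using q(2) \<epsilon> by (intro powr_mono2) auto
      finally show "40000 \<le> real (conv_den a n) powr \<epsilon>" .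
    qed
    have n1: "1 \<le> n" if "n0 \<le> n" for n using that by (simp add: n0_def)
    have q3: "3 \<le> conv_den a n" if "n0 \<le> n" for n using Q(1)[OF that] by simp
    have cl: "\<bar>\<alpha> - real (conv_num a n) / real (conv_den a n)\<bar> \<le> 1 / (40000000 * real (conv_den a n) ^ 12)"
      if n: "n0 \<le> n" for n
      by (rule euler_closeness(1)[OF Q(1)[OF n] \<epsilon> Q(2)[OF n] close[OF n1[OF n]]])
    have B: "0 \<le> 1 / (2 * real (conv_den a n) powr (2 * (5 + euler_mascheroni) + \<epsilon>)) \<and>
        1 / (2 * real (conv_den a n) powr (2 * (5 + euler_mascheroni) + \<epsilon>))
        < 1 / (192 * real (conv_den a n) ^ 11) - 120 * sqrt \<bar>\<alpha> - real (conv_num a n) / real (conv_den a n)\<bar>"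
      if n: "n0 \<le> n" "3 \<le> conv_den a n" for n
      using euler_closeness(2)[OF Q(1)[OF n(1)] \<epsilon> Q(2)[OF n(1)] close[OF n1[OF n(1)]]] by simp
    note N = nested_gaps[of n0 "conv_num a" "conv_den a" \<alpha> "\<lambda>n. 1 / (2 * real (conv_den a n) powr (2 * (5 + euler_mascheroni) + \<epsilon>))",
        OF conv_props(1)[OF a n1] conv_props(2)[OF a n1] irr cl B]
    have dom: "{n. n0 \<le> n \<and> 3 \<le> conv_den a n} = {n. n0 \<le> n}" "n0 \<le> n \<and> 3 \<le> conv_den a n \<and> P \<longleftrightarrow> n0 \<le> n \<and> P" for n P
      using q3 by auto
    show "(\<forall>n\<ge>n0. conv_band a (Suc n) 0 \<union> closure (conv_gap a (Suc n) 0)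
        \<union> closure (conv_gap a (Suc n) (-1)) \<subseteq> interior (conv_band a n 0)) \<and>
      (\<exists>G :: nat \<Rightarrow> nat \<Rightarrow> real set.
        inj_on (\<lambda>(n, j). G n j) ({n. n \<ge> n0} \<times> {1, 2}) \<and>
        (\<forall>n j. n \<ge> n0 \<and> j \<in> {1, 2} \<longrightarrow>
          G n j \<in> gaps (S \<alpha>) \<and> G n j \<inter> conv_gap a n (int j - 2) \<noteq> {} \<and>
          measure lebesgue (G n j) \<ge> measure lebesgue (G n j \<inter> conv_gap a n (int j - 2)) \<and>
          measure lebesgue (G n j \<inter> conv_gap a n (int j - 2))
            > 1 / (2 * real (conv_den a n) powr (2 * (5 + euler_mascheroni) + \<epsilon>))))"
      using conjI[OF N] unfolding dom .
  qed
qed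

theorem theorem4:
  shows "\<exists>C1 C2 :: real. 1 < C1 \<and> C1 < 14 \<and> 1 < C2 \<and> C2 < exp 10 \<and>
    (\<forall>(p::nat) (q::nat) (as :: nat list).
       q \<ge> 1 \<and> coprime p q \<and> as \<noteq> [] \<and> odd (hd as) \<and> (\<forall>x\<in>set (tl as). even x \<and> x > 0) \<and>
       real p / real q = real_of_rat (cfrac as) \<longrightarrow>
         \<bar>deriv (discriminant p q) 0\<bar> < C2 * real q powr C1 \<and>
         half_width p q \<ge> 4 / \<bar>deriv (discriminant p q) 0\<bar> \<and>
         4 / \<bar>deriv (discriminant p q) 0\<bar> > 4 * inverse C2 * real q powr (- C1)) \<and>
    (\<exists>C3 C4 :: real. C3 > 0 \<and> C4 > 0 \<and>
      (\<forall>(\<alpha>::real) (a :: nat \<Rightarrow> nat).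
         0 < \<alpha> \<and> \<alpha> < 1 \<and> \<alpha> \<notin> \<rat> \<and> has_cfrac \<alpha> a \<and> odd (a 1) \<and> (\<forall>k\<ge>2. even (a k)) \<and>
         (\<forall>n\<ge>1. \<bar>\<alpha> - real (conv_num a n) / real (conv_den a n)\<bar>
                   < 1 / (C3 * real (conv_den a n) powr (4 * C1))) \<longrightarrow>
           (\<forall>n\<ge>1. conv_band a (Suc n) 0 \<union> closure (conv_gap a (Suc n) 0)
                     \<union> closure (conv_gap a (Suc n) (-1)) \<subseteq> interior (conv_band a n 0)) \<and>
           (\<exists>G :: nat \<Rightarrow> nat \<Rightarrow> real set.
              inj_on (\<lambda>(n, j). G n j) ({n. n \<ge> 1 \<and> conv_den a n \<ge> 3} \<times> {1, 2}) \<and>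
              (\<forall>n j. n \<ge> 1 \<and> conv_den a n \<ge> 3 \<and> j \<in> {1, 2} \<longrightarrow>
                 G n j \<in> gaps (S \<alpha>) \<and>
                 G n j \<inter> conv_gap a n (int j - 2) \<noteq> {} \<and>
                 measure lebesgue (G n j)
                   \<ge> measure lebesgue (G n j \<inter> conv_gap a n (int j - 2)) \<and>
                 measure lebesgue (G n j \<inter> conv_gap a n (int j - 2))
                   > 1 / (C4 * real (conv_den a n) powr (4 * C1 / 2)))))) \<and>
    (\<forall>\<epsilon>>0. \<exists>n0\<ge>2. \<forall>(\<alpha>::real) (a :: nat \<Rightarrow> nat).
       0 < \<alpha> \<and> \<alpha> < 1 \<and> \<alpha> \<notin> \<rat> \<and> has_cfrac \<alpha> a \<and> odd (a 1) \<and> (\<forall>k\<ge>2. even (a k)) \<and>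
       (\<forall>n\<ge>1. \<bar>\<alpha> - real (conv_num a n) / real (conv_den a n)\<bar>
                 < 1 / (2 * real (conv_den a n) powr (4 * (5 + euler_mascheroni + \<epsilon>)))) \<longrightarrow>
         (\<forall>n\<ge>n0. conv_band a (Suc n) 0 \<union> closure (conv_gap a (Suc n) 0)
                    \<union> closure (conv_gap a (Suc n) (-1)) \<subseteq> interior (conv_band a n 0)) \<and>
         (\<exists>G :: nat \<Rightarrow> nat \<Rightarrow> real set.
            inj_on (\<lambda>(n, j). G n j) ({n. n \<ge> n0} \<times> {1, 2}) \<and>
            (\<forall>n j. n \<ge> n0 \<and> j \<in> {1, 2} \<longrightarrow>
               G n j \<in> gaps (S \<alpha>) \<and>
               G n j \<inter> conv_gap a n (int j - 2) \<noteq> {} \<and>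
               measure lebesgue (G n j)
                 \<ge> measure lebesgue (G n j \<inter> conv_gap a n (int j - 2)) \<and>
               measure lebesgue (G n j \<inter> conv_gap a n (int j - 2))
                 > 1 / (2 * real (conv_den a n) powr (2 * (5 + euler_mascheroni) + \<epsilon>)))))"
proof -
  have e10: "17 < exp (10::real)"
  proof -
    have "6 \<le> exp (5::real)" using exp_ge_add_one_self[of 5] by simp
    then have "6 * 6 \<le> exp (5::real) * exp 5" by (intro mult_mono) auto
    then show ?thesis by (simp flip: exp_add)
  qed
  show ?thesis
    \<comment> \<open>C1 = 6 and C2 = 17 reflect \<bar>\<sigma>'(0)\<bar> \<le> 16 q^6, with 17 for
      strictness. C3 = 10^10 and C4 = 1000, supplied further below, are the constants compared in
      \<open>polynomial_closeness\<close>.\<close>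
    apply (rule exI[of _ 6], rule exI[of _ 17], intro conjI)
          apply simp_all[3]
       apply (rule e10)
      apply (intro allI, rule impI, rule derivative_and_width_bounds, assumption)
     apply (rule exI[of _ 10000000000], rule exI[of _ 1000], intro conjI)
       apply simp_all[2]
     apply (rule allI, rule allI, rule impI, elim conjE, rule gaps_of_polynomial_closeness; assumption)
    apply (rule allI, rule impI)
    subgoal premises \<epsilon> for \<epsilon>
    proof (rule gaps_of_euler_closeness[OF \<epsilon>], goal_cases)
      case (1 n0)
      show ?case
        by (rule exI[of _ n0], rule conjI[OF 1(1)], rule allI, rule allI, rule impI, elim conjE, rule 1(2); assumption)
    qed
    done
qed

end
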